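(* Let $G$ be a finite metric graph whose edges $e$ are intervals of length $\ell_e$, and let $D=-d^2/dt^2+q(t)$ be the Schr\"odinger operator on $G$ with a real potential $q:G\to\mathbb R$, $q\in L^2(G)$. Let $K=L^2(\partial G)=\mathbb C^{|\partial G|}$, where $\partial G$ is the disjoint union of the ends of all edges. Let $X$ be a topological space and let $L=(L_x)_{x\in X}$ be a continuous family of Lagrangian subspaces $L_x\subset K\oplus K$. For each $x$ let $D_{L_x}$ be the realization of $D$ with domain $\{f\in\bigoplus_eH^2(e):(f|_{\partial G},\nabla f|_{\partial G})\in L_x\}$, and let $D_L=(D_{L_x})_{x\in X}$. Then $$\operatorname{ind}D_L=\operatorname{ind}_{K\oplus K}(L)\in K^1(X).$$
   Context: $H=L^2(G)$. The maximal operator $D^{\max}$ is $D$ with domain $\bigoplus_eH^2(e)\subset L^2(G)$ (second order Sobolev spaces). $\nabla f|_{\partial G}$ denotes, at each end of an edge, the derivative of $f$ in the direction coming out from the vertex into the edge. With $\Gamma_0f=f|_{\partial G}$, $\Gamma_1f=\nabla f|_{\partial G}$, the operator $D^{\min}=(D^{\max})^*$ has domain $\ker\Gamma_0\cap\ker\Gamma_1$, and $\langle Df,g\rangle-\langle f,Dg\rangle=\langle\Gamma_1f,\Gamma_0g\rangle_K-\langle\Gamma_0f,\Gamma_1g\rangle_K$. $K\oplus K$ carries the symplectic form $\omega((\xi_0,\xi_1),(\eta_0,\eta_1))=\langle\xi_1,\eta_0\rangle-\langle\xi_0,\eta_1\rangle=\langle J\xi,\eta\rangle$ with $J(\xi_0,\xi_1)=(\xi_1,-\xi_0)$;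 Lagrangian means equal to the $\omega$-annihilator. Families of subspaces are continuous when the orthogonal projections are continuous. Each $D_{L_x}$ is Fredholm and self-adjoint, and the family $D_L$ is graph continuous (the orthogonal projections onto the graphs are norm continuous). $K^1$ index. For a Hilbert space $W$ let $\mathcal U(W)$ be the unitary group with the norm topology, $\mathcal U_K(W)=\{u\in\mathcal U(W): u-1\text{ compact}\}$ and $\mathcal U_F(W)=\{u\in\mathcal U(W): u+1\text{ Fredholm}\}$. For arbitrary $X$ and an infinite-dimensional separable Hilbert space $H$, $K^1(X):=[X,\mathcal U_K(H)]=[X,\mathcal U_F(H)]$ (the inclusion is a homotopy equivalence), with addition given by direct sum and zero element the constant map $1$. The index of a continuous $f:X\to\mathcal U_F(W)$ is the class of $f\oplus1:X\to\mathcal U_F(W\oplus H')$, $H'$ an auxiliary infinite-dimensional separable Hilbert space (if $\dim W<\infty$, then $\mathcal U_F(W)=\mathcal U(W)$). The index of a graph continuous family $(B_x)$ of Fredholm self-adjoint operators is the index of the family of Cayley transforms $(B_x-i)(B_x+i)^{-1}\in\mathcal U_F(H)$. For $\Lambda=K\oplus K$ put $\Lambda^\pm=\ker(J\mp i)$; each Lagrangian $L$ is the graph of a unitary $u_L:\Lambda^+\to\Lambda^-$, and for a continuous family $L=(L_x)$ and a Lagrangian subspace $M$, $\operatorname{ind}_\Lambda(L,M)\in K^1(X)$ is the index of $x\mapsto-u_M^{-1}u_{L_x}\in\mathcal U(\Lambda^+)$. Since $K$ is finite-dimensional, this is independent of the choice of $M$ and is denoted $\operatorname{ind}_{K\oplus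 K}(L)$. *)

theory Defs
  imports "HOL-Analysis.Analysis"
begin

text \<open>
  Complex Hilbert spaces as a type class on top of the real ones of the library, so that
  bounded operators are the library type of bounded linear functions with its operator norm.
  The scalar product is linear in the first and conjugate-linear in the second argument.
  Hilbert spaces that depend on parameters, such as \<open>L\<^sup>2(G)\<close> and \<open>\<Lambda>\<^sup>+\<close>, appear as closed
  complex subspaces of such types.
\<close>

class complex_inner = real_inner +
  fixes scaleC :: "complex \<Rightarrow> 'a \<Rightarrow> 'a"  (infixr "*\<^sub>C" 75)
    and cinner :: "'a \<Rightarrow> 'a \<Rightarrow> complex"
  assumes scaleC_add_right: "c *\<^sub>C (x + y) = c *\<^sub>C x + c *\<^sub>C y"
    and scaleC_add_left: "(c + d) *\<^sub>C x = c *\<^sub>C x + d *\<^sub>C x"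
    and scaleC_scaleC: "c *\<^sub>C d *\<^sub>C x = (c * d) *\<^sub>C x"
    and scaleR_scaleC: "r *\<^sub>R x = complex_of_real r *\<^sub>C x"
    and cinner_commute: "cinner x y = cnj (cinner y x)"
    and cinner_add_left: "cinner (x + y) z = cinner x z + cinner y z"
    and cinner_scaleC_left: "cinner (c *\<^sub>C x) y = c * cinner x y"
    and inner_cinner: "inner x y = Re (cinner x y)"

class chilbert_space = complex_inner + complete_space

instantiation complex :: chilbert_space
begin
definition "scaleC c (z::complex) = c * z"
definition "cinner (z::complex) w = z * cnj w"
instance
  by standard (auto simp: scaleC_complex_def cinner_complex_def algebra_simps scaleR_conv_of_real inner_complex_def)
end

instantiation vec :: (complex_inner, finite) complex_inner
begin
definition "scaleC c (x::'a^'b) = (\<chi> i. c *\<^sub>C (x $ i))"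
definition "cinner (x::'a^'b) y = (\<Sum>i\<in>UNIV. cinner (x $ i) (y $ i))"
instance
proof
  fix x y z :: "'a^'b" and c d :: complex and r :: real
  show "cinner x y = cnj (cinner y x)"
    by (simp add: cinner_vec_def flip: cinner_commute)
qed (auto simp: scaleC_vec_def cinner_vec_def vec_eq_iff scaleC_add_right scaleC_add_left
      scaleC_scaleC scaleR_scaleC cinner_add_left sum.distrib cinner_scaleC_left
      sum_distrib_left inner_vec_def inner_cinner)
end

instance vec :: (chilbert_space, finite) chilbert_space ..

instantiation prod :: (complex_inner, complex_inner) complex_inner
begin
definition "scaleC c (x::'a \<times> 'b) = (c *\<^sub>C fst x, c *\<^sub>C snd x)"
definition "cinner (x::'a \<times> 'b) y = cinner (fst x) (fst y) + cinner (snd x) (snd y)"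
instance
proof
  fix x y z :: "'a \<times> 'b" and c d :: complex and r :: real
  show "cinner x y = cnj (cinner y x)"
    by (simp add: cinner_prod_def flip: cinner_commute)
qed (auto simp: scaleC_prod_def cinner_prod_def prod_eq_iff scaleC_add_right scaleC_add_left
      scaleC_scaleC scaleR_scaleC cinner_add_left cinner_scaleC_left
      algebra_simps inner_prod_def inner_cinner)
end

instance prod :: (chilbert_space, chilbert_space) chilbert_space ..

subsection \<open>The Hilbert space \<open>L\<^sup>2(\<real>)\<close>\<close>

definition sq_integrable :: "(real \<Rightarrow> complex) \<Rightarrow> bool" where
  "sq_integrable f \<longleftrightarrow> f \<in> borel_measurable lebesgue \<and> integrable lebesgue (\<lambda>t. (cmod (f t))\<^sup>2)"

lemma borel_measurable_cnj_comp [measurable]: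
  "f \<in> borel_measurable M \<Longrightarrow> (\<lambda>x. cnj (f x)) \<in> borel_measurable M"
  by (rule measurable_compose[OF _ borel_measurable_continuous_onI]) (auto intro: continuous_intros)

lemma sq_integrable_measurable: "sq_integrable f \<Longrightarrow> f \<in> borel_measurable lebesgue"
  by (simp add: sq_integrable_def)

lemma sq_integrable_zero: "sq_integrable (\<lambda>_. 0)"
  by (simp add: sq_integrable_def)

lemma sq_integrable_add:
  assumes "sq_integrable f" "sq_integrable g" shows "sq_integrable (\<lambda>t. f t + g t)"
proof -
  have *: "(cmod (a + b))\<^sup>2 \<le> 2 * (cmod a)\<^sup>2 + 2 * (cmod b)\<^sup>2" for a b
  proof -
    have "(cmod (a + b))\<^sup>2 \<le> (cmod a + cmod b)\<^sup>2"
      by (intro power_mono norm_triangle_ineq) auto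
    moreover have "0 \<le> (cmod a - cmod b)\<^sup>2" by simp
    ultimately show ?thesis by (simp add: power2_eq_square algebra_simps)
  qed
  note [measurable] = assms[THEN sq_integrable_measurable]
  have "integrable lebesgue (\<lambda>t. 2 * (cmod (f t))\<^sup>2 + 2 * (cmod (g t))\<^sup>2)"
    using assms by (auto simp: sq_integrable_def)
  then have "integrable lebesgue (\<lambda>t. (cmod (f t + g t))\<^sup>2)"
    by (rule Bochner_Integration.integrable_bound) (use * in auto)
  then show ?thesis by (simp add: sq_integrable_def)
qed

lemma sq_integrable_mult:
  assumes "sq_integrable f" shows "sq_integrable (\<lambda>t. c * f t)"
  using assms by (auto simp: sq_integrable_def norm_mult power_mult_distrib)

lemma sq_integrable_cnj_mult:
  assumes "sq_integrable f" "sq_integrable g" shows "integrable lebesgue (\<lambda>t. f t * cnj (g t))"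
proof -
  have *: "cmod (a * cnj b) \<le> (cmod a)\<^sup>2 + (cmod b)\<^sup>2" for a b
  proof -
    have "0 \<le> (cmod a - cmod b)\<^sup>2" by simp
    then have "cmod a * (cmod b * 2) \<le> (cmod a)\<^sup>2 + (cmod b)\<^sup>2"
      by (simp add: power2_eq_square algebra_simps)
    moreover have "0 \<le> cmod a * cmod b" by simp
    ultimately show ?thesis by (simp only: norm_mult complex_mod_cnj)
  qed
  note [measurable] = assms[THEN sq_integrable_measurable]
  have "integrable lebesgue (\<lambda>t. (cmod (f t))\<^sup>2 + (cmod (g t))\<^sup>2)"
    using assms by (auto simp: sq_integrable_def)
  then show ?thesis
    by (rule Bochner_Integration.integrable_bound) (use * in auto)
qed

text \<open>Elements are classes modulo equality almost everywhere; \<open>rep_l2\<close> picks a representative.\<close>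

quotient_type l2 = "real \<Rightarrow> complex" /
  partial: "\<lambda>f g. sq_integrable f \<and> sq_integrable g \<and> (AE t in lebesgue. f t = g t)"
  by (rule part_equivpI) (auto intro!: exI[of _ "\<lambda>_. 0"] sympI transpI simp: sq_integrable_zero)


instantiation l2 :: complex_inner
begin

lift_definition zero_l2 :: l2 is "\<lambda>_. 0"
  by (simp add: sq_integrable_zero)

lift_definition plus_l2 :: "l2 \<Rightarrow> l2 \<Rightarrow> l2" is "\<lambda>f g t. f t + g t"
  by (auto intro: sq_integrable_add elim!: eventually_elim2)

lift_definition scaleC_l2 :: "complex \<Rightarrow> l2 \<Rightarrow> l2" is "\<lambda>c f t. c * f t"
  by (auto intro: sq_integrable_mult)

lift_definition cinner_l2 :: "l2 \<Rightarrow> l2 \<Rightarrow> complex" is "\<lambda>f g. LINT t|lebesgue. f t * cnj (g t)"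
  by (auto intro!: integral_cong_AE borel_measurable_times borel_measurable_cnj_comp
        simp: sq_integrable_measurable elim!: eventually_elim2)

definition uminus_l2 :: "l2 \<Rightarrow> l2" where "uminus_l2 f = (-1) *\<^sub>C f"
definition minus_l2 :: "l2 \<Rightarrow> l2 \<Rightarrow> l2" where "minus_l2 f g = f + (-1) *\<^sub>C g"
definition scaleR_l2 :: "real \<Rightarrow> l2 \<Rightarrow> l2" where "scaleR_l2 r f = complex_of_real r *\<^sub>C f"
definition inner_l2 :: "l2 \<Rightarrow> l2 \<Rightarrow> real" where "inner_l2 f g = Re (cinner f g)"
definition norm_l2 :: "l2 \<Rightarrow> real" where "norm_l2 f = sqrt (inner f f)"
definition dist_l2 :: "l2 \<Rightarrow> l2 \<Rightarrow> real" where "dist_l2 f g = norm (f - g)"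
definition sgn_l2 :: "l2 \<Rightarrow> l2" where "sgn_l2 f = inverse (norm f) *\<^sub>R f"
definition uniformity_l2 :: "(l2 \<times> l2) filter" where
  "uniformity_l2 = (INF e\<in>{0<..}. principal {(f, g). dist f g < e})"
definition open_l2 :: "l2 set \<Rightarrow> bool" where
  "open_l2 U \<longleftrightarrow> (\<forall>x\<in>U. eventually (\<lambda>(x', y). x' = x \<longrightarrow> y \<in> U) uniformity)"

instance
proof
  fix x y z :: l2 and c d :: complex and r s :: real
  have addl: "(c + d) *\<^sub>C x = c *\<^sub>C x + d *\<^sub>C x" for c d and x :: l2
    by transfer (auto simp: algebra_simps intro: sq_integrable_mult sq_integrable_add)
  have addr: "c *\<^sub>C (x + y) = c *\<^sub>C x + c *\<^sub>C y" for c and x y :: l2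
    by transfer (auto simp: algebra_simps intro: sq_integrable_mult sq_integrable_add)
  have ass: "c *\<^sub>C d *\<^sub>C x = (c * d) *\<^sub>C x" for c d and x :: l2
    by transfer (auto simp: algebra_simps intro: sq_integrable_mult)
  have one: "1 *\<^sub>C x = x" for x :: l2
    by transfer auto
  have zero: "0 *\<^sub>C x = 0" for x :: l2
    by transfer (auto simp: sq_integrable_zero)
  have cl: "cinner (x + y) z = cinner x z + cinner y z" for x y z :: l2
    by transfer (auto simp: algebra_simps intro!: Bochner_Integration.integral_add sq_integrable_cnj_mult)
  have cs: "cinner (c *\<^sub>C x) y = c * cinner x y" for c and x y :: l2
    by transfer (auto simp: mult.assoc)
  have cc: "cinner x y = cnj (cinner y x)" for x y :: l2
    by transfer (subst Bochner_Integration.integral_cnj[symmetric], simp add: mult.commute del: Bochner_Integration.integral_cnj)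
  show "x + y + z = x + (y + z)"
    by transfer (auto simp: algebra_simps intro: sq_integrable_add)
  show "x + y = y + x"
    by transfer (auto simp: algebra_simps intro: sq_integrable_add)
  show "0 + x = x"
    by transfer auto
  show "- x + x = 0"
    using addl[of "-1" 1 x] by (simp add: uminus_l2_def zero one)
  show "x - y = x + - y"
    by (simp add: minus_l2_def uminus_l2_def)
  show "c *\<^sub>C (x + y) = c *\<^sub>C x + c *\<^sub>C y" "(c + d) *\<^sub>C x = c *\<^sub>C x + d *\<^sub>C x"
    "c *\<^sub>C d *\<^sub>C x = (c * d) *\<^sub>C x" "r *\<^sub>R x = complex_of_real r *\<^sub>C x"
    "r *\<^sub>R (x + y) = r *\<^sub>R x + r *\<^sub>R y" "(r + s) *\<^sub>R x = r *\<^sub>R x + s *\<^sub>R x"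
    "r *\<^sub>R s *\<^sub>R x = (r * s) *\<^sub>R x" "1 *\<^sub>R x = x"
    by (simp_all add: addr addl ass one scaleR_l2_def)
  show "cinner x y = cnj (cinner y x)" "cinner (x + y) z = cinner x z + cinner y z"
    "cinner (c *\<^sub>C x) y = c * cinner x y" "inner x y = Re (cinner x y)"
    by (fact cc cl cs inner_l2_def)+
  show "dist x y = norm (x - y)" "sgn x = inverse (norm x) *\<^sub>R x" "norm x = sqrt (inner x x)"
    by (simp_all add: dist_l2_def sgn_l2_def norm_l2_def)
  show "(uniformity :: (l2 \<times> l2) filter) = (INF e\<in>{0<..}. principal {(x, y). dist x y < e})"
    by (simp add: uniformity_l2_def)
  show "open U \<longleftrightarrow> (\<forall>x\<in>U. \<forall>\<^sub>F (x', y) in uniformity. x' = x \<longrightarrow> y \<in> U)" for U :: "l2 set"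
    by (simp add: open_l2_def)
  show "inner x y = inner y x"
    using cc[of x y] by (simp add: inner_l2_def)
  show "inner (x + y) z = inner x z + inner y z"
    by (simp add: inner_l2_def cl)
  show "inner (r *\<^sub>R x) y = r * inner x y"
    by (simp add: inner_l2_def scaleR_l2_def cs)
  have sq: "f t * cnj (f t) = complex_of_real ((cmod (f t))\<^sup>2)" for f and t :: real
    by (simp only: complex_norm_square)
  have Re_sq: "Re (LINT t|lebesgue. f t * cnj (f t)) = (LINT t|lebesgue. (cmod (f t))\<^sup>2)" for f :: "real \<Rightarrow> complex"
    by (simp add: sq del: of_real_power)
  have in_eq: "inner x x = (LINT t|lebesgue. (cmod (rep_l2 x t))\<^sup>2)"
    by (simp add: inner_l2_def cinner_l2.rep_eq Re_sq)
  show "0 \<le> inner x x"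
    by (simp add: in_eq)
  have zero_iff: "(LINT t|lebesgue. (cmod (f t))\<^sup>2) = 0 \<longleftrightarrow> (AE t in lebesgue. f t = 0)"
    if "sq_integrable f" for f
    using that by (subst integral_nonneg_eq_0_iff_AE) (auto simp: sq_integrable_def)
  show "inner x x = 0 \<longleftrightarrow> x = 0"
    unfolding inner_l2_def
    by transfer (auto simp: Re_sq zero_iff sq_integrable_zero)
qed

end


lemma rep_l2_sq_integrable [simp, intro]: "sq_integrable (rep_l2 f)"
  using Quotient3_rep_reflp[OF Quotient3_l2] by blast

lemma rep_l2_measurable [measurable, simp]: "rep_l2 f \<in> borel_measurable lebesgue"
  by (rule sq_integrable_measurable) simp

lemma rep_abs_l2: "sq_integrable f \<Longrightarrow> AE t in lebesgue. rep_l2 (abs_l2 f) t = f t"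
  using rep_abs_rsp_left[OF Quotient3_l2, of f f] by simp

lemma abs_rep_l2 [simp]: "abs_l2 (rep_l2 f) = f"
  by (rule Quotient3_abs_rep[OF Quotient3_l2])

lemma rep_l2_diff: "AE t in lebesgue. rep_l2 (f - g) t = rep_l2 f t - rep_l2 g t"
proof -
  have "abs_l2 (rep_l2 f) - abs_l2 (rep_l2 g) = abs_l2 (\<lambda>t. rep_l2 f t + (-1) * rep_l2 g t)"
    unfolding minus_l2_def
    by (simp add: plus_l2.abs_eq scaleC_l2.abs_eq sq_integrable_mult[where c = "-1", simplified] del: abs_rep_l2)
  then show ?thesis
    using rep_abs_l2[OF sq_integrable_add[OF rep_l2_sq_integrable sq_integrable_mult[OF rep_l2_sq_integrable]], of f "-1" g]
    by simp
qed

lemma norm_l2_nn_integral: "(\<integral>\<^sup>+ t. ennreal ((cmod (rep_l2 f t))\<^sup>2) \<partial>lebesgue) = ennreal ((norm f)\<^sup>2)"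
proof -
  have "(norm f)\<^sup>2 = inner f f"
    by (simp add: power2_norm_eq_inner)
  also have "\<dots> = (LINT t|lebesgue. (cmod (rep_l2 f t))\<^sup>2)"
  proof -
    have "inner f f = Re (LINT t|lebesgue. complex_of_real ((cmod (rep_l2 f t))\<^sup>2))"
      unfolding inner_l2_def cinner_l2.rep_eq complex_norm_square ..
    then show ?thesis by (simp del: of_real_power)
  qed
  finally show ?thesis
    using rep_l2_sq_integrable[of f]
    by (subst nn_integral_eq_integral) (auto simp: sq_integrable_def)
qed

instance l2 :: chilbert_space
proof
  fix X :: "nat \<Rightarrow> l2"
  assume "Cauchy X"
  then have "\<forall>n. \<exists>N. \<forall>m\<ge>N. \<forall>k\<ge>N. dist (X m) (X k) < (1/2)^n"
    by (simp add: Cauchy_def)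
  then obtain N where N: "\<And>n m k. m \<ge> N n \<Longrightarrow> k \<ge> N n \<Longrightarrow> dist (X m) (X k) < (1/2)^n"
    by metis
  define M where "M n = Max (N ` {..n})" for n
  have MN: "N k \<le> M n" if "k \<le> n" for k n
    unfolding M_def using that by (intro Max_ge) auto
  define Y where "Y n = X (M n)" for n
  have Yd: "norm (Y n - Y k) < (1/2)^k" if "k \<le> n" for k n
    using N[of k "M n" "M k"] MN[OF that] MN[of k k] by (simp add: Y_def dist_norm)
  define y where "y n t = rep_l2 (Y n) t" for n t
  have [measurable]: "y n \<in> borel_measurable lebesgue" for n
    unfolding y_def by measurable
  have nn: "(\<integral>\<^sup>+ t. ennreal ((cmod (y n t - y k t))\<^sup>2) \<partial>lebesgue) = ennreal ((norm (Y n - Y k))\<^sup>2)" for n k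
    unfolding norm_l2_nn_integral[symmetric] y_def
    by (intro nn_integral_cong_AE) (use rep_l2_diff[of "Y n" "Y k"] in auto)
  have "(\<integral>\<^sup>+ t. (\<Sum>n. ennreal (2^n * (cmod (y (Suc n) t - y n t))\<^sup>2)) \<partial>lebesgue)
      = (\<Sum>n. (\<integral>\<^sup>+ t. ennreal (2^n * (cmod (y (Suc n) t - y n t))\<^sup>2) \<partial>lebesgue))"
    by (intro nn_integral_suminf) measurable
  also have "\<dots> = (\<Sum>n. ennreal (2^n * (norm (Y (Suc n) - Y n))\<^sup>2))"
    by (simp add: ennreal_mult nn_integral_cmult nn)
  also have "\<dots> \<le> (\<Sum>n. ennreal ((1/2)^n))"
  proof (intro suminf_le ennreal_leI)
    fix n
    have "(norm (Y (Suc n) - Y n))\<^sup>2 \<le> ((1/2)^n)\<^sup>2"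
      using Yd[of n "Suc n"] by (intro power_mono) auto
    then have "2^n * (norm (Y (Suc n) - Y n))\<^sup>2 \<le> 2^n * ((1/2)^n)\<^sup>2"
      by (rule mult_left_mono) simp
    also have "\<dots> = (1/2)^n"
      by (simp add: power2_eq_square field_simps)
    finally show "2^n * (norm (Y (Suc n) - Y n))\<^sup>2 \<le> (1/2)^n" .
  qed auto
  also have "\<dots> = ennreal (\<Sum>n. (1/2)^n)"
    by (intro suminf_ennreal2) auto
  also have "\<dots> < \<infinity>"
    by simp
  finally have "AE t in lebesgue. (\<Sum>n. ennreal (2^n * (cmod (y (Suc n) t - y n t))\<^sup>2)) \<noteq> \<infinity>"
    by (intro nn_integral_noteq_infinite) auto
  moreover have "convergent (\<lambda>n. y n t)"
    if fin: "(\<Sum>n. ennreal (2^n * (cmod (y (Suc n) t - y n t))\<^sup>2)) \<noteq> \<infinity>" for t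
  proof -
    have "summable (\<lambda>n. 2^n * (cmod (y (Suc n) t - y n t))\<^sup>2)"
      using fin by (intro summable_suminf_not_top) auto
    then have "Bseq (\<lambda>n. 2^n * (cmod (y (Suc n) t - y n t))\<^sup>2)"
      by (intro convergent_imp_Bseq convergentI[OF summable_LIMSEQ_zero])
    then obtain C where C: "0 < C" "\<And>n. 2^n * (cmod (y (Suc n) t - y n t))\<^sup>2 \<le> C"
      by (auto simp: Bseq_def)
    have bd: "norm (y (Suc n) t - y n t) \<le> sqrt C * (sqrt (1/2))^n" for n
    proof -
      have "(cmod (y (Suc n) t - y n t))\<^sup>2 \<le> C * (1/2)^n"
        using C(2)[of n] by (simp add: field_simps)
      then have "cmod (y (Suc n) t - y n t) \<le> sqrt (C * (1/2)^n)"
        by (rule real_le_rsqrt)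
      then show ?thesis
        by (simp only: real_sqrt_mult real_sqrt_power)
    qed
    have "summable (\<lambda>n. sqrt C * (sqrt (1/2))^n)"
      by (intro summable_mult summable_geometric) (simp add: real_sqrt_divide)
    then have "summable (\<lambda>n. y (Suc n) t - y n t)"
      using bd by (rule summable_comparison_test'[where N = 0])
    then have "(\<lambda>n. y 0 t + (\<Sum>i<n. y (Suc i) t - y i t)) \<longlonglongrightarrow> y 0 t + (\<Sum>i. y (Suc i) t - y i t)"
      by (intro tendsto_add tendsto_const summable_LIMSEQ)
    then show ?thesis
      unfolding sum_lessThan_telescope[of "\<lambda>i. y i t"] by (auto simp: convergent_def)
  qed
  ultimately have conv: "AE t in lebesgue. convergent (\<lambda>n. y n t)"
    by (auto elim!: eventually_mono)
  define f where "f t = lim (\<lambda>n. y n t)" for t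
  have f_meas [measurable]: "f \<in> borel_measurable lebesgue"
    unfolding f_def by measurable
  have lim: "AE t in lebesgue. (\<lambda>n. y n t) \<longlonglongrightarrow> f t"
    using conv by eventually_elim (simp add: f_def convergent_LIMSEQ_iff)
  have fatou: "(\<integral>\<^sup>+ t. ennreal ((cmod (f t - y k t))\<^sup>2) \<partial>lebesgue) \<le> ennreal (((1/2)^k)\<^sup>2)" for k
  proof -
    have "(\<integral>\<^sup>+ t. ennreal ((cmod (f t - y k t))\<^sup>2) \<partial>lebesgue)
        = (\<integral>\<^sup>+ t. liminf (\<lambda>n. ennreal ((cmod (y n t - y k t))\<^sup>2)) \<partial>lebesgue)"
    proof (rule nn_integral_cong_AE, use lim in eventually_elim)
      fix t assume "(\<lambda>n. y n t) \<longlonglongrightarrow> f t"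
      then have "(\<lambda>n. ennreal ((cmod (y n t - y k t))\<^sup>2)) \<longlonglongrightarrow> ennreal ((cmod (f t - y k t))\<^sup>2)"
        by (intro tendsto_intros)
      then show "ennreal ((cmod (f t - y k t))\<^sup>2) = liminf (\<lambda>n. ennreal ((cmod (y n t - y k t))\<^sup>2))"
        by (intro lim_imp_Liminf[symmetric]) auto
    qed
    also have "\<dots> \<le> liminf (\<lambda>n. \<integral>\<^sup>+ t. ennreal ((cmod (y n t - y k t))\<^sup>2) \<partial>lebesgue)"
      by (intro nn_integral_liminf) measurable
    also have "\<dots> \<le> limsup (\<lambda>n. \<integral>\<^sup>+ t. ennreal ((cmod (y n t - y k t))\<^sup>2) \<partial>lebesgue)"
      by (intro Liminf_le_Limsup) auto
    also have "\<dots> \<le> ennreal (((1/2)^k)\<^sup>2)"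
      unfolding nn
      by (intro Limsup_bounded eventually_sequentiallyI[of k] ennreal_leI power_mono)
        (use Yd in \<open>auto intro: less_imp_le\<close>)
    finally show ?thesis .
  qed
  have sqd: "sq_integrable (\<lambda>t. f t - y k t)" for k
    unfolding sq_integrable_def
    using fatou[of k] by (auto intro!: integrableI_bounded simp: le_less_trans)
  have "sq_integrable (\<lambda>t. (f t - y 0 t) + y 0 t)"
    by (intro sq_integrable_add sqd) (simp add: y_def)
  then have sqf: "sq_integrable f" by simp
  have near: "norm (abs_l2 f - Y k) \<le> (1/2)^k" for k
  proof -
    have "ennreal ((norm (abs_l2 f - Y k))\<^sup>2) = (\<integral>\<^sup>+ t. ennreal ((cmod (f t - y k t))\<^sup>2) \<partial>lebesgue)"
      unfolding norm_l2_nn_integral[symmetric] y_def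
      by (intro nn_integral_cong_AE) (use rep_l2_diff[of "abs_l2 f" "Y k"] rep_abs_l2[OF sqf] in auto)
    with fatou[of k] have "(norm (abs_l2 f - Y k))\<^sup>2 \<le> ((1/2)^k)\<^sup>2"
      by (metis ennreal_le_iff zero_le_power2)
    then show ?thesis
      by (rule power2_le_imp_le) simp
  qed
  have "X \<longlonglongrightarrow> abs_l2 f"
  proof (rule metric_LIMSEQ_I)
    fix e :: real assume "0 < e"
    then obtain k where k: "(1/2)^k < e / 2"
      using real_arch_pow_inv[of "e/2" "1/2"] by auto
    show "\<exists>n0. \<forall>n\<ge>n0. dist (X n) (abs_l2 f) < e"
    proof (intro exI allI impI)
      fix n assume "M k \<le> n"
      then have "dist (X n) (Y k) < (1/2)^k"
        using N[of k n "M k"] MN[of k k] by (simp add: Y_def)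
      moreover have "dist (Y k) (abs_l2 f) \<le> (1/2)^k"
        using near[of k] by (simp add: dist_norm norm_minus_commute)
      ultimately show "dist (X n) (abs_l2 f) < e"
        using dist_triangle[of "X n" "abs_l2 f" "Y k"] k by linarith
    qed
  qed
  then show "convergent X"
    by (auto simp: convergent_def)
qed


subsection \<open>Unitary operators and \<open>K\<^sup>1\<close>\<close>

definition unitary_between ::
    "'a::complex_inner set \<Rightarrow> 'b::complex_inner set \<Rightarrow> ('a \<Rightarrow> 'b) \<Rightarrow> bool" where
  "unitary_between V W u \<longleftrightarrow> bij_betw u V W \<and>
     (\<forall>x\<in>V. \<forall>y\<in>V. u (x + y) = u x + u y) \<and>
     (\<forall>c. \<forall>x\<in>V. u (c *\<^sub>C x) = c *\<^sub>C u x) \<and>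
     (\<forall>x\<in>V. \<forall>y\<in>V. cinner (u x) (u y) = cinner x y)"

text \<open>The real span is harmless here: finite dimension over \<open>\<real>\<close> and over \<open>\<complex>\<close> are equivalent.\<close>

definition fredholm :: "('a::chilbert_space \<Rightarrow>\<^sub>L 'a) \<Rightarrow> bool" where
  "fredholm T \<longleftrightarrow> (\<exists>B. finite B \<and> {x. blinfun_apply T x = 0} \<subseteq> span B) \<and>
     closed (range (blinfun_apply T)) \<and>
     (\<exists>B. finite B \<and> span (range (blinfun_apply T) \<union> B) = UNIV)"

definition unitary_fredholm :: "('h::chilbert_space \<Rightarrow>\<^sub>L 'h) set"  (\<open>\<U>\<^sub>F\<close>) where
  "\<U>\<^sub>F = {u. unitary_between UNIV UNIV (blinfun_apply u) \<and> fredholm (u + id_blinfun)}"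

definition separable_infinite_dim :: "'h::chilbert_space itself \<Rightarrow> bool" where
  "separable_infinite_dim _ \<longleftrightarrow> (\<exists>S::'h set. countable S \<and> closure S = UNIV) \<and>
     \<not> (\<exists>B::'h set. finite B \<and> span B = UNIV)"

abbreviation homotopic_UF ::
    "'x topology \<Rightarrow> ('x \<Rightarrow> 'h::chilbert_space \<Rightarrow>\<^sub>L 'h) \<Rightarrow> ('x \<Rightarrow> 'h \<Rightarrow>\<^sub>L 'h) \<Rightarrow> bool" where
  "homotopic_UF X \<equiv> homotopic_with (\<lambda>_. True) X (top_of_set \<U>\<^sub>F)"

text \<open>\<open>K\<^sup>1(X) = [X, \<U>\<^sub>F(H)]\<close>, where \<open>H\<close> is the Hilbert space given by the type \<^typ>\<open>'h\<close>; it is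
  used with \<^const>\<open>separable_infinite_dim\<close> types only.\<close>

definition K1 :: "'x topology \<Rightarrow> ('x \<Rightarrow> 'h::chilbert_space \<Rightarrow>\<^sub>L 'h) set set" where
  "K1 X = {g. continuous_map X (top_of_set \<U>\<^sub>F) g} // {(g, h). homotopic_UF X g h}"

text \<open>
  The index of \<open>f : X \<rightarrow> \<U>\<^sub>F(W)\<close>, where \<open>W\<close> is a closed subspace of \<^typ>\<open>'w\<close>: the homotopy class of
  \<open>f \<oplus> 1 : X \<rightarrow> \<U>\<^sub>F(W \<oplus> H')\<close>. The auxiliary space \<open>H'\<close> is a copy of \<open>H\<close>, and \<open>W \<oplus> H'\<close> is identified
  with \<open>H\<close> by a unitary \<open>\<phi>\<close>; the operators \<open>g x = \<phi> (f x \<oplus> 1) \<phi>\<^sup>-\<^sup>1\<close> are determined by the displayed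
  equation, and their homotopy class does not depend on \<open>\<phi>\<close>. The values \<open>f x\<close> matter on \<open>W\<close> only.
  Norm continuity of \<open>f\<close> and \<open>f x \<in> \<U>\<^sub>F(W)\<close> are not separate side conditions: \<open>homotopic_UF\<close> forces
  \<open>g\<close> to be a continuous map into \<open>\<U>\<^sub>F(H)\<close>, which says the same, and if this fails then the index is
  the empty set, which is not an element of \<^term>\<open>K1 X\<close>.
\<close>

definition K1_index ::
    "'x topology \<Rightarrow> 'w::complex_inner set \<Rightarrow> ('x \<Rightarrow> 'w \<Rightarrow> 'w) \<Rightarrow> ('x \<Rightarrow> 'h::chilbert_space \<Rightarrow>\<^sub>L 'h) set" where
  "K1_index X W f = {g'. \<exists>\<phi> g. unitary_between (W \<times> (UNIV :: 'h set)) (UNIV :: 'h set) \<phi> \<and>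
     (\<forall>x\<in>topspace X. \<forall>w\<in>W. f x w \<in> W \<and> (\<forall>k. blinfun_apply (g x) (\<phi> (w, k)) = \<phi> (f x w, k))) \<and>
     homotopic_UF X g g'}"

text \<open>\<open>(B - i)(B + i)\<^sup>-\<^sup>1\<close> for an operator \<open>B\<close> with domain \<open>D\<close>.\<close>

definition cayley :: "'w::complex_inner set \<Rightarrow> ('w \<Rightarrow> 'w) \<Rightarrow> 'w \<Rightarrow> 'w" where
  "cayley D B w = (let f = inv_into D (\<lambda>f. B f + \<i> *\<^sub>C f) w in B f - \<i> *\<^sub>C f)"

text \<open>Index of a graph continuous family of self-adjoint Fredholm operators \<open>B x\<close>, with domains
  \<open>D x\<close>, in the Hilbert space \<open>W\<close>.\<close>

definition operator_index ::
    "'x topology \<Rightarrow> 'w::complex_inner set \<Rightarrow> ('x \<Rightarrow> 'w set) \<Rightarrow> ('x \<Rightarrow> 'w \<Rightarrow> 'w) \<Rightarrow>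
     ('x \<Rightarrow> 'h::chilbert_space \<Rightarrow>\<^sub>L 'h) set" where
  "operator_index X W D B = K1_index X W (\<lambda>x. cayley (D x) (B x))"

subsection \<open>Lagrangian subspaces of \<open>K \<oplus> K\<close>\<close>

definition symplectic_form :: "'k::complex_inner \<times> 'k \<Rightarrow> 'k \<times> 'k \<Rightarrow> complex" where
  "symplectic_form \<xi> \<eta> = cinner (snd \<xi>) (fst \<eta>) - cinner (fst \<xi>) (snd \<eta>)"

definition symplectic_J :: "'k::complex_inner \<times> 'k \<Rightarrow> 'k \<times> 'k" where
  "symplectic_J \<xi> = (snd \<xi>, - fst \<xi>)"

text \<open>An annihilator is automatically a closed complex subspace.\<close>

definition lagrangian :: "('k::complex_inner \<times> 'k) set \<Rightarrow> bool" where
  "lagrangian L \<longleftrightarrow> L = {\<eta>. \<forall>\<xi>\<in>L. symplectic_form \<xi> \<eta> = 0}"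

definition orthogonal_projection :: "'a::complex_inner set \<Rightarrow> 'a \<Rightarrow>\<^sub>L 'a" where
  "orthogonal_projection S =
     (THE P. \<forall>x. blinfun_apply P x \<in> S \<and> (\<forall>y\<in>S. cinner (x - blinfun_apply P x) y = 0))"

definition continuous_lagrangian_family ::
    "'x topology \<Rightarrow> ('x \<Rightarrow> ('k::complex_inner \<times> 'k) set) \<Rightarrow> bool" where
  "continuous_lagrangian_family X L \<longleftrightarrow> (\<forall>x\<in>topspace X. lagrangian (L x)) \<and>
     continuous_map X euclidean (\<lambda>x. orthogonal_projection (L x))"

definition Lambda_plus :: "('k::complex_inner \<times> 'k) set" where
  "Lambda_plus = {\<xi>. symplectic_J \<xi> = \<i> *\<^sub>C \<xi>}"

definition Lambda_minus :: "('k::complex_inner \<times> 'k) set" where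
  "Lambda_minus = {\<xi>. symplectic_J \<xi> = - \<i> *\<^sub>C \<xi>}"

text \<open>The unitary \<open>u\<^sub>L : \<Lambda>\<^sup>+ \<rightarrow> \<Lambda>\<^sup>-\<close> whose graph is \<open>L\<close> (meaningful on \<open>\<Lambda>\<^sup>+\<close> only).\<close>

definition lagrangian_unitary :: "('k::complex_inner \<times> 'k) set \<Rightarrow> 'k \<times> 'k \<Rightarrow> 'k \<times> 'k" where
  "lagrangian_unitary L v = (THE w. w \<in> Lambda_minus \<and> v + w \<in> L)"

definition lagrangian_index ::
    "'x topology \<Rightarrow> ('x \<Rightarrow> ('k::complex_inner \<times> 'k) set) \<Rightarrow> ('k \<times> 'k) set \<Rightarrow>
     ('x \<Rightarrow> 'h::chilbert_space \<Rightarrow>\<^sub>L 'h) set" where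
  "lagrangian_index X L M = K1_index X Lambda_plus
     (\<lambda>x v. - inv_into Lambda_plus (lagrangian_unitary M) (lagrangian_unitary (L x) v))"

subsection \<open>Sobolev spaces on an interval\<close>

text \<open>\<open>L\<^sup>2(0,l)\<close>, with functions extended by zero.\<close>

definition L2_interval :: "real \<Rightarrow> l2 set" where
  "L2_interval l = {f. AE t in lebesgue. t \<notin> {0..l} \<longrightarrow> rep_l2 f t = 0}"

definition test_function :: "real \<Rightarrow> (real \<Rightarrow> real) \<Rightarrow> (real \<Rightarrow> real) \<Rightarrow> bool" where
  "test_function l \<phi> \<phi>' \<longleftrightarrow> (\<forall>t. (\<phi> has_real_derivative \<phi>' t) (at t)) \<and> continuous_on UNIV \<phi>' \<and>
     (\<exists>a b. 0 < a \<and> b < l \<and> (\<forall>t. t \<notin> {a..b} \<longrightarrow> \<phi> t = 0))"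

text \<open>Weak derivatives, tested as usual in one dimension against compactly supported
  \<open>C\<^sup>1\<close> functions on the open interval.\<close>

definition weak_derivative :: "real \<Rightarrow> l2 \<Rightarrow> l2 \<Rightarrow> bool" where
  "weak_derivative l f g \<longleftrightarrow> f \<in> L2_interval l \<and> g \<in> L2_interval l \<and>
     (\<forall>\<phi> \<phi>'. test_function l \<phi> \<phi>' \<longrightarrow>
        (LINT t:{0..l}|lebesgue. rep_l2 f t * complex_of_real (\<phi>' t)) =
        - (LINT t:{0..l}|lebesgue. rep_l2 g t * complex_of_real (\<phi> t)))"

definition wderiv :: "real \<Rightarrow> l2 \<Rightarrow> l2" where
  "wderiv l f = (THE g. weak_derivative l f g)"

definition sobolev1 :: "real \<Rightarrow> l2 set" where
  "sobolev1 l = {f. \<exists>g. weak_derivative l f g}"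

definition sobolev2 :: "real \<Rightarrow> l2 set" where
  "sobolev2 l = {f \<in> sobolev1 l. wderiv l f \<in> sobolev1 l}"

text \<open>Value at a point of \<open>{0..l}\<close>, end points included, of the continuous representative.\<close>

definition value_at :: "real \<Rightarrow> l2 \<Rightarrow> real \<Rightarrow> complex" where
  "value_at l f t = (THE c. \<exists>u. continuous_on {0..l} u \<and>
     (AE s in lebesgue. s \<in> {0..l} \<longrightarrow> rep_l2 f s = u s) \<and> u t = c)"

subsection \<open>Schroedinger operators on a finite metric graph\<close>

text \<open>
  An edge \<open>e\<close> is the interval \<open>{0..edge_length G e}\<close>, its two ends \<open>(e, False)\<close> and \<open>(e, True)\<close> are at
  \<open>0\<close> and at \<open>edge_length G e\<close>, and \<open>end_vertex\<close> says how the ends are glued to vertices. The gluing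
  enters neither \<open>L\<^sup>2(G)\<close> nor the operators below: vertex conditions are part of \<open>L\<close>.
\<close>

record ('v, 'e) metric_graph =
  edge_length :: "'e \<Rightarrow> real"
  end_vertex :: "'e \<times> bool \<Rightarrow> 'v"

definition finite_metric_graph :: "('v::finite, 'e::finite) metric_graph \<Rightarrow> bool" where
  "finite_metric_graph G \<longleftrightarrow> (\<forall>e. 0 < edge_length G e)"

type_synonym 'e boundary_space = "complex ^ ('e \<times> bool)"

definition L2_graph :: "('v, 'e::finite) metric_graph \<Rightarrow> (l2 ^ 'e) set" where
  "L2_graph G = {f. \<forall>e. f $ e \<in> L2_interval (edge_length G e)}"

definition sobolev2_graph :: "('v, 'e::finite) metric_graph \<Rightarrow> (l2 ^ 'e) set" where
  "sobolev2_graph G = {f. \<forall>e. f $ e \<in> sobolev2 (edge_length G e)}"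

definition L2_potential :: "('v, 'e) metric_graph \<Rightarrow> ('e \<Rightarrow> real \<Rightarrow> real) \<Rightarrow> bool" where
  "L2_potential G q \<longleftrightarrow> (\<forall>e. q e \<in> borel_measurable (lebesgue_on {0..edge_length G e}) \<and>
     integrable (lebesgue_on {0..edge_length G e}) (\<lambda>t. (q e t)\<^sup>2))"

definition schroedinger ::
    "('v, 'e::finite) metric_graph \<Rightarrow> ('e \<Rightarrow> real \<Rightarrow> real) \<Rightarrow> l2 ^ 'e \<Rightarrow> l2 ^ 'e" where
  "schroedinger G q f = (\<chi> e. - wderiv (edge_length G e) (wderiv (edge_length G e) (f $ e)) +
     abs_l2 (\<lambda>t. if t \<in> {0..edge_length G e} then complex_of_real (q e t) * rep_l2 (f $ e) t else 0))"

definition boundary_value ::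
    "('v, 'e::finite) metric_graph \<Rightarrow> l2 ^ 'e \<Rightarrow> 'e boundary_space" where
  "boundary_value G f = (\<chi> p. let l = edge_length G (fst p) in
     value_at l (f $ fst p) (if snd p then l else 0))"

text \<open>Derivatives in the direction from the vertex into the edge, hence the sign at \<open>(e, True)\<close>.\<close>

definition boundary_gradient ::
    "('v, 'e::finite) metric_graph \<Rightarrow> l2 ^ 'e \<Rightarrow> 'e boundary_space" where
  "boundary_gradient G f = (\<chi> p. let l = edge_length G (fst p); f' = wderiv l (f $ fst p) in
     if snd p then - value_at l f' l else value_at l f' 0)"

definition realization_domain ::
    "('v, 'e::finite) metric_graph \<Rightarrow> ('e boundary_space \<times> 'e boundary_space) set \<Rightarrow> (l2 ^ 'e) set" where
  "realization_domain G L =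
     {f \<in> sobolev2_graph G. (boundary_value G f, boundary_gradient G f) \<in> L}"

end

theory Submission
  imports Defs
begin

text \<open>
  The operator \<open>D\<close> has a bounded right inverse and its kernel is identified by the boundary values
  with a Lagrangian subspace \<open>Q\<close> of \<open>K \<oplus> K\<close>. Correcting the right inverse by elements of the kernel,
  one obtains a bounded self-adjoint operator \<open>R\<^sub>0\<close> and an injective map \<open>Y : K \<rightarrow> L\<^sup>2(G)\<close> such that, as
  a relation, \<open>D\<^sub>L\<^sup>-\<^sup>1 = R\<^sub>0 + Y L' Y\<^sup>*\<close>, where the Lagrangian relation \<open>L'\<close> in \<open>K\<close> has the Cayley
  transform \<open>- u\<^sub>Q\<^sup>-\<^sup>1 u\<^sub>L\<close>. On \<open>L\<^sup>2(G) \<oplus> H\<close> one can shrink \<open>R\<^sub>0\<close> to \<open>0\<close> and simultaneously rotate \<open>Y\<close> to an isometry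
  into \<open>H\<close> without leaving the Fredholm self-adjoint relations. This deforms the Cayley transforms of \<open>D\<^sub>L\<close>
  into \<open>- u\<^sub>Q\<^sup>-\<^sup>1 u\<^sub>L \<oplus> 1\<close>, and as the unitary group of \<open>K\<close> is path connected, \<open>- u\<^sub>Q\<^sup>-\<^sup>1\<close> can be replaced
  by \<open>- u\<^sub>M\<^sup>-\<^sup>1\<close>.
\<close>

section \<open>Complex inner product spaces\<close>

text \<open>The realizations need not be invertible and \<open>L'\<close> need not be the graph of
  an operator, hence the use of relations. For f in the domain and g = D f the Cayley transform
  sends g + i f to g - i f, which makes sense for any self-adjoint relation; its sum with the
  identity sends g + i f to 2 g. Whether it is Fredholm therefore depends only on which g and f
  occur, and finite dimension of K settles this for every bounded symmetric operator in place of
  \<open>R\<^sub>0\<close>. This is why that operator may be shrunk to 0.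

  The obstacle is to replace \<open>Y\<close> by an isometry while staying within such relations:
  the map has to remain injective on the way. A right inverse of its adjoint witnesses this and is
  deformed along with it. Rotating \<open>Y\<close> towards a map whose range is orthogonal to
  everything in sight preserves the witness, and the auxiliary infinite-dimensional space always has
  room for such a map.

  Both indices are computed for an arbitrary identification \<phi> and compared with one normal
  form, \<open>cayley_rel 0 J J Js\<close> for an isometry \<open>J\<close> of K into H, so that
  independence of \<phi> and of M comes out along the way.\<close>

lemma scaleC_one [simp]: "1 *\<^sub>C x = (x::'a::complex_inner)"
  using scaleR_scaleC[of 1 x] by simp

lemma scaleC_zero_left [simp]: "0 *\<^sub>C x = (0::'a::complex_inner)"
  using scaleR_scaleC[of 0 x] by simp

lemma scaleC_minus1: "(-1) *\<^sub>C x = - (x::'a::complex_inner)"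
  using scaleR_scaleC[of "-1" x] by simp

lemma scaleC_zero_right [simp]: "c *\<^sub>C 0 = (0::'a::complex_inner)"
  using scaleC_add_right[of c "0::'a" 0] by simp

lemma scaleC_minus_right [simp]: "c *\<^sub>C (- x) = - (c *\<^sub>C (x::'a::complex_inner))"
  by (metis add.right_inverse add_eq_0_iff scaleC_add_right scaleC_zero_right)

lemma scaleC_minus_left [simp]: "(- c) *\<^sub>C x = - (c *\<^sub>C (x::'a::complex_inner))"
  by (metis add.right_inverse add_eq_0_iff scaleC_add_left scaleC_zero_left)

lemma scaleC_diff_right: "c *\<^sub>C (x - y) = c *\<^sub>C x - c *\<^sub>C (y::'a::complex_inner)"
  using scaleC_add_right[of c x "- y"] by simp

lemma scaleC_diff_left: "(c - d) *\<^sub>C x = c *\<^sub>C x - d *\<^sub>C (x::'a::complex_inner)"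
  using scaleC_add_left[of c "- d" x] by simp

lemma scaleC_scaleR: "c *\<^sub>C (r *\<^sub>R x) = r *\<^sub>R (c *\<^sub>C (x::'a::complex_inner))"
  by (simp add: scaleR_scaleC scaleC_scaleC mult.commute)

lemma cinner_add_right: "cinner x (y + z) = cinner x y + cinner x (z::'a::complex_inner)"
  by (metis cinner_add_left cinner_commute complex_cnj_add)

lemma cinner_scaleC_right: "cinner x (c *\<^sub>C y) = cnj c * cinner x (y::'a::complex_inner)"
  by (metis cinner_commute cinner_scaleC_left complex_cnj_mult)

lemma cinner_zero_left [simp]: "cinner 0 (x::'a::complex_inner) = 0"
  using cinner_scaleC_left[of 0 x x] by simp

lemma cinner_zero_right [simp]: "cinner (x::'a::complex_inner) 0 = 0"
  using cinner_scaleC_right[of x 0 x] by simp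

lemma cinner_minus_left [simp]: "cinner (- x) y = - cinner x (y::'a::complex_inner)"
  using cinner_scaleC_left[of "-1" x y] by simp

lemma cinner_minus_right [simp]: "cinner x (- y) = - cinner x (y::'a::complex_inner)"
  using cinner_scaleC_right[of x "-1" y] by simp

lemma cinner_diff_left: "cinner (x - y) z = cinner x z - cinner y (z::'a::complex_inner)"
  using cinner_add_left[of x "- y" z] by simp

lemma cinner_diff_right: "cinner x (y - z) = cinner x y - cinner x (z::'a::complex_inner)"
  using cinner_add_right[of x y "- z"] by simp

lemma cinner_scaleR_left: "cinner (r *\<^sub>R x) y = r *\<^sub>R cinner x (y::'a::complex_inner)"
  by (simp add: scaleR_scaleC[of r x] cinner_scaleC_left scaleR_conv_of_real)

lemma cinner_scaleR_right: "cinner x (r *\<^sub>R y) = r *\<^sub>R cinner x (y::'a::complex_inner)"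
  by (simp add: scaleR_scaleC[of r y] cinner_scaleC_right scaleR_conv_of_real)

lemmas cinner_simps = cinner_add_left cinner_add_right cinner_diff_left cinner_diff_right
  cinner_scaleC_left cinner_scaleC_right cinner_scaleR_left cinner_scaleR_right

lemmas scaleC_simps = scaleC_add_left scaleC_add_right scaleC_diff_left scaleC_diff_right
  scaleC_scaleC scaleC_scaleR

lemma cinner_self: "cinner x x = complex_of_real ((norm (x::'a::complex_inner))\<^sup>2)"
proof -
  have "Im (cinner x x) = 0"
    using cinner_commute[of x x] by (metis cnj.simps(2) equal_neg_zero)
  moreover have "Re (cinner x x) = (norm x)\<^sup>2"
    by (simp add: power2_norm_eq_inner inner_cinner)
  ultimately show ?thesis
    by (simp add: complex_eq_iff)
qed

lemma cinner_self_eq_0 [simp]: "cinner x x = 0 \<longleftrightarrow> x = (0::'a::complex_inner)"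
  by (simp add: cinner_self)

lemma cinner_eq_inner: "cinner x y = Complex (inner x y) (inner x (\<i> *\<^sub>C (y::'a::complex_inner)))"
  by (simp add: complex_eq_iff inner_cinner cinner_scaleC_right)

lemma norm_scaleC [simp]: "norm (c *\<^sub>C x) = cmod c * norm (x::'a::complex_inner)"
proof -
  have "complex_of_real ((norm (c *\<^sub>C x))\<^sup>2) = cinner (c *\<^sub>C x) (c *\<^sub>C x)"
    by (rule cinner_self[symmetric])
  also have "\<dots> = (c * cnj c) * cinner x x"
    by (simp add: cinner_scaleC_left cinner_scaleC_right)
  also have "\<dots> = complex_of_real ((cmod c)\<^sup>2) * complex_of_real ((norm x)\<^sup>2)"
    by (simp only: cinner_self complex_norm_square[of c])
  also have "\<dots> = complex_of_real ((cmod c * norm x)\<^sup>2)"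
    by (simp add: power_mult_distrib)
  finally have "complex_of_real ((norm (c *\<^sub>C x))\<^sup>2) = complex_of_real ((cmod c * norm x)\<^sup>2)" .
  then have "(norm (c *\<^sub>C x))\<^sup>2 = (cmod c * norm x)\<^sup>2"
    by (simp only: of_real_eq_iff)
  then show ?thesis
    by (simp add: power2_eq_iff_nonneg)
qed

lemma scaleC_eq_0_iff [simp]: "c *\<^sub>C x = 0 \<longleftrightarrow> c = 0 \<or> x = (0::'a::complex_inner)"
  using norm_scaleC[of c x] by (metis mult_eq_0_iff norm_eq_zero)

text \<open>A phase factor on \<open>x\<close> makes the scalar product real and nonnegative, and
  then the real Cauchy-Schwarz inequality applies.\<close>

lemma cinner_bound: "cmod (cinner x y) \<le> norm x * norm (y::'a::complex_inner)"
proof (cases "cinner x y = 0")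
  case False
  define c where "c = cnj (cinner x y) / complex_of_real (cmod (cinner x y))"
  have c: "cmod c = 1"
    using False by (simp add: c_def norm_divide)
  have "cinner x y * cnj (cinner x y) = (complex_of_real (cmod (cinner x y)))\<^sup>2"
    using complex_norm_square[of "cinner x y"] by simp
  then have "c * cinner x y = complex_of_real (cmod (cinner x y))"
    using False by (simp add: c_def field_simps power2_eq_square)
  then have "cmod (cinner x y) = inner (c *\<^sub>C x) y"
    by (simp add: inner_cinner cinner_scaleC_left)
  also have "\<dots> \<le> norm (c *\<^sub>C x) * norm y"
    by (rule norm_cauchy_schwarz)
  finally show ?thesis
    using c by simp
qed auto

lemma bounded_bilinear_cinner: "bounded_bilinear (cinner :: 'a::complex_inner \<Rightarrow> 'a \<Rightarrow> complex)"
  by standard (auto simp: cinner_simps intro!: exI[of _ 1] cinner_bound)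

lemma bounded_bilinear_scaleC: "bounded_bilinear (scaleC :: complex \<Rightarrow> 'a::complex_inner \<Rightarrow> 'a)"
proof
  show "(r *\<^sub>R a) *\<^sub>C b = r *\<^sub>R (a *\<^sub>C b)" for r a and b :: 'a
    by (simp add: scaleR_scaleC[of r "a *\<^sub>C b"] scaleC_scaleC scaleR_conv_of_real)
qed (auto simp: scaleC_simps intro!: exI[of _ 1])

lemmas bounded_linear_scaleC_right [simp] = bounded_bilinear.bounded_linear_right[OF bounded_bilinear_scaleC]

lemma cinner_eqI: "(\<And>y. cinner x y = cinner x' y) \<Longrightarrow> x = (x'::'a::complex_inner)"
  by (metis cinner_diff_left cinner_self_eq_0 eq_iff_diff_eq_0)

definition clinear :: "('a::complex_inner \<Rightarrow> 'b::complex_inner) \<Rightarrow> bool" where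
  "clinear f \<longleftrightarrow> (\<forall>x y. f (x + y) = f x + f y) \<and> (\<forall>c x. f (c *\<^sub>C x) = c *\<^sub>C f x)"

lemma clinearI: "(\<And>x y. f (x + y) = f x + f y) \<Longrightarrow> (\<And>c x. f (c *\<^sub>C x) = c *\<^sub>C f x) \<Longrightarrow> clinear f"
  by (simp add: clinear_def)

lemma clinear_add: "clinear f \<Longrightarrow> f (x + y) = f x + f y"
  by (simp add: clinear_def)

lemma clinear_scaleC: "clinear f \<Longrightarrow> f (c *\<^sub>C x) = c *\<^sub>C f x"
  by (simp add: clinear_def)

lemma clinear_zero: "clinear f \<Longrightarrow> f 0 = 0"
  using clinear_scaleC[of f 0 0] by simp

lemma clinear_minus: "clinear f \<Longrightarrow> f (- x) = - f x"
  using clinear_scaleC[of f "-1" x] by (simp add: scaleC_minus1)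

lemma clinear_diff: "clinear f \<Longrightarrow> f (x - y) = f x - f y"
  using clinear_add[of f x "- y"] by (simp add: clinear_minus)

lemma clinear_scaleR: "clinear f \<Longrightarrow> f (r *\<^sub>R x) = r *\<^sub>R f x"
  by (simp add: scaleR_scaleC clinear_scaleC)

lemmas clinear_simps = clinear_add clinear_scaleC clinear_zero clinear_minus clinear_diff clinear_scaleR

lemma clinear_linear: "clinear f \<Longrightarrow> linear f"
  by (intro linearI) (auto simp: clinear_simps)

lemma clinear_bounded_linear:
  "clinear f \<Longrightarrow> (\<And>x. norm (f x) \<le> norm x * K) \<Longrightarrow> bounded_linear f"
  by (intro bounded_linear_intro[where K = K]) (auto simp: clinear_simps)

text \<open>Polarization recovers the real scalar product from the norm; complex linearity transfers
  this to the imaginary part, which by \<open>cinner_eq_inner\<close> is the real scalar product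
  with \<open>\<i> *\<^sub>C y\<close>.\<close>

lemma cinner_isometry:
  assumes f: "clinear f" and n: "\<And>x. norm (f x) = norm x"
  shows "cinner (f x) (f y) = cinner x y"
proof -
  have *: "inner (f x) (f y) = inner x y" for x y
  proof -
    have "(norm (f x + f y))\<^sup>2 = (norm (x + y))\<^sup>2"
      by (simp add: n flip: clinear_add[OF f])
    moreover have "(norm (f x))\<^sup>2 = (norm x)\<^sup>2" "(norm (f y))\<^sup>2 = (norm y)\<^sup>2"
      by (simp_all add: n)
    ultimately show ?thesis
      unfolding power2_norm_eq_inner inner_add_left inner_add_right
      by (simp add: inner_commute)
  qed
  show ?thesis
    unfolding cinner_eq_inner * clinear_scaleC[OF f, symmetric] ..
qed

text \<open>This turns isometry of a Cayley transform, the equality of the norms of g + i f and g -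
  i f, into the vanishing of the real part of one scalar product.\<close>

lemma norm_add_sub_squared:
  "(norm (x + y))\<^sup>2 - (norm (x - y))\<^sup>2 = 4 * Re (cinner x (y::'a::complex_inner))"
  by (simp add: power2_norm_eq_inner inner_add_left inner_add_right inner_diff_left inner_diff_right
      inner_commute flip: inner_cinner)

lemma cinner_sum_left: "cinner (sum f S) h = (\<Sum>i\<in>S. cinner (f i) (h::'h::complex_inner))"
  by (induction S rule: infinite_finite_induct) (auto simp: cinner_add_left)

lemma cinner_sum_right: "cinner h (sum f S) = (\<Sum>i\<in>S. cinner (h::'h::complex_inner) (f i))"
  by (induction S rule: infinite_finite_induct) (auto simp: cinner_add_right)

section \<open>Cayley transforms of self-adjoint relations\<close>

lemma continuous_map_euclidean_tendsto:
  "continuous_map X euclidean f \<longleftrightarrow> (\<forall>x\<in>topspace X. (f \<longlongrightarrow> f x) (atin X x))"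
  by (auto simp only: continuous_map_atin limitin_canonical_iff)

lemmas blinfun_compose_tendsto = bounded_bilinear.tendsto[OF bounded_bilinear_blinfun_compose]

lemma blinfun_compose_apply: "blinfun_apply (S o\<^sub>L T) x = blinfun_apply S (blinfun_apply T x)"
  by (simp add: blinfun_compose.rep_eq)

lemma blinfun_compose_assoc: "(R o\<^sub>L S) o\<^sub>L T = R o\<^sub>L (S o\<^sub>L T)"
  by (rule blinfun_eqI) simp

lemma blinfun_compose_id [simp]: "id_blinfun o\<^sub>L T = T" "T o\<^sub>L id_blinfun = T"
  by (simp_all add: blinfun_eqI)

lemma power2_le_mult_imp_le:
  fixes a b :: real
  assumes "a\<^sup>2 \<le> b * a" "0 \<le> b" shows "a \<le> b"
proof (rule ccontr)
  assume "\<not> a \<le> b"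
  then have "b * a < a * a"
    using assms by (intro mult_strict_right_mono) auto
  then show False
    using assms by (simp add: power2_eq_square)
qed

definition scaleC_blinfun :: "complex \<Rightarrow> 'a::complex_inner \<Rightarrow>\<^sub>L 'a" where
  "scaleC_blinfun c = Blinfun (\<lambda>x. c *\<^sub>C x)"

lemma scaleC_blinfun_apply [simp]: "blinfun_apply (scaleC_blinfun c) x = c *\<^sub>C x"
  by (simp add: scaleC_blinfun_def bounded_linear_Blinfun_apply)

lemma bounded_linear_scaleC_blinfun:
  "bounded_linear (scaleC_blinfun :: complex \<Rightarrow> 'a::complex_inner \<Rightarrow>\<^sub>L 'a)"
  by (rule bounded_linear_intro[where K = 1])
    (auto intro!: blinfun_eqI norm_blinfun_bound simp: blinfun.add_left blinfun.scaleR_left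
      scaleC_simps scaleR_scaleC[of _ "_ *\<^sub>C _"] scaleR_conv_of_real)

text \<open>With \<open>u x\<close> the quotient of \<open>N x\<close> by \<open>T x\<close>, one
  has u x - u0 = ((N x - N0) - u x (T x - T0)) S. As \<open>u x\<close> is a contraction, a right
  inverse at the limit alone controls the difference, and no continuity of inversion enters.\<close>

lemma tendsto_contraction_quotient:
  fixes T N u :: "'x \<Rightarrow> 'a::real_normed_vector \<Rightarrow>\<^sub>L 'a"
  assumes T: "(T \<longlongrightarrow> T0) F" and N: "(N \<longlongrightarrow> N0) F"
    and u: "eventually (\<lambda>x. norm (u x) \<le> 1 \<and> u x o\<^sub>L T x = N x) F"
    and u0: "u0 o\<^sub>L T0 = N0" and S: "T0 o\<^sub>L S = id_blinfun"
  shows "(u \<longlongrightarrow> u0) F"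
proof -
  have bound: "norm (u x - u0) \<le> (norm (T x - T0) + norm (N x - N0)) * norm S"
    if "norm (u x) \<le> 1 \<and> u x o\<^sub>L T x = N x" for x
  proof -
    have "u x - u0 = (u x - u0) o\<^sub>L (T0 o\<^sub>L S)"
      unfolding S by (auto intro: blinfun_eqI)
    also have "\<dots> = ((N x - N0) - (u x o\<^sub>L (T x - T0))) o\<^sub>L S"
    proof (rule blinfun_eqI)
      fix y
      have "u x (T x y) = N x y" "u0 (T0 y) = N0 y" for y
        using that u0 by (metis blinfun_compose_apply)+
      then show "((u x - u0) o\<^sub>L (T0 o\<^sub>L S)) y = (((N x - N0) - (u x o\<^sub>L (T x - T0))) o\<^sub>L S) y"
        by (simp add: blinfun.diff_left blinfun.diff_right)
    qed
    finally have 1: "norm (u x - u0) \<le> norm ((N x - N0) - (u x o\<^sub>L (T x - T0))) * norm S"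
      by (simp add: norm_blinfun_compose)
    have 2: "norm ((N x - N0) - (u x o\<^sub>L (T x - T0))) \<le> norm (N x - N0) + norm (T x - T0)"
    proof -
      have "norm (u x o\<^sub>L (T x - T0)) \<le> norm (u x) * norm (T x - T0)"
        by (rule norm_blinfun_compose)
      also have "\<dots> \<le> 1 * norm (T x - T0)"
        using that by (intro mult_right_mono) auto
      finally show ?thesis
        using norm_triangle_ineq4[of "N x - N0" "u x o\<^sub>L (T x - T0)"] by simp
    qed
    show ?thesis
      using 1 mult_right_mono[OF 2 norm_ge_zero[of S]] by (simp add: add.commute)
  qed
  have "((\<lambda>x. (norm (T x - T0) + norm (N x - N0)) * norm S) \<longlongrightarrow> (norm (T0 - T0) + norm (N0 - N0)) * norm S) F"
    by (intro tendsto_intros T N)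
  then have lim: "((\<lambda>x. (norm (T x - T0) + norm (N x - N0)) * norm S) \<longlongrightarrow> 0) F"
    by simp
  have "((\<lambda>x. u x - u0) \<longlongrightarrow> 0) F"
    by (rule Lim_null_comparison[OF eventually_mono[OF u bound] lim])
  then show ?thesis
    by (simp add: LIM_zero_iff)
qed

text \<open>Symmetry makes \<open>c *\<^sub>C A z\<close> orthogonal to \<open>z\<close> over the
  reals. This gives injectivity at once, and surjectivity by Banach's fixed point theorem for the
  damped iteration z - r (z + c A z - h).\<close>

lemma bij_one_plus_imaginary:
  fixes A :: "'h::chilbert_space \<Rightarrow>\<^sub>L 'h"
  assumes sa: "\<And>x y. cinner (A x) y = cinner x (A y)" and c: "c = \<i> \<or> c = - \<i>"
  shows "bij (\<lambda>z. z + c *\<^sub>C A z)"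
proof -
  have re: "Re (cinner z (c *\<^sub>C A z)) = 0" for z
  proof -
    have "cinner z (A z) = cnj (cinner z (A z))"
      using sa[of z z] cinner_commute[of "A z" z] by simp
    then have "Im (cinner z (A z)) = 0"
      by (metis Im_complex_div_eq_0 complex_cnj complex_eq_iff cnj.sel(2) equal_neg_zero)
    then show ?thesis
      using c by (auto simp: cinner_scaleC_right)
  qed
  have inj: "z = 0" if "z + c *\<^sub>C A z = 0" for z
  proof -
    have "Re (cinner z (z + c *\<^sub>C A z)) = 0"
      using that by simp
    then show ?thesis
      using re[of z] by (simp add: cinner_add_right cinner_self)
  qed
  have surj: "\<exists>z. z + c *\<^sub>C A z = h" for h
  proof -
    \<comment> \<open>This \<open>r\<close> minimizes the squared contraction factor (1 - r)^2 + r^2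
      |A|^2, whose minimum is 1 - r.\<close>
    define r where "r = 1 / (1 + (norm A)\<^sup>2)"
    have r: "0 < r" "r \<le> 1" "r * (1 + (norm A)\<^sup>2) = 1"
      by (auto simp: r_def add_pos_nonneg add_nonneg_eq_0_iff)
    have "\<exists>!z. z - r *\<^sub>R (z + c *\<^sub>C A z - h) = z"
    proof (rule banach_fix_type[OF _ _ allI[OF allI]])
      show "0 \<le> sqrt (1 - r)" "sqrt (1 - r) < 1"
        using r by auto
      show "dist (x - r *\<^sub>R (x + c *\<^sub>C A x - h)) (y - r *\<^sub>R (y + c *\<^sub>C A y - h)) \<le> sqrt (1 - r) * dist x y"
        for x y
      proof -
        define d where "d = x - y"
        have eq: "(x - r *\<^sub>R (x + c *\<^sub>C A x - h)) - (y - r *\<^sub>R (y + c *\<^sub>C A y - h)) = (1 - r) *\<^sub>R d - r *\<^sub>R (c *\<^sub>C A d)"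
          by (simp add: d_def blinfun.diff_right scaleC_simps algebra_simps)
        have "inner d (c *\<^sub>C A d) = 0"
          using re[of d] by (simp add: inner_cinner)
        then have "(norm ((1 - r) *\<^sub>R d - r *\<^sub>R (c *\<^sub>C A d)))\<^sup>2 = (1 - r)\<^sup>2 * (norm d)\<^sup>2 + r\<^sup>2 * (norm (A d))\<^sup>2"
        proof -
          have "inner ((1 - r) *\<^sub>R d) (r *\<^sub>R (c *\<^sub>C A d)) = 0"
            using \<open>inner d (c *\<^sub>C A d) = 0\<close> by simp
          then have "(norm ((1 - r) *\<^sub>R d - r *\<^sub>R (c *\<^sub>C A d)))\<^sup>2
              = (norm ((1 - r) *\<^sub>R d))\<^sup>2 + (norm (r *\<^sub>R (c *\<^sub>C A d)))\<^sup>2"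
            unfolding power2_norm_eq_inner inner_diff_left inner_diff_right
            by (simp add: inner_commute)
          then show ?thesis
            using c by (auto simp: power_mult_distrib)
        qed
        also have "\<dots> \<le> (1 - r)\<^sup>2 * (norm d)\<^sup>2 + r\<^sup>2 * (norm A * norm d)\<^sup>2"
          by (intro add_left_mono mult_left_mono power_mono norm_blinfun) auto
        also have "\<dots> = ((1 - 2 * r) + r * (r * (1 + (norm A)\<^sup>2))) * (norm d)\<^sup>2"
          by (simp add: power2_eq_square algebra_simps)
        also have "\<dots> = (sqrt (1 - r) * norm d)\<^sup>2"
          using r by (simp add: power_mult_distrib)
        finally show ?thesis
          unfolding dist_norm eq d_def[symmetric]
          by (rule power2_le_imp_le) (use r in auto)
      qed
    qed
    then obtain z where "z - r *\<^sub>R (z + c *\<^sub>C A z - h) = z"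
      by blast
    then show ?thesis
      using r by (intro exI[of _ z]) simp
  qed
  have "inj (\<lambda>z. z + c *\<^sub>C A z)"
  proof (rule injI)
    fix x y assume "x + c *\<^sub>C A x = y + c *\<^sub>C A y"
    then have "(x - y) + c *\<^sub>C A (x - y) = 0"
      by (simp add: blinfun.diff_right scaleC_diff_right algebra_simps)
    then have "x - y = 0"
      by (rule inj)
    then show "x = y"
      by simp
  qed
  moreover have "surj (\<lambda>z. z + c *\<^sub>C A z)"
    unfolding surj_def using surj by (metis (no_types))
  ultimately show ?thesis
    by (simp add: bij_def)
qed

text \<open>Fredholm alternative for a perturbation that factors through a finite-dimensional space:
  with R the inverse of S, injectivity of S + C E passes to 1 + E R C on that space, where injective
  means surjective, and surjectivity is carried back.\<close>

lemma surj_finite_rank_perturbation: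
  fixes S :: "'h::real_vector \<Rightarrow> 'h" and C :: "'k::euclidean_space \<Rightarrow> 'h" and E :: "'h \<Rightarrow> 'k"
  assumes S: "linear S" "bij S" and C: "linear C" and E: "linear E"
    and inj: "\<And>z. S z + C (E z) = 0 \<Longrightarrow> z = 0"
  shows "surj (\<lambda>z. S z + C (E z))"
proof -
  define R where "R = inv S"
  have SR: "S (R h) = h" for h
    using S by (simp add: R_def bij_is_surj surj_f_inv_f)
  have R: "linear R"
    using SR bij_is_inj[OF S(2)]
    by (intro linearI) (metis injD linear_add[OF S(1)], metis injD linear_scale[OF S(1)])
  have lin: "linear (\<lambda>k. k + E (R (C k)))"
    using linear_compose[OF linear_compose[OF C R] E]
    by (intro linear_compose_add) (auto simp: o_def linear_id[unfolded id_def])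
  have "inj (\<lambda>k. k + E (R (C k)))"
    unfolding linear_injective_0[OF lin]
  proof (intro allI impI)
    fix k assume k: "k + E (R (C k)) = 0"
    define z where "z = - R (C k)"
    have Ez: "E z = k"
      using k by (simp add: z_def linear_neg[OF E] add_eq_0_iff)
    have "z = 0"
      by (rule inj) (simp add: Ez, simp add: z_def linear_neg[OF S(1)] SR)
    then show "k = 0"
      using Ez linear_0[OF E] by simp
  qed
  with lin have surj: "surj (\<lambda>k. k + E (R (C k)))"
    by (rule linear_injective_imp_surjective) auto
  show ?thesis
    unfolding surj_def
  proof
    fix h
    obtain k where k: "E (R h) = k + E (R (C k))"
      using surj unfolding surj_def by blast
    \<comment> \<open>The solution is z = R (h - C k), for which the choice of \<open>k\<close>
      gives E z = k.\<close>
    have "h = S (R (h - C k)) + C (E (R (h - C k)))"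
      using k by (simp add: SR linear_diff[OF R] linear_diff[OF E] linear_diff[OF S(1)])
    then show "\<exists>z. h = S z + C (E z)" ..
  qed
qed

section \<open>Self-adjoint relations parametrized by a unitary map of K\<close>

definition unitary_maps :: "('k::complex_inner \<Rightarrow>\<^sub>L 'k) set" where
  "unitary_maps = {w. clinear (blinfun_apply w) \<and> (\<forall>k. norm (w k) = norm k)}"

definition half_defect :: "('k::complex_inner \<Rightarrow>\<^sub>L 'k) \<Rightarrow> 'k \<Rightarrow>\<^sub>L 'k" where
  "half_defect w = (1/2) *\<^sub>R (id_blinfun - w)"

text \<open>
  For a self-adjoint operator \<open>A\<close>, an injective map \<open>Y\<close> with adjoint \<open>Ys\<close>, and a unitary \<open>w\<close>, the
  pairs \<open>(A g + Y v, g)\<close> with \<open>Ys g - i v = w (Ys g + i v)\<close> form a self-adjoint relation. A right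
  inverse \<open>B\<close> of \<open>Ys\<close> parametrizes these pairs by \<open>z \<in> H\<close>: with \<open>y = Ys z\<close> and \<open>e = (1 - w) / 2\<close>
  one has \<open>g = z - B e y\<close> and \<open>i v = e y\<close>. The Cayley transform maps \<open>g + i (A g + Y v)\<close>
  (the denominator) to \<open>g - i (A g + Y v)\<close> (the numerator), and its sum with the identity
  maps the former to \<open>2 g\<close>.
\<close>

definition rel_value ::
    "('k \<Rightarrow>\<^sub>L 'h) \<Rightarrow> ('h \<Rightarrow>\<^sub>L 'k) \<Rightarrow> ('k::complex_inner \<Rightarrow>\<^sub>L 'k) \<Rightarrow> 'h::complex_inner \<Rightarrow>\<^sub>L 'h" where
  "rel_value B Ys w = id_blinfun - (B o\<^sub>L half_defect w o\<^sub>L Ys)"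

definition rel_arg where
  "rel_arg A Y B Ys w = (scaleC_blinfun \<i> o\<^sub>L A o\<^sub>L rel_value B Ys w) + (Y o\<^sub>L half_defect w o\<^sub>L Ys)"

definition cayley_den where
  "cayley_den A Y B Ys w = rel_value B Ys w + rel_arg A Y B Ys w"

definition cayley_num where
  "cayley_num A Y B Ys w = rel_value B Ys w - rel_arg A Y B Ys w"

definition cayley_rel where
  "cayley_rel A Y B Ys w = (THE u. u o\<^sub>L cayley_den A Y B Ys w = cayley_num A Y B Ys w)"

lemma half_defect_apply: "half_defect w k = (1/2) *\<^sub>R (k - w k)"
  by (simp add: half_defect_def blinfun.diff_left blinfun.scaleR_left)

lemma rel_value_apply: "rel_value B Ys w z = z - B (half_defect w (Ys z))"
  by (simp add: rel_value_def blinfun.diff_left)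

lemma rel_arg_apply:
  "rel_arg A Y B Ys w z = \<i> *\<^sub>C A (rel_value B Ys w z) + Y (half_defect w (Ys z))"
  by (simp add: rel_arg_def blinfun.add_left)

text \<open>The operator \<open>B\<close> expresses injectivity of \<open>Y\<close> by an equation.
  It is part of the data because an equation survives the homotopies below, and because
  \<open>B\<close> yields the parametrization of the relation by the whole space.\<close>

definition cayley_data ::
    "('h::chilbert_space \<Rightarrow>\<^sub>L 'h) \<Rightarrow> ('k::{complex_inner,euclidean_space} \<Rightarrow>\<^sub>L 'h) \<Rightarrow> ('k \<Rightarrow>\<^sub>L 'h) \<Rightarrow> ('h \<Rightarrow>\<^sub>L 'k) \<Rightarrow> bool" where
  "cayley_data A Y B Ys \<longleftrightarrow> clinear (blinfun_apply A) \<and> clinear (blinfun_apply Y) \<and>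
     clinear (blinfun_apply B) \<and> clinear (blinfun_apply Ys) \<and>
     (\<forall>x y. cinner (A x) y = cinner x (A y)) \<and> (\<forall>k h. cinner (Y k) h = cinner k (Ys h)) \<and>
     (\<forall>k. Ys (B k) = k)"

context
  fixes A :: "'h::chilbert_space \<Rightarrow>\<^sub>L 'h" and Y B :: "'k::{complex_inner,euclidean_space} \<Rightarrow>\<^sub>L 'h"
    and Ys :: "'h \<Rightarrow>\<^sub>L 'k" and w :: "'k \<Rightarrow>\<^sub>L 'k"
  assumes data: "cayley_data A Y B Ys" and w: "w \<in> unitary_maps"
begin

private lemma cl: "clinear A" "clinear Y" "clinear B" "clinear Ys" "clinear w"
  and sa: "cinner (A x) y = cinner x (A y)"
  and adj: "cinner (Y k) h = cinner k (Ys h)"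
  and rinv: "Ys (B k) = k"
  and norm_w: "norm (w k) = norm k"
  using data w by (auto simp: cayley_data_def unitary_maps_def)

private abbreviation (input) "T \<equiv> cayley_den A Y B Ys w"
private abbreviation (input) "N \<equiv> cayley_num A Y B Ys w"
private abbreviation (input) "G \<equiv> rel_value B Ys w"
private abbreviation (input) "E \<equiv> half_defect w"

lemma cayley_den_apply: "T z = G z + (\<i> *\<^sub>C A (G z) + Y (E (Ys z)))"
  by (simp add: cayley_den_def blinfun.add_left rel_arg_apply)

lemma cayley_num_apply: "N z = G z - (\<i> *\<^sub>C A (G z) + Y (E (Ys z)))"
  by (simp add: cayley_num_def blinfun.diff_left rel_arg_apply)

text \<open>The two summands, g and i (A g + Y v), are orthogonal over the reals: for i A g by
  symmetry of A, and for i Y v = Y e because \<open>Ys\<close> moves the scalar product to K, where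
  it becomes that of (y + w y) / 2 and (y - w y) / 2, which are orthogonal as w is
  isometric.\<close>

lemma norm_den_eq_num: "norm (T z) = norm (N z)"
proof -
  define y where "y = Ys z"
  have Ysg: "Ys (G z) = (1/2) *\<^sub>R (y + w y)"
  proof -
    have "Ys (G z) = y - (1/2) *\<^sub>R (y - w y)"
      by (simp only: rel_value_apply blinfun.diff_right rinv half_defect_apply y_def)
    also have "\<dots> = ((1/2) *\<^sub>R y + (1/2) *\<^sub>R y) - (1/2) *\<^sub>R (y - w y)"
      by (simp flip: scaleR_left_distrib)
    also have "\<dots> = (1/2) *\<^sub>R (y + w y)"
      by (simp only: scaleR_right_diff_distrib scaleR_right_distrib) simp
    finally show ?thesis .
  qed
  have "Re (cinner (y + w y) (y - w y)) = 0"
    using norm_w[of y]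
    by (simp add: inner_cinner[symmetric] inner_add_left inner_diff_right norm_eq_sqrt_inner)
      (simp add: inner_commute)
  then have "Re (cinner (Ys (G z)) (E y)) = 0"
    unfolding Ysg half_defect_apply by (simp add: cinner_scaleR_left cinner_scaleR_right)
  then have 1: "Re (cinner (G z) (Y (E y))) = 0"
    by (subst cinner_commute) (simp add: adj, subst cinner_commute, simp)
  have "cinner (G z) (A (G z)) = cnj (cinner (G z) (A (G z)))"
    using sa[of "G z" "G z"] cinner_commute[of "A (G z)" "G z"] by simp
  then have "Im (cinner (G z) (A (G z))) = 0"
    by (metis cnj.sel(2) equal_neg_zero)
  then have "Re (cinner (G z) (\<i> *\<^sub>C A (G z) + Y (E y))) = 0"
    using 1 by (simp add: cinner_simps)
  then have "(norm (T z))\<^sup>2 = (norm (N z))\<^sup>2"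
    using norm_add_sub_squared[of "G z" "\<i> *\<^sub>C A (G z) + Y (E y)"]
    by (simp add: cayley_den_apply cayley_num_apply y_def)
  then show ?thesis
    by simp
qed

lemma den_plus_num: "T z + N z = 2 *\<^sub>R G z"
  by (simp add: cayley_den_apply cayley_num_apply scaleR_2)

text \<open>Half the sum of denominator and numerator is g, so g is bounded by the denominator, and
  then so is Y e = T z - g - i A g. From Y e one recovers e by pairing with B e, since (Y e, B e) =
  (e, Ys B e) = (e, e). Finally z = g + B e.\<close>

lemma den_bounded_below: "\<exists>K>0. \<forall>z. norm z \<le> K * norm (T z)"
proof -
  define a b where "a = 2 + norm A" and "b = 1 + norm B * norm B * a"
  have "norm z \<le> b * norm (T z)" for z
  proof -
    have "norm (2 *\<^sub>R G z) \<le> norm (T z) + norm (N z)"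
      unfolding den_plus_num[symmetric] by (rule norm_triangle_ineq)
    then have g: "norm (G z) \<le> norm (T z)"
      by (simp add: norm_den_eq_num)
    have "Y (E (Ys z)) = T z - G z - \<i> *\<^sub>C A (G z)"
      by (simp add: cayley_den_apply)
    then have "norm (Y (E (Ys z))) \<le> norm (T z) + norm (G z) + norm (A (G z))"
      using norm_triangle_ineq4[of "T z - G z" "\<i> *\<^sub>C A (G z)"] norm_triangle_ineq4[of "T z" "G z"]
      by simp
    also have "norm (A (G z)) \<le> norm A * norm (T z)"
      using norm_blinfun[of A "G z"] mult_left_mono[OF g norm_ge_zero[of A]] by linarith
    finally have YE: "norm (Y (E (Ys z))) \<le> a * norm (T z)"
      using g by (simp add: a_def algebra_simps)
    have "cinner (E (Ys z)) (E (Ys z)) = cinner (Y (E (Ys z))) (B (E (Ys z)))"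
      by (simp add: adj rinv)
    then have "(norm (E (Ys z)))\<^sup>2 \<le> norm (Y (E (Ys z))) * norm (B (E (Ys z)))"
      using cinner_bound[of "Y (E (Ys z))" "B (E (Ys z))"]
      by (metis cinner_self norm_of_real abs_of_nonneg zero_le_power2)
    also have "\<dots> \<le> (a * norm (T z)) * (norm B * norm (E (Ys z)))"
      using YE by (intro mult_mono norm_blinfun) (auto simp: a_def)
    finally have "norm (E (Ys z)) \<le> a * norm (T z) * norm B"
      using power2_le_mult_imp_le[of "norm (E (Ys z))" "a * norm (T z) * norm B"]
      by (simp add: a_def mult_ac)
    then have "norm (B (E (Ys z))) \<le> norm B * (a * norm (T z) * norm B)"
      using norm_blinfun[of B "E (Ys z)"] by (meson mult_left_mono norm_ge_zero order_trans)
    moreover have "z = G z + B (E (Ys z))"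
      by (simp add: rel_value_apply)
    then have "norm z \<le> norm (G z) + norm (B (E (Ys z)))"
      by (metis norm_triangle_ineq)
    ultimately show ?thesis
      using g by (simp add: b_def algebra_simps)
  qed
  moreover have "b > 0"
    by (simp add: b_def a_def add_pos_nonneg)
  ultimately show ?thesis
    by blast
qed

lemma den_eq_0D: "T z = 0 \<Longrightarrow> z = 0"
  using den_bounded_below by (metis mult_zero_right norm_le_zero_iff norm_zero)

text \<open>Up to a term that factors through \<open>Ys\<close>, hence through K, denominator and
  numerator are 1 + i A and 1 - i A. So it is enough that both are injective; for the numerator this
  follows from equality of norms.\<close>

lemma surj_den: "surj (blinfun_apply T)" and surj_num: "surj (blinfun_apply N)"
proof -
  have *: "surj (\<lambda>z. z + c *\<^sub>C A z + C (Ys z))"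
    if c: "c = \<i> \<or> c = - \<i>" and C: "linear C" and inj: "\<And>z. z + c *\<^sub>C A z + C (Ys z) = 0 \<Longrightarrow> z = 0"
    for c and C :: "'k \<Rightarrow> 'h"
  proof (rule surj_finite_rank_perturbation[OF _ _ C _ inj])
    show "bij (\<lambda>z. z + c *\<^sub>C A z)"
      using sa c by (rule bij_one_plus_imaginary)
    show "linear (\<lambda>z. z + c *\<^sub>C A z)"
      by (intro linearI) (simp_all add: blinfun.add_right blinfun.scaleR_right scaleC_simps algebra_simps)
    show "linear (blinfun_apply Ys)"
      by (intro clinear_linear cl)
  qed
  have eqT: "blinfun_apply T = (\<lambda>z. z + \<i> *\<^sub>C A z + (\<lambda>k. Y (E k) - B (E k) - \<i> *\<^sub>C A (B (E k))) (Ys z))"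
    by (rule ext) (simp add: cayley_den_apply rel_value_apply blinfun.diff_right scaleC_simps)
  have eqN: "blinfun_apply N = (\<lambda>z. z + (- \<i>) *\<^sub>C A z + (\<lambda>k. - Y (E k) - B (E k) + \<i> *\<^sub>C A (B (E k))) (Ys z))"
    by (rule ext) (simp add: cayley_num_apply rel_value_apply blinfun.diff_right scaleC_simps)
  show "surj (blinfun_apply T)"
    unfolding eqT
  proof (rule *)
    show "linear (\<lambda>k. Y (E k) - B (E k) - \<i> *\<^sub>C A (B (E k)))"
      by (intro linearI) (simp_all add: blinfun.add_right blinfun.scaleR_right scaleC_simps algebra_simps)
    fix z assume "z + \<i> *\<^sub>C A z + (\<lambda>k. Y (E k) - B (E k) - \<i> *\<^sub>C A (B (E k))) (Ys z) = 0"
    then have "T z = 0" unfolding eqT .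
    then show "z = 0" by (rule den_eq_0D)
  qed simp
  show "surj (blinfun_apply N)"
    unfolding eqN
  proof (rule *)
    show "linear (\<lambda>k. - Y (E k) - B (E k) + \<i> *\<^sub>C A (B (E k)))"
      by (intro linearI) (simp_all add: blinfun.add_right blinfun.scaleR_right scaleC_simps algebra_simps)
    fix z assume "z + (- \<i>) *\<^sub>C A z + (\<lambda>k. - Y (E k) - B (E k) + \<i> *\<^sub>C A (B (E k))) (Ys z) = 0"
    then have "N z = 0" unfolding eqN .
    then have "T z = 0"
      using norm_den_eq_num[of z] by simp
    then show "z = 0" by (rule den_eq_0D)
  qed simp
qed

lemma cayley_den_inverse: "\<exists>S. T o\<^sub>L S = id_blinfun \<and> S o\<^sub>L T = id_blinfun"
proof -
  obtain K where K: "K > 0" "\<And>z. norm z \<le> K * norm (T z)"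
    using den_bounded_below by blast
  define R where "R = inv (blinfun_apply T)"
  have TR: "T (R h) = h" for h
    unfolding R_def by (rule surj_f_inv_f[OF surj_den])
  have inj: "x = y" if "T x = T y" for x y
    using den_eq_0D[of "x - y"] that by (simp add: blinfun.diff_right)
  have "bounded_linear R"
  proof (rule bounded_linear_intro[where K = K])
    show "R (x + y) = R x + R y" for x y
      by (rule inj) (simp add: TR blinfun.add_right)
    show "R (r *\<^sub>R x) = r *\<^sub>R R x" for r x
      by (rule inj) (simp add: TR blinfun.scaleR_right)
    show "norm (R x) \<le> norm x * K" for x
      using K(2)[of "R x"] by (simp add: TR mult.commute)
  qed
  then have R: "blinfun_apply (Blinfun R) = R"
    by (rule bounded_linear_Blinfun_apply)
  show ?thesis
    by (intro exI[of _ "Blinfun R"] conjI blinfun_eqI) (auto simp: R TR intro: inj)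
qed

lemma cayley_rel_unique:
  assumes "u o\<^sub>L T = N" shows "cayley_rel A Y B Ys w = u"
  unfolding cayley_rel_def
proof (rule the_equality)
  show "u o\<^sub>L T = N" by (rule assms)
  fix u' assume u': "u' o\<^sub>L T = N"
  obtain S where S: "T o\<^sub>L S = id_blinfun"
    using cayley_den_inverse by blast
  have "u' o\<^sub>L T o\<^sub>L S = u o\<^sub>L T o\<^sub>L S"
    by (simp add: u' assms)
  then show "u' = u"
    by (simp add: blinfun_compose_assoc S)
qed

lemma cayley_rel_compose_den: "cayley_rel A Y B Ys w o\<^sub>L T = N"
proof -
  obtain S where S: "S o\<^sub>L T = id_blinfun"
    using cayley_den_inverse by blast
  have *: "(N o\<^sub>L S) o\<^sub>L T = N"
    by (simp add: blinfun_compose_assoc S)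
  show ?thesis
    unfolding cayley_rel_unique[OF *] by (rule *)
qed

lemma cayley_rel_apply_den: "cayley_rel A Y B Ys w (T z) = N z"
  by (metis blinfun_compose_apply cayley_rel_compose_den)

lemma clinear_half_defect: "clinear E"
  by (rule clinearI) (simp_all add: half_defect_apply clinear_simps[OF cl(5)] scaleC_simps algebra_simps)

lemma clinear_rel_value: "clinear G"
  by (rule clinearI) (simp_all add: rel_value_apply clinear_simps[OF cl(3)] clinear_simps[OF cl(4)]
      clinear_simps[OF clinear_half_defect] scaleC_simps)

lemma clinear_den: "clinear T"
  by (rule clinearI) (simp_all add: cayley_den_apply clinear_simps[OF cl(1)] clinear_simps[OF cl(2)] clinear_simps[OF cl(4)]
      clinear_simps[OF clinear_half_defect] clinear_simps[OF clinear_rel_value] scaleC_simps mult.commute)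

lemma clinear_num: "clinear N"
  by (rule clinearI) (simp_all add: cayley_num_apply clinear_simps[OF cl(1)] clinear_simps[OF cl(2)] clinear_simps[OF cl(4)]
      clinear_simps[OF clinear_half_defect] clinear_simps[OF clinear_rel_value] scaleC_simps mult.commute)

lemma norm_cayley_rel: "norm (cayley_rel A Y B Ys w h) = norm h"
proof -
  obtain z where "h = T z"
    using surj_den unfolding surj_def by blast
  then show ?thesis
    by (simp add: cayley_rel_apply_den norm_den_eq_num)
qed

text \<open>After composition with the invertible denominator, u + 1 becomes twice
  \<open>rel_value\<close>, that is, the identity minus a map with values in the range of
  \<open>B\<close>. Kernel and cokernel are therefore controlled by the image under \<open>B\<close>
  of a basis of K.\<close>

lemma cayley_rel_UF: "cayley_rel A Y B Ys w \<in> \<U>\<^sub>F"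
proof -
  let ?u = "cayley_rel A Y B Ys w"
  have T: "\<exists>z. h = T z" for h
    using surj_den unfolding surj_def by blast
  have "clinear ?u"
  proof (rule clinearI)
    show "?u (x + y) = ?u x + ?u y" for x y
      by (rule blinfun.add_right)
    fix x c
    obtain a where x: "x = T a"
      using T by blast
    show "?u (c *\<^sub>C x) = c *\<^sub>C ?u x"
      unfolding x cayley_rel_apply_den clinear_scaleC[OF clinear_den, symmetric]
        clinear_scaleC[OF clinear_num, symmetric] ..
  qed
  have iso: "cinner (?u x) (?u y) = cinner x y" for x y
    using \<open>clinear ?u\<close> norm_cayley_rel by (rule cinner_isometry)
  have "inj ?u"
  proof (rule injI)
    fix x y assume "?u x = ?u y"
    then have "norm (?u (x - y)) = 0"
      by (simp add: blinfun.diff_right)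
    then show "x = y"
      unfolding norm_cayley_rel by simp
  qed
  moreover have "surj ?u"
  proof (rule surjI)
    show "?u (T (inv N h)) = h" for h
      unfolding cayley_rel_apply_den by (rule surj_f_inv_f[OF surj_num])
  qed
  ultimately have "unitary_between UNIV UNIV ?u"
    unfolding unitary_between_def
    using \<open>clinear ?u\<close> iso by (simp add: bij_def clinear_scaleC blinfun.add_right)
  moreover have "fredholm (?u + id_blinfun)"
  proof -
    have uT: "(?u + id_blinfun) (T z) = 2 *\<^sub>R G z" for z
      using den_plus_num[of z] by (simp add: blinfun.add_left cayley_rel_apply_den add.commute)
    have ker: "{x. (?u + id_blinfun) x = 0} \<subseteq> span ((\<lambda>k. T (B k)) ` Basis)"
    proof
      fix x assume "x \<in> {x. (?u + id_blinfun) x = 0}"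
      then have x: "(?u + id_blinfun) x = 0" by simp
      obtain z where z: "x = T z"
        using T by blast
      have "G z = 0"
        using x uT[of z] unfolding z by simp
      then have "z = B (E (Ys z))"
        by (simp add: rel_value_apply)
      then have "x = T (B (E (Ys z)))"
        using z by simp
      also have "\<dots> \<in> (\<lambda>k. T (B k)) ` span Basis"
        by simp
      also have "\<dots> = span ((\<lambda>k. T (B k)) ` Basis)"
        by (rule linear_span_image[symmetric]) (intro linearI; simp add: blinfun.add_right blinfun.scaleR_right)
      finally show "x \<in> span ((\<lambda>k. T (B k)) ` Basis)" .
    qed
    have range: "range (?u + id_blinfun) = range G"
    proof (intro subset_antisym subsetI)
      fix x assume "x \<in> range (?u + id_blinfun)"
      then obtain h where "x = (?u + id_blinfun) h" by auto
      then obtain z where "x = (?u + id_blinfun) (T z)"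
        using T[of h] by auto
      then have "x = G (2 *\<^sub>R z)"
        by (simp only: uT blinfun.scaleR_right)
      then show "x \<in> range G" by simp
    next
      fix x assume "x \<in> range G"
      then obtain z where "x = G z" by auto
      then have "x = (?u + id_blinfun) (T ((1/2) *\<^sub>R z))"
        by (simp only: uT blinfun.scaleR_right) simp
      then show "x \<in> range (?u + id_blinfun)" by simp
    qed
    \<comment> \<open>The range is the preimage of a subspace of K, hence closed. The witness
      \<open>x - B (Ys x) + B k\<close> replaces the value of \<open>Ys\<close> at \<open>x\<close>
      by \<open>k\<close>, and \<open>rel_value\<close> sends it back to \<open>x\<close>.\<close>
    have rangeG: "range G = Ys -` range (\<lambda>k. k - E k)"
    proof (intro subset_antisym subsetI)
      fix x assume "x \<in> range G"
      then show "x \<in> Ys -` range (\<lambda>k. k - E k)"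
        by (auto simp: rel_value_apply blinfun.diff_right rinv)
    next
      fix x assume "x \<in> Ys -` range (\<lambda>k. k - E k)"
      then obtain k where k: "Ys x = k - E k" by auto
      have "Ys (x - B (Ys x) + B k) = k"
        by (simp add: blinfun.diff_right blinfun.add_right rinv)
      then have "x = G (x - B (Ys x) + B k)"
        by (simp add: rel_value_apply k blinfun.diff_right)
      then show "x \<in> range G" by blast
    qed
    have sub: "subspace (range (\<lambda>k. k - E k))"
      by (intro linear_subspace_image subspace_UNIV linearI)
        (simp_all add: blinfun.add_right blinfun.scaleR_right algebra_simps)
    have "closed (range (?u + id_blinfun))"
      unfolding range rangeG
      by (intro closed_vimage closed_subspace sub linear_continuous_on blinfun.bounded_linear_right)
    moreover have "span (range (?u + id_blinfun) \<union> B ` Basis) = UNIV"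
    proof -
      have "z \<in> span (range G \<union> B ` Basis)" for z
      proof -
        have "B (E (Ys z)) \<in> B ` span Basis"
          by simp
        also have "\<dots> = span (B ` Basis)"
          by (rule linear_span_image[symmetric]) (intro linearI; simp add: blinfun.add_right blinfun.scaleR_right)
        finally have "B (E (Ys z)) \<in> span (range G \<union> B ` Basis)"
          using span_mono[of "B ` Basis" "range G \<union> B ` Basis"] by blast
        moreover have "G z \<in> span (range G \<union> B ` Basis)"
          by (rule span_base) simp
        ultimately have "G z + B (E (Ys z)) \<in> span (range G \<union> B ` Basis)"
          by (intro span_add)
        then show ?thesis
          by (simp add: rel_value_apply)
      qed
      then show ?thesis
        unfolding range by blast
    qed
    ultimately show ?thesis
      unfolding fredholm_def
      by (intro conjI exI[of _ "(\<lambda>k. T (B k)) ` Basis"] exI[of _ "B ` Basis"] ker) auto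
  qed
  ultimately show ?thesis
    by (simp add: unitary_fredholm_def)
qed

end

section \<open>Homotopies of Cayley transforms\<close>

lemma eventually_atin_topspace: "eventually (\<lambda>x. x \<in> topspace X) (atin X a)"
  unfolding eventually_atin by (cases "a \<in> topspace X") auto

text \<open>Numerator and denominator are polynomial in the data, and the Cayley transforms are
  contractions, so \<open>tendsto_contraction_quotient\<close> applies. All data may vary, since the
  lemma is also applied to the product of the unit interval with X, where it produces
  homotopies.\<close>

lemma continuous_map_cayley_rel:
  fixes A :: "'x \<Rightarrow> 'h::chilbert_space \<Rightarrow>\<^sub>L 'h" and Y :: "'x \<Rightarrow> 'k::{complex_inner,euclidean_space} \<Rightarrow>\<^sub>L 'h"
  assumes cont: "continuous_map X euclidean A" "continuous_map X euclidean Y"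
      "continuous_map X euclidean B" "continuous_map X euclidean Ys" "continuous_map X euclidean w"
    and data: "\<And>x. x \<in> topspace X \<Longrightarrow> cayley_data (A x) (Y x) (B x) (Ys x)"
    and w: "\<And>x. x \<in> topspace X \<Longrightarrow> w x \<in> unitary_maps"
  shows "continuous_map X (top_of_set \<U>\<^sub>F) (\<lambda>x. cayley_rel (A x) (Y x) (B x) (Ys x) (w x))"
  unfolding continuous_map_in_subtopology
proof
  show "(\<lambda>x. cayley_rel (A x) (Y x) (B x) (Ys x) (w x)) \<in> topspace X \<rightarrow> \<U>\<^sub>F"
    using cayley_rel_UF data w by blast
  show "continuous_map X euclidean (\<lambda>x. cayley_rel (A x) (Y x) (B x) (Ys x) (w x))"
    unfolding continuous_map_euclidean_tendsto
  proof
    fix x assume x: "x \<in> topspace X"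
    note lim = cont[unfolded continuous_map_euclidean_tendsto, rule_format, OF x]
    obtain S where S: "cayley_den (A x) (Y x) (B x) (Ys x) (w x) o\<^sub>L S = id_blinfun"
      using cayley_den_inverse[OF data[OF x] w[OF x]] by blast
    show "((\<lambda>x. cayley_rel (A x) (Y x) (B x) (Ys x) (w x)) \<longlongrightarrow> cayley_rel (A x) (Y x) (B x) (Ys x) (w x)) (atin X x)"
    proof (rule tendsto_contraction_quotient[OF _ _ _ cayley_rel_compose_den[OF data[OF x] w[OF x]] S])
      show "((\<lambda>x. cayley_den (A x) (Y x) (B x) (Ys x) (w x)) \<longlongrightarrow> cayley_den (A x) (Y x) (B x) (Ys x) (w x)) (atin X x)"
        "((\<lambda>x. cayley_num (A x) (Y x) (B x) (Ys x) (w x)) \<longlongrightarrow> cayley_num (A x) (Y x) (B x) (Ys x) (w x)) (atin X x)"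
        unfolding cayley_den_def cayley_num_def rel_arg_def rel_value_def half_defect_def
        by (intro tendsto_intros blinfun_compose_tendsto lim)+
      show "\<forall>\<^sub>F x in atin X x. norm (cayley_rel (A x) (Y x) (B x) (Ys x) (w x)) \<le> 1 \<and>
          cayley_rel (A x) (Y x) (B x) (Ys x) (w x) o\<^sub>L cayley_den (A x) (Y x) (B x) (Ys x) (w x) =
          cayley_num (A x) (Y x) (B x) (Ys x) (w x)"
        using eventually_atin_topspace
      proof (rule eventually_mono)
        fix y assume y: "y \<in> topspace X"
        show "norm (cayley_rel (A y) (Y y) (B y) (Ys y) (w y)) \<le> 1 \<and>
          cayley_rel (A y) (Y y) (B y) (Ys y) (w y) o\<^sub>L cayley_den (A y) (Y y) (B y) (Ys y) (w y) =
          cayley_num (A y) (Y y) (B y) (Ys y) (w y)"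
          using cayley_rel_compose_den[OF data[OF y] w[OF y]] norm_cayley_rel[OF data[OF y] w[OF y]]
          by (intro conjI norm_blinfun_bound) auto
      qed
    qed
  qed
qed

lemma continuous_map_snd_family:
  assumes "continuous_map X Z f"
  shows "continuous_map (prod_topology T X) Z (\<lambda>p. f (snd p))"
  by (rule continuous_map_compose[OF continuous_map_snd assms, unfolded o_def])

lemma continuous_map_fst_family:
  assumes "continuous_on S f"
  shows "continuous_map (prod_topology (top_of_set S) X) euclidean (\<lambda>p. f (fst p))"
proof -
  have "continuous_map (top_of_set S) euclidean f"
    using assms by simp
  then show ?thesis
    by (rule continuous_map_compose[OF continuous_map_fst, unfolded o_def])
qed

text \<open>\<open>A\<close> is scaled by a cosine c while \<open>Y\<close>, \<open>B\<close> and
  \<open>Ys\<close> are rotated towards \<open>J\<close>, \<open>J\<close> and \<open>Js\<close>.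
  The orthogonality assumptions remove the mixed terms, so the product of the rotated
  \<open>Ys\<close> with the rotated \<open>B\<close> is c^2 + d^2 = 1 at every time.\<close>

lemma homotopic_cayley_rel_isometry:
  fixes A :: "'h::chilbert_space \<Rightarrow>\<^sub>L 'h" and Y :: "'k::{complex_inner,euclidean_space} \<Rightarrow>\<^sub>L 'h"
  assumes data: "cayley_data A Y B Ys" and iso: "cayley_data 0 J J Js"
    and orth: "\<And>k. Ys (J k) = 0" "\<And>k. Js (B k) = 0"
    and w: "continuous_map X euclidean w" "\<And>x. x \<in> topspace X \<Longrightarrow> w x \<in> unitary_maps"
  shows "homotopic_UF X (\<lambda>x. cayley_rel A Y B Ys (w x)) (\<lambda>x. cayley_rel 0 J J Js (w x))"
proof -
  define c d :: "real \<Rightarrow> real" where "c t = cos (pi / 2 * t)" and "d t = sin (pi / 2 * t)" for t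
  define h where "h = (\<lambda>(t, x). cayley_rel (c t *\<^sub>R A) (c t *\<^sub>R Y + d t *\<^sub>R J) (c t *\<^sub>R B + d t *\<^sub>R J)
    (c t *\<^sub>R Ys + d t *\<^sub>R Js) (w x))"
  have cont: "continuous_on {0..1} c" "continuous_on {0..1} d"
    unfolding c_def d_def by (intro continuous_intros)+
  have data_t: "cayley_data (c t *\<^sub>R A) (c t *\<^sub>R Y + d t *\<^sub>R J) (c t *\<^sub>R B + d t *\<^sub>R J) (c t *\<^sub>R Ys + d t *\<^sub>R Js)" for t
  proof -
    have lin: "clinear A" "clinear Y" "clinear B" "clinear Ys" "clinear J" "clinear Js"
      using data iso by (auto simp: cayley_data_def)
    have adj: "cinner (A x) y = cinner x (A y)" "cinner (Y k) x = cinner k (Ys x)" "cinner (J k) x = cinner k (Js x)" for x y k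
      using data iso by (auto simp: cayley_data_def)
    have inv: "Ys (B k) = k" "Js (J k) = k" for k
      using data iso by (auto simp: cayley_data_def)
    have cd: "(c t * c t) *\<^sub>R k + (d t * d t) *\<^sub>R k = k" for k :: 'k
    proof -
      have "c t * c t + d t * d t = 1"
        unfolding c_def d_def by (simp flip: power2_eq_square)
      then show ?thesis
        by (simp flip: scaleR_left_distrib)
    qed
    show ?thesis
      unfolding cayley_data_def
    proof (intro conjI allI clinearI)
      show "(c t *\<^sub>R Ys + d t *\<^sub>R Js) ((c t *\<^sub>R B + d t *\<^sub>R J) k) = k" for k
        using cd[of k] by (simp add: blinfun.add_left blinfun.add_right blinfun.scaleR_left blinfun.scaleR_right
          inv orth)
    qed (simp_all add: blinfun.add_left blinfun.add_right blinfun.scaleR_left adj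
        lin[THEN clinear_scaleC] scaleC_simps cinner_simps algebra_simps)
  qed
  show ?thesis
    unfolding homotopic_with_def
  proof (intro exI[of _ h] conjI allI ballI TrueI)
    show "continuous_map (prod_topology (top_of_set {0..1}) X) (top_of_set \<U>\<^sub>F) h"
      unfolding h_def case_prod_beta
    proof (rule continuous_map_cayley_rel)
      show "continuous_map (prod_topology (top_of_set {0..1}) X) euclidean (\<lambda>p. c (fst p) *\<^sub>R A)"
        "continuous_map (prod_topology (top_of_set {0..1}) X) euclidean (\<lambda>p. c (fst p) *\<^sub>R Y + d (fst p) *\<^sub>R J)"
        "continuous_map (prod_topology (top_of_set {0..1}) X) euclidean (\<lambda>p. c (fst p) *\<^sub>R B + d (fst p) *\<^sub>R J)"
        "continuous_map (prod_topology (top_of_set {0..1}) X) euclidean (\<lambda>p. c (fst p) *\<^sub>R Ys + d (fst p) *\<^sub>R Js)"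
        by (rule continuous_map_fst_family, intro continuous_intros cont)+
      show "continuous_map (prod_topology (top_of_set {0..1}) X) euclidean (\<lambda>p. w (snd p))"
        by (rule continuous_map_snd_family[OF w(1)])
    qed (use data_t w(2) in auto)
  qed (auto simp: h_def c_def d_def)
qed

section \<open>Orthonormal families orthogonal to finitely many vectors\<close>

lemma cinner_span_eq_0:
  assumes "\<And>f. f \<in> F \<Longrightarrow> cinner x f = 0" and "v \<in> span F"
  shows "cinner x (v::'h::complex_inner) = 0"
  using assms(2) by (induction rule: span_induct_alt) (auto simp: cinner_simps assms(1))

text \<open>Gram-Schmidt, with the existence of orthogonal projections onto the space as induction
  invariant. The new direction \<open>g\<close> contributes both \<open>g\<close> and
  \<open>\<i> *\<^sub>C g\<close> to \<open>B\<close>, because \<open>span\<close> is the real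
  span.\<close>

lemma finite_orthogonal_decomposition:
  fixes F :: "'h::complex_inner set"
  assumes "finite F"
  shows "\<exists>V. F \<subseteq> V \<and> (\<exists>B. finite B \<and> V \<subseteq> span B) \<and> (\<forall>x. \<exists>y\<in>V. \<forall>v\<in>V. cinner (x - y) v = 0)
    \<and> 0 \<in> V \<and> (\<forall>u\<in>V. \<forall>v\<in>V. u + v \<in> V)"
  using assms
proof (induction F)
  case empty
  show ?case
    by (intro exI[of _ "{0}"]) (auto intro: exI[of _ "{}"])
next
  case (insert f F)
  then obtain V B where V: "F \<subseteq> V" "finite B" "V \<subseteq> span B" "\<And>x. \<exists>y\<in>V. \<forall>v\<in>V. cinner (x - y) v = 0"
    "0 \<in> V" "\<And>u v. u \<in> V \<Longrightarrow> v \<in> V \<Longrightarrow> u + v \<in> V"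
    by blast
  obtain y0 where y0: "y0 \<in> V" "\<And>v. v \<in> V \<Longrightarrow> cinner (f - y0) v = 0"
    using V(4)[of f] by blast
  define g where "g = f - y0"
  have g: "cinner g v = 0" "cinner v g = 0" if "v \<in> V" for v
    using y0(2)[OF that] cinner_commute[of v g] by (simp_all add: g_def)
  define V' where "V' = {v + c *\<^sub>C g |v c. v \<in> V}"
  have mem: "v + c *\<^sub>C g \<in> V'" if "v \<in> V" for v c
    using that unfolding V'_def by blast
  have "insert f F \<subseteq> V'"
    using mem[OF y0(1), of 1] mem[of _ 0] V(1) by (auto simp: g_def)
  moreover have "V' \<subseteq> span (B \<union> {g, \<i> *\<^sub>C g})"
  proof
    fix x assume "x \<in> V'"
    then obtain v c where x: "x = v + c *\<^sub>C g" "v \<in> V"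
      unfolding V'_def by blast
    have "c *\<^sub>C g = (complex_of_real (Re c) + complex_of_real (Im c) * \<i>) *\<^sub>C g"
      by (metis complex_eq mult.commute)
    also have "\<dots> = Re c *\<^sub>R g + Im c *\<^sub>R (\<i> *\<^sub>C g)"
      by (simp add: scaleC_add_left scaleR_scaleC scaleC_scaleC)
    finally have c: "c *\<^sub>C g = Re c *\<^sub>R g + Im c *\<^sub>R (\<i> *\<^sub>C g)" .
    have "v \<in> span (B \<union> {g, \<i> *\<^sub>C g})"
      using x(2) V(3) span_mono[of B "B \<union> {g, \<i> *\<^sub>C g}"] by blast
    then show "x \<in> span (B \<union> {g, \<i> *\<^sub>C g})"
      unfolding x c by (intro span_add span_scale) (auto intro: span_base)
  qed
  moreover have "\<exists>y\<in>V'. \<forall>v\<in>V'. cinner (x - y) v = 0" for x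
  proof -
    obtain y where y: "y \<in> V" "\<And>v. v \<in> V \<Longrightarrow> cinner (x - y) v = 0"
      using V(4)[of x] by blast
    \<comment> \<open>If \<open>g\<close> is 0, division by zero makes \<open>c\<close> equal to 0,
      and the identity \<open>cg\<close> remains true.\<close>
    define c where "c = cinner x g / cinner g g"
    have cg: "c * cinner g g = cinner x g"
      by (cases "g = 0") (simp_all add: c_def)
    have "cinner (x - (y + c *\<^sub>C g)) (v + d *\<^sub>C g) = 0" if "v \<in> V" for v d
    proof -
      have "cinner (x - (y + c *\<^sub>C g)) (v + d *\<^sub>C g)
          = cinner (x - y) v + cnj d * (cinner x g - c * cinner g g) - cnj d * cinner y g - c * cinner g v"
        by (simp add: cinner_simps algebra_simps)
      then show ?thesis
        using y(2)[OF that] g[OF that] g(2)[OF y(1)] by (simp add: cg)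
    qed
    then show ?thesis
      using mem[OF y(1), of c] unfolding V'_def by blast
  qed
  moreover have "0 \<in> V'"
    using mem[OF V(5), of 0] by simp
  moreover have "u + v \<in> V'" if uv: "u \<in> V'" "v \<in> V'" for u v
  proof -
    obtain u1 c v1 d where "u = u1 + c *\<^sub>C g" "u1 \<in> V" "v = v1 + d *\<^sub>C g" "v1 \<in> V"
      using uv unfolding V'_def by blast
    then show ?thesis
      using mem[OF V(6)[of u1 v1], of "c + d"] by (simp add: scaleC_add_left algebra_simps)
  qed
  ultimately show ?case
    using V(2) by (intro exI[of _ V'] conjI exI[of _ "B \<union> {g, \<i> *\<^sub>C g}"]) auto
qed

lemma exists_unit_orthogonal:
  fixes F :: "'h::complex_inner set"
  assumes inf: "\<not> (\<exists>B::'h set. finite B \<and> span B = UNIV)" and "finite F"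
  shows "\<exists>x. norm x = 1 \<and> (\<forall>f\<in>F. cinner x f = 0)"
proof -
  obtain V B where V: "F \<subseteq> V" "finite B" "V \<subseteq> span B" "\<And>x. \<exists>y\<in>V. \<forall>v\<in>V. cinner (x - y) v = 0"
    using finite_orthogonal_decomposition[OF \<open>finite F\<close>] by blast
  obtain x where "x \<notin> span B"
    using inf V(2) by blast
  obtain y where y: "y \<in> V" "\<And>v. v \<in> V \<Longrightarrow> cinner (x - y) v = 0"
    using V(4)[of x] by blast
  have "x - y \<noteq> 0"
    using \<open>x \<notin> span B\<close> y(1) V(3) by auto
  then show ?thesis
    using y(2) V(1) by (intro exI[of _ "(1 / norm (x - y)) *\<^sub>R (x - y)"]) (auto simp: cinner_scaleR_left)
qed

lemma cinner_self_eq_1: "cinner x x = 1 \<longleftrightarrow> norm (x::'h::complex_inner) = 1"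
proof -
  have "cinner x x = 1 \<longleftrightarrow> complex_of_real ((norm x)\<^sup>2) = complex_of_real 1"
    by (simp add: cinner_self)
  also have "\<dots> \<longleftrightarrow> (norm x)\<^sup>2 = 1"
    by (rule of_real_eq_iff)
  also have "\<dots> \<longleftrightarrow> norm x = 1"
    by (simp add: abs_square_eq_1)
  finally show ?thesis .
qed

lemma exists_orthonormal_family:
  fixes F :: "'h::complex_inner set"
  assumes inf: "\<not> (\<exists>B::'h set. finite B \<and> span B = UNIV)" and F: "finite F"
  shows "\<exists>b::'n::finite \<Rightarrow> 'h. (\<forall>i j. cinner (b i) (b j) = (if i = j then 1 else 0)) \<and> (\<forall>i. \<forall>f\<in>F. cinner (b i) f = 0)"
proof -
  have "\<exists>b::'n \<Rightarrow> 'h. (\<forall>i\<in>I. \<forall>j\<in>I. cinner (b i) (b j) = (if i = j then 1 else 0)) \<and> (\<forall>i\<in>I. \<forall>f\<in>F. cinner (b i) f = 0)"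
    if "finite I" for I
    using that
  proof (induction I)
    case (insert a I)
    then obtain b where b: "\<And>i j. i \<in> I \<Longrightarrow> j \<in> I \<Longrightarrow> cinner (b i) (b j) = (if i = j then 1 else 0)"
      "\<And>i f. i \<in> I \<Longrightarrow> f \<in> F \<Longrightarrow> cinner (b i) f = (0::complex)"
      by blast
    obtain x where x: "norm x = 1" "\<And>f. f \<in> F \<union> b ` I \<Longrightarrow> cinner x f = 0"
      using exists_unit_orthogonal[OF inf, of "F \<union> b ` I"] F insert.hyps by blast
    have x': "cinner f x = 0" if "f \<in> F \<union> b ` I" for f
      using x(2)[OF that] cinner_commute[of f x] by simp
    show ?case
      using b x x' insert.hyps cinner_self_eq_1[of x] by (intro exI[of _ "b(a := x)"]) auto
  qed auto
  from this[of UNIV] show ?thesis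
    by simp
qed

text \<open>An orthonormal family indexed by the coordinates of K, chosen orthogonal to
  \<open>F\<close>, spans the range of \<open>J\<close>. For an isometry the adjoint is a left
  inverse, so \<open>J\<close> can serve as its own \<open>B\<close>.\<close>

lemma exists_isometry_orthogonal:
  fixes F :: "'h::chilbert_space set"
  assumes inf: "\<not> (\<exists>B::'h set. finite B \<and> span B = UNIV)" and F: "finite F"
  shows "\<exists>(J :: (complex ^ 'n::finite) \<Rightarrow>\<^sub>L 'h) Js. cayley_data 0 J J Js \<and> (\<forall>k. \<forall>f\<in>span F. cinner (J k) f = 0)"
proof -
  obtain b :: "'n \<Rightarrow> 'h" where "(\<forall>i j. cinner (b i) (b j) = (if i = j then 1 else 0)) \<and> (\<forall>i. \<forall>f\<in>F. cinner (b i) f = 0)"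
    using exists_orthonormal_family[OF inf F] by blast
  then have b: "\<And>i j. cinner (b i) (b j) = (if i = j then 1 else 0)"
    and bF: "\<And>i f. f \<in> F \<Longrightarrow> cinner (b i) f = 0"
    by blast+
  define J :: "complex ^ 'n \<Rightarrow> 'h" where "J k = (\<Sum>i\<in>UNIV. (k $ i) *\<^sub>C b i)" for k
  define Js :: "'h \<Rightarrow> complex ^ 'n" where "Js h = (\<chi> i. cinner h (b i))" for h
  have J: "clinear J"
  proof (rule clinearI)
    show "J (x + y) = J x + J y" for x y
      by (simp add: J_def scaleC_add_left sum.distrib)
    show "J (c *\<^sub>C x) = c *\<^sub>C J x" for c x
      unfolding J_def linear_sum[OF bounded_linear.linear[OF bounded_linear_scaleC_right]]
      by (simp add: scaleC_vec_def scaleC_complex_def scaleC_scaleC)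
  qed
  have Js: "clinear Js"
    by (rule clinearI) (auto simp: Js_def vec_eq_iff cinner_simps scaleC_vec_def scaleC_complex_def)
  have "bounded_linear J"
    using clinear_linear[OF J] by (simp add: linear_conv_bounded_linear)
  then have bJ: "blinfun_apply (Blinfun J) = J"
    by (rule bounded_linear_Blinfun_apply)
  have "norm (Js h) \<le> norm h * of_nat CARD('n)" for h
  proof -
    have "norm (b i) = 1" for i
      using b[of i i] by (simp add: cinner_self_eq_1)
    then have "cmod (cinner h (b i)) \<le> norm h" for i
      using cinner_bound[of h "b i"] by simp
    then have "(\<Sum>i\<in>(UNIV::'n set). cmod (cinner h (b i))) \<le> of_nat CARD('n) * norm h"
      by (intro sum_bounded_above) auto
    moreover have "norm (Js h) \<le> (\<Sum>i\<in>UNIV. norm (Js h $ i))"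
      unfolding norm_vec_def by (intro L2_set_le_sum) auto
    ultimately show ?thesis
      by (simp add: Js_def mult.commute)
  qed
  with Js have "bounded_linear Js"
    by (rule clinear_bounded_linear)
  then have bJs: "blinfun_apply (Blinfun Js) = Js"
    by (rule bounded_linear_Blinfun_apply)
  have "Js (J k) = k" for k
    by (simp add: J_def Js_def cinner_sum_left cinner_scaleC_left b vec_eq_iff if_distrib[of "\<lambda>x. _ * x"] cong: if_cong)
  moreover have "cinner (J k) h = cinner k (Js h)" for k h
    by (simp add: J_def Js_def cinner_sum_left cinner_scaleC_left cinner_vec_def cinner_complex_def
        flip: cinner_commute)
  moreover have "cinner (J k) f = 0" if "f \<in> span F" for k f
    using cinner_span_eq_0[OF bF that] by (simp add: J_def cinner_sum_left cinner_scaleC_left)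
  ultimately show ?thesis
    using J Js by (intro exI[of _ "Blinfun J"] exI[of _ "Blinfun Js"])
      (auto simp: cayley_data_def bJ bJs clinear_def)
qed

section \<open>Path connectedness of the unitary group of a finite-dimensional space\<close>

lemma unitary_maps_inner:
  assumes "w \<in> unitary_maps"
  shows "cinner (w x) (w y) = cinner x y"
proof (rule cinner_isometry)
  show "clinear w" "norm (w x) = norm x" for x
    using assms by (simp_all add: unitary_maps_def)
qed

lemma unitary_maps_compose:
  assumes "v \<in> unitary_maps" "w \<in> unitary_maps"
  shows "v o\<^sub>L w \<in> unitary_maps"
proof -
  have "clinear v" "clinear w" and n: "norm (v k) = norm k" "norm (w k) = norm k" for k
    using assms by (simp_all add: unitary_maps_def)
  then have "clinear (v o\<^sub>L w)"
    by (intro clinearI) (simp_all add: blinfun.add_right clinear_scaleC)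
  then show ?thesis
    by (simp add: unitary_maps_def n)
qed

lemma unitary_maps_id: "id_blinfun \<in> unitary_maps"
  by (auto simp: unitary_maps_def clinear_def)

text \<open>In finite dimension a linear isometry is onto. This is why \<open>unitary_maps\<close>
  asks for isometry only.\<close>

lemma unitary_maps_inverse:
  fixes w :: "'k::{complex_inner,euclidean_space} \<Rightarrow>\<^sub>L 'k"
  assumes w: "w \<in> unitary_maps"
  shows "\<exists>v\<in>unitary_maps. v o\<^sub>L w = id_blinfun \<and> w o\<^sub>L v = id_blinfun"
proof -
  have lin: "clinear w" and n: "\<And>k. norm (w k) = norm k"
    using w by (auto simp: unitary_maps_def)
  have inj: "inj w"
  proof (rule injI)
    fix x y assume "w x = w y"
    then have "norm (w (x - y)) = 0"
      by (simp add: blinfun.diff_right)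
    then show "x = y"
      unfolding n by simp
  qed
  have surj: "surj w"
    by (rule linear_injective_imp_surjective[OF clinear_linear[OF lin] inj]) auto
  define v where "v = inv w"
  have wv: "w (v k) = k" and vw: "v (w k) = k" for k
    by (simp_all add: v_def surj_f_inv_f[OF surj] inv_f_f[OF inj])
  have v: "clinear v"
  proof (rule clinearI)
    show "v (x + y) = v x + v y" for x y
      using vw[of "v x + v y"] by (simp add: blinfun.add_right wv)
    show "v (c *\<^sub>C x) = c *\<^sub>C v x" for c x
      using vw[of "c *\<^sub>C v x"] by (simp add: clinear_scaleC[OF lin] wv)
  qed
  then have "bounded_linear v"
    using clinear_linear linear_conv_bounded_linear by blast
  then have bv: "blinfun_apply (Blinfun v) = v"
    by (rule bounded_linear_Blinfun_apply)
  have nv: "norm (v k) = norm k" for k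
    using n[of "v k"] by (simp add: wv)
  show ?thesis
    using v by (intro bexI[of _ "Blinfun v"] conjI blinfun_eqI) (auto simp: bv wv vw nv unitary_maps_def)
qed

text \<open>Eigenvectors of a unitary map for different unimodular eigenvalues are orthogonal, so
  there are only finitely many eigenvalues. If every - cis t were one, the parameters between 0 and
  1 alone would give an infinite independent set.\<close>

lemma exists_shift_injective:
  fixes a :: "'k::{complex_inner,euclidean_space} \<Rightarrow>\<^sub>L 'k"
  assumes a: "a \<in> unitary_maps"
  shows "\<exists>t. \<forall>k. a k = - cis t *\<^sub>C k \<longrightarrow> k = 0"
proof (rule ccontr)
  assume "\<not> ?thesis"
  then obtain v where v: "\<And>t. a (v t) = - cis t *\<^sub>C v t" "\<And>t. v t \<noteq> 0"
    by metis
  \<comment> \<open>The unit interval lies in the interval from 0 to pi, on which the cosine is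
    injective.\<close>
  have cis_ne: "cis s \<noteq> cis t" if "s \<in> {0..1}" "t \<in> {0..1}" "s \<noteq> t" for s t :: real
  proof
    assume "cis s = cis t"
    then have "cos s = cos t"
      by (metis cis.simps(1))
    then show False
      using that pi_gt3 cos_inj_pi[of s t] by simp
  qed
  have orth: "cinner (v s) (v t) = 0" if "cis s \<noteq> cis t" for s t
  proof -
    have "cinner (v s) (v t) = cis s * cnj (cis t) * cinner (v s) (v t)"
      using unitary_maps_inner[OF a, of "v s" "v t"] by (simp add: v(1) cinner_simps mult_ac)
    moreover have "cis s * cnj (cis t) \<noteq> 1"
    proof
      assume "cis s * cnj (cis t) = 1"
      then have "cis s * cnj (cis t) * cis t = cis t"
        by simp
      then show False
        using that by (simp add: mult.assoc cis_cnj cis_mult)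
    qed
    ultimately show ?thesis
      by (auto simp: mult_cancel_right1)
  qed
  have "pairwise orthogonal (v ` {0..1})"
    using orth cis_ne by (auto simp: pairwise_def orthogonal_def inner_cinner) (metis zero_complex.sel(1))
  moreover have "0 \<notin> v ` {0..1}"
    using v(2) by auto
  ultimately have "independent (v ` {0..1})"
    by (rule pairwise_orthogonal_independent)
  then have "finite (v ` {0..1})"
    by (rule independent_imp_finite)
  moreover have "inj_on v {0..1}"
  proof (rule inj_onI)
    fix s t :: real assume st: "s \<in> {0..1}" "t \<in> {0..1}" "v s = v t"
    then have "cinner (v s) (v t) \<noteq> 0"
      using v(2) by simp
    then show "s = t"
      using orth cis_ne st by blast
  qed
  ultimately have "finite {0..1::real}"
    by (rule finite_imageD)
  then show False
    using infinite_Icc[of 0 "1::real"] by simp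
qed

text \<open>A substitute for diagonalization. A scalar rotation leads from the identity to
  \<open>cis t\<close> and turns \<open>a\<close> into a map \<open>b\<close> without eigenvalue -1.
  A Moebius path joins \<open>b\<close> to the identity, and multiplied by \<open>cis t\<close> it
  joins \<open>a\<close> to that scalar.\<close>

lemma path_component_unitary_maps_id:
  fixes a :: "'k::{complex_inner,euclidean_space} \<Rightarrow>\<^sub>L 'k"
  assumes a: "a \<in> unitary_maps"
  shows "path_component unitary_maps id_blinfun a"
proof -
  obtain t where t: "\<And>k. a k = - cis t *\<^sub>C k \<Longrightarrow> k = 0"
    using exists_shift_injective[OF a] by blast
  have cis_unitary: "scaleC_blinfun (cis s) \<in> (unitary_maps :: ('k \<Rightarrow>\<^sub>L 'k) set)" for s
    by (auto simp: unitary_maps_def clinear_def scaleC_simps mult.commute)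
  have "path_component unitary_maps id_blinfun (scaleC_blinfun (cis t) :: 'k \<Rightarrow>\<^sub>L 'k)"
    unfolding path_component_def
  proof (intro exI[of _ "\<lambda>s. scaleC_blinfun (cis (s * t))"] conjI)
    show "path (\<lambda>s. scaleC_blinfun (cis (s * t)) :: 'k \<Rightarrow>\<^sub>L 'k)"
      unfolding path_def by (intro bounded_linear.continuous_on[OF bounded_linear_scaleC_blinfun] continuous_intros)
    show "pathstart (\<lambda>s. scaleC_blinfun (cis (s * t)) :: 'k \<Rightarrow>\<^sub>L 'k) = id_blinfun"
      by (auto simp: pathstart_def intro: blinfun_eqI)
  qed (use cis_unitary in \<open>auto simp: path_image_def pathfinish_def\<close>)
  moreover
  define b where "b = scaleC_blinfun (cis (- t)) o\<^sub>L a"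
  have b: "b \<in> unitary_maps"
    unfolding b_def by (intro unitary_maps_compose cis_unitary a)
  have ab: "a = scaleC_blinfun (cis t) o\<^sub>L b"
    by (rule blinfun_eqI) (simp add: b_def scaleC_scaleC cis_mult)
  have inj1: "k = 0" if "k + b k = 0" for k
  proof (rule t)
    have "b k = - k"
      using that by (simp add: add_eq_0_iff)
    then have "cis t *\<^sub>C b k = cis t *\<^sub>C (- k)"
      by simp
    then show "a k = - cis t *\<^sub>C k"
      by (simp add: ab)
  qed
  \<comment> \<open>The path is (r + b) (1 + r b)^(-1), which is b at r = 0 and the identity at r =
    1. Since b is isometric, numerator and denominator have equal norms. The denominator is
    injective for r < 1 by comparing norms, and for r = 1 because -1 is not an eigenvalue of
    b.\<close>
  define T N :: "real \<Rightarrow> 'k \<Rightarrow>\<^sub>L 'k" where "T r = id_blinfun + r *\<^sub>R b" and "N r = r *\<^sub>R id_blinfun + b" for r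
  have Tap: "T r k = k + r *\<^sub>R b k" and Nap: "N r k = r *\<^sub>R k + b k" for r k
    by (simp_all add: T_def N_def blinfun.add_left blinfun.scaleR_left)
  have nb: "norm (b k) = norm k" and lb: "clinear b" for k
    using b by (auto simp: unitary_maps_def)
  have TN: "norm (T r k) = norm (N r k)" for r k
  proof -
    have "(norm (T r k))\<^sup>2 = (norm (N r k))\<^sup>2"
      using nb[of k] unfolding Tap Nap power2_norm_eq_inner inner_add_left inner_add_right
      by (simp add: norm_eq_sqrt_inner inner_commute)
    then show ?thesis by simp
  qed
  have injT: "k = 0" if "T r k = 0" "r \<in> {0..1}" for r k
  proof (cases "r = 1")
    case True
    show ?thesis
      by (rule inj1) (use that(1) True in \<open>simp add: Tap\<close>)
  next
    case False
    have "k = - (r *\<^sub>R b k)"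
      using that(1) unfolding Tap by (simp only: eq_neg_iff_add_eq_0)
    then have "norm k = norm (- (r *\<^sub>R b k))"
      by (rule arg_cong)
    then have "norm k = r * norm k"
      using that(2) by (simp add: nb)
    then show ?thesis
      using False by simp
  qed
  have clT: "clinear (T r)" and clN: "clinear (N r)" for r
    by (auto intro!: clinearI simp: Tap Nap scaleC_simps clinear_simps[OF lb] scaleR_right_distrib)
  have surjT: "surj (T r)" if "r \<in> {0..1}" for r
  proof (rule linear_injective_imp_surjective)
    show "linear (T r)"
      by (rule clinear_linear[OF clT])
    then show "inj (T r)"
      using injT[OF _ that] by (simp only: linear_injective_0) blast
  qed auto
  define m where "m r = Blinfun (\<lambda>k. N r (inv (T r) k))" for r
  have "\<exists>S. T r o\<^sub>L S = id_blinfun \<and> m r = N r o\<^sub>L S \<and> S o\<^sub>L T r = id_blinfun" if r: "r \<in> {0..1}" for r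
  proof -
    have TT: "T r (inv (T r) k) = k" for k
      by (rule surj_f_inv_f[OF surjT[OF r]])
    have inj: "x = y" if "T r x = T r y" for x y
      using injT[OF _ r, of "x - y"] that by (simp add: blinfun.diff_right)
    have "linear (inv (T r))"
      by (intro linearI; rule inj) (simp_all add: TT blinfun.add_right blinfun.scaleR_right)
    then have "bounded_linear (inv (T r))"
      by (simp add: linear_conv_bounded_linear)
    then have S: "blinfun_apply (Blinfun (inv (T r))) = inv (T r)"
      by (rule bounded_linear_Blinfun_apply)
    have "(\<lambda>k. N r (inv (T r) k)) = blinfun_apply (N r o\<^sub>L Blinfun (inv (T r)))"
      by (rule ext) (simp add: S)
    then have "m r = N r o\<^sub>L Blinfun (inv (T r))"
      by (simp only: m_def blinfun_apply_inverse)
    moreover have "inv (T r) (T r k) = k" for k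
      by (rule inj) (rule TT)
    then have "Blinfun (inv (T r)) o\<^sub>L T r = id_blinfun"
      by (intro blinfun_eqI) (simp add: S)
    moreover have "T r o\<^sub>L Blinfun (inv (T r)) = id_blinfun"
      by (intro blinfun_eqI) (simp add: S TT)
    ultimately show ?thesis
      by blast
  qed
  then obtain S where S: "\<And>r. r \<in> {0..1} \<Longrightarrow> T r o\<^sub>L S r = id_blinfun"
    and mS: "\<And>r. r \<in> {0..1} \<Longrightarrow> m r = N r o\<^sub>L S r" and ST: "\<And>r. r \<in> {0..1} \<Longrightarrow> S r o\<^sub>L T r = id_blinfun"
    by metis
  have mT: "m r o\<^sub>L T r = N r" if "r \<in> {0..1}" for r
    by (simp add: mS[OF that] ST[OF that] blinfun_compose_assoc)
  have mTap: "m r (T r k) = N r k" if "r \<in> {0..1}" for r k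
    by (metis mT[OF that] blinfun_compose_apply)
  have ex: "\<exists>z. k = T r z" if "r \<in> {0..1}" for r k
    using surjT[OF that] unfolding surj_def by blast
  have nm: "norm (m r k) = norm k" if r: "r \<in> {0..1}" for r k
  proof -
    obtain z where "k = T r z"
      using ex[OF r] by blast
    then show ?thesis
      by (simp add: mTap[OF r] TN)
  qed
  have mU: "m r \<in> unitary_maps" if r: "r \<in> {0..1}" for r
  proof -
    have "clinear (m r)"
    proof (rule clinearI)
      show "m r (x + y) = m r x + m r y" for x y
        by (rule blinfun.add_right)
      fix c x
      obtain z where x: "x = T r z"
        using ex[OF r] by blast
      show "m r (c *\<^sub>C x) = c *\<^sub>C m r x"
        unfolding x clinear_scaleC[OF clT, symmetric] mTap[OF r] clinear_scaleC[OF clN] ..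
    qed
    then show ?thesis
      using nm[OF r] by (simp add: unitary_maps_def)
  qed
  have m0: "m 0 = b"
  proof (rule blinfun_eqI)
    show "m 0 k = b k" for k
      using mTap[of 0 k] by (simp add: Tap Nap)
  qed
  have m1: "m 1 = id_blinfun"
  proof (rule blinfun_eqI)
    fix k
    obtain z where z: "k = T 1 z"
      using ex[of 1 k] by auto
    show "m 1 k = id_blinfun k"
      using mTap[of 1 z] z by (simp add: Tap Nap)
  qed
  have "continuous_on {0..1} m"
    unfolding continuous_on_def
  proof
    fix r :: real assume r: "r \<in> {0..1}"
    show "(m \<longlongrightarrow> m r) (at r within {0..1})"
    proof (rule tendsto_contraction_quotient[OF _ _ _ mT[OF r] S[OF r]])
      show "(T \<longlongrightarrow> T r) (at r within {0..1})" "(N \<longlongrightarrow> N r) (at r within {0..1})"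
        unfolding T_def N_def by (intro tendsto_intros)+
      show "\<forall>\<^sub>F x in at r within {0..1}. norm (m x) \<le> 1 \<and> m x o\<^sub>L T x = N x"
        unfolding eventually_at_filter
        by (rule always_eventually) (auto intro!: norm_blinfun_bound simp: nm mT)
    qed
  qed
  then have cm: "continuous_on {0..1} (\<lambda>r. scaleC_blinfun (cis t) o\<^sub>L m r)"
    by (intro bounded_bilinear.continuous_on[OF bounded_bilinear_blinfun_compose] continuous_on_const)
  have "path_component unitary_maps a (scaleC_blinfun (cis t))"
    unfolding path_component_def
  proof (intro exI[of _ "\<lambda>r. scaleC_blinfun (cis t) o\<^sub>L m r"] conjI)
    show "path (\<lambda>r. scaleC_blinfun (cis t) o\<^sub>L m r)"
      unfolding path_def by (rule cm)
    show "path_image (\<lambda>r. scaleC_blinfun (cis t) o\<^sub>L m r) \<subseteq> unitary_maps"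
      unfolding path_image_def using unitary_maps_compose[OF cis_unitary mU] by blast
    show "pathstart (\<lambda>r. scaleC_blinfun (cis t) o\<^sub>L m r) = a"
      by (simp add: pathstart_def m0 ab)
    show "pathfinish (\<lambda>r. scaleC_blinfun (cis t) o\<^sub>L m r) = scaleC_blinfun (cis t)"
      by (simp add: pathfinish_def m1)
  qed
  ultimately show ?thesis
    using path_component_sym path_component_trans by blast
qed

lemma path_component_unitary_maps:
  fixes a b :: "'k::{complex_inner,euclidean_space} \<Rightarrow>\<^sub>L 'k"
  assumes "a \<in> unitary_maps" "b \<in> unitary_maps"
  shows "path_component unitary_maps a b"
  by (rule path_component_trans[OF path_component_sym])
    (rule path_component_unitary_maps_id, rule assms)+

lemma continuous_map_blinfun_compose:
  fixes f :: "'x \<Rightarrow> 'b::real_normed_vector \<Rightarrow>\<^sub>L 'c::real_normed_vector" and g :: "'x \<Rightarrow> 'a::real_normed_vector \<Rightarrow>\<^sub>L 'b"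
  assumes "continuous_map X euclidean f" "continuous_map X euclidean g"
  shows "continuous_map X euclidean (\<lambda>x. f x o\<^sub>L g x)"
  using assms unfolding continuous_map_euclidean_tendsto by (intro ballI blinfun_compose_tendsto) simp_all

text \<open>The range of \<open>J\<close> need not be orthogonal to those of \<open>Y\<close> and
  \<open>B\<close>, so both sides are rotated onto a third isometry \<open>I\<close>, orthogonal to
  all three. There the constant unitary \<open>a\<close> is joined to \<open>b\<close> by a
  path.\<close>

theorem homotopic_cayley_rel:
  fixes A :: "'h::chilbert_space \<Rightarrow>\<^sub>L 'h" and Y :: "(complex ^ 'n::finite) \<Rightarrow>\<^sub>L 'h"
  assumes inf: "\<not> (\<exists>B::'h set. finite B \<and> span B = UNIV)"
    and data: "cayley_data A Y B Ys" and iso: "cayley_data 0 J J Js"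
    and w: "continuous_map X euclidean w" "\<And>x. x \<in> topspace X \<Longrightarrow> w x \<in> unitary_maps"
    and ab: "a \<in> unitary_maps" "b \<in> unitary_maps"
  shows "homotopic_UF X (\<lambda>x. cayley_rel A Y B Ys (a o\<^sub>L w x)) (\<lambda>x. cayley_rel 0 J J Js (b o\<^sub>L w x))"
proof -
  define F where "F = Y ` Basis \<union> B ` Basis \<union> J ` Basis"
  have "finite F"
    by (simp add: F_def)
  from exists_isometry_orthogonal[OF inf this] obtain I :: "(complex ^ 'n) \<Rightarrow>\<^sub>L 'h" and Is
    where "cayley_data 0 I I Is \<and> (\<forall>k. \<forall>f\<in>span F. cinner (I k) f = 0)"
    by (elim exE) (rule that)
  then have I: "cayley_data 0 I I Is" and IF: "\<And>k f. f \<in> span F \<Longrightarrow> cinner (I k) f = 0"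
    by blast+
  have span: "V k \<in> span F" if "V ` Basis \<subseteq> F" for V :: "(complex ^ 'n) \<Rightarrow>\<^sub>L 'h" and k
  proof -
    have "V k \<in> V ` span Basis"
      by simp
    also have "\<dots> = span (V ` Basis)"
      by (rule linear_span_image[symmetric]) (intro linearI; simp add: blinfun.add_right blinfun.scaleR_right)
    also have "\<dots> \<subseteq> span F"
      using that by (rule span_mono)
    finally show ?thesis .
  qed
  have IV: "cinner (I k) (V k') = 0" if "V ` Basis \<subseteq> F" for V :: "(complex ^ 'n) \<Rightarrow>\<^sub>L 'h" and k k'
    by (rule IF[OF span[OF that]])
  have IsV: "Is (V k) = 0" if "V ` Basis \<subseteq> F" for V :: "(complex ^ 'n) \<Rightarrow>\<^sub>L 'h" and k
  proof (rule cinner_eqI)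
    fix y
    have "cinner (I y) (V k) = cinner y (Is (V k))"
      using I by (simp add: cayley_data_def)
    then show "cinner (Is (V k)) y = cinner 0 y"
      using IV[OF that, of y k] cinner_commute[of "Is (V k)" y] by simp
  qed
  have VsI: "Vs (I k) = 0" if "V ` Basis \<subseteq> F" "\<And>k h. cinner (V k) h = cinner k (Vs h)"
    for V :: "(complex ^ 'n) \<Rightarrow>\<^sub>L 'h" and Vs :: "'h \<Rightarrow>\<^sub>L (complex ^ 'n)" and k
  proof (rule cinner_eqI)
    fix y
    show "cinner (Vs (I k)) y = cinner 0 y"
      using IV[OF that(1), of k y] that(2)[of y "I k"] cinner_commute[of "Vs (I k)" y] cinner_commute[of "V y" "I k"]
      by simp
  qed
  have F: "Y ` Basis \<subseteq> F" "B ` Basis \<subseteq> F" "J ` Basis \<subseteq> F"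
    by (auto simp: F_def)
  have adj: "cinner (Y k) h = cinner k (Ys h)" "cinner (J k) h = cinner k (Js h)" for k h
    using data iso by (auto simp: cayley_data_def)
  have aw: "continuous_map X euclidean (\<lambda>x. a o\<^sub>L w x)" "\<And>x. x \<in> topspace X \<Longrightarrow> a o\<^sub>L w x \<in> unitary_maps"
    if "a \<in> unitary_maps" for a
    using that w by (auto intro!: unitary_maps_compose continuous_map_blinfun_compose)
  have "homotopic_UF X (\<lambda>x. cayley_rel A Y B Ys (a o\<^sub>L w x)) (\<lambda>x. cayley_rel 0 I I Is (a o\<^sub>L w x))"
    by (rule homotopic_cayley_rel_isometry[OF data I VsI[OF F(1) adj(1)] IsV[OF F(2)] aw[OF ab(1)]])
  moreover have "homotopic_UF X (\<lambda>x. cayley_rel 0 J J Js (b o\<^sub>L w x)) (\<lambda>x. cayley_rel 0 I I Is (b o\<^sub>L w x))"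
    by (rule homotopic_cayley_rel_isometry[OF iso I VsI[OF F(3) adj(2)] IsV[OF F(3)] aw[OF ab(2)]])
  moreover have "homotopic_UF X (\<lambda>x. cayley_rel 0 I I Is (a o\<^sub>L w x)) (\<lambda>x. cayley_rel 0 I I Is (b o\<^sub>L w x))"
  proof -
    obtain g where g: "path g" "path_image g \<subseteq> unitary_maps" "pathstart g = a" "pathfinish g = b"
      using path_component_unitary_maps[OF ab] unfolding path_component_def by blast
    have gc: "continuous_on {0..1} g" and gU: "\<And>t. t \<in> {0..1} \<Longrightarrow> g t \<in> unitary_maps"
      using g(1,2) by (auto simp: path_def path_image_def)
    show ?thesis
      unfolding homotopic_with_def
    proof (intro exI[of _ "\<lambda>(t, x). cayley_rel 0 I I Is (g t o\<^sub>L w x)"] conjI allI ballI TrueI)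
      show "continuous_map (prod_topology (top_of_set {0..1}) X) (top_of_set \<U>\<^sub>F)
          (\<lambda>(t, x). cayley_rel 0 I I Is (g t o\<^sub>L w x))"
        unfolding case_prod_beta
      proof (rule continuous_map_cayley_rel)
        show "continuous_map (prod_topology (top_of_set {0..1}) X) euclidean (\<lambda>p. g (fst p) o\<^sub>L w (snd p))"
          by (intro continuous_map_blinfun_compose continuous_map_fst_family gc continuous_map_snd_family w)
      qed (auto intro!: unitary_maps_compose gU w(2) I)
    qed (use g(3,4) in \<open>auto simp: pathstart_def pathfinish_def\<close>)
  qed
  ultimately show ?thesis
    by (meson homotopic_with_symD homotopic_with_trans)
qed

section \<open>Orthonormal bases\<close>

instance chilbert_space \<subseteq> banach ..

definition csubspace :: "'a::complex_inner set \<Rightarrow> bool" where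
  "csubspace Z \<longleftrightarrow> 0 \<in> Z \<and> (\<forall>x\<in>Z. \<forall>y\<in>Z. x + y \<in> Z) \<and> (\<forall>c. \<forall>x\<in>Z. c *\<^sub>C x \<in> Z)"

lemma csubspace_0: "csubspace Z \<Longrightarrow> 0 \<in> Z"
  and csubspace_add: "csubspace Z \<Longrightarrow> x \<in> Z \<Longrightarrow> y \<in> Z \<Longrightarrow> x + y \<in> Z"
  and csubspace_scaleC: "csubspace Z \<Longrightarrow> x \<in> Z \<Longrightarrow> c *\<^sub>C x \<in> Z"
  by (auto simp: csubspace_def)

lemma csubspace_scaleR: "csubspace Z \<Longrightarrow> x \<in> Z \<Longrightarrow> r *\<^sub>R x \<in> Z"
  by (simp add: scaleR_scaleC csubspace_scaleC)

lemma csubspace_diff: "csubspace Z \<Longrightarrow> x \<in> Z \<Longrightarrow> y \<in> Z \<Longrightarrow> x - y \<in> Z"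
  using csubspace_add[of Z x "- y"] csubspace_scaleC[of Z y "-1"] by (simp add: scaleC_minus1)

lemma csubspace_sum:
  assumes "csubspace Z" "\<And>i. i \<in> I \<Longrightarrow> f i \<in> Z"
  shows "sum f I \<in> Z"
  using assms(2) by (induction I rule: infinite_finite_induct) (simp_all add: csubspace_0 csubspace_add assms(1))

lemma csubspace_subspace: "csubspace Z \<Longrightarrow> subspace Z"
  by (intro subspaceI) (auto intro: csubspace_0 csubspace_add csubspace_scaleR)

lemma norm_sum_orthonormal:
  assumes I: "finite I" and b: "\<And>i j. i \<in> I \<Longrightarrow> j \<in> I \<Longrightarrow> cinner (b i) (b j) = (if i = j then 1 else 0)"
  shows "(norm (\<Sum>i\<in>I. c i *\<^sub>C (b i :: 'a::complex_inner)))\<^sup>2 = (\<Sum>i\<in>I. (cmod (c i))\<^sup>2)"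
proof -
  have "complex_of_real ((norm (\<Sum>i\<in>I. c i *\<^sub>C b i))\<^sup>2) = (\<Sum>i\<in>I. \<Sum>j\<in>I. c i * (cnj (c j) * cinner (b i) (b j)))"
    by (subst cinner_self[symmetric], subst cinner_sum_left)
      (simp only: cinner_scaleC_left cinner_sum_right cinner_scaleC_right sum_distrib_left mult.left_commute)
  also have "\<dots> = (\<Sum>i\<in>I. \<Sum>j\<in>I. if j = i then c i * cnj (c i) else 0)"
    by (intro sum.cong refl) (auto simp: b)
  also have "\<dots> = (\<Sum>i\<in>I. complex_of_real ((cmod (c i))\<^sup>2))"
    using I by (simp add: complex_norm_square del: of_real_power)
  also have "\<dots> = complex_of_real (\<Sum>i\<in>I. (cmod (c i))\<^sup>2)"
    by simp
  finally show ?thesis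
    by (simp only: of_real_eq_iff)
qed

lemma bessel_inequality:
  assumes I: "finite I" and b: "\<And>i j. i \<in> I \<Longrightarrow> j \<in> I \<Longrightarrow> cinner (b i) (b j) = (if i = j then 1 else 0)"
  shows "(\<Sum>i\<in>I. (cmod (cinner x (b i)))\<^sup>2) \<le> (norm (x::'a::complex_inner))\<^sup>2"
proof -
  define s where "s = (\<Sum>i\<in>I. cinner x (b i) *\<^sub>C b i)"
  have s: "(norm s)\<^sup>2 = (\<Sum>i\<in>I. (cmod (cinner x (b i)))\<^sup>2)"
    unfolding s_def by (rule norm_sum_orthonormal[OF I b])
  have "cinner x s = (\<Sum>i\<in>I. complex_of_real ((cmod (cinner x (b i)))\<^sup>2))"
    unfolding s_def cinner_sum_right cinner_scaleC_right complex_norm_square by (simp add: mult.commute)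
  then have "cinner x s = complex_of_real ((norm s)\<^sup>2)"
    unfolding s by simp
  then have xs: "inner x s = (norm s)\<^sup>2"
    by (simp add: inner_cinner)
  have xs2: "(norm (x - s))\<^sup>2 = (norm x)\<^sup>2 - (norm s)\<^sup>2"
    using xs by (simp add: power2_norm_eq_inner inner_diff_left inner_diff_right inner_commute)
  then show ?thesis
    using zero_le_power2[of "norm (x - s)"] s by linarith
qed

definition orthonormal_seq :: "(nat \<Rightarrow> 'a::complex_inner) \<Rightarrow> bool" where
  "orthonormal_seq b \<longleftrightarrow> (\<forall>m n. cinner (b m) (b n) = (if m = n then 1 else 0))"

text \<open>A countable separating set \<open>S\<close> stands in for separability. A maximal
  orthonormal set in Z exists by Zorn's lemma; each of its members meets some element of
  \<open>S\<close> nontrivially, while by Bessel's inequality every element of \<open>S\<close>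
  meets only countably many members. The last assumption excludes a finite maximal set.\<close>

lemma exists_orthonormal_basis:
  fixes Z :: "'a::complex_inner set"
  assumes Z: "csubspace Z" and S: "countable S"
    and total: "\<And>x. x \<in> Z \<Longrightarrow> (\<And>s. s \<in> S \<Longrightarrow> cinner x s = 0) \<Longrightarrow> x = 0"
    and inf: "\<And>F. finite F \<Longrightarrow> F \<subseteq> Z \<Longrightarrow> \<exists>x\<in>Z. norm x = 1 \<and> (\<forall>f\<in>F. cinner x f = 0)"
  shows "\<exists>b. orthonormal_seq b \<and> range b \<subseteq> Z \<and> (\<forall>x\<in>Z. (\<forall>n. cinner x (b n) = 0) \<longrightarrow> x = 0)"
proof -
  define \<A> where "\<A> = {B. B \<subseteq> Z \<and> (\<forall>x\<in>B. \<forall>y\<in>B. cinner x y = (if x = y then 1 else 0))}"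
  have "\<exists>M\<in>\<A>. \<forall>X\<in>\<A>. M \<subseteq> X \<longrightarrow> X = M"
  proof (rule subset_Zorn_nonempty)
    show "\<A> \<noteq> {}"
      unfolding \<A>_def by (intro exI[of "\<lambda>x. x \<in> {B. _ B}" "{}", THEN ex_in_conv[THEN iffD1]]) simp
    fix \<C> assume C: "\<C> \<noteq> {}" "subset.chain \<A> \<C>"
    have "cinner x y = (if x = y then 1 else 0)" if "x \<in> X" "y \<in> Y" "X \<in> \<C>" "Y \<in> \<C>" for x y X Y
    proof -
      have "X \<subseteq> Y \<or> Y \<subseteq> X"
        using C(2) that(3,4) by (auto simp: subset_chain_def)
      moreover have "X \<in> \<A>" "Y \<in> \<A>"
        using C(2) that(3,4) by (auto simp: subset_chain_def)
      ultimately show ?thesis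
        using that(1,2) unfolding \<A>_def by blast
    qed
    moreover have "\<Union>\<C> \<subseteq> Z"
      using C(2) by (auto simp: subset_chain_def \<A>_def)
    ultimately show "\<Union>\<C> \<in> \<A>"
      unfolding \<A>_def by blast
  qed
  then obtain B where "B \<in> \<A>" and max: "\<And>X. X \<in> \<A> \<Longrightarrow> B \<subseteq> X \<Longrightarrow> X = B"
    by blast
  then have BZ: "B \<subseteq> Z" and B: "\<And>x y. x \<in> B \<Longrightarrow> y \<in> B \<Longrightarrow> cinner x y = (if x = y then 1 else 0)"
    by (auto simp: \<A>_def)
  have no_unit: False if x: "x \<in> Z" "norm x = 1" "\<And>b. b \<in> B \<Longrightarrow> cinner x b = 0" for x
  proof -
    have x': "cinner b x = 0" if "b \<in> B" for b
      using x(3)[OF that] cinner_commute[of b x] by simp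
    have xx: "cinner x x = 1"
      using x(2) by (simp add: cinner_self_eq_1)
    then have "x \<notin> B"
      using x(3)[of x] by auto
    have "insert x B \<in> \<A>"
      using BZ B x x' xx \<open>x \<notin> B\<close> unfolding \<A>_def by auto
    then show False
      using max[of "insert x B"] \<open>x \<notin> B\<close> by blast
  qed
  have B_total: "x = 0" if x: "x \<in> Z" "\<And>b. b \<in> B \<Longrightarrow> cinner x b = 0" for x
  proof (rule ccontr)
    assume "x \<noteq> 0"
    then show False
      using x by (intro no_unit[of "(1 / norm x) *\<^sub>R x"]) (auto simp: csubspace_scaleR[OF Z] cinner_scaleR_left)
  qed
  have "infinite B"
    using inf[of B] BZ no_unit by blast
  \<comment> \<open>Bessel's inequality allows at most (n + 1)^2 |s|^2 members whose coefficient
    exceeds 1 / (n + 1).\<close>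
  have fin: "finite {b \<in> B. cmod (cinner s b) > 1 / real (Suc n)}" for s n
  proof -
    have "card G \<le> nat \<lceil>(real (Suc n))\<^sup>2 * (norm s)\<^sup>2\<rceil>"
      if G: "G \<subseteq> {b \<in> B. cmod (cinner s b) > 1 / real (Suc n)}" "finite G" for G
    proof -
      have "(\<Sum>b\<in>G. (1 / real (Suc n))\<^sup>2) \<le> (\<Sum>b\<in>G. (cmod (cinner s b))\<^sup>2)"
        using G(1) by (intro sum_mono power_mono) auto
      also have "\<dots> \<le> (norm s)\<^sup>2"
        using bessel_inequality[OF G(2), of "\<lambda>b. b" s] G(1) B by blast
      finally have "real (card G) * (1 / real (Suc n))\<^sup>2 \<le> (norm s)\<^sup>2"
        by simp
      then have "real (card G) \<le> (real (Suc n))\<^sup>2 * (norm s)\<^sup>2"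
        by (simp add: power_divide field_simps del: of_nat_Suc)
      then show ?thesis
        by linarith
    qed
    then show ?thesis
      using finite_if_finite_subsets_card_bdd by blast
  qed
  have "B \<subseteq> (\<Union>s\<in>S. \<Union>n. {b \<in> B. cmod (cinner s b) > 1 / real (Suc n)})"
  proof
    fix b assume b: "b \<in> B"
    have "b \<noteq> 0"
      using B[OF b b] by auto
    then obtain s where s: "s \<in> S" "cinner b s \<noteq> 0"
      using total[of b] b BZ by blast
    then have "0 < cmod (cinner s b)"
      using cinner_commute[of b s] by auto
    then obtain n where "inverse (real (Suc n)) < cmod (cinner s b)"
      using reals_Archimedean by blast
    then show "b \<in> (\<Union>s\<in>S. \<Union>n. {b \<in> B. cmod (cinner s b) > 1 / real (Suc n)})"
      using b s(1) by (auto simp: inverse_eq_divide)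
  qed
  then have "countable B"
    by (rule countable_subset) (intro countable_UN S countable_finite fin countableI_type)
  then obtain e :: "'a \<Rightarrow> nat" where e: "bij_betw e B UNIV"
    using \<open>infinite B\<close> by (rule countableE_infinite)
  define b where "b = inv_into B e"
  have b: "bij_betw b UNIV B"
    unfolding b_def by (rule bij_betw_inv_into[OF e])
  have bB: "b n \<in> B" for n
    using b by (auto simp: bij_betw_def)
  have "orthonormal_seq b"
    unfolding orthonormal_seq_def using B[OF bB bB] bij_betw_imp_inj_on[OF b] by (auto simp: inj_def)
  moreover have "x = 0" if "x \<in> Z" "\<forall>n. cinner x (b n) = 0" for x
  proof (rule B_total[OF that(1)])
    fix y assume "y \<in> B"
    then obtain n where "y = b n"
      using b by (auto simp: bij_betw_def)
    then show "cinner x y = 0"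
      using that(2) by simp
  qed
  ultimately show ?thesis
    using bB BZ by blast
qed

lemma orthonormal_seq_summable:
  fixes b :: "nat \<Rightarrow> 'a::chilbert_space"
  assumes b: "orthonormal_seq b" and c: "summable (\<lambda>n. (cmod (c n))\<^sup>2)"
  shows "summable (\<lambda>n. c n *\<^sub>C b n)"
  unfolding summable_Cauchy
proof (intro allI impI)
  fix e :: real assume "0 < e"
  then have "0 < e\<^sup>2"
    by simp
  then obtain N where N: "\<And>m n. m \<ge> N \<Longrightarrow> norm (\<Sum>k = m..<n. (cmod (c k))\<^sup>2) < e\<^sup>2"
    using c unfolding summable_Cauchy by blast
  have "norm (\<Sum>k = m..<n. c k *\<^sub>C b k) < e" if "m \<ge> N" for m n
  proof -
    have "(norm (\<Sum>k = m..<n. c k *\<^sub>C b k))\<^sup>2 = (\<Sum>k = m..<n. (cmod (c k))\<^sup>2)"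
      using b by (intro norm_sum_orthonormal) (auto simp: orthonormal_seq_def)
    also have "\<dots> < e\<^sup>2"
      using N[OF that, of n] by simp
    finally show ?thesis
      using \<open>0 < e\<close> by (intro power2_less_imp_less[of _ e]) auto
  qed
  then show "\<exists>N. \<forall>m\<ge>N. \<forall>n. norm (\<Sum>k = m..<n. c k *\<^sub>C b k) < e"
    by blast
qed

lemma bounded_linear_cinner_left: "bounded_linear (\<lambda>x. cinner x (y::'a::complex_inner))"
  by (rule bounded_bilinear.bounded_linear_left[OF bounded_bilinear_cinner])

lemma orthonormal_seq_coeff:
  fixes b :: "nat \<Rightarrow> 'a::chilbert_space"
  assumes b: "orthonormal_seq b" and c: "summable (\<lambda>n. (cmod (c n))\<^sup>2)"
  shows "cinner (\<Sum>n. c n *\<^sub>C b n) (b m) = c m"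
proof -
  have "(\<lambda>n. cinner (c n *\<^sub>C b n) (b m)) sums cinner (\<Sum>n. c n *\<^sub>C b n) (b m)"
    by (intro bounded_linear.sums[OF bounded_linear_cinner_left] summable_sums orthonormal_seq_summable[OF b c])
  moreover have "(\<lambda>n. cinner (c n *\<^sub>C b n) (b m)) = (\<lambda>n. if n = m then c n else 0)"
    using b by (auto simp: orthonormal_seq_def cinner_scaleC_left)
  ultimately show ?thesis
    using sums_single[of m c] sums_unique2 by metis
qed

lemma orthonormal_seq_summable_coeff:
  assumes b: "orthonormal_seq (b :: nat \<Rightarrow> 'a::complex_inner)"
  shows "summable (\<lambda>n. (cmod (cinner x (b n)))\<^sup>2)"
proof (rule summableI_nonneg_bounded)
  show "(\<Sum>i<n. (cmod (cinner x (b i)))\<^sup>2) \<le> (norm x)\<^sup>2" for n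
    using b by (intro bessel_inequality) (auto simp: orthonormal_seq_def)
qed simp

definition total_orthonormal :: "'a::chilbert_space set \<Rightarrow> (nat \<Rightarrow> 'a) \<Rightarrow> bool" where
  "total_orthonormal Z b \<longleftrightarrow> csubspace Z \<and> closed Z \<and> orthonormal_seq b \<and> range b \<subseteq> Z \<and>
     (\<forall>x\<in>Z. (\<forall>n. cinner x (b n) = 0) \<longrightarrow> x = 0)"

lemma total_orthonormal_suminf_mem:
  assumes b: "total_orthonormal Z b" and c: "summable (\<lambda>n. (cmod (c n))\<^sup>2)"
  shows "(\<Sum>n. c n *\<^sub>C b n) \<in> Z"
proof (rule closed_sequentially)
  show "closed Z"
    using b by (simp add: total_orthonormal_def)
  show "(\<Sum>n<m. c n *\<^sub>C b n) \<in> Z" for m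
    using b by (intro csubspace_sum csubspace_scaleC) (auto simp: total_orthonormal_def)
  show "(\<lambda>m. \<Sum>n<m. c n *\<^sub>C b n) \<longlonglongrightarrow> (\<Sum>n. c n *\<^sub>C b n)"
    using b c by (intro summable_LIMSEQ orthonormal_seq_summable) (auto simp: total_orthonormal_def)
qed

lemma total_orthonormal_expansion:
  assumes b: "total_orthonormal Z b" and x: "x \<in> Z"
  shows "(\<lambda>n. cinner x (b n) *\<^sub>C b n) sums x"
proof -
  have ob: "orthonormal_seq b" and Z: "csubspace Z"
    and tot: "\<And>x. x \<in> Z \<Longrightarrow> \<forall>n. cinner x (b n) = 0 \<Longrightarrow> x = 0"
    using b by (auto simp: total_orthonormal_def)
  note s = orthonormal_seq_summable_coeff[OF ob, of x]
  define y where "y = (\<Sum>n. cinner x (b n) *\<^sub>C b n)"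
  have "y \<in> Z"
    unfolding y_def by (rule total_orthonormal_suminf_mem[OF b s])
  then have "x - y \<in> Z"
    by (rule csubspace_diff[OF Z x])
  moreover have "\<forall>n. cinner (x - y) (b n) = 0"
    by (simp add: cinner_diff_left y_def orthonormal_seq_coeff[OF ob s])
  ultimately have "x - y = 0"
    by (rule tot)
  then show ?thesis
    using summable_sums[OF orthonormal_seq_summable[OF ob s]] by (simp add: y_def)
qed

lemma total_orthonormal_parseval:
  assumes b: "total_orthonormal Z b" and x: "x \<in> Z"
  shows "(\<lambda>n. cinner x (b n) * cnj (cinner y (b n))) sums cinner x y"
proof -
  have "(\<lambda>n. cinner (cinner x (b n) *\<^sub>C b n) y) sums cinner x y"
    by (intro bounded_linear.sums[OF bounded_linear_cinner_left] total_orthonormal_expansion[OF b x])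
  then show ?thesis
    by (simp add: cinner_scaleC_left flip: cinner_commute)
qed

text \<open>Coefficient sequences with respect to \<open>b\<close> are reused with respect to
  \<open>e\<close>. Bessel's inequality makes them square summable, completeness makes the series
  converge, and Parseval's identity gives preservation of the scalar product.\<close>

lemma unitary_between_total_orthonormal:
  fixes b :: "nat \<Rightarrow> 'a::chilbert_space" and e :: "nat \<Rightarrow> 'h::chilbert_space"
  assumes b: "total_orthonormal Z b" and e: "total_orthonormal UNIV e"
  shows "\<exists>\<phi>. unitary_between Z (UNIV :: 'h set) \<phi>"
proof -
  define \<phi> where "\<phi> x = (\<Sum>n. cinner x (b n) *\<^sub>C e n)" for x
  have ob: "orthonormal_seq b" and Z: "csubspace Z" and oe: "orthonormal_seq e"
    using b e by (auto simp: total_orthonormal_def)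
  note s = orthonormal_seq_summable_coeff[OF ob]
  note ss = orthonormal_seq_summable[OF oe s]
  have coeff: "cinner (\<phi> x) (e n) = cinner x (b n)" for x n
    unfolding \<phi>_def by (rule orthonormal_seq_coeff[OF oe s])
  have add: "\<phi> (x + y) = \<phi> x + \<phi> y" for x y
    unfolding \<phi>_def by (subst suminf_add[OF ss ss]) (simp add: cinner_add_left scaleC_add_left)
  have scale: "\<phi> (c *\<^sub>C x) = c *\<^sub>C \<phi> x" for c x
    unfolding \<phi>_def bounded_linear.suminf[OF bounded_linear_scaleC_right ss]
    by (simp add: cinner_scaleC_left scaleC_scaleC)
  have inner: "cinner (\<phi> x) (\<phi> y) = cinner x y" if "x \<in> Z" for x y
    using total_orthonormal_parseval[OF e, of "\<phi> x" "\<phi> y"] total_orthonormal_parseval[OF b that, of y]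
    by (simp add: coeff sums_unique2)
  have "inj_on \<phi> Z"
  proof (rule inj_onI)
    fix x y assume xy: "x \<in> Z" "y \<in> Z" "\<phi> x = \<phi> y"
    have "\<phi> (x - y) = \<phi> x - \<phi> y"
      using add[of x "(-1) *\<^sub>C y"] scale[of "-1" y] by (simp add: scaleC_minus1)
    then have "\<phi> (x - y) = 0"
      by (simp add: xy(3))
    moreover have "cinner (\<phi> (x - y)) (\<phi> (x - y)) = cinner (x - y) (x - y)"
      by (rule inner[OF csubspace_diff[OF Z xy(1,2)]])
    ultimately show "x = y"
      by simp
  qed
  moreover have "\<phi> ` Z = UNIV"
  proof (intro subset_antisym subset_UNIV subsetI)
    fix h :: 'h
    note t = orthonormal_seq_summable_coeff[OF oe, of h]
    define x where "x = (\<Sum>n. cinner h (e n) *\<^sub>C b n)"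
    have "x \<in> Z"
      unfolding x_def by (rule total_orthonormal_suminf_mem[OF b t])
    have "cinner x (b n) = cinner h (e n)" for n
      unfolding x_def by (rule orthonormal_seq_coeff[OF ob t])
    then have "\<phi> x = h"
      unfolding \<phi>_def using sums_unique[OF total_orthonormal_expansion[OF e, of h]] by simp
    then show "h \<in> \<phi> ` Z"
      using \<open>x \<in> Z\<close> by blast
  qed
  ultimately have "unitary_between Z UNIV \<phi>"
    unfolding unitary_between_def bij_betw_def using add scale inner by blast
  then show ?thesis
    by (rule exI[of "unitary_between Z UNIV" \<phi>])
qed

text \<open>This provides the identification of W + H with H on which \<open>K1_index\<close> rests.
  It has to cover both a finite-dimensional W, namely \<open>Lambda_plus\<close>, and W = L^2(G), so
  W enters only through a countable separating set.\<close>

lemma unitary_between_stabilization: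
  fixes W :: "'w::chilbert_space set"
  assumes sep: "separable_infinite_dim TYPE('h::chilbert_space)"
    and W: "csubspace W" "closed W"
    and S: "countable S" and total: "\<And>x. x \<in> W \<Longrightarrow> (\<And>s. s \<in> S \<Longrightarrow> cinner x s = 0) \<Longrightarrow> x = 0"
  shows "\<exists>\<phi>. unitary_between (W \<times> (UNIV :: 'h set)) (UNIV :: 'h set) \<phi>"
proof -
  obtain D :: "'h set" where D: "countable D" "closure D = UNIV"
    using sep by (auto simp: separable_infinite_dim_def)
  have inf: "\<not> (\<exists>B::'h set. finite B \<and> span B = UNIV)"
    using sep by (simp add: separable_infinite_dim_def)
  have D_total: "x = 0" if "\<And>d. d \<in> D \<Longrightarrow> cinner x d = 0" for x
  proof -
    have "closed {y. cinner x y = 0}"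
      by (intro closed_Collect_eq continuous_intros linear_continuous_on
          bounded_bilinear.bounded_linear_right[OF bounded_bilinear_cinner])
    moreover have "D \<subseteq> {y. cinner x y = 0}"
      using that by blast
    ultimately have "closure D \<subseteq> {y. cinner x y = 0}"
      by (rule closure_minimal[rotated])
    then have "cinner x x = 0"
      using D(2) by blast
    then show ?thesis
      by simp
  qed
  have "\<exists>e. orthonormal_seq e \<and> range e \<subseteq> (UNIV :: 'h set) \<and> (\<forall>x\<in>UNIV. (\<forall>n. cinner x (e n) = 0) \<longrightarrow> x = 0)"
    using D_total exists_unit_orthogonal[OF inf]
    by (intro exists_orthonormal_basis[OF _ D(1)]) (auto simp: csubspace_def)
  then obtain e :: "nat \<Rightarrow> 'h" where e: "total_orthonormal UNIV e"
    by (auto simp: total_orthonormal_def csubspace_def)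
  define Z where "Z = W \<times> (UNIV :: 'h set)"
  have Z: "csubspace Z"
    using W(1) by (auto simp: Z_def csubspace_def scaleC_prod_def zero_prod_def)
  have cZ: "closed Z"
    unfolding Z_def by (intro closed_Times W closed_UNIV)
  have "\<exists>b. orthonormal_seq b \<and> range b \<subseteq> Z \<and> (\<forall>x\<in>Z. (\<forall>n. cinner x (b n) = 0) \<longrightarrow> x = 0)"
  proof (rule exists_orthonormal_basis[OF Z])
    show "countable (S \<times> {0} \<union> {0} \<times> D)"
      using S D(1) by simp
    show "x = 0" if x: "x \<in> Z" "\<And>s. s \<in> S \<times> {0} \<union> {0} \<times> D \<Longrightarrow> cinner x s = 0" for x
    proof -
      have "cinner (fst x) s = 0" if "s \<in> S" for s
        using x(2)[of "(s, 0)"] that by (simp add: cinner_prod_def)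
      then have "fst x = 0"
        using x(1) total[of "fst x"] by (auto simp: Z_def)
      moreover have "cinner (snd x) d = 0" if "d \<in> D" for d
        using x(2)[of "(0, d)"] that by (simp add: cinner_prod_def)
      then have "snd x = 0"
        by (rule D_total)
      ultimately show ?thesis
        by (simp add: prod_eq_iff)
    qed
    \<comment> \<open>Infinite dimension comes from the second factor, whatever W is.\<close>
    show "\<exists>x\<in>Z. norm x = 1 \<and> (\<forall>f\<in>F. cinner x f = 0)" if F: "finite F" for F
    proof -
      obtain h where h: "norm h = 1" "\<forall>f\<in>snd ` F. cinner h f = 0"
        using exists_unit_orthogonal[OF inf finite_imageI[OF F]] by blast
      then show ?thesis
        using W(1) by (intro bexI[of _ "(0, h)"]) (auto simp: cinner_prod_def Z_def csubspace_def norm_prod_def)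
    qed
  qed
  then obtain b where "total_orthonormal Z b"
    using Z cZ by (auto simp: total_orthonormal_def)
  then show ?thesis
    using unitary_between_total_orthonormal[OF _ e] by (simp add: Z_def)
qed

section \<open>Lagrangian subspaces as graphs of unitaries\<close>

text \<open>\<open>lag_vec p m\<close> is the vector of \<open>K \<oplus> K\<close> whose components in \<open>\<Lambda>\<^sup>+\<close> and \<open>\<Lambda>\<^sup>-\<close> are \<open>(p, i p)\<close> and
  \<open>(m, - i m)\<close>; this identifies both with \<open>K\<close>.\<close>

definition lag_vec :: "'k::complex_inner \<Rightarrow> 'k \<Rightarrow> 'k \<times> 'k" where
  "lag_vec p m = (p + m, \<i> *\<^sub>C (p - m))"

definition plus_part :: "'k::complex_inner \<times> 'k \<Rightarrow> 'k" where
  "plus_part \<xi> = (1/2) *\<^sub>R (fst \<xi> - \<i> *\<^sub>C snd \<xi>)"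

definition minus_part :: "'k::complex_inner \<times> 'k \<Rightarrow> 'k" where
  "minus_part \<xi> = (1/2) *\<^sub>R (fst \<xi> + \<i> *\<^sub>C snd \<xi>)"

lemma half_add_half: "(1/2) *\<^sub>R x + (1/2) *\<^sub>R x = (x::'a::real_vector)"
  by (simp flip: scaleR_left_distrib)

lemma scaleC_i_i: "\<i> *\<^sub>C \<i> *\<^sub>C x = - (x::'a::complex_inner)"
  by (simp add: scaleC_scaleC scaleC_minus1)

lemma plus_part_lag_vec [simp]: "plus_part (lag_vec p m) = p"
  using half_add_half[of p] by (simp add: plus_part_def lag_vec_def scaleC_i_i scaleC_diff_right algebra_simps)

lemma minus_part_lag_vec [simp]: "minus_part (lag_vec p m) = m"
  using half_add_half[of m] by (simp add: minus_part_def lag_vec_def scaleC_i_i scaleC_diff_right algebra_simps)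

lemma lag_vec_parts [simp]: "lag_vec (plus_part \<xi>) (minus_part \<xi>) = \<xi>"
proof -
  have "plus_part \<xi> + minus_part \<xi> = fst \<xi>" "plus_part \<xi> - minus_part \<xi> = - (\<i> *\<^sub>C snd \<xi>)"
    using half_add_half[of "fst \<xi>"] half_add_half[of "\<i> *\<^sub>C snd \<xi>"]
    by (simp_all add: plus_part_def minus_part_def algebra_simps)
  then show ?thesis
    by (simp add: lag_vec_def scaleC_i_i)
qed

lemma lag_vec_add: "lag_vec p m + lag_vec p' m' = lag_vec (p + p') (m + m')"
proof (rule prod_eqI)
  show "fst (lag_vec p m + lag_vec p' m') = fst (lag_vec (p + p') (m + m'))"
    by (simp add: lag_vec_def ac_simps)
  show "snd (lag_vec p m + lag_vec p' m') = snd (lag_vec (p + p') (m + m'))"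
    unfolding lag_vec_def snd_add snd_conv scaleC_add_right[symmetric] by (simp only: add_diff_add)
qed

lemma lag_vec_scaleC: "c *\<^sub>C lag_vec p m = lag_vec (c *\<^sub>C p) (c *\<^sub>C m)"
  by (simp add: lag_vec_def scaleC_prod_def scaleC_add_right scaleC_diff_right scaleC_scaleC mult.commute)

lemma lag_vec_inject [simp]: "lag_vec p m = lag_vec p' m' \<longleftrightarrow> p = p' \<and> m = m'"
proof
  assume eq: "lag_vec p m = lag_vec p' m'"
  show "p = p' \<and> m = m'"
    using arg_cong[OF eq, of plus_part] arg_cong[OF eq, of minus_part] by simp
qed simp

lemma clinear_plus_part: "clinear (plus_part :: 'k::complex_inner \<times> 'k \<Rightarrow> 'k)"
  by (rule clinearI) (simp_all add: plus_part_def scaleC_prod_def scaleC_simps algebra_simps)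

lemma clinear_minus_part: "clinear (minus_part :: 'k::complex_inner \<times> 'k \<Rightarrow> 'k)"
  by (rule clinearI) (simp_all add: minus_part_def scaleC_prod_def scaleC_simps algebra_simps)

lemma cinner_lag_vec: "cinner (lag_vec p m) (lag_vec q r) = 2 * (cinner p q + cinner m r)"
  by (simp add: lag_vec_def cinner_prod_def cinner_simps) (simp add: algebra_simps)

lemma symplectic_form_lag_vec:
  "symplectic_form (lag_vec p m) (lag_vec q r) = 2 * \<i> * (cinner p q - cinner m r)"
  by (simp add: symplectic_form_def lag_vec_def cinner_simps) (simp add: algebra_simps)

lemma symplectic_form_parts:
  "symplectic_form \<xi> \<eta> = 2 * \<i> * (cinner (plus_part \<xi>) (plus_part \<eta>) - cinner (minus_part \<xi>) (minus_part \<eta>))"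
  using symplectic_form_lag_vec[of "plus_part \<xi>" "minus_part \<xi>" "plus_part \<eta>" "minus_part \<eta>"] by simp

text \<open>Real orthogonality to a subspace stable under multiplication by i is complex
  orthogonality: the imaginary part is tested with \<open>\<i> *\<^sub>C p\<close>.\<close>

lemma subspace_orthogonal_exists:
  fixes P :: "'k::{complex_inner,euclidean_space} set"
  assumes P: "subspace P" "\<And>c x. x \<in> P \<Longrightarrow> c *\<^sub>C x \<in> P" and "P \<noteq> UNIV"
  shows "\<exists>x. x \<noteq> 0 \<and> (\<forall>p\<in>P. cinner p x = 0)"
proof -
  have "dim P \<noteq> DIM('k)"
    using P(1) \<open>P \<noteq> UNIV\<close> by (metis dim_eq_full span_eq_iff)
  then have "dim P < DIM('k)"
    using dim_subset_UNIV[of P] by linarith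
  then obtain x where x: "x \<noteq> 0" "\<And>y. y \<in> span P \<Longrightarrow> orthogonal x y"
    using orthogonal_to_subspace_exists by blast
  have "cinner p x = 0" if "p \<in> P" for p
  proof (rule complex_eqI)
    show "Re (cinner p x) = Re 0"
      using x(2)[OF span_base[OF that]] by (simp add: orthogonal_def inner_commute flip: inner_cinner)
    have "inner (\<i> *\<^sub>C p) x = 0"
      using x(2)[OF span_base[OF P(2)[OF that]], of \<i>] by (simp add: orthogonal_def inner_commute)
    then show "Im (cinner p x) = Im 0"
      by (simp add: inner_cinner cinner_scaleC_left)
  qed
  then show ?thesis
    using x(1) by blast
qed

text \<open>In the coordinates of \<open>lag_vec\<close> the symplectic form is the difference of
  the scalar products of plus parts and minus parts. Isotropy thus makes the minus part an isometric
  function of the plus part. It is defined on all of K by maximality: for x orthogonal to all plus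
  parts, \<open>lag_vec x 0\<close> lies in the annihilator L, although its two parts have different
  norms unless x = 0.\<close>

lemma lagrangian_graph_unitary:
  fixes L :: "('k::{complex_inner,euclidean_space} \<times> 'k) set"
  assumes L: "lagrangian L"
  shows "\<exists>u\<in>unitary_maps. L = {lag_vec p (blinfun_apply u p) |p. True}"
proof -
  have memD: "symplectic_form \<xi> \<eta> = 0" if "\<xi> \<in> L" "\<eta> \<in> L" for \<xi> \<eta>
    using L that unfolding lagrangian_def by blast
  have memI: "\<eta> \<in> L" if "\<And>\<xi>. \<xi> \<in> L \<Longrightarrow> symplectic_form \<xi> \<eta> = 0" for \<eta>
    using L that unfolding lagrangian_def by blast
  have add: "x + y \<in> L" if "x \<in> L" "y \<in> L" for x y
  proof (rule memI)
    fix \<xi> assume "\<xi> \<in> L"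
    have "symplectic_form \<xi> (x + y) = symplectic_form \<xi> x + symplectic_form \<xi> y"
      by (simp add: symplectic_form_def cinner_simps)
    then show "symplectic_form \<xi> (x + y) = 0"
      using memD[OF \<open>\<xi> \<in> L\<close>] that by simp
  qed
  have scale: "c *\<^sub>C x \<in> L" if "x \<in> L" for x c
  proof (rule memI)
    fix \<xi> assume "\<xi> \<in> L"
    have "symplectic_form \<xi> (c *\<^sub>C x) = cnj c * symplectic_form \<xi> x"
      by (simp add: symplectic_form_def scaleC_prod_def cinner_simps right_diff_distrib)
    then show "symplectic_form \<xi> (c *\<^sub>C x) = 0"
      using memD[OF \<open>\<xi> \<in> L\<close> that] by simp
  qed
  have zero: "0 \<in> L"
    by (rule memI) (simp add: symplectic_form_def)
  have iso: "cinner (plus_part \<xi>) (plus_part \<eta>) = cinner (minus_part \<xi>) (minus_part \<eta>)" if "\<xi> \<in> L" "\<eta> \<in> L" for \<xi> \<eta>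
    using memD[OF that] by (simp add: symplectic_form_parts)
  have norm: "norm (minus_part \<xi>) = norm (plus_part \<xi>)" if "\<xi> \<in> L" for \<xi>
    using iso[OF that that] by (simp add: norm_eq_sqrt_inner inner_cinner)
  have diff: "x - y \<in> L" if "x \<in> L" "y \<in> L" for x y
    using add[OF that(1) scale[OF that(2), of "-1"]] by (simp add: scaleC_minus1)
  have unique: "\<xi> = \<eta>" if "\<xi> \<in> L" "\<eta> \<in> L" "plus_part \<xi> = plus_part \<eta>" for \<xi> \<eta>
  proof -
    have "plus_part (\<xi> - \<eta>) = 0"
      using that(3) by (simp add: clinear_diff[OF clinear_plus_part])
    then have "minus_part (\<xi> - \<eta>) = 0"
      using norm[OF diff[OF that(1,2)]] by simp
    then have "\<xi> - \<eta> = lag_vec 0 0"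
      using lag_vec_parts[of "\<xi> - \<eta>"] \<open>plus_part (\<xi> - \<eta>) = 0\<close> by simp
    then show ?thesis
      by (simp add: lag_vec_def flip: zero_prod_def)
  qed
  have "plus_part ` L = UNIV"
  proof (rule ccontr)
    assume "plus_part ` L \<noteq> UNIV"
    moreover have "subspace (plus_part ` L)"
    proof (rule linear_subspace_image[OF clinear_linear[OF clinear_plus_part]])
      show "subspace L"
        using zero add scale by (intro subspaceI) (simp_all add: scaleR_scaleC)
    qed
    moreover have "c *\<^sub>C x \<in> plus_part ` L" if "x \<in> plus_part ` L" for c x
      using that scale clinear_scaleC[OF clinear_plus_part, of c] by (metis image_iff)
    ultimately obtain x where x: "x \<noteq> 0" "\<And>p. p \<in> plus_part ` L \<Longrightarrow> cinner p x = 0"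
      using subspace_orthogonal_exists[of "plus_part ` L"] by blast
    have "lag_vec x 0 \<in> L"
      by (rule memI) (simp add: symplectic_form_parts x(2))
    then show False
      using norm[of "lag_vec x 0"] x(1) by simp
  qed
  then have "\<exists>\<xi>. \<xi> \<in> L \<and> plus_part \<xi> = p" for p
    by (metis UNIV_I image_iff)
  then obtain X where X: "\<And>p. X p \<in> L" "\<And>p. plus_part (X p) = p"
    by metis
  have cX: "clinear X"
  proof (rule clinearI)
    show "X (x + y) = X x + X y" for x y
      by (rule unique) (auto intro: add X simp: X clinear_add[OF clinear_plus_part])
    show "X (c *\<^sub>C x) = c *\<^sub>C X x" for c x
      by (rule unique) (auto intro: scale X simp: X clinear_scaleC[OF clinear_plus_part])
  qed
  define u where "u p = minus_part (X p)" for p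
  have cu: "clinear u"
    unfolding u_def by (rule clinearI) (simp_all add: clinear_add[OF cX] clinear_scaleC[OF cX]
        clinear_add[OF clinear_minus_part] clinear_scaleC[OF clinear_minus_part])
  then have "bounded_linear u"
    using clinear_linear linear_conv_bounded_linear by blast
  then have bu: "blinfun_apply (Blinfun u) = u"
    by (rule bounded_linear_Blinfun_apply)
  have "norm (u p) = norm p" for p
    using norm[OF X(1)[of p]] by (simp add: u_def X)
  then have "Blinfun u \<in> unitary_maps"
    using cu by (simp add: unitary_maps_def bu)
  moreover have "lag_vec p (u p) = X p" for p
    using lag_vec_parts[of "X p"] by (simp add: u_def X)
  then have "L = {lag_vec p (Blinfun u p) |p. True}"
    using X unique by (auto simp: bu) (metis X unique)
  ultimately show ?thesis
    by blast
qed

definition lagrangian_map :: "('k::{complex_inner,euclidean_space} \<times> 'k) set \<Rightarrow> 'k \<Rightarrow>\<^sub>L 'k" where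
  "lagrangian_map L = (SOME u. u \<in> unitary_maps \<and> L = {lag_vec p (blinfun_apply u p) |p. True})"

lemma lagrangian_map:
  assumes "lagrangian L"
  shows lagrangian_map_unitary: "lagrangian_map L \<in> unitary_maps"
    and lagrangian_eq_graph: "L = {lag_vec p (lagrangian_map L p) |p. True}"
proof -
  have "lagrangian_map L \<in> unitary_maps \<and> L = {lag_vec p (lagrangian_map L p) |p. True}"
    unfolding lagrangian_map_def by (rule someI_ex[OF lagrangian_graph_unitary[OF assms, unfolded Bex_def]])
  then show "lagrangian_map L \<in> unitary_maps" "L = {lag_vec p (lagrangian_map L p) |p. True}"
    by blast+
qed

lemma lag_vec_mem_lagrangian:
  assumes "lagrangian L" shows "lag_vec p m \<in> L \<longleftrightarrow> m = lagrangian_map L p"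
proof -
  have "lag_vec p m \<in> L \<longleftrightarrow> lag_vec p m \<in> {lag_vec p (lagrangian_map L p) |p. True}"
    by (rule arg_cong[OF lagrangian_eq_graph[OF assms]])
  then show ?thesis
    by simp
qed

lemma mem_lagrangian:
  assumes "lagrangian L" shows "\<xi> \<in> L \<longleftrightarrow> minus_part \<xi> = lagrangian_map L (plus_part \<xi>)"
  using lag_vec_mem_lagrangian[OF assms, of "plus_part \<xi>" "minus_part \<xi>"] by simp

definition unitary_inverse :: "('k::{complex_inner,euclidean_space} \<Rightarrow>\<^sub>L 'k) \<Rightarrow> 'k \<Rightarrow>\<^sub>L 'k" where
  "unitary_inverse w = (SOME v. v \<in> unitary_maps \<and> v o\<^sub>L w = id_blinfun \<and> w o\<^sub>L v = id_blinfun)"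

lemma unitary_inverse:
  assumes "w \<in> unitary_maps"
  shows unitary_inverse_unitary: "unitary_inverse w \<in> unitary_maps"
    and unitary_inverse_left: "unitary_inverse w (w x) = x"
    and unitary_inverse_right: "w (unitary_inverse w x) = x"
proof -
  have *: "unitary_inverse w \<in> unitary_maps \<and> unitary_inverse w o\<^sub>L w = id_blinfun \<and> w o\<^sub>L unitary_inverse w = id_blinfun"
    unfolding unitary_inverse_def by (rule someI_ex[OF unitary_maps_inverse[OF assms, unfolded Bex_def]])
  then show "unitary_inverse w \<in> unitary_maps"
    by blast
  have "(unitary_inverse w o\<^sub>L w) x = x" "(w o\<^sub>L unitary_inverse w) x = x"
    using * by (simp_all del: blinfun_apply_blinfun_compose)
  then show "unitary_inverse w (w x) = x" "w (unitary_inverse w x) = x"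
    by simp_all
qed

lemma bounded_linear_clinear:
  "clinear (f :: 'a::{complex_inner,euclidean_space} \<Rightarrow> 'b::complex_inner) \<Longrightarrow> bounded_linear f"
  using clinear_linear linear_conv_bounded_linear by blast

text \<open>The projection onto the graph of u sends the vector with parts p and 0 to the one with
  parts p / 2 and u p / 2. Twice its minus part is u p, so u depends continuously on the
  projection.\<close>

lemma lagrangian_map_projection:
  fixes L :: "('k::{complex_inner,euclidean_space} \<times> 'k) set"
  assumes L: "lagrangian L"
  shows "lagrangian_map L = 2 *\<^sub>R (Blinfun minus_part o\<^sub>L orthogonal_projection L o\<^sub>L Blinfun (\<lambda>p. lag_vec p 0))"
proof -
  define u v where "u = lagrangian_map L" and "v = unitary_inverse u"
  have u: "u \<in> unitary_maps"
    unfolding u_def by (rule lagrangian_map_unitary[OF L])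
  note v = unitary_inverse[OF u, folded v_def]
  have lin: "clinear u" "clinear v"
    using u v(1) by (auto simp: unitary_maps_def)
  define q where "q \<xi> = (1/2) *\<^sub>R (plus_part \<xi> + v (minus_part \<xi>))" for \<xi>
  have cq: "clinear q"
    unfolding q_def by (rule clinearI) (simp_all add: clinear_add[OF clinear_plus_part] clinear_scaleC[OF clinear_plus_part]
        clinear_add[OF clinear_minus_part] clinear_scaleC[OF clinear_minus_part] blinfun.add_right
        clinear_scaleC[OF lin(2)] scaleC_simps algebra_simps)
  have "clinear (\<lambda>\<xi>. lag_vec (q \<xi>) (u (q \<xi>)))"
    by (rule clinearI) (simp_all add: clinear_add[OF cq] clinear_scaleC[OF cq] blinfun.add_right
        clinear_scaleC[OF lin(1)] lag_vec_add lag_vec_scaleC)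
  then have P: "blinfun_apply (Blinfun (\<lambda>\<xi>. lag_vec (q \<xi>) (u (q \<xi>)))) = (\<lambda>\<xi>. lag_vec (q \<xi>) (u (q \<xi>)))"
    by (intro bounded_linear_Blinfun_apply bounded_linear_clinear)
  have memL: "\<xi> \<in> L \<longleftrightarrow> minus_part \<xi> = u (plus_part \<xi>)" for \<xi>
    unfolding u_def by (rule mem_lagrangian[OF L])
  have orth: "cinner (\<xi> - lag_vec (q \<xi>) (u (q \<xi>))) y = 0" if y: "y \<in> L" for \<xi> y
  proof -
    define p m r where "p = plus_part \<xi>" and "m = minus_part \<xi>" and "r = plus_part y"
    have xi: "\<xi> = lag_vec p m"
      by (simp add: p_def m_def)
    have yr: "y = lag_vec r (u r)"
      unfolding r_def y[unfolded memL, symmetric] by simp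
    have "cinner (v m) r = cinner m (u r)"
      using unitary_maps_inner[OF u, of "v m" r] by (simp add: v)
    moreover have "cinner (u (q \<xi>)) (u r) = cinner (q \<xi>) r"
      by (rule unitary_maps_inner[OF u])
    moreover have "2 * cinner (q \<xi>) r = cinner p r + cinner (v m) r"
      by (simp add: q_def p_def m_def cinner_scaleR_left cinner_add_left scaleR_conv_of_real)
    ultimately show ?thesis
      unfolding cinner_diff_left yr cinner_lag_vec
      by (subst xi) (simp add: cinner_lag_vec algebra_simps)
  qed
  have "orthogonal_projection L = Blinfun (\<lambda>\<xi>. lag_vec (q \<xi>) (u (q \<xi>)))"
    unfolding orthogonal_projection_def
  proof (rule the_equality)
    show "\<forall>x. Blinfun (\<lambda>\<xi>. lag_vec (q \<xi>) (u (q \<xi>))) x \<in> L \<and>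
       (\<forall>y\<in>L. cinner (x - Blinfun (\<lambda>\<xi>. lag_vec (q \<xi>) (u (q \<xi>))) x) y = 0)"
      unfolding P using orth by (simp add: memL)
    fix P' assume P': "\<forall>x. blinfun_apply P' x \<in> L \<and> (\<forall>y\<in>L. cinner (x - P' x) y = 0)"
    show "P' = Blinfun (\<lambda>\<xi>. lag_vec (q \<xi>) (u (q \<xi>)))"
    proof (rule blinfun_eqI)
      fix x
      define d where "d = P' x - lag_vec (q x) (u (q x))"
      have "d \<in> L"
        using P'[rule_format, of x, THEN conjunct1]
        by (simp add: memL d_def clinear_diff[OF clinear_plus_part] clinear_diff[OF clinear_minus_part]
            blinfun.diff_right)
      then have "cinner (x - P' x) d = 0" "cinner (x - lag_vec (q x) (u (q x))) d = 0"
        using P' orth by blast+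
      then have "cinner d d = 0"
        by (simp add: d_def cinner_diff_left)
      then show "P' x = Blinfun (\<lambda>\<xi>. lag_vec (q \<xi>) (u (q \<xi>))) x"
        by (simp add: P d_def)
    qed
  qed
  moreover have "clinear (\<lambda>p. lag_vec p (0::'k))"
    by (rule clinearI) (simp_all add: lag_vec_add lag_vec_scaleC)
  then have "blinfun_apply (Blinfun (\<lambda>p. lag_vec p (0::'k))) = (\<lambda>p. lag_vec p 0)"
    by (intro bounded_linear_Blinfun_apply bounded_linear_clinear)
  moreover have "blinfun_apply (Blinfun (minus_part :: 'k \<times> 'k \<Rightarrow> 'k)) = minus_part"
    by (intro bounded_linear_Blinfun_apply bounded_linear_clinear clinear_minus_part)
  ultimately show ?thesis
    by (intro blinfun_eqI)
      (simp add: P blinfun.scaleR_left, simp add: q_def u_def blinfun.scaleR_right blinfun.zero_right)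
qed

lemma continuous_lagrangian_map:
  fixes L :: "'x \<Rightarrow> ('k::{complex_inner,euclidean_space} \<times> 'k) set"
  assumes "continuous_lagrangian_family X L"
  shows "continuous_map X euclidean (\<lambda>x. lagrangian_map (L x))"
proof -
  have L: "\<And>x. x \<in> topspace X \<Longrightarrow> lagrangian (L x)"
    and c: "continuous_map X euclidean (\<lambda>x. orthogonal_projection (L x))"
    using assms by (auto simp: continuous_lagrangian_family_def)
  have "continuous_map X euclidean
      (\<lambda>x. 2 *\<^sub>R (Blinfun minus_part o\<^sub>L orthogonal_projection (L x) o\<^sub>L Blinfun (\<lambda>p. lag_vec p 0)))"
    using c unfolding continuous_map_euclidean_tendsto by (intro ballI tendsto_intros blinfun_compose_tendsto) simp
  then show ?thesis
    by (rule continuous_map_eq) (simp add: L lagrangian_map_projection)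
qed

section \<open>The eigenspaces of J and the unitary between them\<close>

lemma symplectic_J_lag_vec: "symplectic_J (lag_vec p m) = lag_vec (\<i> *\<^sub>C p) (- (\<i> *\<^sub>C m))"
  by (simp add: symplectic_J_def lag_vec_def scaleC_add_right scaleC_diff_right scaleC_i_i)

lemma eq_uminus_self_iff: "x = - x \<longleftrightarrow> x = (0::'a::real_vector)"
proof
  assume "x = - x"
  then have "2 *\<^sub>R x = 0"
    unfolding scaleR_2 by (simp only: eq_neg_iff_add_eq_0)
  then show "x = 0"
    by simp
qed simp

lemma Lambda_plus_eq: "Lambda_plus = range (\<lambda>p. lag_vec p 0)"
proof -
  have *: "lag_vec p m \<in> Lambda_plus \<longleftrightarrow> m = 0" for p m :: "'k::complex_inner"
    using eq_uminus_self_iff[of "\<i> *\<^sub>C m"]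
    by (auto simp: Lambda_plus_def symplectic_J_lag_vec lag_vec_scaleC)
  have "\<xi> \<in> Lambda_plus \<longleftrightarrow> \<xi> \<in> range (\<lambda>p. lag_vec p 0)" for \<xi> :: "'k::complex_inner \<times> 'k"
    using *[of "plus_part \<xi>" "minus_part \<xi>"] * by (auto simp: image_iff) (metis lag_vec_parts)
  then show ?thesis
    by blast
qed

lemma Lambda_minus_eq: "Lambda_minus = range (\<lambda>m. lag_vec 0 m)"
proof -
  have *: "lag_vec p m \<in> Lambda_minus \<longleftrightarrow> p = 0" for p m :: "'k::complex_inner"
    using eq_uminus_self_iff[of "\<i> *\<^sub>C p"] scaleC_minus1[of "lag_vec (\<i> *\<^sub>C p) (\<i> *\<^sub>C m)"]
    by (simp add: Lambda_minus_def symplectic_J_lag_vec lag_vec_scaleC del: scaleC_minus_left)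
      (simp add: scaleC_minus1)
  have "\<xi> \<in> Lambda_minus \<longleftrightarrow> \<xi> \<in> range (\<lambda>m. lag_vec 0 m)" for \<xi> :: "'k::complex_inner \<times> 'k"
    using *[of "plus_part \<xi>" "minus_part \<xi>"] * by (auto simp: image_iff) (metis lag_vec_parts)
  then show ?thesis
    by blast
qed

lemma lagrangian_unitary_lag_vec:
  assumes "lagrangian L"
  shows "lagrangian_unitary L (lag_vec p 0) = lag_vec 0 (lagrangian_map L p)"
  unfolding lagrangian_unitary_def Lambda_minus_eq
  by (rule the_equality) (auto simp: lag_vec_add lag_vec_mem_lagrangian[OF assms])

lemma inv_into_lagrangian_unitary:
  assumes M: "lagrangian M"
  shows "inv_into Lambda_plus (lagrangian_unitary M) (lag_vec 0 m) = lag_vec (unitary_inverse (lagrangian_map M) m) 0"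
proof (rule inv_into_f_eq)
  note u = lagrangian_map_unitary[OF M]
  show "inj_on (lagrangian_unitary M) Lambda_plus"
    unfolding Lambda_plus_eq
  proof (rule inj_onI)
    fix x y assume xy: "x \<in> range (\<lambda>p. lag_vec p 0)" "y \<in> range (\<lambda>p. lag_vec p 0)"
      "lagrangian_unitary M x = lagrangian_unitary M y"
    then obtain p p' where p: "x = lag_vec p 0" "y = lag_vec p' 0"
      by blast
    then have "lagrangian_map M p = lagrangian_map M p'"
      using xy(3) by (simp add: lagrangian_unitary_lag_vec[OF M])
    then have "p = p'"
      using arg_cong[of _ _ "unitary_inverse (lagrangian_map M)"] unitary_inverse_left[OF u] by metis
    then show "x = y"
      by (simp only: p)
  qed
  show "lag_vec (unitary_inverse (lagrangian_map M) m) 0 \<in> Lambda_plus"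
    by (simp add: Lambda_plus_eq)
  show "lagrangian_unitary M (lag_vec (unitary_inverse (lagrangian_map M) m) 0) = lag_vec 0 m"
    by (simp add: lagrangian_unitary_lag_vec[OF M] unitary_inverse_right[OF u])
qed

section \<open>The index as a homotopy class\<close>

lemma scaleC_Pair: "c *\<^sub>C (a, b) = (c *\<^sub>C a, c *\<^sub>C b)"
  by (simp add: scaleC_prod_def)

lemma fst_scaleC [simp]: "fst (c *\<^sub>C x) = c *\<^sub>C fst x" and snd_scaleC [simp]: "snd (c *\<^sub>C x) = c *\<^sub>C snd x"
  by (simp_all add: scaleC_prod_def)

text \<open>\<open>K1_index\<close> collects the classes obtained from all identifications \<phi>.
  It is a single class once every \<phi> leads to a representative homotopic to one fixed
  \<open>g\<^sub>0\<close>; the existence of some \<phi> is what prevents the index from being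
  empty.\<close>

lemma K1_index_eq_homotopy_class:
  fixes W :: "'w::complex_inner set" and g\<^sub>0 :: "'x \<Rightarrow> 'h::chilbert_space \<Rightarrow>\<^sub>L 'h"
  assumes ex: "\<exists>\<phi>. unitary_between (W \<times> (UNIV :: 'h set)) (UNIV :: 'h set) \<phi>"
    and G: "\<And>\<phi> :: 'w \<times> 'h \<Rightarrow> 'h. unitary_between (W \<times> UNIV) UNIV \<phi> \<Longrightarrow>
      \<exists>g. (\<forall>x\<in>topspace X. \<forall>w\<in>W. f x w \<in> W \<and> (\<forall>k. blinfun_apply (g x) (\<phi> (w, k)) = \<phi> (f x w, k))) \<and>
        homotopic_UF X g g\<^sub>0"
  shows "K1_index X W f = {g. homotopic_UF X g\<^sub>0 g}"
proof (intro subset_antisym subsetI)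
  fix h :: "'x \<Rightarrow> 'h \<Rightarrow>\<^sub>L 'h" assume "h \<in> K1_index X W f"
  then obtain \<phi> g where \<phi>: "unitary_between (W \<times> (UNIV :: 'h set)) (UNIV :: 'h set) \<phi>"
    and g: "\<forall>x\<in>topspace X. \<forall>w\<in>W. f x w \<in> W \<and> (\<forall>k. blinfun_apply (g x) (\<phi> (w, k)) = \<phi> (f x w, k))"
    and gh: "homotopic_UF X g h"
    unfolding K1_index_def mem_Collect_eq by (elim exE conjE) (rule that)
  obtain g' where g': "\<forall>x\<in>topspace X. \<forall>w\<in>W. f x w \<in> W \<and> (\<forall>k. blinfun_apply (g' x) (\<phi> (w, k)) = \<phi> (f x w, k))"
    and g'0: "homotopic_UF X g' g\<^sub>0"
    using G[OF \<phi>] by (elim exE conjE) (rule that)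
  \<comment> \<open>The displayed equations determine a representative on \<open>topspace X\<close>
    because \<phi> is onto. Values elsewhere are arbitrary and are handled by
    \<open>homotopic_with_equal\<close>.\<close>
  have eq: "g' x = g x" if x: "x \<in> topspace X" for x
  proof (rule blinfun_eqI)
    fix y
    have "y \<in> \<phi> ` (W \<times> UNIV)"
      using \<phi> by (simp add: unitary_between_def bij_betw_def)
    then obtain w k where y: "y = \<phi> (w, k)" "w \<in> W"
      by blast
    then show "g' x y = g x y"
      using g[rule_format, OF x y(2), THEN conjunct2] g'[rule_format, OF x y(2), THEN conjunct2] by simp
  qed
  have "continuous_map X (top_of_set \<U>\<^sub>F) g'"
    using homotopic_with_imp_continuous_maps[OF g'0] by blast
  then have "homotopic_UF X g' g"
    by (rule homotopic_with_equal[where P = "\<lambda>_. True", OF TrueI TrueI]) (rule eq)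
  then show "h \<in> {g. homotopic_UF X g\<^sub>0 g}"
    using homotopic_with_trans[OF homotopic_with_symD[OF g'0]] gh homotopic_with_trans by blast
next
  fix h :: "'x \<Rightarrow> 'h \<Rightarrow>\<^sub>L 'h" assume "h \<in> {g. homotopic_UF X g\<^sub>0 g}"
  then have h: "homotopic_UF X g\<^sub>0 h"
    by simp
  obtain \<phi> :: "'w \<times> 'h \<Rightarrow> 'h" where \<phi>: "unitary_between (W \<times> UNIV) UNIV \<phi>"
    using ex by (elim exE) (rule that)
  obtain g where g: "\<forall>x\<in>topspace X. \<forall>w\<in>W. f x w \<in> W \<and> (\<forall>k. blinfun_apply (g x) (\<phi> (w, k)) = \<phi> (f x w, k))"
    and g0: "homotopic_UF X g g\<^sub>0"
    using G[OF \<phi>] by (elim exE conjE) (rule that)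
  show "h \<in> K1_index X W f"
    unfolding K1_index_def mem_Collect_eq
    by (intro exI[of _ \<phi>] exI[of _ g] conjI \<phi> g homotopic_with_trans[OF g0 h])
qed

lemma homotopy_class_in_K1:
  assumes "homotopic_UF X g g"
  shows "{h. homotopic_UF X g h} \<in> K1 X"
proof -
  have g: "g \<in> {g. continuous_map X (top_of_set \<U>\<^sub>F) g}"
    using homotopic_with_imp_continuous_maps[OF assms] by simp
  have eq: "{(g, h). homotopic_UF X g h} `` {g} = {h. homotopic_UF X g h}"
    by (rule set_eqI) (simp only: Image_singleton_iff mem_Collect_eq prod.case)
  show ?thesis
    unfolding K1_def eq[symmetric] by (rule quotientI[OF g])
qed

lemma unitary_between_inverse:
  fixes \<phi> :: "'v::complex_inner \<Rightarrow> 'h::complex_inner"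
  assumes V: "csubspace V" and \<phi>: "unitary_between V UNIV \<phi>"
  shows "\<exists>\<psi>. clinear \<psi> \<and> (\<forall>h. \<psi> h \<in> V \<and> \<phi> (\<psi> h) = h \<and> norm (\<psi> h) = norm h) \<and>
    (\<forall>x\<in>V. \<psi> (\<phi> x) = x \<and> norm (\<phi> x) = norm x \<and> (\<forall>h. cinner (\<phi> x) h = cinner x (\<psi> h)))"
proof -
  define \<psi> where "\<psi> = inv_into V \<phi>"
  have bij: "bij_betw \<phi> V UNIV" and add: "\<And>x y. x \<in> V \<Longrightarrow> y \<in> V \<Longrightarrow> \<phi> (x + y) = \<phi> x + \<phi> y"
    and scale: "\<And>c x. x \<in> V \<Longrightarrow> \<phi> (c *\<^sub>C x) = c *\<^sub>C \<phi> x"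
    and inner: "\<And>x y. x \<in> V \<Longrightarrow> y \<in> V \<Longrightarrow> cinner (\<phi> x) (\<phi> y) = cinner x y"
    using \<phi> by (auto simp: unitary_between_def)
  have mem: "\<psi> h \<in> V" and \<phi>\<psi>: "\<phi> (\<psi> h) = h" for h
    using bij unfolding \<psi>_def by (auto simp: bij_betw_def inv_into_into f_inv_into_f)
  have \<psi>\<phi>: "\<psi> (\<phi> x) = x" if "x \<in> V" for x
    unfolding \<psi>_def by (rule inv_into_f_f[OF bij_betw_imp_inj_on[OF bij] that])
  have "clinear \<psi>"
  proof (rule clinearI)
    show "\<psi> (x + y) = \<psi> x + \<psi> y" for x y
      using \<psi>\<phi>[OF csubspace_add[OF V mem[of x] mem[of y]]] by (simp add: add mem \<phi>\<psi>)
    show "\<psi> (c *\<^sub>C x) = c *\<^sub>C \<psi> x" for c x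
      using \<psi>\<phi>[OF csubspace_scaleC[OF V mem[of x]], of c] by (simp add: scale mem \<phi>\<psi>)
  qed
  moreover have n: "norm (\<phi> x) = norm x" if "x \<in> V" for x
    using inner[OF that that] by (simp add: norm_eq_sqrt_inner inner_cinner)
  moreover have "norm (\<psi> h) = norm h" for h
    using n[OF mem[of h]] by (simp add: \<phi>\<psi>)
  moreover have "cinner (\<phi> x) h = cinner x (\<psi> h)" if "x \<in> V" for x h
    using inner[OF that mem[of h]] by (simp add: \<phi>\<psi>)
  ultimately show ?thesis
    using mem \<phi>\<psi> \<psi>\<phi> by (intro exI[of _ \<psi>] conjI allI ballI) auto
qed

text \<open>Here the denominator is the identity, as J e is subtracted in g and added again. The
  result is w on the range of \<open>J\<close> and 1 on its orthogonal complement: the stabilization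
  of w.\<close>

lemma cayley_rel_isometry:
  assumes data: "cayley_data 0 J J Js" and w: "w \<in> unitary_maps"
  shows "cayley_rel 0 J J Js w = id_blinfun - (J o\<^sub>L (id_blinfun - w) o\<^sub>L Js)"
proof (rule cayley_rel_unique[OF data w])
  have "J (half_defect w (Js z)) + J (half_defect w (Js z)) = J (Js z - w (Js z))" for z
    by (simp add: half_defect_apply half_add_half flip: blinfun.add_right)
  then show "(id_blinfun - (J o\<^sub>L (id_blinfun - w) o\<^sub>L Js)) o\<^sub>L cayley_den 0 J J Js w = cayley_num 0 J J Js w"
    by (intro blinfun_eqI) (simp add: cayley_den_apply[OF data w] cayley_num_apply[OF data w] rel_value_apply
        blinfun.diff_left blinfun.add_left algebra_simps)
qed

lemma unitary_maps_uminus: "w \<in> unitary_maps \<Longrightarrow> - w \<in> unitary_maps"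
  by (auto simp: unitary_maps_def blinfun.minus_left clinear_def)

lemma csubspace_Lambda_plus: "csubspace (Lambda_plus :: ('k::complex_inner \<times> 'k) set)"
proof -
  have "(0 :: 'k \<times> 'k) = lag_vec 0 0"
    by (simp add: lag_vec_def zero_prod_def)
  then show ?thesis
    unfolding csubspace_def Lambda_plus_eq by (auto simp: lag_vec_add lag_vec_scaleC)
qed

lemma closed_Lambda_plus: "closed (Lambda_plus :: ('k::{complex_inner,euclidean_space} \<times> 'k) set)"
  by (rule closed_subspace[OF csubspace_subspace[OF csubspace_Lambda_plus]])

text \<open>The identification \<phi> turns \<open>Lambda_plus\<close> into the range of an isometry
  \<open>I\<close> of K into H, and the stabilized map becomes \<open>cayley_rel 0 I I Is\<close>
  with parameter - u_M^(-1) u_L. By \<open>homotopic_cayley_rel\<close> both \<open>I\<close> and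
  the constant factor - u_M^(-1) can be exchanged, for \<open>J\<close> and
  \<open>b\<close>.\<close>

lemma lagrangian_index_eq:
  fixes L :: "'x \<Rightarrow> ((complex ^ 'n::finite) \<times> (complex ^ 'n)) set" and J :: "(complex ^ 'n) \<Rightarrow>\<^sub>L 'h::chilbert_space"
  assumes sep: "separable_infinite_dim TYPE('h)" and L: "continuous_lagrangian_family X L" and M: "lagrangian M"
    and J: "cayley_data 0 J J Js" and b: "b \<in> unitary_maps"
  shows "lagrangian_index X L M = {g. homotopic_UF X (\<lambda>x. cayley_rel 0 J J Js (b o\<^sub>L lagrangian_map (L x))) g}"
  unfolding lagrangian_index_def
proof (rule K1_index_eq_homotopy_class)
  have Lx: "lagrangian (L x)" if "x \<in> topspace X" for x
    using L that by (simp add: continuous_lagrangian_family_def)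
  have inf: "\<not> (\<exists>B::'h set. finite B \<and> span B = UNIV)"
    using sep by (simp add: separable_infinite_dim_def)
  define v where "v = unitary_inverse (lagrangian_map M)"
  have v: "- v \<in> unitary_maps"
    unfolding v_def by (intro unitary_maps_uminus unitary_inverse_unitary lagrangian_map_unitary M)
  show "\<exists>\<phi>. unitary_between ((Lambda_plus :: ((complex ^ 'n) \<times> (complex ^ 'n)) set) \<times> (UNIV :: 'h set)) (UNIV :: 'h set) \<phi>"
  proof (rule unitary_between_stabilization[OF sep csubspace_Lambda_plus closed_Lambda_plus])
    show "countable (range (\<lambda>i::'n. lag_vec (axis i (1::complex)) 0))"
      by (intro countable_image countable_finite) simp
    fix x :: "(complex ^ 'n) \<times> (complex ^ 'n)"
    assume x: "x \<in> Lambda_plus" "\<And>s. s \<in> range (\<lambda>i. lag_vec (axis i 1) 0) \<Longrightarrow> cinner x s = 0"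
    then obtain p where p: "x = lag_vec p 0"
      unfolding Lambda_plus_eq by blast
    have "p $ i = 0" for i
    proof -
      have "cinner p (axis i 1) = p $ i"
        by (simp add: cinner_vec_def cinner_complex_def axis_def if_distrib[of "\<lambda>x. _ * cnj x"] cong: if_cong)
      then show ?thesis
        using x(2)[of "lag_vec (axis i 1) 0"] by (simp add: p cinner_lag_vec)
    qed
    then have "p = 0"
      by (simp add: vec_eq_iff)
    then show "x = 0"
      by (simp add: p lag_vec_def zero_prod_def)
  qed
  fix \<phi> :: "((complex ^ 'n) \<times> (complex ^ 'n)) \<times> 'h \<Rightarrow> 'h"
  assume \<phi>: "unitary_between (Lambda_plus \<times> UNIV) UNIV \<phi>"
  have V: "csubspace ((Lambda_plus :: ((complex ^ 'n) \<times> (complex ^ 'n)) set) \<times> (UNIV :: 'h set))"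
    using csubspace_Lambda_plus by (auto simp: csubspace_def scaleC_prod_def zero_prod_def)
  obtain \<psi> where \<psi>: "clinear \<psi>" "\<And>h. \<psi> h \<in> Lambda_plus \<times> UNIV" "\<And>h. \<phi> (\<psi> h) = h"
    "\<And>h. norm (\<psi> h) = norm h"
    and \<phi>': "\<And>x. x \<in> Lambda_plus \<times> UNIV \<Longrightarrow> \<psi> (\<phi> x) = x" "\<And>x. x \<in> Lambda_plus \<times> UNIV \<Longrightarrow> norm (\<phi> x) = norm x"
    "\<And>x h. x \<in> Lambda_plus \<times> UNIV \<Longrightarrow> cinner (\<phi> x) h = cinner x (\<psi> h)"
    using unitary_between_inverse[OF V \<phi>] by auto
  have lag_in: "(lag_vec p 0, k) \<in> Lambda_plus \<times> UNIV" for p :: "complex ^ 'n" and k :: 'h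
    by (simp add: Lambda_plus_eq)
  have \<phi>_add: "\<phi> (x + y) = \<phi> x + \<phi> y" if "x \<in> Lambda_plus \<times> UNIV" "y \<in> Lambda_plus \<times> UNIV" for x y
    using \<phi> that unfolding unitary_between_def by blast
  have \<phi>_scale: "\<phi> (c *\<^sub>C x) = c *\<^sub>C \<phi> x" if "x \<in> Lambda_plus \<times> UNIV" for c x
    using \<phi> that unfolding unitary_between_def by blast
  \<comment> \<open>The vector \<open>lag_vec k 0\<close> is (k, i k), whose norm is sqrt 2 times
    that of \<open>k\<close>.\<close>
  define I where "I k = (1 / sqrt 2) *\<^sub>R \<phi> (lag_vec k 0, 0)" for k
  define Is where "Is h = sqrt 2 *\<^sub>R plus_part (fst (\<psi> h))" for h
  have cI: "clinear I"
  proof (rule clinearI)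
    show "I (x + y) = I x + I y" for x y
      using \<phi>_add[OF lag_in[of x 0] lag_in[of y 0]] by (simp add: I_def lag_vec_add scaleR_right_distrib)
    show "I (c *\<^sub>C x) = c *\<^sub>C I x" for c x
      using \<phi>_scale[OF lag_in[of x 0], of c] by (simp add: I_def scaleC_Pair lag_vec_scaleC scaleC_scaleR)
  qed
  then have bI: "blinfun_apply (Blinfun I) = I"
    by (intro bounded_linear_Blinfun_apply bounded_linear_clinear)
  have cIs: "clinear Is"
    by (rule clinearI) (simp_all add: Is_def clinear_add[OF \<psi>(1)] clinear_scaleC[OF \<psi>(1)]
        clinear_add[OF clinear_plus_part] clinear_scaleC[OF clinear_plus_part] scaleR_right_distrib scaleC_scaleR)
  have adj: "cinner (I k) h = cinner k (Is h)" for k h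
  proof -
    obtain p where p: "fst (\<psi> h) = lag_vec p 0"
      using \<psi>(2)[of h] by (auto simp: Lambda_plus_eq mem_Times_iff)
    have "cinner (I k) h = (1 / sqrt 2) *\<^sub>R cinner (lag_vec k 0) (fst (\<psi> h))"
      using \<phi>'(3)[OF lag_in[of k 0], of h] by (simp add: I_def cinner_scaleR_left cinner_prod_def)
    also have "\<dots> = (1 / sqrt 2) *\<^sub>R (2 *\<^sub>R cinner k p)"
      unfolding p cinner_lag_vec by (simp add: scaleR_conv_of_real)
    also have "\<dots> = sqrt 2 *\<^sub>R cinner k p"
      by (simp add: real_div_sqrt)
    finally show ?thesis
      by (simp add: Is_def p cinner_scaleR_right)
  qed
  have IsI: "Is (I k) = k" for k
    using \<phi>'(1)[OF lag_in[of k 0]] by (simp add: Is_def I_def clinear_scaleR[OF \<psi>(1)] clinear_scaleR[OF clinear_plus_part])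
  have nI: "norm (I k) = norm k" for k
    using adj[of k "I k"] by (simp add: IsI norm_eq_sqrt_inner inner_cinner)
  have "norm (Is h) \<le> norm h * 1" for h
  proof -
    have "(norm (Is h))\<^sup>2 = cmod (cinner (I (Is h)) h)"
      by (simp add: adj cinner_self norm_power)
    also have "\<dots> \<le> norm (Is h) * norm h"
      using cinner_bound[of "I (Is h)" h] by (simp add: nI)
    finally show ?thesis
      using power2_le_mult_imp_le[of "norm (Is h)" "norm h"] by (simp add: mult.commute)
  qed
  then have bIs: "blinfun_apply (Blinfun Is) = Is"
    by (intro bounded_linear_Blinfun_apply clinear_bounded_linear[OF cIs])
  have data: "cayley_data 0 (Blinfun I) (Blinfun I) (Blinfun Is)"
    using cI cIs adj IsI by (simp add: cayley_data_def bI bIs clinear_def)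
  have wx: "- v o\<^sub>L lagrangian_map (L x) \<in> unitary_maps" if "x \<in> topspace X" for x
    by (intro unitary_maps_compose v lagrangian_map_unitary Lx that)
  show "\<exists>g. (\<forall>x\<in>topspace X. \<forall>w\<in>Lambda_plus.
         - inv_into Lambda_plus (lagrangian_unitary M) (lagrangian_unitary (L x) w) \<in> Lambda_plus \<and>
         (\<forall>k. blinfun_apply (g x) (\<phi> (w, k)) =
           \<phi> (- inv_into Lambda_plus (lagrangian_unitary M) (lagrangian_unitary (L x) w), k))) \<and>
      homotopic_UF X g (\<lambda>x. cayley_rel 0 J J Js (b o\<^sub>L lagrangian_map (L x)))"
  proof (intro exI[of _ "\<lambda>x. cayley_rel 0 (Blinfun I) (Blinfun I) (Blinfun Is) (- v o\<^sub>L lagrangian_map (L x))"] conjI ballI allI)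
    show "homotopic_UF X (\<lambda>x. cayley_rel 0 (Blinfun I) (Blinfun I) (Blinfun Is) (- v o\<^sub>L lagrangian_map (L x)))
       (\<lambda>x. cayley_rel 0 J J Js (b o\<^sub>L lagrangian_map (L x)))"
      using continuous_lagrangian_map[OF L] lagrangian_map_unitary[OF Lx]
      by (intro homotopic_cayley_rel[OF inf data J _ _ v b]) auto
    fix x w assume x: "x \<in> topspace X" and w: "w \<in> (Lambda_plus :: ((complex ^ 'n) \<times> (complex ^ 'n)) set)"
    obtain p where p: "w = lag_vec p 0"
      using w unfolding Lambda_plus_eq by blast
    define m where "m = - v (lagrangian_map (L x) p)"
    have f: "- inv_into Lambda_plus (lagrangian_unitary M) (lagrangian_unitary (L x) w) = lag_vec m 0"
      using lag_vec_scaleC[of "-1" "v (lagrangian_map (L x) p)" 0]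
      by (simp add: p lagrangian_unitary_lag_vec[OF Lx[OF x]] inv_into_lagrangian_unitary[OF M] m_def scaleC_minus1 flip: v_def)
    show "- inv_into Lambda_plus (lagrangian_unitary M) (lagrangian_unitary (L x) w) \<in> Lambda_plus"
      unfolding f by (simp add: Lambda_plus_eq)
    fix k
    have "Is (\<phi> (w, k)) = sqrt 2 *\<^sub>R p"
      using \<phi>'(1)[OF lag_in[of p k]] by (simp add: Is_def p)
    then have "cayley_rel 0 (Blinfun I) (Blinfun I) (Blinfun Is) (- v o\<^sub>L lagrangian_map (L x)) (\<phi> (w, k))
        = \<phi> (w, k) - \<phi> (lag_vec (p - m) 0, 0)"
      by (simp add: cayley_rel_isometry[OF data wx[OF x]] blinfun.diff_left blinfun.minus_left bI bIs m_def
          blinfun.scaleR_right I_def clinear_scaleR[OF cI, unfolded I_def] flip: scaleR_right_distrib)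
    also have "\<dots> = \<phi> (lag_vec m 0, k)"
      using \<phi>_add[OF lag_in[of m k] lag_in[of "p - m" 0]] by (simp add: lag_vec_add p)
    finally show "cayley_rel 0 (Blinfun I) (Blinfun I) (Blinfun Is) (- v o\<^sub>L lagrangian_map (L x)) (\<phi> (w, k)) =
        \<phi> (- inv_into Lambda_plus (lagrangian_unitary M) (lagrangian_unitary (L x) w), k)"
      unfolding f .
  qed
qed

section \<open>Boundary triples\<close>

lemma clinear_injective_inverse:
  fixes f :: "'k::{complex_inner,euclidean_space} \<Rightarrow> 'k"
  assumes f: "clinear f" and inj: "\<And>x. f x = 0 \<Longrightarrow> x = 0"
  shows "\<exists>g. clinear g \<and> (\<forall>x. f (g x) = x)"
proof -
  have inj_f: "x = y" if "f x = f y" for x y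
    using inj[of "x - y"] that by (simp add: clinear_diff[OF f])
  have "inj f"
    by (rule injI) (rule inj_f)
  have "surj f"
    by (rule linear_injective_imp_surjective[OF clinear_linear[OF f] \<open>inj f\<close>]) auto
  then have fg: "f (inv f x) = x" for x
    by (rule surj_f_inv_f)
  have "clinear (inv f)"
    by (intro clinearI; rule inj_f) (simp_all add: fg clinear_add[OF f] clinear_scaleC[OF f])
  then show ?thesis
    using fg by blast
qed

text \<open>The map \<open>F\<close> lists solutions of D f = 0 with linearly independent boundary
  values. By Green's formula these values form an isotropic subspace, and having half the dimension
  of K + K it is Lagrangian. The bound on \<open>\<Gamma> (R g)\<close> is what keeps
  \<open>R\<close> bounded after its correction by elements of the kernel.\<close>

locale boundary_triple =
  fixes W :: "'w::chilbert_space set" and dom :: "'w set" and D :: "'w \<Rightarrow> 'w"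
    and \<Gamma> :: "'w \<Rightarrow> (complex ^ 'n::finite) \<times> (complex ^ 'n)"
    and F :: "complex ^ 'n \<Rightarrow> 'w" and R :: "'w \<Rightarrow> 'w" and c :: real
  assumes W: "csubspace W" and dom: "csubspace dom" "dom \<subseteq> W"
    and D_add: "\<And>f g. f \<in> dom \<Longrightarrow> g \<in> dom \<Longrightarrow> D (f + g) = D f + D g"
    and D_scale: "\<And>f a. f \<in> dom \<Longrightarrow> D (a *\<^sub>C f) = a *\<^sub>C D f"
    and \<Gamma>_add: "\<And>f g. f \<in> dom \<Longrightarrow> g \<in> dom \<Longrightarrow> \<Gamma> (f + g) = \<Gamma> f + \<Gamma> g"
    and \<Gamma>_scale: "\<And>f a. f \<in> dom \<Longrightarrow> \<Gamma> (a *\<^sub>C f) = a *\<^sub>C \<Gamma> f"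
    and green: "\<And>f g. f \<in> dom \<Longrightarrow> g \<in> dom \<Longrightarrow>
      cinner (D f) g - cinner f (D g) = symplectic_form (\<Gamma> f) (\<Gamma> g)"
    and F: "clinear F" "\<And>k. F k \<in> dom" "\<And>k. D (F k) = 0" "\<And>k. \<Gamma> (F k) = 0 \<Longrightarrow> k = 0"
    and R_mem: "\<And>g. g \<in> W \<Longrightarrow> R g \<in> dom" and D_R: "\<And>g. g \<in> W \<Longrightarrow> D (R g) = g"
    and R_add: "\<And>f g. f \<in> W \<Longrightarrow> g \<in> W \<Longrightarrow> R (f + g) = R f + R g"
    and R_scale: "\<And>f a. f \<in> W \<Longrightarrow> R (a *\<^sub>C f) = a *\<^sub>C R f"
    and R_bound: "\<And>g. g \<in> W \<Longrightarrow> norm (R g) \<le> c * norm g"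
    and \<Gamma>_R_bound: "\<And>g. g \<in> W \<Longrightarrow> norm (\<Gamma> (R g)) \<le> c * norm g"
begin

text \<open>
  The boundary values of the kernel of \<open>D\<close> form a Lagrangian subspace, described by \<open>uQ\<close>. The right
  inverse \<open>R\<^sub>0\<close> of \<open>D\<close> differs from \<open>R\<close> by elements of the kernel, chosen such that the
  boundary values of \<open>R\<^sub>0\<close> lie in the orthogonal complement of that subspace.
\<close>

lemma decomposition:
  obtains Y :: "complex ^ 'n \<Rightarrow> 'w" and Ys :: "'w \<Rightarrow> complex ^ 'n" and B :: "complex ^ 'n \<Rightarrow> 'w"
    and R\<^sub>0 :: "'w \<Rightarrow> 'w" and uQ :: "(complex ^ 'n) \<Rightarrow>\<^sub>L (complex ^ 'n)" and K :: real
  where "clinear Y" "\<And>v. Y v \<in> dom" "\<And>v. D (Y v) = 0"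
    "\<And>v. \<Gamma> (Y v) = lag_vec ((1/2) *\<^sub>R v) ((1/2) *\<^sub>R uQ v)" "uQ \<in> unitary_maps"
    "clinear Ys" "\<And>k g. cinner (Y k) g = cinner k (Ys g)"
    "clinear B" "\<And>k. B k \<in> W" "\<And>k. Ys (B k) = k"
    "\<And>g. g \<in> W \<Longrightarrow> R\<^sub>0 g \<in> dom" "\<And>g. g \<in> W \<Longrightarrow> D (R\<^sub>0 g) = g"
    "\<And>f g. f \<in> W \<Longrightarrow> g \<in> W \<Longrightarrow> R\<^sub>0 (f + g) = R\<^sub>0 f + R\<^sub>0 g" "\<And>f a. f \<in> W \<Longrightarrow> R\<^sub>0 (a *\<^sub>C f) = a *\<^sub>C R\<^sub>0 f"
    "\<And>g. g \<in> W \<Longrightarrow> norm (R\<^sub>0 g) \<le> K * norm g"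
    "\<And>f g. f \<in> W \<Longrightarrow> g \<in> W \<Longrightarrow> cinner (R\<^sub>0 f) g = cinner f (R\<^sub>0 g)"
    "\<And>g. g \<in> W \<Longrightarrow> \<Gamma> (R\<^sub>0 g) = lag_vec (- (\<i> / 2) *\<^sub>C Ys g) ((\<i> / 2) *\<^sub>C uQ (Ys g))"
proof -
  define p where "p k = plus_part (\<Gamma> (F k))" for k
  have \<Gamma>F: "clinear (\<lambda>k. \<Gamma> (F k))"
    by (rule clinearI) (simp_all add: clinear_add[OF F(1)] clinear_scaleC[OF F(1)] \<Gamma>_add \<Gamma>_scale F(2))
  have cp: "clinear p"
    unfolding p_def by (rule clinearI) (simp_all add: clinear_add[OF \<Gamma>F] clinear_scaleC[OF \<Gamma>F]
        clinear_add[OF clinear_plus_part] clinear_scaleC[OF clinear_plus_part])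
  have iso: "norm (minus_part (\<Gamma> (F k))) = norm (plus_part (\<Gamma> (F k)))" for k
    using green[OF F(2) F(2), of k k] by (simp add: F(3) symplectic_form_parts norm_eq_sqrt_inner inner_cinner)
  have inj: "k = 0" if "p k = 0" for k
  proof (rule F(4))
    have "minus_part (\<Gamma> (F k)) = 0"
      using iso[of k] that by (simp add: p_def)
    then show "\<Gamma> (F k) = 0"
      using lag_vec_parts[of "\<Gamma> (F k)"] that by (simp add: p_def lag_vec_def zero_prod_def)
  qed
  obtain pinv where pinv: "clinear pinv" "\<And>k. p (pinv k) = k"
    using clinear_injective_inverse[OF cp inj] by blast
  \<comment> \<open>The factor 1/2 gives the boundary values of \<open>Y\<close> the same weight as
    those of \<open>R\<^sub>0\<close>, which carry a factor i / 2. In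
    \<open>R\<^sub>0 g + Y (- \<i> *\<^sub>C e)\<close> the plus part then collapses to - (i / 2)
    (Ys g + e).\<close>
  define Y where "Y v = F (pinv ((1/2) *\<^sub>R v))" for v
  have cY: "clinear Y"
    unfolding Y_def by (rule clinearI) (simp_all add: clinear_add[OF F(1)] clinear_scaleC[OF F(1)] clinear_add[OF pinv(1)]
        clinear_scaleC[OF pinv(1)] clinear_scaleR[OF F(1)] clinear_scaleR[OF pinv(1)] scaleR_right_distrib scaleC_scaleR)
  have Yd: "Y v \<in> dom" "D (Y v) = 0" for v
    by (simp_all add: Y_def F)
  have YW: "Y v \<in> W" for v
    using Yd(1) dom(2) by blast
  have plus_Y: "plus_part (\<Gamma> (Y v)) = (1/2) *\<^sub>R v" for v
    using pinv(2)[of "(1/2) *\<^sub>R v"] by (simp add: Y_def p_def)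
  define q where "q v = 2 *\<^sub>R minus_part (\<Gamma> (Y v))" for v
  have cq: "clinear q"
    unfolding q_def by (rule clinearI) (simp_all add: clinear_add[OF cY] clinear_scaleC[OF cY] \<Gamma>_add \<Gamma>_scale Yd
        clinear_add[OF clinear_minus_part] clinear_scaleC[OF clinear_minus_part] scaleR_right_distrib scaleC_scaleR)
  define uQ where "uQ = Blinfun q"
  have uQ: "blinfun_apply uQ = q"
    unfolding uQ_def by (intro bounded_linear_Blinfun_apply bounded_linear_clinear cq)
  have minus_Y: "minus_part (\<Gamma> (Y v)) = (1/2) *\<^sub>R uQ v" for v
    by (simp add: uQ q_def)
  have "norm (q v) = norm v" for v
    using iso[of "pinv ((1/2) *\<^sub>R v)"] plus_Y[of v] by (simp add: q_def Y_def)
  then have uQU: "uQ \<in> unitary_maps"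
    using cq by (simp add: unitary_maps_def uQ)
  have \<Gamma>Y: "\<Gamma> (Y v) = lag_vec ((1/2) *\<^sub>R v) ((1/2) *\<^sub>R uQ v)" for v
    using lag_vec_parts[of "\<Gamma> (Y v)"] by (simp only: plus_Y minus_Y)
  note iQ = unitary_inverse[OF uQU]
  define iQ where "iQ = unitary_inverse uQ"
  have ciQ: "clinear iQ" and niQ: "norm (iQ k) = norm k" for k
    using iQ(1) by (auto simp: unitary_maps_def iQ_def)
  have cuQ: "clinear uQ"
    using cq by (simp add: uQ)
  define Ys where "Ys g = (\<chi> i. cinner g (Y (axis i 1)))" for g
  have cYs: "clinear Ys"
    by (rule clinearI) (auto simp: Ys_def vec_eq_iff cinner_simps scaleC_vec_def scaleC_complex_def)
  have adj: "cinner (Y k) g = cinner k (Ys g)" for k g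
  proof -
    have "k = (\<Sum>i\<in>UNIV. (k $ i) *\<^sub>C axis i 1)"
      by (auto simp: vec_eq_iff scaleC_vec_def scaleC_complex_def axis_def if_distrib[of "\<lambda>x. _ * x"] cong: if_cong)
    then have "Y k = Y (\<Sum>i\<in>UNIV. (k $ i) *\<^sub>C axis i 1)"
      by (rule arg_cong)
    also have "\<dots> = (\<Sum>i\<in>UNIV. (k $ i) *\<^sub>C Y (axis i 1))"
      unfolding linear_sum[OF clinear_linear[OF cY]] by (simp add: clinear_scaleC[OF cY])
    finally show ?thesis
      by (simp add: cinner_sum_left cinner_scaleC_left cinner_vec_def cinner_complex_def Ys_def flip: cinner_commute)
  qed
  have Y0: "v = 0" if "Y v = 0" for v
  proof -
    have "\<Gamma> (0::'w) = 0"
      using \<Gamma>_scale[OF csubspace_0[OF dom(1)], of 0] by simp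
    then have "plus_part (\<Gamma> (Y v)) = 0"
      using that by (simp add: clinear_zero[OF clinear_plus_part])
    then show ?thesis
      by (simp add: plus_Y)
  qed
  \<comment> \<open>The Gram map of \<open>Y\<close>, injective because (k, G k) is the squared norm
    of \<open>Y k\<close>. Hence Y G^(-1) is a right inverse of \<open>Ys\<close>.\<close>
  define G where "G k = Ys (Y k)" for k
  have cG: "clinear G"
    unfolding G_def by (rule clinearI) (simp_all add: clinear_add[OF cY] clinear_scaleC[OF cY]
        clinear_add[OF cYs] clinear_scaleC[OF cYs])
  have "k = 0" if "G k = 0" for k
    using adj[of k "Y k"] that by (intro Y0) (simp add: G_def)
  then obtain Ginv where Ginv: "clinear Ginv" "\<And>k. G (Ginv k) = k"
    using clinear_injective_inverse[OF cG] by blast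
  define B where "B k = Y (Ginv k)" for k
  have cB: "clinear B"
    unfolding B_def by (rule clinearI) (simp_all add: clinear_add[OF cY] clinear_scaleC[OF cY]
        clinear_add[OF Ginv(1)] clinear_scaleC[OF Ginv(1)])
  have YsB: "Ys (B k) = k" for k
    using Ginv(2) by (simp add: B_def G_def)
  \<comment> \<open>With a and b the parts of \<open>\<Gamma> (R g)\<close>, the orthogonal
    projection to the graph of \<open>uQ\<close> has plus part (a + uQ^(-1) b) / 2. As
    \<open>Y s\<close> has plus part s / 2, this choice of s cancels the projection, and the
    boundary values end up in the graph of - uQ.\<close>
  define s where "s g = - (plus_part (\<Gamma> (R g)) + iQ (minus_part (\<Gamma> (R g))))" for g
  define R\<^sub>0 where "R\<^sub>0 g = R g + Y (s g)" for g
  have s_add: "s (f + g) = s f + s g" if "f \<in> W" "g \<in> W" for f g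
    using that by (simp add: s_def R_add \<Gamma>_add R_mem clinear_add[OF clinear_plus_part] clinear_add[OF clinear_minus_part]
        blinfun.add_right)
  have s_scale: "s (a *\<^sub>C f) = a *\<^sub>C s f" if "f \<in> W" for a f
    using that by (simp add: s_def R_scale \<Gamma>_scale R_mem clinear_scaleC[OF clinear_plus_part] clinear_scaleC[OF clinear_minus_part]
        clinear_scaleC[OF ciQ] scaleC_simps)
  have R0_dom: "R\<^sub>0 g \<in> dom" if "g \<in> W" for g
    unfolding R\<^sub>0_def by (intro csubspace_add dom R_mem Yd that)
  have D_R0: "D (R\<^sub>0 g) = g" if "g \<in> W" for g
    using that by (simp add: R\<^sub>0_def D_add R_mem Yd D_R)
  have R0_add: "R\<^sub>0 (f + g) = R\<^sub>0 f + R\<^sub>0 g" if "f \<in> W" "g \<in> W" for f g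
    using that by (simp add: R\<^sub>0_def R_add s_add clinear_add[OF cY])
  have R0_scale: "R\<^sub>0 (a *\<^sub>C f) = a *\<^sub>C R\<^sub>0 f" if "f \<in> W" for a f
    using that by (simp add: R\<^sub>0_def R_scale s_scale clinear_scaleC[OF cY] scaleC_add_right)
  have \<Gamma>_R0: "\<Gamma> (R\<^sub>0 g) = \<Gamma> (R g) + \<Gamma> (Y (s g))" if "g \<in> W" for g
    unfolding R\<^sub>0_def by (rule \<Gamma>_add[OF R_mem[OF that] Yd(1)])
  have minus_R0: "minus_part (\<Gamma> (R\<^sub>0 g)) = - uQ (plus_part (\<Gamma> (R\<^sub>0 g)))" if "g \<in> W" for g
  proof -
    define a b where "a = plus_part (\<Gamma> (R g))" and "b = minus_part (\<Gamma> (R g))"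
    have s: "s g = - (a + iQ b)"
      by (simp add: s_def a_def b_def)
    have us: "uQ (s g) = - uQ a - b"
      unfolding s by (simp only: blinfun.add_right blinfun.minus_right iQ_def iQ(3)) simp
    have "minus_part (\<Gamma> (R\<^sub>0 g)) = b + (1/2) *\<^sub>R (- uQ a - b)"
      unfolding \<Gamma>_R0[OF that] clinear_add[OF clinear_minus_part] minus_Y us b_def ..
    moreover have "uQ (plus_part (\<Gamma> (R\<^sub>0 g))) = uQ a + (1/2) *\<^sub>R (- uQ a - b)"
      unfolding \<Gamma>_R0[OF that] clinear_add[OF clinear_plus_part] plus_Y blinfun.add_right blinfun.scaleR_right us a_def ..
    moreover have "b + (1/2) *\<^sub>R (- uQ a - b) = - (uQ a + (1/2) *\<^sub>R (- uQ a - b))"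
    proof -
      define x y where "x = (1/2) *\<^sub>R b" and "y = (1/2) *\<^sub>R uQ a"
      have "b = x + x" "uQ a = y + y"
        by (simp_all only: x_def y_def half_add_half)
      moreover have "(1/2) *\<^sub>R (- uQ a - b) = - y - x"
        by (simp add: x_def y_def scaleR_right_diff_distrib)
      ultimately show ?thesis
        by simp
    qed
    ultimately show ?thesis
      by simp
  qed
  \<comment> \<open>Green's formula against the elements \<open>Y v\<close> of the kernel reduces to
    (g, Y v) and so expresses the boundary value of \<open>R\<^sub>0 g\<close> by the adjoint
    \<open>Ys\<close>.\<close>
  have plus_R0: "plus_part (\<Gamma> (R\<^sub>0 g)) = - (\<i> / 2) *\<^sub>C Ys g" if g: "g \<in> W" for g
  proof (rule cinner_eqI)
    fix v
    define a where "a = plus_part (\<Gamma> (R\<^sub>0 g))"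
    have "cinner g (Y v) = symplectic_form (\<Gamma> (R\<^sub>0 g)) (\<Gamma> (Y v))"
      using green[OF R0_dom[OF g] Yd(1), of v] by (simp add: D_R0[OF g] Yd)
    also have "\<dots> = 2 * \<i> * (cinner a ((1/2) *\<^sub>R v) + cinner (uQ a) ((1/2) *\<^sub>R uQ v))"
      unfolding symplectic_form_parts plus_Y minus_Y minus_R0[OF g] by (simp add: a_def)
    also have "\<dots> = 2 * \<i> * cinner a v"
      by (simp add: cinner_scaleR_right unitary_maps_inner[OF uQU] half_add_half)
    finally have "cinner g (Y v) = 2 * \<i> * cinner a v" .
    moreover have "cinner (Ys g) v = cinner g (Y v)"
      using adj[of v g] cinner_commute[of "Ys g" v] cinner_commute[of g "Y v"] by simp
    ultimately show "cinner (plus_part (\<Gamma> (R\<^sub>0 g))) v = cinner (- (\<i> / 2) *\<^sub>C Ys g) v"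
      by (simp add: cinner_scaleC_left a_def)
  qed
  have \<Gamma>R0: "\<Gamma> (R\<^sub>0 g) = lag_vec (- (\<i> / 2) *\<^sub>C Ys g) ((\<i> / 2) *\<^sub>C uQ (Ys g))" if g: "g \<in> W" for g
  proof -
    have "minus_part (\<Gamma> (R\<^sub>0 g)) = (\<i> / 2) *\<^sub>C uQ (Ys g)"
      by (simp add: minus_R0[OF g] plus_R0[OF g] clinear_scaleC[OF cuQ] blinfun.minus_right)
    then show ?thesis
      using lag_vec_parts[of "\<Gamma> (R\<^sub>0 g)"] by (simp only: plus_R0[OF g])
  qed
  \<comment> \<open>The graph of - uQ is isotropic too, so the boundary term in Green's formula
    vanishes.\<close>
  have sym: "cinner (R\<^sub>0 f) g = cinner f (R\<^sub>0 g)" if fg: "f \<in> W" "g \<in> W" for f g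
  proof -
    have "symplectic_form (\<Gamma> (R\<^sub>0 f)) (\<Gamma> (R\<^sub>0 g)) = 0"
      by (simp add: symplectic_form_parts minus_R0 fg unitary_maps_inner[OF uQU])
    then show ?thesis
      using green[OF R0_dom R0_dom, OF fg] by (simp add: D_R0 fg)
  qed
  obtain KY where KY: "\<And>v. norm (Y v) \<le> norm v * KY" "0 \<le> KY"
    using bounded_linear.nonneg_bounded[OF bounded_linear_clinear[OF cY]] by blast
  obtain Kp where Kp: "\<And>x :: (complex ^ 'n) \<times> (complex ^ 'n). norm (plus_part x) \<le> norm x * Kp" "0 \<le> Kp"
    using bounded_linear.nonneg_bounded[OF bounded_linear_clinear[OF clinear_plus_part]] by blast
  obtain Km where Km: "\<And>x :: (complex ^ 'n) \<times> (complex ^ 'n). norm (minus_part x) \<le> norm x * Km" "0 \<le> Km"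
    using bounded_linear.nonneg_bounded[OF bounded_linear_clinear[OF clinear_minus_part]] by blast
  have bound: "norm (R\<^sub>0 g) \<le> (c + c * (Kp + Km) * KY) * norm g" if g: "g \<in> W" for g
  proof -
    have "norm (s g) \<le> norm (plus_part (\<Gamma> (R g))) + norm (minus_part (\<Gamma> (R g)))"
      unfolding s_def norm_minus_cancel by (rule order_trans[OF norm_triangle_ineq]) (simp add: niQ)
    also have "\<dots> \<le> norm (\<Gamma> (R g)) * (Kp + Km)"
      using Kp(1)[of "\<Gamma> (R g)"] Km(1)[of "\<Gamma> (R g)"] by (simp add: algebra_simps)
    also have "\<dots> \<le> (c * norm g) * (Kp + Km)"
      using Kp(2) Km(2) by (intro mult_right_mono \<Gamma>_R_bound g) auto
    finally have "norm (s g) * KY \<le> (c * norm g) * (Kp + Km) * KY"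
      using KY(2) by (rule mult_right_mono)
    then have "norm (Y (s g)) \<le> (c * norm g) * (Kp + Km) * KY"
      using KY(1)[of "s g"] by linarith
    then show ?thesis
      using norm_triangle_ineq[of "R g" "Y (s g)"] R_bound[OF g] by (simp add: R\<^sub>0_def algebra_simps)
  qed
  show thesis
    by (rule that[OF cY Yd(1) Yd(2) \<Gamma>Y uQU cYs adj cB _ YsB R0_dom D_R0 R0_add R0_scale bound sym \<Gamma>R0])
      (simp_all add: B_def YW)
qed

text \<open>Isotropy of L makes the realization symmetric, and a symmetric operator does not have
  the eigenvalue -i. Hence the inverse in \<open>cayley\<close> is determined by any preimage that
  one can exhibit.\<close>

lemma realization_injective:
  assumes L: "lagrangian L"
  shows "inj_on (\<lambda>f. D f + \<i> *\<^sub>C f) {f \<in> dom. \<Gamma> f \<in> L}"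
proof (rule inj_onI)
  fix f g assume f: "f \<in> {f \<in> dom. \<Gamma> f \<in> L}" and g: "g \<in> {f \<in> dom. \<Gamma> f \<in> L}"
    and eq: "D f + \<i> *\<^sub>C f = D g + \<i> *\<^sub>C g"
  define h where "h = f + (-1) *\<^sub>C g"
  have mg: "(-1) *\<^sub>C g \<in> dom"
    using g by (intro csubspace_scaleC dom) simp
  have h: "h \<in> dom"
    unfolding h_def using f by (intro csubspace_add dom mg) simp
  have "\<Gamma> h = \<Gamma> f + (-1) *\<^sub>C \<Gamma> g" and Dh: "D h = D f + (-1) *\<^sub>C D g"
    using f g mg unfolding h_def by (simp_all only: \<Gamma>_add \<Gamma>_scale D_add D_scale mem_Collect_eq)
  then have \<Gamma>h: "\<Gamma> h = \<Gamma> f - \<Gamma> g" and Dh: "D h = D f - D g"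
    by (simp_all add: scaleC_minus1)
  have "\<Gamma> h \<in> L"
    using f g by (simp add: mem_lagrangian[OF L] \<Gamma>h clinear_diff[OF clinear_plus_part] clinear_diff[OF clinear_minus_part]
        blinfun.diff_right)
  then have "symplectic_form (\<Gamma> h) (\<Gamma> h) = 0"
    using L unfolding lagrangian_def by blast
  then have *: "cinner (D h) h = cinner h (D h)"
    using green[OF h h] by simp
  have hfg: "h = f - g"
    by (simp add: h_def scaleC_minus1)
  have ih: "\<i> *\<^sub>C h = \<i> *\<^sub>C f - \<i> *\<^sub>C g"
    by (simp add: hfg scaleC_diff_right)
  have "D h + \<i> *\<^sub>C h = (D f + \<i> *\<^sub>C f) - (D g + \<i> *\<^sub>C g)"
    unfolding Dh ih by simp
  then have "D h + \<i> *\<^sub>C h = 0"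
    by (simp add: eq)
  then have Dh_eq: "D h = - (\<i> *\<^sub>C h)"
    by (simp add: add_eq_0_iff2)
  have "- (\<i> * cinner h h) = \<i> * cinner h h"
    using * unfolding Dh_eq by (simp add: cinner_scaleC_left cinner_scaleC_right)
  then have "cinner h h = 0"
    by simp
  then show "f = g"
    by (simp add: hfg)
qed

text \<open>Through \<phi>, the decomposition of \<open>R\<^sub>0\<close>, \<open>Y\<close> and
  \<open>B\<close> becomes Cayley data on H that vanish on the auxiliary summand. The work consists
  in recognizing the Cayley transform of the realization, stabilized by 1, as
  \<open>cayley_rel\<close> of these data with parameter - u_Q^(-1) u_L.\<close>

theorem operator_index_eq_homotopy_class:
  fixes L :: "'x \<Rightarrow> ((complex ^ 'n) \<times> (complex ^ 'n)) set" and J :: "(complex ^ 'n) \<Rightarrow>\<^sub>L 'h::chilbert_space"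
  assumes sep: "separable_infinite_dim TYPE('h)" and W_closed: "closed W"
    and S: "countable S" "\<And>x. x \<in> W \<Longrightarrow> (\<And>s. s \<in> S \<Longrightarrow> cinner x s = 0) \<Longrightarrow> x = 0"
    and L: "continuous_lagrangian_family X L"
    and J: "cayley_data 0 J J Js" and b: "b \<in> unitary_maps"
  shows "operator_index X W (\<lambda>x. {f \<in> dom. \<Gamma> f \<in> L x}) (\<lambda>x. D) =
    {g. homotopic_UF X (\<lambda>x. cayley_rel 0 J J Js (b o\<^sub>L lagrangian_map (L x))) g}"
  unfolding operator_index_def
proof (rule K1_index_eq_homotopy_class)
  show "\<exists>\<phi>. unitary_between (W \<times> (UNIV :: 'h set)) (UNIV :: 'h set) \<phi>"
    by (rule unitary_between_stabilization[OF sep W W_closed S])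
  have Lx: "lagrangian (L x)" if "x \<in> topspace X" for x
    using L that by (simp add: continuous_lagrangian_family_def)
  have inf: "\<not> (\<exists>B::'h set. finite B \<and> span B = UNIV)"
    using sep by (simp add: separable_infinite_dim_def)
  fix \<phi> :: "'w \<times> 'h \<Rightarrow> 'h"
  assume \<phi>: "unitary_between (W \<times> UNIV) UNIV \<phi>"
  have V: "csubspace (W \<times> (UNIV :: 'h set))"
    using W by (auto simp: csubspace_def scaleC_prod_def zero_prod_def)
  obtain \<psi> where \<psi>: "clinear \<psi>" "\<And>h. \<psi> h \<in> W \<times> UNIV" "\<And>h. \<phi> (\<psi> h) = h"
    "\<And>h. norm (\<psi> h) = norm h"
    and \<phi>': "\<And>x. x \<in> W \<times> UNIV \<Longrightarrow> \<psi> (\<phi> x) = x" "\<And>x. x \<in> W \<times> UNIV \<Longrightarrow> norm (\<phi> x) = norm x"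
    "\<And>x h. x \<in> W \<times> UNIV \<Longrightarrow> cinner (\<phi> x) h = cinner x (\<psi> h)"
    using unitary_between_inverse[OF V \<phi>] by auto
  have \<phi>_add: "\<phi> (w, k) + \<phi> (w', k') = \<phi> (w + w', k + k')" if "w \<in> W" "w' \<in> W" for w w' k k'
    using \<phi> that by (simp add: unitary_between_def flip: add_Pair)
  have \<phi>_scale: "a *\<^sub>C \<phi> (w, k) = \<phi> (a *\<^sub>C w, a *\<^sub>C k)" if "w \<in> W" for a w k
    using \<phi> that by (simp add: unitary_between_def scaleC_prod_def)
  have \<psi>W: "fst (\<psi> h) \<in> W" for h
    using \<psi>(2)[of h] by (simp add: mem_Times_iff)
  obtain Y Ys B R\<^sub>0 uQ K where Y: "clinear Y" "\<And>v. Y v \<in> dom" "\<And>v. D (Y v) = 0"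
    "\<And>v. \<Gamma> (Y v) = lag_vec ((1/2) *\<^sub>R v) ((1/2) *\<^sub>R blinfun_apply uQ v)" and uQ: "uQ \<in> unitary_maps"
    and Ys: "clinear Ys" "\<And>k g. cinner (Y k) g = cinner k (Ys g)"
    and B: "clinear B" "\<And>k. B k \<in> W" "\<And>k. Ys (B k) = k"
    and R0: "\<And>g. g \<in> W \<Longrightarrow> R\<^sub>0 g \<in> dom" "\<And>g. g \<in> W \<Longrightarrow> D (R\<^sub>0 g) = g"
    "\<And>f g. f \<in> W \<Longrightarrow> g \<in> W \<Longrightarrow> R\<^sub>0 (f + g) = R\<^sub>0 f + R\<^sub>0 g" "\<And>f a. f \<in> W \<Longrightarrow> R\<^sub>0 (a *\<^sub>C f) = a *\<^sub>C R\<^sub>0 f"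
    "\<And>g. g \<in> W \<Longrightarrow> norm (R\<^sub>0 g) \<le> K * norm g"
    "\<And>f g. f \<in> W \<Longrightarrow> g \<in> W \<Longrightarrow> cinner (R\<^sub>0 f) g = cinner f (R\<^sub>0 g)"
    "\<And>g. g \<in> W \<Longrightarrow> \<Gamma> (R\<^sub>0 g) = lag_vec (- (\<i> / 2) *\<^sub>C Ys g) ((\<i> / 2) *\<^sub>C blinfun_apply uQ (Ys g))"
    by (rule decomposition) (rule that; assumption)
  have YW: "Y v \<in> W" and R0W: "g \<in> W \<Longrightarrow> R\<^sub>0 g \<in> W" for v g
    using Y(2) R0(1) dom(2) by blast+
  define A where "A h = \<phi> (R\<^sub>0 (fst (\<psi> h)), 0)" for h
  define Y' where "Y' k = \<phi> (Y k, 0)" for k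
  define B' where "B' k = \<phi> (B k, 0)" for k
  define Ys' where "Ys' h = Ys (fst (\<psi> h))" for h
  have fst_\<psi>: "fst (\<psi> (\<phi> (w, k))) = w" if "w \<in> W" for w k
    using \<phi>'(1)[of "(w, k)"] that by simp
  have cA: "clinear A"
    by (rule clinearI) (simp_all add: A_def clinear_add[OF \<psi>(1)] clinear_scaleC[OF \<psi>(1)] R0 \<psi>W
        \<phi>_add \<phi>_scale R0W)
  have cY': "clinear Y'" and cB': "clinear B'"
    by (rule clinearI; simp add: Y'_def B'_def clinear_add[OF Y(1)] clinear_scaleC[OF Y(1)] clinear_add[OF B(1)]
        clinear_scaleC[OF B(1)] \<phi>_add \<phi>_scale YW B(2))+
  have cYs': "clinear Ys'"
    by (rule clinearI) (simp_all add: Ys'_def clinear_add[OF \<psi>(1)] clinear_scaleC[OF \<psi>(1)]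
        clinear_add[OF Ys(1)] clinear_scaleC[OF Ys(1)])
  have "norm (A h) \<le> norm h * \<bar>K\<bar>" for h
  proof -
    have "norm (A h) = norm (R\<^sub>0 (fst (\<psi> h)))"
      using \<phi>'(2)[of "(R\<^sub>0 (fst (\<psi> h)), 0)"] by (simp add: A_def R0W \<psi>W norm_Pair)
    also have "\<dots> \<le> K * norm (fst (\<psi> h))"
      by (rule R0(5)[OF \<psi>W])
    also have "\<dots> \<le> \<bar>K\<bar> * norm (\<psi> h)"
      using norm_fst_le[of "fst (\<psi> h)" "snd (\<psi> h)"] by (intro mult_mono) auto
    finally show ?thesis
      by (simp add: \<psi>(4) mult.commute)
  qed
  then have bA: "blinfun_apply (Blinfun A) = A"
    by (intro bounded_linear_Blinfun_apply clinear_bounded_linear[OF cA])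
  have bY: "blinfun_apply (Blinfun Y') = Y'" and bB: "blinfun_apply (Blinfun B') = B'"
    by (intro bounded_linear_Blinfun_apply bounded_linear_clinear cY' cB')+
  have adj: "cinner (Y' k) h = cinner k (Ys' h)" for k h
    using \<phi>'(3)[of "(Y k, 0)" h] by (simp add: Y'_def Ys'_def YW cinner_prod_def Ys(2))
  obtain KY where KY: "\<And>v. norm (Y' v) \<le> norm v * KY" "0 \<le> KY"
    using bounded_linear.nonneg_bounded[OF bounded_linear_clinear[OF cY']] by blast
  have "norm (Ys' h) \<le> norm h * KY" for h
  proof -
    have "(norm (Ys' h))\<^sup>2 = cmod (cinner (Y' (Ys' h)) h)"
      by (simp add: adj cinner_self norm_power)
    also have "\<dots> \<le> norm (Y' (Ys' h)) * norm h"
      by (rule cinner_bound)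
    also have "\<dots> \<le> (norm (Ys' h) * KY) * norm h"
      by (intro mult_right_mono KY) auto
    finally show ?thesis
      using power2_le_mult_imp_le[of "norm (Ys' h)" "norm h * KY"] KY(2) by (simp add: mult_ac)
  qed
  then have bYs: "blinfun_apply (Blinfun Ys') = Ys'"
    by (intro bounded_linear_Blinfun_apply clinear_bounded_linear[OF cYs'])
  have symA: "cinner (A h) h' = cinner h (A h')" for h h'
  proof -
    have "cinner (A h) h' = cinner (R\<^sub>0 (fst (\<psi> h))) (fst (\<psi> h'))" for h h'
      using \<phi>'(3)[of "(R\<^sub>0 (fst (\<psi> h)), 0)" h'] by (simp add: A_def R0W \<psi>W cinner_prod_def)
    then show ?thesis
      using R0(6)[OF \<psi>W[of h] \<psi>W[of h']] cinner_commute[of h "A h'"] cinner_commute[of "fst (\<psi> h)" "R\<^sub>0 (fst (\<psi> h'))"]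
      by simp
  qed
  have data: "cayley_data (Blinfun A) (Blinfun Y') (Blinfun B') (Blinfun Ys')"
    unfolding cayley_data_def bA bY bB bYs
    using cA cY' cB' cYs' symA adj by (simp add: Ys'_def B'_def fst_\<psi> B)
  define v where "v = unitary_inverse uQ"
  have v: "- v \<in> unitary_maps"
    unfolding v_def by (intro unitary_maps_uminus unitary_inverse_unitary uQ)
  have wx: "- v o\<^sub>L lagrangian_map (L x) \<in> unitary_maps" if "x \<in> topspace X" for x
    by (intro unitary_maps_compose v lagrangian_map_unitary Lx that)
  show "\<exists>g. (\<forall>x\<in>topspace X. \<forall>w\<in>W. cayley {f \<in> dom. \<Gamma> f \<in> L x} D w \<in> W \<and>
         (\<forall>k. blinfun_apply (g x) (\<phi> (w, k)) = \<phi> (cayley {f \<in> dom. \<Gamma> f \<in> L x} D w, k))) \<and>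
      homotopic_UF X g (\<lambda>x. cayley_rel 0 J J Js (b o\<^sub>L lagrangian_map (L x)))"
  proof (rule exI[of _ "\<lambda>x. cayley_rel (Blinfun A) (Blinfun Y') (Blinfun B') (Blinfun Ys') (- v o\<^sub>L lagrangian_map (L x))"],
      rule conjI, rule ballI, rule ballI)
    show "homotopic_UF X (\<lambda>x. cayley_rel (Blinfun A) (Blinfun Y') (Blinfun B') (Blinfun Ys') (- v o\<^sub>L lagrangian_map (L x)))
       (\<lambda>x. cayley_rel 0 J J Js (b o\<^sub>L lagrangian_map (L x)))"
      using continuous_lagrangian_map[OF L] lagrangian_map_unitary[OF Lx]
      by (intro homotopic_cayley_rel[OF inf data J _ _ v b]) auto
    fix x w assume x: "x \<in> topspace X" and w: "w \<in> W"
    define u where "u = - v o\<^sub>L lagrangian_map (L x)"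
    have u: "u \<in> unitary_maps"
      unfolding u_def by (rule wx[OF x])
    have cE: "clinear (half_defect u)"
      by (rule clinear_half_defect[OF data u])
    have cL: "clinear (lagrangian_map (L x))" and cuQ: "clinear uQ"
      using lagrangian_map_unitary[OF Lx[OF x]] uQ by (auto simp: unitary_maps_def)
    \<comment> \<open>Since the denominator is onto, the solution f of D f + i f = w can be read off
      from a preimage \<open>z\<close>. Surjectivity of the realization plus i is obtained in this
      way.\<close>
    define z where "z = (SOME z. cayley_den (Blinfun A) (Blinfun Y') (Blinfun B') (Blinfun Ys') u z = \<phi> (w, 0))"
    have z: "cayley_den (Blinfun A) (Blinfun Y') (Blinfun B') (Blinfun Ys') u z = \<phi> (w, 0)"
      unfolding z_def by (rule someI_ex) (metis surjD[OF surj_den[OF data u]])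
    define z1 k where "z1 = fst (\<psi> z)" and "k = snd (\<psi> z)"
    have z1: "z1 \<in> W"
      unfolding z1_def by (rule \<psi>W)
    have zk: "z = \<phi> (z1, k)"
      using \<psi>(3)[of z] by (simp add: z1_def k_def)
    define y e where "y = Ys z1" and "e = half_defect u (Ys z1)"
    define g where "g = z1 - B e"
    \<comment> \<open>The pair (f, g) is the element of the relation with parameter
      \<open>z\<close>; the argument of \<open>Y\<close> is the v with i v = e.\<close>
    define f where "f = R\<^sub>0 g + Y (- \<i> *\<^sub>C e)"
    have g: "g \<in> W"
      unfolding g_def by (intro csubspace_diff W z1 B)
    have fdom: "f \<in> dom"
      unfolding f_def by (intro csubspace_add dom R0 g Y)
    then have fW: "f \<in> W"
      using dom(2) by blast
    have Df: "D f = g"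
      unfolding f_def using g by (simp only: D_add R0 Y) simp
    have if_eq: "\<i> *\<^sub>C f = \<i> *\<^sub>C R\<^sub>0 g + Y e"
      by (simp add: f_def scaleC_add_right scaleC_diff_right clinear_minus[OF Y(1)] clinear_scaleC[OF Y(1)] scaleC_i_i)
    have \<psi>z: "Ys' z = y"
      by (simp add: Ys'_def y_def z1_def)
    have diff\<phi>: "\<phi> (a, k) - \<phi> (b, k') = \<phi> (a - b, k - k')" if "a \<in> W" "b \<in> W" for a b k k'
      using \<phi>_add[OF csubspace_diff[OF W that] that(2), of "k - k'" k'] by (simp add: algebra_simps)
    have Gz: "rel_value (Blinfun B') (Blinfun Ys') u z = \<phi> (g, k)"
      unfolding rel_value_apply bB bYs \<psi>z unfolding zk B'_def diff\<phi>[OF z1 B(2)] by (simp add: g_def e_def y_def)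
    have arg: "\<i> *\<^sub>C A (\<phi> (g, k)) + Y' e = \<phi> (\<i> *\<^sub>C f, 0)"
      unfolding A_def Y'_def fst_\<psi>[OF g] if_eq
      by (simp add: \<phi>_scale[OF R0W[OF g]] \<phi>_add csubspace_scaleC[OF W] R0W g YW)
    have den: "\<phi> (w, 0) = \<phi> (g + \<i> *\<^sub>C f, k)"
      using z unfolding cayley_den_apply[OF data u] Gz bA bY bYs \<psi>z y_def e_def[symmetric] arg
      by (simp add: \<phi>_add g csubspace_scaleC[OF W fW])
    have gif: "g + \<i> *\<^sub>C f \<in> W"
      by (intro csubspace_add csubspace_scaleC W g fW)
    have "(w, 0) = (g + \<i> *\<^sub>C f, k)"
      using arg_cong[OF den, of \<psi>] \<phi>'(1)[of "(w, 0)"] \<phi>'(1)[of "(g + \<i> *\<^sub>C f, k)"] w gif by simp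
    then have w_eq: "w = g + \<i> *\<^sub>C f" and k0: "k = 0"
      by simp_all
    have num: "cayley_num (Blinfun A) (Blinfun Y') (Blinfun B') (Blinfun Ys') u z = \<phi> (g - \<i> *\<^sub>C f, 0)"
      unfolding cayley_num_apply[OF data u] Gz bA bY bYs \<psi>z y_def e_def[symmetric] arg
      by (simp add: diff\<phi> g csubspace_scaleC[OF W fW] k0)
    \<comment> \<open>The parts of \<open>\<Gamma> f\<close> are - (i / 2) y and (i / 2) uQ (y - 2
      e) = (i / 2) uQ (u y). They lie in the graph of u_L exactly because u = - u_Q^(-1) u_L; this
      accounts for the twist by Q.\<close>
    have "\<Gamma> f \<in> L x"
    proof -
      have Ysg: "Ys g = y - e"
        by (simp add: g_def clinear_diff[OF Ys(1)] B(3) y_def)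
      have e2: "e + e = y - u y"
        by (simp add: e_def y_def half_defect_apply half_add_half)
      have uQu: "uQ (u y) = - lagrangian_map (L x) y"
        by (simp add: u_def v_def blinfun.minus_left blinfun.minus_right unitary_inverse_right[OF uQ])
      have half: "(1/2) *\<^sub>R (a::complex ^ 'n) = (1/2) *\<^sub>C a" for a
        by (simp add: scaleR_scaleC)
      have "\<Gamma> f = \<Gamma> (R\<^sub>0 g) + \<Gamma> (Y (- \<i> *\<^sub>C e))"
        unfolding f_def by (rule \<Gamma>_add[OF R0(1)[OF g] Y(2)])
      also have "\<dots> = lag_vec (- (\<i> / 2) *\<^sub>C (y - e) + (1/2) *\<^sub>C (- \<i> *\<^sub>C e))
          ((\<i> / 2) *\<^sub>C uQ (y - e) + (1/2) *\<^sub>C uQ (- \<i> *\<^sub>C e))"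
        unfolding R0(7)[OF g] Y(4) lag_vec_add Ysg half ..
      finally have \<Gamma>f: "\<Gamma> f = lag_vec (- (\<i> / 2) *\<^sub>C (y - e) + (1/2) *\<^sub>C (- \<i> *\<^sub>C e))
          ((\<i> / 2) *\<^sub>C uQ (y - e) + (1/2) *\<^sub>C uQ (- \<i> *\<^sub>C e))" .
      have p1: "- (\<i> / 2) *\<^sub>C (y - e) + (1/2) *\<^sub>C (- \<i> *\<^sub>C e) = - (\<i> / 2) *\<^sub>C y"
        by (simp add: scaleC_scaleC scaleC_diff_right)
      have "(1/2) *\<^sub>C uQ (- \<i> *\<^sub>C e) = - ((\<i> / 2) *\<^sub>C uQ e)"
        by (simp add: clinear_scaleC[OF cuQ] blinfun.minus_right scaleC_scaleC)
      then have "(\<i> / 2) *\<^sub>C uQ (y - e) + (1/2) *\<^sub>C uQ (- \<i> *\<^sub>C e) = (\<i> / 2) *\<^sub>C (uQ (y - e) - uQ e)"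
        by (simp add: scaleC_diff_right)
      also have "\<dots> = (\<i> / 2) *\<^sub>C uQ (y - (e + e))"
        by (simp only: blinfun.diff_right[symmetric] diff_diff_eq)
      also have "\<dots> = (\<i> / 2) *\<^sub>C uQ (u y)"
        by (simp add: e2)
      also have "\<dots> = lagrangian_map (L x) (- (\<i> / 2) *\<^sub>C y)"
        by (simp add: uQu clinear_scaleC[OF cL] blinfun.minus_right)
      finally show ?thesis
        unfolding \<Gamma>f p1 by (simp only: lag_vec_mem_lagrangian[OF Lx[OF x]])
    qed
    then have fL: "f \<in> {f \<in> dom. \<Gamma> f \<in> L x}"
      using fdom by simp
    have "inv_into {f \<in> dom. \<Gamma> f \<in> L x} (\<lambda>f. D f + \<i> *\<^sub>C f) w = f"
      by (rule inv_into_f_eq[OF realization_injective[OF Lx[OF x]] fL]) (simp add: Df w_eq)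
    then have cay: "cayley {f \<in> dom. \<Gamma> f \<in> L x} D w = g - \<i> *\<^sub>C f"
      by (simp add: cayley_def Df)
    have cW: "g - \<i> *\<^sub>C f \<in> W"
      by (intro csubspace_diff csubspace_scaleC W g fW)
    have base: "cayley_rel (Blinfun A) (Blinfun Y') (Blinfun B') (Blinfun Ys') u (\<phi> (w, 0)) = \<phi> (g - \<i> *\<^sub>C f, 0)"
      using cayley_rel_apply_den[OF data u, of z] unfolding z num .
    \<comment> \<open>On the auxiliary summand \<open>A\<close> and \<open>Ys\<close> vanish, so
      numerator and denominator agree and the transform is 1.\<close>
    have fix_snd: "cayley_rel (Blinfun A) (Blinfun Y') (Blinfun B') (Blinfun Ys') u (\<phi> (0, k)) = \<phi> (0, k)" for k
    proof -
      have W0: "0 \<in> W"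
        by (rule csubspace_0[OF W])
      have y0: "Ys' (\<phi> (0, k)) = 0"
        by (simp add: Ys'_def fst_\<psi>[OF W0] clinear_zero[OF Ys(1)])
      have G0: "rel_value (Blinfun B') (Blinfun Ys') u (\<phi> (0, k)) = \<phi> (0, k)"
        by (simp add: rel_value_apply bB bYs y0 clinear_zero[OF cE] clinear_zero[OF cB'])
      have "\<phi> (0, 0) = 0"
        using \<phi>_scale[OF W0, of 0 0] by simp
      moreover have "R\<^sub>0 0 = 0"
        using R0(4)[OF W0, of 0] by simp
      ultimately have A0: "A (\<phi> (0, k)) = 0"
        by (simp add: A_def fst_\<psi>[OF W0])
      have "cayley_den (Blinfun A) (Blinfun Y') (Blinfun B') (Blinfun Ys') u (\<phi> (0, k)) = \<phi> (0, k)"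
        "cayley_num (Blinfun A) (Blinfun Y') (Blinfun B') (Blinfun Ys') u (\<phi> (0, k)) = \<phi> (0, k)"
        by (simp_all add: cayley_den_apply[OF data u] cayley_num_apply[OF data u] G0 bA bY bYs y0 A0
            clinear_zero[OF cE] clinear_zero[OF cY'])
      then show ?thesis
        using cayley_rel_apply_den[OF data u, of "\<phi> (0, k)"] by simp
    qed
    show "cayley {f \<in> dom. \<Gamma> f \<in> L x} D w \<in> W \<and>
      (\<forall>k. blinfun_apply (cayley_rel (Blinfun A) (Blinfun Y') (Blinfun B') (Blinfun Ys') (- v o\<^sub>L lagrangian_map (L x))) (\<phi> (w, k)) =
        \<phi> (cayley {f \<in> dom. \<Gamma> f \<in> L x} D w, k))"
      unfolding cay u_def[symmetric]
    proof (intro conjI allI cW)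
      fix k
      have "\<phi> (w, k) = \<phi> (w, 0) + \<phi> (0, k)" "\<phi> (g - \<i> *\<^sub>C f, k) = \<phi> (g - \<i> *\<^sub>C f, 0) + \<phi> (0, k)"
        using \<phi>_add[OF w csubspace_0[OF W], of 0 k] \<phi>_add[OF cW csubspace_0[OF W], of 0 k] by simp_all
      then show "cayley_rel (Blinfun A) (Blinfun Y') (Blinfun B') (Blinfun Ys') u (\<phi> (w, k)) = \<phi> (g - \<i> *\<^sub>C f, k)"
        by (simp only: blinfun.add_right base fix_snd)
    qed
  qed
qed

end

section \<open>Square integrable functions on an interval\<close>

lemma sigma_finite_lebesgue: "sigma_finite_measure (lebesgue :: real measure)"
proof
  obtain A :: "real set set" where A: "countable A" "A \<subseteq> sets lborel" "\<Union>A = space lborel" "\<forall>a\<in>A. emeasure lborel a \<noteq> \<infinity>"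
    using lborel.sigma_finite_countable by blast
  then show "\<exists>A::real set set. countable A \<and> A \<subseteq> sets lebesgue \<and> \<Union>A = space lebesgue \<and> (\<forall>a\<in>A. emeasure lebesgue a \<noteq> \<infinity>)"
    by (intro exI[of _ A]) auto
qed

text \<open>Half-lines form a generator of the Borel sets that is stable under intersection, so the
  integrals vanish over all Borel sets. A Lebesgue set differs from a Borel set by a null set, and
  \<open>density_zero\<close> concludes.\<close>

lemma AE_zero_if_integrals_atMost_zero:
  fixes g :: "real \<Rightarrow> complex"
  assumes g: "integrable lebesgue g" and total: "(LINT t|lebesgue. g t) = 0"
    and atMost: "\<And>a. (LINT t:{..a}|lebesgue. g t) = 0"
  shows "AE t in lebesgue. g t = 0"
proof -
  interpret sigma_finite_measure "lebesgue :: real measure"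
    by (rule sigma_finite_lebesgue)
  have si: "set_integrable lebesgue A g" if "A \<in> sets lebesgue" for A
    unfolding set_integrable_def using g that by (rule integrable_mult_indicator[rotated])
  have borel: "(LINT t:A|lebesgue. g t) = 0" if "A \<in> sets borel" for A
  proof -
    have "A \<in> sigma_sets UNIV (range (\<lambda>a::real. {..a}))"
      using that unfolding borel_eq_atMost by simp
    have "Int_stable (range (\<lambda>a::real. {..a}))" "range (\<lambda>a::real. {..a}) \<subseteq> Pow UNIV"
      by (auto simp: Int_stable_def)
    from this \<open>A \<in> sigma_sets UNIV (range (\<lambda>a::real. {..a}))\<close> show ?thesis
    proof (induction rule: sigma_sets_induct_disjoint)
      case (basic A)
      then show ?case using atMost by auto
    next
      case empty
      show ?case by (simp add: set_lebesgue_integral_def)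
    next
      case (compl A)
      then have A: "A \<in> sets lebesgue"
        by (simp add: borel_eq_atMost)
      have A': "UNIV - A \<in> sets lebesgue"
        using sets.compl_sets[OF A] by simp
      have "(LINT t:((UNIV - A) \<union> A)|lebesgue. g t) = (LINT t:(UNIV - A)|lebesgue. g t) + (LINT t:A|lebesgue. g t)"
        by (rule set_integral_Un[OF _ si[OF A'] si[OF A]]) blast
      then show ?case
        using compl total by (simp add: set_lebesgue_integral_def)
    next
      case (union A)
      then have A: "A i \<in> sets lebesgue" for i
        by (auto simp: borel_eq_atMost image_subset_iff)
      have "(LINT t:(\<Union>i. A i)|lebesgue. g t) = (\<Sum>i. (LINT t:A i|lebesgue. g t))"
        using union(1) A by (intro lebesgue_integral_countable_add si sets.countable_UN) (auto simp: disjoint_family_on_def)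
      then show ?case
        using union by simp
    qed
  qed
  show ?thesis
  proof (rule density_zero[OF g])
    fix A :: "real set" assume A: "A \<in> sets lebesgue"
    then obtain S N N' where S: "A = S \<union> N" "N \<subseteq> N'" "N' \<in> null_sets lborel" "S \<in> sets lborel"
      by (rule sets_completionE)
    have "N' \<in> null_sets lebesgue"
      using S(3) by (rule null_sets_completionI)
    then have "AE t in lebesgue. t \<notin> N'"
      by (rule AE_not_in)
    then have "AE t in lebesgue. (t \<in> A) = (t \<in> S)"
      using S(1,2) by (auto elim!: eventually_mono)
    then have "(LINT t:A|lebesgue. g t) = (LINT t:S|lebesgue. g t)"
      using A S(4) g unfolding set_lebesgue_integral_def
      by (intro integral_cong_AE borel_measurable_integrable integrable_mult_indicator)
        (auto elim!: eventually_mono simp: indicator_def)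
    then show "(LINT t:A|lebesgue. g t) = 0"
      using borel S(4) by simp
  qed
qed

lemma l2_eqI: "(AE t in lebesgue. rep_l2 f t = rep_l2 g t) \<Longrightarrow> f = g"
  using Quotient3_rel_abs[OF Quotient3_l2, of "rep_l2 f" "rep_l2 g"] by simp

lemma rep_l2_add: "AE t in lebesgue. rep_l2 (f + g) t = rep_l2 f t + rep_l2 g t"
proof -
  have "abs_l2 (rep_l2 f) + abs_l2 (rep_l2 g) = abs_l2 (\<lambda>t. rep_l2 f t + rep_l2 g t)"
    by (simp add: plus_l2.abs_eq del: abs_rep_l2)
  then show ?thesis
    using rep_abs_l2[OF sq_integrable_add[OF rep_l2_sq_integrable rep_l2_sq_integrable], of f g] by simp
qed

lemma rep_l2_scaleC: "AE t in lebesgue. rep_l2 (c *\<^sub>C f) t = c * rep_l2 f t"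
proof -
  have "c *\<^sub>C abs_l2 (rep_l2 f) = abs_l2 (\<lambda>t. c * rep_l2 f t)"
    by (simp add: scaleC_l2.abs_eq del: abs_rep_l2)
  then show ?thesis
    using rep_abs_l2[OF sq_integrable_mult[OF rep_l2_sq_integrable], of c f] by simp
qed

lemma rep_l2_zero: "AE t in lebesgue. rep_l2 0 t = 0"
  using rep_abs_l2[OF sq_integrable_zero] by (simp add: zero_l2_def)

definition restr :: "real \<Rightarrow> (real \<Rightarrow> complex) \<Rightarrow> real \<Rightarrow> complex" where
  "restr l u t = (if t \<in> {0..l} then u t else 0)"

lemma restr_indicator: "restr l u = (\<lambda>t. indicator {0..l} t *\<^sub>R u t)"
  by (auto simp: restr_def fun_eq_iff)

lemma restr_measurable_cont: "continuous_on {0..l} u \<Longrightarrow> restr l u \<in> borel_measurable lebesgue"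
  unfolding restr_indicator
  using borel_measurable_continuous_on_indicator[of "{0..l}" u] by (intro measurable_completion) simp

lemma sq_integrable_restr:
  assumes "restr l u \<in> borel_measurable lebesgue" "integrable lebesgue (\<lambda>t. (cmod (restr l u t))\<^sup>2)"
  shows "sq_integrable (restr l u)"
  using assms by (simp add: sq_integrable_def)

lemma sq_integrable_cont:
  assumes u: "continuous_on {0..l} u"
  shows "sq_integrable (restr l u)"
proof (rule sq_integrable_restr[OF restr_measurable_cont[OF u]])
  have "set_integrable lborel {0..l} (\<lambda>t. (cmod (u t))\<^sup>2)"
    by (rule borel_integrable_atLeastAtMost') (intro continuous_intros u)
  then have "integrable lebesgue (\<lambda>t. indicator {0..l} t *\<^sub>R (cmod (u t))\<^sup>2)"
    unfolding set_integrable_def by (subst integrable_completion) auto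
  then show "integrable lebesgue (\<lambda>t. (cmod (restr l u t))\<^sup>2)"
    by (rule back_subst[of "integrable lebesgue"]) (auto simp: restr_def fun_eq_iff)
qed

definition l2_cut :: "real \<Rightarrow> (real \<Rightarrow> complex) \<Rightarrow> l2" where
  "l2_cut l u = abs_l2 (restr l u)"

lemma rep_l2_cut: "continuous_on {0..l} u \<Longrightarrow> AE t in lebesgue. rep_l2 (l2_cut l u) t = restr l u t"
  unfolding l2_cut_def by (intro rep_abs_l2 sq_integrable_cont)

lemma cinner_l2_cut:
  assumes u: "continuous_on {0..l} u"
  shows "cinner h (l2_cut l u) = (LINT t|lebesgue. restr l (\<lambda>t. rep_l2 h t * cnj (u t)) t)"
  unfolding cinner_l2.rep_eq
proof (rule integral_cong_AE)
  show "AE t in lebesgue. rep_l2 h t * cnj (rep_l2 (l2_cut l u) t) = restr l (\<lambda>t. rep_l2 h t * cnj (u t)) t"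
    using rep_l2_cut[OF u] by eventually_elim (simp add: restr_def)
  have "restr l (\<lambda>t. rep_l2 h t * cnj (u t)) = (\<lambda>t. rep_l2 h t * cnj (restr l u t))"
    by (auto simp: restr_def fun_eq_iff)
  then show "restr l (\<lambda>t. rep_l2 h t * cnj (u t)) \<in> borel_measurable lebesgue"
    using restr_measurable_cont[OF u] by simp
qed simp

lemma integrable_l2_cut:
  assumes u: "continuous_on {0..l} u"
  shows "integrable lebesgue (restr l (\<lambda>t. rep_l2 h t * cnj (u t)))"
proof -
  have "restr l (\<lambda>t. rep_l2 h t * cnj (u t)) = (\<lambda>t. rep_l2 h t * cnj (restr l u t))"
    by (auto simp: restr_def fun_eq_iff)
  then show ?thesis
    using sq_integrable_cnj_mult[OF rep_l2_sq_integrable sq_integrable_cont[OF u], of h] by simp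
qed

definition l2_ind :: "real \<Rightarrow> l2" where
  "l2_ind t = l2_cut t (\<lambda>_. 1)"

text \<open>The integral of \<open>h\<close> from 0 to \<open>t\<close>, written as a scalar product
  with an indicator function. Its bounds and its continuity in \<open>t\<close> thus reduce to
  Cauchy-Schwarz in L^2.\<close>

definition l2_prim :: "l2 \<Rightarrow> real \<Rightarrow> complex" where
  "l2_prim h t = cinner h (l2_ind t)"

lemma l2_prim_integral: "l2_prim h t = (LINT s|lebesgue. restr t (rep_l2 h) s)"
  unfolding l2_prim_def l2_ind_def by (subst cinner_l2_cut) simp_all

lemma integrable_restr_rep: "integrable lebesgue (restr t (rep_l2 h))"
  using integrable_l2_cut[of t "\<lambda>_. 1" h] by simp

lemma cinner_l2_ind:
  assumes "0 \<le> s" "s \<le> t"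
  shows "cinner (l2_ind s) (l2_ind t) = complex_of_real s"
proof -
  have "cinner (l2_ind s) (l2_ind t) = (LINT r|lebesgue. restr t (\<lambda>r. rep_l2 (l2_ind s) r * cnj 1) r)"
    unfolding l2_ind_def by (rule cinner_l2_cut) simp
  also have "\<dots> = (LINT r|lebesgue. indicator {0..s} r *\<^sub>R (1::complex))"
  proof (rule integral_cong_AE)
    have "AE r in lebesgue. rep_l2 (l2_ind s) r = restr s (\<lambda>_. 1) r"
      unfolding l2_ind_def by (rule rep_l2_cut) simp
    then show "AE r in lebesgue. restr t (\<lambda>r. rep_l2 (l2_ind s) r * cnj 1) r = indicator {0..s} r *\<^sub>R (1::complex)"
      by eventually_elim (use assms in \<open>auto simp: restr_def\<close>)
    show "(\<lambda>r. indicator {0..s} r *\<^sub>R (1::complex)) \<in> borel_measurable lebesgue"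
      using restr_measurable_cont[of s "\<lambda>_. 1"] by (simp add: restr_indicator)
  qed (use integrable_restr_rep[of t "l2_ind s"] in \<open>auto intro: borel_measurable_integrable\<close>)
  also have "\<dots> = complex_of_real s"
    using assms by (simp add: scaleR_conv_of_real)
  finally show ?thesis .
qed

text \<open>This is the source of the Hoelder continuity with exponent 1/2 of primitives of L^2
  functions.\<close>

lemma norm_l2_ind_diff:
  assumes "0 \<le> s" "0 \<le> t"
  shows "(norm (l2_ind t - l2_ind s))\<^sup>2 = \<bar>t - s\<bar>"
proof -
  have *: "(norm (l2_ind t - l2_ind s))\<^sup>2 = t - s" if "0 \<le> s" "s \<le> t" for s t
  proof -
    have "inner (l2_ind t) (l2_ind t) = t" "inner (l2_ind s) (l2_ind s) = s" "inner (l2_ind s) (l2_ind t) = s"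
      using cinner_l2_ind[of t t] cinner_l2_ind[of s s] cinner_l2_ind[of s t] that by (simp_all add: inner_cinner)
    then show ?thesis
      by (simp add: power2_norm_eq_inner inner_diff_left inner_diff_right inner_commute)
  qed
  show ?thesis
  proof (cases "s \<le> t")
    case True
    then show ?thesis using *[of s t] assms by simp
  next
    case False
    then show ?thesis using *[of t s] assms by (simp add: norm_minus_commute)
  qed
qed

lemma norm_l2_ind: "0 \<le> t \<Longrightarrow> norm (l2_ind t) = sqrt t"
  using cinner_l2_ind[of t t] by (simp add: norm_eq_sqrt_inner inner_cinner)

lemma L2_interval_l2_cut: "continuous_on {0..l} u \<Longrightarrow> l2_cut l u \<in> L2_interval l"
  unfolding L2_interval_def mem_Collect_eq
  using rep_l2_cut[of l u] by (auto elim!: eventually_mono simp: restr_def)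

lemma L2_interval_ind_total:
  assumes f: "f \<in> L2_interval l" and l: "0 < l" and prim: "\<And>t. t \<in> {0..l} \<Longrightarrow> l2_prim f t = 0"
  shows "f = 0"
proof (rule l2_eqI)
  have eq: "AE t in lebesgue. rep_l2 f t = restr l (rep_l2 f) t"
    using f unfolding L2_interval_def by (auto elim!: eventually_mono simp: restr_def)
  have "AE t in lebesgue. restr l (rep_l2 f) t = 0"
  proof (rule AE_zero_if_integrals_atMost_zero)
    show "integrable lebesgue (restr l (rep_l2 f))"
      by (rule integrable_restr_rep)
    show "(LINT t|lebesgue. restr l (rep_l2 f) t) = 0"
      using prim[of l] l by (simp add: l2_prim_integral)
    show "(LINT t:{..a}|lebesgue. restr l (rep_l2 f) t) = 0" for a
    proof (cases "a < 0")
      case True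
      then have "(\<lambda>t. indicator {..a} t *\<^sub>R restr l (rep_l2 f) t) = (\<lambda>t. 0)"
        by (auto simp: fun_eq_iff restr_def indicator_def)
      then show ?thesis
        by (simp add: set_lebesgue_integral_def)
    next
      case False
      then have "(\<lambda>t. indicator {..a} t *\<^sub>R restr l (rep_l2 f) t) = restr (min a l) (rep_l2 f)"
        by (auto simp: fun_eq_iff restr_def indicator_def)
      then show ?thesis
        using prim[of "min a l"] False l by (simp add: set_lebesgue_integral_def l2_prim_integral)
    qed
  qed
  then show "AE t in lebesgue. rep_l2 f t = rep_l2 0 t"
    using eq rep_l2_zero by eventually_elim simp
qed

lemma L2_interval_csubspace: "csubspace (L2_interval l)"
  unfolding csubspace_def
proof (intro conjI ballI allI)
  show "0 \<in> L2_interval l"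
    using rep_l2_zero by (auto simp: L2_interval_def elim!: eventually_mono)
  show "x + y \<in> L2_interval l" if "x \<in> L2_interval l" "y \<in> L2_interval l" for x y
  proof -
    have "AE t in lebesgue. t \<notin> {0..l} \<longrightarrow> rep_l2 x t = 0" "AE t in lebesgue. t \<notin> {0..l} \<longrightarrow> rep_l2 y t = 0"
      using that by (simp_all add: L2_interval_def)
    then have "AE t in lebesgue. t \<notin> {0..l} \<longrightarrow> rep_l2 (x + y) t = 0"
      using rep_l2_add[of x y] by eventually_elim simp
    then show ?thesis
      by (simp add: L2_interval_def)
  qed
  show "c *\<^sub>C x \<in> L2_interval l" if "x \<in> L2_interval l" for c x
  proof -
    have "AE t in lebesgue. t \<notin> {0..l} \<longrightarrow> rep_l2 x t = 0"
      using that by (simp add: L2_interval_def)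
    then have "AE t in lebesgue. t \<notin> {0..l} \<longrightarrow> rep_l2 (c *\<^sub>C x) t = 0"
      using rep_l2_scaleC[of c x] by eventually_elim simp
    then show ?thesis
      by (simp add: L2_interval_def)
  qed
qed

section \<open>Multiplication by bounded functions\<close>

definition l2_mult :: "(real \<Rightarrow> real) \<Rightarrow> l2 \<Rightarrow> l2" where
  "l2_mult m f = abs_l2 (\<lambda>t. complex_of_real (m t) * rep_l2 f t)"

lemma norm_l2_le:
  assumes "AE t in lebesgue. cmod (rep_l2 f t) \<le> C * cmod (rep_l2 g t)" and C: "0 \<le> C"
  shows "norm f \<le> C * norm g"
proof -
  have "ennreal ((norm f)\<^sup>2) \<le> (\<integral>\<^sup>+ t. ennreal (C\<^sup>2) * ennreal ((cmod (rep_l2 g t))\<^sup>2) \<partial>lebesgue)"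
    unfolding norm_l2_nn_integral[symmetric]
  proof (rule nn_integral_mono_AE)
    show "AE t in lebesgue. ennreal ((cmod (rep_l2 f t))\<^sup>2) \<le> ennreal (C\<^sup>2) * ennreal ((cmod (rep_l2 g t))\<^sup>2)"
      using assms(1)
    proof eventually_elim
      case (elim t)
      have "(cmod (rep_l2 f t))\<^sup>2 \<le> (C * cmod (rep_l2 g t))\<^sup>2"
        using elim by (intro power_mono) auto
      then show ?case
        by (simp add: power_mult_distrib flip: ennreal_mult)
    qed
  qed
  also have "\<dots> = ennreal (C\<^sup>2) * (\<integral>\<^sup>+ t. ennreal ((cmod (rep_l2 g t))\<^sup>2) \<partial>lebesgue)"
    by (rule nn_integral_cmult) measurable
  also have "\<dots> = ennreal ((C * norm g)\<^sup>2)"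
    by (simp add: norm_l2_nn_integral power_mult_distrib ennreal_mult)
  finally have "(norm f)\<^sup>2 \<le> (C * norm g)\<^sup>2"
    by simp
  then show ?thesis
    by (rule power2_le_imp_le) (use C in auto)
qed

lemma sq_integrable_l2_mult:
  assumes m: "m \<in> borel_measurable borel" "\<And>t. \<bar>m t\<bar> \<le> C"
  shows "sq_integrable (\<lambda>t. complex_of_real (m t) * rep_l2 f t)"
proof -
  have [measurable]: "m \<in> borel_measurable lebesgue"
    using m(1) by (intro measurable_completion) simp
  have "integrable lebesgue (\<lambda>t. C\<^sup>2 * (cmod (rep_l2 f t))\<^sup>2)"
    using rep_l2_sq_integrable[of f] by (simp add: sq_integrable_def)
  then have "integrable lebesgue (\<lambda>t. (cmod (complex_of_real (m t) * rep_l2 f t))\<^sup>2)"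
  proof (rule Bochner_Integration.integrable_bound)
    show "AE t in lebesgue. norm ((cmod (complex_of_real (m t) * rep_l2 f t))\<^sup>2) \<le> norm (C\<^sup>2 * (cmod (rep_l2 f t))\<^sup>2)"
    proof (rule AE_I2)
      fix t
      have "(m t)\<^sup>2 \<le> C\<^sup>2"
        using m(2)[of t] by (metis abs_ge_zero power2_abs power_mono)
      then show "norm ((cmod (complex_of_real (m t) * rep_l2 f t))\<^sup>2) \<le> norm (C\<^sup>2 * (cmod (rep_l2 f t))\<^sup>2)"
        by (simp add: norm_mult power_mult_distrib mult_right_mono)
    qed
  qed simp
  then show ?thesis
    by (simp add: sq_integrable_def)
qed

context
  fixes m :: "real \<Rightarrow> real" and C :: real
  assumes m: "m \<in> borel_measurable borel" "\<And>t. \<bar>m t\<bar> \<le> C"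
begin

lemma rep_l2_mult: "AE t in lebesgue. rep_l2 (l2_mult m f) t = complex_of_real (m t) * rep_l2 f t"
  unfolding l2_mult_def by (rule rep_abs_l2[OF sq_integrable_l2_mult[OF m]])

lemma norm_l2_mult: "norm (l2_mult m f) \<le> C * norm f"
proof (rule norm_l2_le)
  show "AE t in lebesgue. cmod (rep_l2 (l2_mult m f) t) \<le> C * cmod (rep_l2 f t)"
    using rep_l2_mult[of f] by eventually_elim (simp add: norm_mult mult_right_mono m(2))
  show "0 \<le> C"
    using m(2)[of 0] by linarith
qed

lemma clinear_l2_mult: "clinear (l2_mult m)"
proof (rule clinearI)
  show "l2_mult m (f + g) = l2_mult m f + l2_mult m g" for f g
    by (rule l2_eqI, use rep_l2_mult[of "f + g"] rep_l2_mult[of f] rep_l2_mult[of g] rep_l2_add[of f g]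
        rep_l2_add[of "l2_mult m f" "l2_mult m g"] in eventually_elim) (simp add: algebra_simps)
  show "l2_mult m (c *\<^sub>C f) = c *\<^sub>C l2_mult m f" for c f
    by (rule l2_eqI, use rep_l2_mult[of "c *\<^sub>C f"] rep_l2_mult[of f] rep_l2_scaleC[of c f]
        rep_l2_scaleC[of c "l2_mult m f"] in eventually_elim) simp
qed

lemma continuous_on_l2_mult: "continuous_on UNIV (l2_mult m)"
  by (intro linear_continuous_on clinear_bounded_linear[OF clinear_l2_mult, of C]) (metis norm_l2_mult mult.commute)

end

abbreviation (input) l2_restr :: "real \<Rightarrow> l2 \<Rightarrow> l2" where
  "l2_restr l \<equiv> l2_mult (indicator {0..l})"

text \<open>As the fixed point set of a continuous operator, the subspace is closed.\<close>

lemma L2_interval_iff: "f \<in> L2_interval l \<longleftrightarrow> l2_restr l f = f"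
proof -
  have m: "indicator {0..l} \<in> borel_measurable (borel :: real measure)" "\<And>t. \<bar>indicator {0..l} t :: real\<bar> \<le> 1"
    by (auto simp: indicator_def)
  note rep = rep_l2_mult[OF m, of f]
  show ?thesis
  proof
    assume "f \<in> L2_interval l"
    then have supp: "AE t in lebesgue. t \<notin> {0..l} \<longrightarrow> rep_l2 f t = 0"
      by (simp add: L2_interval_def)
    have "AE t in lebesgue. rep_l2 (l2_restr l f) t = rep_l2 f t"
      using rep supp
    proof eventually_elim
      case (elim t)
      then show ?case
        by (cases "t \<in> {0..l}") simp_all
    qed
    then show "l2_restr l f = f"
      by (rule l2_eqI)
  next
    assume "l2_restr l f = f"
    then have "AE t in lebesgue. rep_l2 f t = complex_of_real (indicator {0..l} t) * rep_l2 f t"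
      using rep by simp
    then have "AE t in lebesgue. t \<notin> {0..l} \<longrightarrow> rep_l2 f t = 0"
      by eventually_elim (auto simp: indicator_def)
    then show "f \<in> L2_interval l"
      by (simp add: L2_interval_def)
  qed
qed

lemma closed_L2_interval: "closed (L2_interval l)"
proof -
  have "continuous_on UNIV (l2_restr l)"
    by (rule continuous_on_l2_mult[where C = 1]) (auto simp: indicator_def)
  then have "closed {f. l2_restr l f = f}"
    by (intro closed_Collect_eq continuous_intros)
  moreover have "L2_interval l = {f. l2_restr l f = f}"
    using L2_interval_iff by blast
  ultimately show ?thesis
    by simp
qed

subsection \<open>The Volterra operator\<close>

lemma clinear_l2_prim: "l2_prim (f + g) t = l2_prim f t + l2_prim g t" "l2_prim (c *\<^sub>C f) t = c * l2_prim f t"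
  by (simp_all add: l2_prim_def cinner_simps)

lemma l2_prim_le: "0 \<le> t \<Longrightarrow> cmod (l2_prim h t) \<le> sqrt t * norm h"
  using cinner_bound[of h "l2_ind t"] by (simp add: l2_prim_def norm_l2_ind mult.commute)

lemma continuous_on_l2_prim: "continuous_on {0..l} (l2_prim h)"
proof (cases "h = 0")
  case True
  then show ?thesis by (simp add: l2_prim_def)
next
  case False
  show ?thesis
    unfolding continuous_on_iff
  proof (intro ballI allI impI)
    fix x e :: real assume x: "x \<in> {0..l}" and e: "0 < e"
    have "dist (l2_prim h y) (l2_prim h x) < e" if y: "y \<in> {0..l}" "dist y x < (e / norm h)\<^sup>2" for y
    proof -
      have "dist (l2_prim h y) (l2_prim h x) = cmod (cinner h (l2_ind y - l2_ind x))"
        by (simp add: dist_norm l2_prim_def cinner_diff_right)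
      also have "\<dots> \<le> norm h * norm (l2_ind y - l2_ind x)"
        by (rule cinner_bound)
      also have "norm (l2_ind y - l2_ind x) = sqrt \<bar>y - x\<bar>"
        using norm_l2_ind_diff[of x y] x y(1) by (metis atLeastAtMost_iff norm_ge_zero real_sqrt_unique)
      also have "sqrt \<bar>y - x\<bar> < e / norm h"
        using y(2) e False by (intro real_less_lsqrt) (auto simp: dist_norm)
      then have "norm h * sqrt \<bar>y - x\<bar> < e"
        using False by (simp add: field_simps)
      finally show ?thesis .
    qed
    then show "\<exists>d>0. \<forall>y\<in>{0..l}. dist y x < d \<longrightarrow> dist (l2_prim h y) (l2_prim h x) < e"
      using e False by (intro exI[of _ "(e / norm h)\<^sup>2"]) auto
  qed
qed

definition volterra :: "real \<Rightarrow> l2 \<Rightarrow> l2" where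
  "volterra l h = l2_cut l (l2_prim h)"

lemma rep_volterra: "AE t in lebesgue. rep_l2 (volterra l h) t = restr l (l2_prim h) t"
  unfolding volterra_def by (rule rep_l2_cut[OF continuous_on_l2_prim])

lemma volterra_mem [simp]: "volterra l h \<in> L2_interval l"
  unfolding volterra_def by (rule L2_interval_l2_cut[OF continuous_on_l2_prim])

lemma l2_ind_mem [simp]: "l2_ind l \<in> L2_interval l"
  unfolding l2_ind_def by (rule L2_interval_l2_cut) simp

lemma rep_l2_ind: "AE t in lebesgue. rep_l2 (l2_ind l) t = restr l (\<lambda>_. 1) t"
  unfolding l2_ind_def by (rule rep_l2_cut) simp

lemma clinear_volterra: "clinear (volterra l)"
proof (rule clinearI)
  show "volterra l (f + g) = volterra l f + volterra l g" for f g
    by (rule l2_eqI, use rep_volterra[of l "f + g"] rep_volterra[of l f] rep_volterra[of l g]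
        rep_l2_add[of "volterra l f" "volterra l g"] in eventually_elim)
      (simp add: restr_def clinear_l2_prim)
  show "volterra l (c *\<^sub>C f) = c *\<^sub>C volterra l f" for c f
    by (rule l2_eqI, use rep_volterra[of l "c *\<^sub>C f"] rep_volterra[of l f]
        rep_l2_scaleC[of c "volterra l f"] in eventually_elim)
      (simp add: restr_def clinear_l2_prim)
qed

lemma norm_volterra:
  assumes l: "0 \<le> l" shows "norm (volterra l h) \<le> l * norm h"
proof -
  have "norm (volterra l h) \<le> (sqrt l * norm h) * norm (l2_ind l)"
  proof (rule norm_l2_le)
    show "AE t in lebesgue. cmod (rep_l2 (volterra l h) t) \<le> sqrt l * norm h * cmod (rep_l2 (l2_ind l) t)"
      using rep_volterra[of l h] rep_l2_ind[of l]
    proof eventually_elim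
      case (elim t)
      show ?case
      proof (cases "t \<in> {0..l}")
        case True
        then have "cmod (l2_prim h t) \<le> sqrt t * norm h"
          by (intro l2_prim_le) simp
        also have "\<dots> \<le> sqrt l * norm h"
          using True by (intro mult_right_mono) auto
        finally show ?thesis
          using True elim by (simp add: restr_def)
      qed (use elim in \<open>auto simp: restr_def\<close>)
    qed
  qed (use l in simp)
  also have "\<dots> = (sqrt l * sqrt l) * norm h"
    by (simp only: norm_l2_ind[OF l] mult_ac)
  also have "\<dots> = l * norm h"
    using l by simp
  finally show ?thesis .
qed

text \<open>Integration by parts for two primitives that vanish at 0, proved by Fubini's theorem on
  the triangle s \<le> t. No differentiation is involved, so square integrable functions are
  admissible.\<close>

lemma volterra_adjoint:
  "cinner (volterra l f) g + cinner f (volterra l g) = l2_prim f l * cnj (l2_prim g l)"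
proof -
  interpret S: sigma_finite_measure "lebesgue :: real measure"
    by (rule sigma_finite_lebesgue)
  interpret P: pair_sigma_finite "lebesgue :: real measure" "lebesgue :: real measure"
    unfolding pair_sigma_finite_def by (intro conjI sigma_finite_lebesgue)
  define a where "a = restr l (rep_l2 f)"
  define b where "b t = cnj (restr l (rep_l2 g) t)" for t
  have ia: "integrable lebesgue a" and ib: "integrable lebesgue b"
    unfolding a_def b_def by (auto intro: integrable_restr_rep)
  note [measurable] = borel_measurable_integrable[OF ia] borel_measurable_integrable[OF ib]
  have [measurable]: "(\<lambda>t. t) \<in> borel_measurable (lebesgue :: real measure)"
    by (intro measurable_completion) simp
  \<comment> \<open>Integrating first over s gives the primitive of f at t, paired with g.
    Integrating first over t leaves the integral of g from s to l, a difference of two values of the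
    primitive of g.\<close>
  define H where "H s t = (if s \<le> t then a s * b t else 0)" for s t
  have H_int: "integrable (lebesgue \<Otimes>\<^sub>M lebesgue) (case_prod H)"
  proof (rule P.Fubini_integrable)
    show meas: "case_prod H \<in> borel_measurable (lebesgue \<Otimes>\<^sub>M lebesgue)"
      unfolding H_def by measurable
    have int_t: "integrable lebesgue (\<lambda>t. H s t)" for s
    proof (rule Bochner_Integration.integrable_bound)
      show "integrable lebesgue (\<lambda>t. a s * b t)"
        using ib by simp
    qed (auto simp: H_def)
    then show "AE s in lebesgue. integrable lebesgue (\<lambda>t. case_prod H (s, t))"
      by simp
    show "integrable lebesgue (\<lambda>s. LINT t|lebesgue. norm (case_prod H (s, t)))"
    proof (rule Bochner_Integration.integrable_bound)
      show "integrable lebesgue (\<lambda>s. cmod (a s) * (LINT t|lebesgue. cmod (b t)))"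
        using ia by simp
      show "(\<lambda>s. LINT t|lebesgue. norm (case_prod H (s, t))) \<in> borel_measurable lebesgue"
        using meas by measurable
      show "AE s in lebesgue. norm (LINT t|lebesgue. norm (case_prod H (s, t))) \<le> norm (cmod (a s) * (LINT t|lebesgue. cmod (b t)))"
      proof (rule AE_I2)
        fix s
        have "(LINT t|lebesgue. norm (H s t)) \<le> (LINT t|lebesgue. cmod (a s) * cmod (b t))"
          using int_t[of s] ib by (intro integral_mono) (auto simp: H_def norm_mult)
        then show "norm (LINT t|lebesgue. norm (case_prod H (s, t))) \<le> norm (cmod (a s) * (LINT t|lebesgue. cmod (b t)))"
          by (simp add: integral_nonneg_AE)
      qed
    qed
  qed
  have 1: "cinner (volterra l f) g = (LINT t|lebesgue. LINT s|lebesgue. H s t)"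
    unfolding cinner_l2.rep_eq
  proof (rule integral_cong_AE)
    have H_eq: "(LINT s|lebesgue. H s t) = restr l (l2_prim f) t * cnj (rep_l2 g t)" for t
    proof (cases "t \<in> {0..l}")
      case True
      then have "(\<lambda>s. H s t) = (\<lambda>s. restr t (rep_l2 f) s * cnj (rep_l2 g t))"
        by (auto simp: H_def a_def b_def restr_def fun_eq_iff)
      then show ?thesis
        using True by (simp add: l2_prim_integral restr_def)
    next
      case False
      then have "(\<lambda>s. H s t) = (\<lambda>s. 0)"
        by (auto simp: H_def a_def b_def restr_def fun_eq_iff)
      then show ?thesis
        using False by (auto simp: restr_def)
    qed
    show "AE t in lebesgue. rep_l2 (volterra l f) t * cnj (rep_l2 g t) = (LINT s|lebesgue. H s t)"
      using rep_volterra[of l f] by eventually_elim (simp add: H_eq)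
    show "(\<lambda>t. LINT s|lebesgue. H s t) \<in> borel_measurable lebesgue"
      unfolding H_eq using restr_measurable_cont[OF continuous_on_l2_prim] by simp
  qed simp
  have 2: "(LINT t|lebesgue. LINT s|lebesgue. H s t) = (LINT s|lebesgue. LINT t|lebesgue. H s t)"
    using H_int by (rule P.Fubini_integral)
  have 3: "(LINT t|lebesgue. H s t) = a s * cnj (l2_prim g l) - rep_l2 f s * cnj (restr l (l2_prim g) s)" for s
  proof (cases "s \<in> {0..l}")
    case True
    have "(LINT t|lebesgue. H s t) = (LINT t|lebesgue. a s * (b t - cnj (restr s (rep_l2 g) t)))"
    proof (rule integral_cong_AE)
      \<comment> \<open>The diagonal point is excluded because \<open>H\<close> includes it and the
        right-hand side does not.\<close>
      have "AE t in lebesgue. t \<noteq> s"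
        by (rule AE_completion) (rule AE_lborel_singleton)
      then show "AE t in lebesgue. H s t = a s * (b t - cnj (restr s (rep_l2 g) t))"
        by eventually_elim (use True in \<open>auto simp: H_def b_def restr_def\<close>)
      show "(\<lambda>t. a s * (b t - cnj (restr s (rep_l2 g) t))) \<in> borel_measurable lebesgue"
        using borel_measurable_integrable[OF integrable_restr_rep[of s g]] by measurable
    qed (unfold H_def, measurable)
    also have "\<dots> = a s * ((LINT t|lebesgue. b t) - (LINT t|lebesgue. cnj (restr s (rep_l2 g) t)))"
      using ib integrable_restr_rep[of s g] by simp
    also have "\<dots> = a s * (cnj (l2_prim g l) - cnj (l2_prim g s))"
      by (simp add: b_def l2_prim_integral)
    finally show ?thesis
      using True by (simp add: a_def restr_def algebra_simps)
  next
    case False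
    then have "a s = 0"
      by (auto simp: a_def restr_def)
    then have "(\<lambda>t. H s t) = (\<lambda>t. 0)"
      by (auto simp: H_def)
    then show ?thesis
      using False \<open>a s = 0\<close> by (auto simp: restr_def)
  qed
  have 4: "cinner f (volterra l g) = (LINT s|lebesgue. rep_l2 f s * cnj (restr l (l2_prim g) s))"
    unfolding volterra_def cinner_l2_cut[OF continuous_on_l2_prim]
    by (intro arg_cong[where f = "integral\<^sup>L lebesgue"]) (auto simp: restr_def fun_eq_iff)
  have i4: "integrable lebesgue (\<lambda>s. rep_l2 f s * cnj (restr l (l2_prim g) s))"
    by (intro sq_integrable_cnj_mult rep_l2_sq_integrable sq_integrable_cont continuous_on_l2_prim)
  have "(LINT s|lebesgue. LINT t|lebesgue. H s t) = l2_prim f l * cnj (l2_prim g l) - cinner f (volterra l g)"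
    unfolding 3 4 using ia i4 by (simp add: a_def l2_prim_integral)
  then show ?thesis
    using 1 2 by simp
qed

subsection \<open>Sobolev spaces\<close>

lemma l2_prim_0 [simp]: "l2_prim h 0 = 0"
  using l2_prim_le[of 0 h] by simp

lemma l2_prim_ind:
  assumes "0 \<le> t" "t \<le> l" shows "l2_prim (l2_ind l) t = complex_of_real t"
  using cinner_l2_ind[OF assms] cinner_commute[of "l2_ind l" "l2_ind t"] by (simp add: l2_prim_def)

text \<open>In the open interval the set where the functions differ is open and negligible, hence
  empty; the end points follow by continuity. This makes \<open>value_at\<close> well defined up to
  the boundary.\<close>

lemma continuous_AE_eq:
  fixes u v :: "real \<Rightarrow> complex"
  assumes u: "continuous_on {0..l} u" and v: "continuous_on {0..l} v" and l: "0 < l"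
    and ae: "AE t in lebesgue. t \<in> {0..l} \<longrightarrow> u t = v t" and t: "t \<in> {0..l}"
  shows "u t = v t"
proof -
  define w where "w t = u t - v t" for t
  have w: "continuous_on {0..l} w"
    unfolding w_def by (intro continuous_intros u v)
  define S where "S = {0<..<l} \<inter> w -` (- {0})"
  have "open S"
    unfolding S_def
    by (rule continuous_open_preimage[OF continuous_on_subset[OF w]]) auto
  obtain N where N: "{t \<in> space lebesgue. \<not> (t \<in> {0..l} \<longrightarrow> u t = v t)} \<subseteq> N" "N \<in> null_sets lebesgue"
    using ae by (auto simp: eventually_ae_filter)
  have "S \<subseteq> N"
  proof
    fix x assume "x \<in> S"
    then have "x \<in> {t \<in> space lebesgue. \<not> (t \<in> {0..l} \<longrightarrow> u t = v t)}"
      by (auto simp: S_def w_def)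
    then show "x \<in> N"
      using N(1) by blast
  qed
  then have "negligible S"
    using N(2) negligible_iff_null_sets negligible_subset by blast
  then have "S = {}"
    using \<open>open S\<close> open_not_negligible by blast
  then have zero: "w x = 0" if "x \<in> {0<..<l}" for x
    using that by (auto simp: S_def)
  have cl: "closure {0<..<l} = {0..l}"
    using l by simp
  have "w t = 0"
    by (rule continuous_constant_on_closure[of "{0<..<l}" w]) (use w zero t cl in auto)
  then show ?thesis
    by (simp add: w_def)
qed

lemma value_at_eqI:
  assumes l: "0 < l" and u: "continuous_on {0..l} u" and ae: "AE t in lebesgue. rep_l2 f t = restr l u t" and t: "t \<in> {0..l}"
  shows "value_at l f t = u t"
  unfolding value_at_def
proof (rule the_equality)
  have ae': "AE s in lebesgue. s \<in> {0..l} \<longrightarrow> rep_l2 f s = u s"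
    using ae by eventually_elim (simp add: restr_def)
  then show "\<exists>v. continuous_on {0..l} v \<and> (AE s in lebesgue. s \<in> {0..l} \<longrightarrow> rep_l2 f s = v s) \<and> v t = u t"
    using u by blast
  fix c assume "\<exists>v. continuous_on {0..l} v \<and> (AE s in lebesgue. s \<in> {0..l} \<longrightarrow> rep_l2 f s = v s) \<and> v t = c"
  then obtain v where v: "continuous_on {0..l} v" "AE s in lebesgue. s \<in> {0..l} \<longrightarrow> rep_l2 f s = v s" "v t = c"
    by blast
  have "AE s in lebesgue. s \<in> {0..l} \<longrightarrow> v s = u s"
    using ae' v(2) by eventually_elim auto
  then show "c = u t"
    using continuous_AE_eq[OF v(1) u l _ t] v(3) by simp
qed

text \<open>Normal form of an H^1 function: \<open>a\<close> is its value at 0 and \<open>g\<close>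
  its weak derivative.\<close>

definition antideriv :: "real \<Rightarrow> complex \<Rightarrow> l2 \<Rightarrow> l2" where
  "antideriv l a g = a *\<^sub>C l2_ind l + volterra l g"

lemma rep_antideriv: "AE t in lebesgue. rep_l2 (antideriv l a g) t = restr l (\<lambda>t. a + l2_prim g t) t"
  unfolding antideriv_def
  using rep_l2_add[of "a *\<^sub>C l2_ind l" "volterra l g"] rep_l2_scaleC[of a "l2_ind l"] rep_volterra[of l g] rep_l2_ind[of l]
  by eventually_elim (simp add: restr_def)

lemma antideriv_mem: "antideriv l a g \<in> L2_interval l"
  unfolding antideriv_def by (intro csubspace_add csubspace_scaleC L2_interval_csubspace volterra_mem l2_ind_mem)

lemma antideriv_add: "antideriv l a f + antideriv l b g = antideriv l (a + b) (f + g)"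
  by (simp add: antideriv_def clinear_add[OF clinear_volterra] scaleC_add_left)

lemma antideriv_scaleC: "c *\<^sub>C antideriv l a f = antideriv l (c * a) (c *\<^sub>C f)"
  by (simp add: antideriv_def clinear_scaleC[OF clinear_volterra] scaleC_add_right scaleC_scaleC)

lemma value_at_antideriv:
  assumes "0 < l" "t \<in> {0..l}"
  shows "value_at l (antideriv l a g) t = a + l2_prim g t"
  by (rule value_at_eqI[OF assms(1) _ rep_antideriv assms(2)]) (intro continuous_intros continuous_on_l2_prim)

lemma antideriv_inject:
  assumes l: "0 < l" and g: "g \<in> L2_interval l" "h \<in> L2_interval l" and eq: "antideriv l a g = antideriv l b h"
  shows "a = b" "g = h"
proof -
  have v: "a + l2_prim g t = b + l2_prim h t" if "t \<in> {0..l}" for t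
    using value_at_antideriv[OF l that, of a g] value_at_antideriv[OF l that, of b h] eq by simp
  show "a = b"
    using v[of 0] l by simp
  have "g - h = 0"
  proof (rule L2_interval_ind_total[OF _ l])
    show "g - h \<in> L2_interval l"
      by (rule csubspace_diff[OF L2_interval_csubspace g])
    show "l2_prim (g - h) t = 0" if "t \<in> {0..l}" for t
      using v[OF that] \<open>a = b\<close> by (simp add: l2_prim_def cinner_diff_left)
  qed
  then show "g = h"
    by simp
qed

lemma set_integral_cinner_cut:
  assumes "continuous_on UNIV \<psi>"
  shows "(LINT t:{0..l}|lebesgue. rep_l2 f t * complex_of_real (\<psi> t)) = cinner f (l2_cut l (\<lambda>t. complex_of_real (\<psi> t)))"
proof -
  have "continuous_on {0..l} (\<lambda>t. complex_of_real (\<psi> t))"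
    by (intro continuous_intros continuous_on_subset[OF assms]) auto
  then have "cinner f (l2_cut l (\<lambda>t. complex_of_real (\<psi> t))) = (LINT t|lebesgue. restr l (\<lambda>t. rep_l2 f t * cnj (complex_of_real (\<psi> t))) t)"
    by (rule cinner_l2_cut)
  then show ?thesis
    by (simp add: set_lebesgue_integral_def restr_indicator)
qed

lemma l2_prim_cut_derivative:
  assumes F: "\<And>t. (F has_real_derivative \<psi> t) (at t)" and \<psi>: "continuous_on UNIV \<psi>" and t: "0 \<le> t" "t \<le> l"
  shows "l2_prim (l2_cut l (\<lambda>t. complex_of_real (\<psi> t))) t = complex_of_real (F t - F 0)"
proof -
  have cont: "continuous_on {0..l} (\<lambda>t. complex_of_real (\<psi> t))"
    by (intro continuous_intros continuous_on_subset[OF \<psi>]) auto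
  have "l2_prim (l2_cut l (\<lambda>t. complex_of_real (\<psi> t))) t = (LINT s|lebesgue. indicator {0..t} s *\<^sub>R complex_of_real (\<psi> s))"
    unfolding l2_prim_integral
  proof (rule integral_cong_AE)
    show "AE s in lebesgue. restr t (rep_l2 (l2_cut l (\<lambda>t. complex_of_real (\<psi> t)))) s = indicator {0..t} s *\<^sub>R complex_of_real (\<psi> s)"
      using rep_l2_cut[OF cont] by eventually_elim (use t in \<open>auto simp: restr_def\<close>)
    show "restr t (rep_l2 (l2_cut l (\<lambda>t. complex_of_real (\<psi> t)))) \<in> borel_measurable lebesgue"
      by (rule borel_measurable_integrable[OF integrable_restr_rep])
    have "restr t (\<lambda>t. complex_of_real (\<psi> t)) \<in> borel_measurable lebesgue"
      by (rule restr_measurable_cont) (intro continuous_intros continuous_on_subset[OF \<psi>], auto)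
    then show "(\<lambda>s. indicator {0..t} s *\<^sub>R complex_of_real (\<psi> s)) \<in> borel_measurable lebesgue"
      by (simp add: restr_indicator)
  qed
  also have "\<dots> = (LINT s|lborel. indicator {0..t} s *\<^sub>R complex_of_real (\<psi> s))"
  proof (rule integral_completion)
    show "(\<lambda>s. indicator {0..t} s *\<^sub>R complex_of_real (\<psi> s)) \<in> borel_measurable lborel"
      using borel_measurable_continuous_on_indicator[of "{0..t}" "\<lambda>t. complex_of_real (\<psi> t)"]
        continuous_on_subset[OF \<psi>, of "{0..t}"] by (simp add: continuous_on_of_real)
  qed
  also have "\<dots> = complex_of_real (F t) - complex_of_real (F 0)"
  proof (rule integral_FTC_Icc[OF t(1)])
    show "((\<lambda>t. complex_of_real (F t)) has_vector_derivative complex_of_real (\<psi> x)) (at x within {0..t})" for x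
      using F[of x] by (intro has_vector_derivative_of_real)
        (auto simp: has_real_derivative_iff_has_vector_derivative intro: has_vector_derivative_at_within)
    show "continuous_on {0..t} (\<lambda>t. complex_of_real (\<psi> t))"
      by (intro continuous_intros continuous_on_subset[OF \<psi>]) auto
  qed
  finally show ?thesis
    by simp
qed

lemma test_function_continuous:
  assumes "test_function l \<phi> \<phi>'"
  shows "continuous_on UNIV \<phi>'" "continuous_on UNIV \<phi>"
proof -
  show "continuous_on UNIV \<phi>'"
    using assms unfolding test_function_def by (elim conjE)
  have "(\<phi> has_real_derivative \<phi>' t) (at t)" for t
    using assms unfolding test_function_def by (elim conjE allE)
  then show "continuous_on UNIV \<phi>"
    by (intro continuous_at_imp_continuous_on ballI) (rule DERIV_isCont)
qed

text \<open>The primitive of \<phi>' is \<phi>, which vanishes at both ends. Hence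
  \<open>volterra_adjoint\<close> has no boundary term, and constants are orthogonal to
  \<phi>'.\<close>

lemma test_function_pairing:
  assumes l: "0 < l" and \<phi>: "test_function l \<phi> \<phi>'"
  shows "cinner (volterra l g) (l2_cut l (\<lambda>t. complex_of_real (\<phi>' t))) = - cinner g (l2_cut l (\<lambda>t. complex_of_real (\<phi> t)))"
    and "cinner (l2_ind l) (l2_cut l (\<lambda>t. complex_of_real (\<phi>' t))) = 0"
proof -
  have der: "\<And>t. (\<phi> has_real_derivative \<phi>' t) (at t)" and cont: "continuous_on UNIV \<phi>'"
    using \<phi> by (auto simp: test_function_def)
  obtain a b where "0 < a" "b < l" and z: "\<And>t. t \<notin> {a..b} \<Longrightarrow> \<phi> t = 0"
    using \<phi> unfolding test_function_def by (elim conjE exE) blast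
  then have ends: "\<phi> 0 = 0" "\<phi> l = 0"
    by auto
  have prim: "l2_prim (l2_cut l (\<lambda>t. complex_of_real (\<phi>' t))) t = complex_of_real (\<phi> t)" if "0 \<le> t" "t \<le> l" for t
    using l2_prim_cut_derivative[OF der cont that] ends by simp
  have p0: "l2_prim (l2_cut l (\<lambda>t. complex_of_real (\<phi>' t))) l = 0"
    using prim[of l] l ends by simp
  have "restr l (l2_prim (l2_cut l (\<lambda>t. complex_of_real (\<phi>' t)))) = restr l (\<lambda>t. complex_of_real (\<phi> t))"
    by (auto simp: restr_def fun_eq_iff prim)
  then have "volterra l (l2_cut l (\<lambda>t. complex_of_real (\<phi>' t))) = l2_cut l (\<lambda>t. complex_of_real (\<phi> t))"
    by (simp add: volterra_def l2_cut_def)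
  then show "cinner (volterra l g) (l2_cut l (\<lambda>t. complex_of_real (\<phi>' t))) = - cinner g (l2_cut l (\<lambda>t. complex_of_real (\<phi> t)))"
    using volterra_adjoint[of l g "l2_cut l (\<lambda>t. complex_of_real (\<phi>' t))"] by (simp add: p0 add_eq_0_iff2)
  show "cinner (l2_ind l) (l2_cut l (\<lambda>t. complex_of_real (\<phi>' t))) = 0"
    using p0 cinner_commute[of "l2_ind l"] by (simp add: l2_prim_def)
qed

lemma weak_derivative_antideriv:
  assumes l: "0 < l" and g: "g \<in> L2_interval l"
  shows "weak_derivative l (antideriv l a g) g"
  unfolding weak_derivative_def
proof (intro conjI allI impI antideriv_mem g)
  fix \<phi> \<phi>' assume \<phi>: "test_function l \<phi> \<phi>'"
  have c: "continuous_on UNIV \<phi>'" "continuous_on UNIV \<phi>"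
    by (rule test_function_continuous[OF \<phi>])+
  show "(LINT t:{0..l}|lebesgue. rep_l2 (antideriv l a g) t * complex_of_real (\<phi>' t)) =
      - (LINT t:{0..l}|lebesgue. rep_l2 g t * complex_of_real (\<phi> t))"
    unfolding set_integral_cinner_cut[OF c(1)] set_integral_cinner_cut[OF c(2)]
    by (simp add: antideriv_def cinner_add_left cinner_scaleC_left test_function_pairing[OF l \<phi>])
qed

text \<open>Continuous approximations of the indicator function of \<open>[0, s]\<close> with support in \<open>(0, s)\<close>.\<close>

definition trapezoid :: "nat \<Rightarrow> real \<Rightarrow> real \<Rightarrow> real" where
  "trapezoid n s t = max 0 (min 1 (min (real n * t - 1) (real n * (s - t) - 1)))"

lemma trapezoid_bounds: "0 \<le> trapezoid n s t" "trapezoid n s t \<le> 1"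
  by (auto simp: trapezoid_def)

lemma continuous_on_trapezoid: "continuous_on A (trapezoid n s)"
  unfolding trapezoid_def by (intro continuous_intros)

lemma trapezoid_eq_0:
  assumes "0 < n" "t \<le> 1 / real n \<or> s - 1 / real n \<le> t"
  shows "trapezoid n s t = 0"
proof -
  have "real n * t \<le> 1 \<or> real n * (s - t) \<le> 1"
    using assms by (auto simp: field_simps)
  then show ?thesis
    by (auto simp: trapezoid_def)
qed

lemma trapezoid_LIMSEQ: "t \<noteq> 0 \<Longrightarrow> t \<noteq> s \<Longrightarrow> (\<lambda>n. trapezoid n s t) \<longlonglongrightarrow> (if 0 < t \<and> t < s then 1 else 0)"
proof (cases "0 < t \<and> t < s")
  case True
  obtain N where N: "2 / t \<le> real N" "2 / (s - t) \<le> real N"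
    using real_arch_simple[of "max (2 / t) (2 / (s - t))"] by auto
  have "trapezoid n s t = 1" if "n \<ge> N" for n
  proof -
    have "2 / t \<le> real n" "2 / (s - t) \<le> real n"
      using N that by linarith+
    then have "2 \<le> real n * t" "2 \<le> real n * (s - t)"
      using True by (simp_all add: pos_divide_le_eq)
    then show ?thesis
      by (simp add: trapezoid_def)
  qed
  then show ?thesis
    using True by (intro tendsto_eventually) (auto simp: eventually_sequentially)
next
  case False
  assume ne: "t \<noteq> 0" "t \<noteq> s"
  have "trapezoid n s t = 0" for n
  proof (cases "t < 0")
    case True
    then have "real n * t \<le> 0"
      by (simp add: mult_nonneg_nonpos)
    then show ?thesis
      by (simp add: trapezoid_def)
  next
    case f: False
    then have "real n * (s - t) \<le> 0"
      using False ne by (intro mult_nonneg_nonpos) auto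
    then show ?thesis
      by (simp add: trapezoid_def)
  qed
  then show ?thesis
    using False by (simp only: if_False tendsto_const)
qed

lemma cinner_trapezoid_LIMSEQ:
  assumes s: "0 < s" "s \<le> l"
  shows "(\<lambda>n. cinner r (l2_cut l (\<lambda>t. complex_of_real (trapezoid n s t)))) \<longlonglongrightarrow> cinner r (l2_ind s)"
proof -
  have cont: "continuous_on {0..l} (\<lambda>t. complex_of_real (trapezoid n s t))" for n
    by (intro continuous_intros continuous_on_trapezoid)
  have 1: "cinner r (l2_cut l (\<lambda>t. complex_of_real (trapezoid n s t)))
      = (LINT t|lebesgue. restr l (\<lambda>t. rep_l2 r t * cnj (complex_of_real (trapezoid n s t))) t)" for n
    by (rule cinner_l2_cut[OF cont])
  have 2: "cinner r (l2_ind s) = (LINT t|lebesgue. restr s (rep_l2 r) t)"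
    using l2_prim_integral[of r s] by (simp add: l2_prim_def)
  show ?thesis
    unfolding 1 2
  proof (rule integral_dominated_convergence)
    show "restr s (rep_l2 r) \<in> borel_measurable lebesgue"
      by (rule borel_measurable_integrable[OF integrable_restr_rep])
    show "restr l (\<lambda>t. rep_l2 r t * cnj (complex_of_real (trapezoid n s t))) \<in> borel_measurable lebesgue" for n
      by (rule borel_measurable_integrable[OF integrable_l2_cut[OF cont]])
    show "integrable lebesgue (\<lambda>t. cmod (restr l (rep_l2 r) t))"
      by (intro integrable_norm integrable_restr_rep)
    have "AE t in lebesgue. t \<noteq> 0" "AE t in lebesgue. t \<noteq> s"
      by (rule AE_completion, rule AE_lborel_singleton)+
    then show "AE t in lebesgue. (\<lambda>n. restr l (\<lambda>t. rep_l2 r t * cnj (complex_of_real (trapezoid n s t))) t) \<longlonglongrightarrow> restr s (rep_l2 r) t"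
    proof eventually_elim
      case (elim t)
      have "(\<lambda>n. complex_of_real (trapezoid n s t)) \<longlonglongrightarrow> complex_of_real (if 0 < t \<and> t < s then 1 else 0)"
        by (intro tendsto_of_real trapezoid_LIMSEQ elim)
      then have "(\<lambda>n. rep_l2 r t * complex_of_real (trapezoid n s t)) \<longlonglongrightarrow> rep_l2 r t * complex_of_real (if 0 < t \<and> t < s then 1 else 0)"
        by (rule tendsto_mult_left)
      then show ?case
        using s elim by (cases "t \<le> l") (auto simp: restr_def split: if_splits)
    qed
    show "AE t in lebesgue. norm (restr l (\<lambda>t. rep_l2 r t * cnj (complex_of_real (trapezoid n s t))) t) \<le> cmod (restr l (rep_l2 r) t)" for n
    proof (rule AE_I2)
      fix t
      have "cmod (rep_l2 r t) * trapezoid n s t \<le> cmod (rep_l2 r t)"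
        using trapezoid_bounds[of n s t] by (simp add: mult_left_le)
      then show "norm (restr l (\<lambda>t. rep_l2 r t * cnj (complex_of_real (trapezoid n s t))) t) \<le> cmod (restr l (rep_l2 r) t)"
        using trapezoid_bounds[of n s t] by (simp add: restr_def norm_mult)
    qed
  qed
qed

lemma continuous_antiderivative_exists:
  fixes \<psi> :: "real \<Rightarrow> real"
  assumes "continuous_on UNIV \<psi>"
  shows "\<exists>F. \<forall>t. (F has_real_derivative \<psi> t) (at t)"
proof -
  have "isCont \<psi> t" for t
    using assms by (simp add: continuous_on_eq_continuous_at)
  then have "\<exists>F. \<forall>x. (-\<infinity>::ereal) < ereal x \<longrightarrow> ereal x < \<infinity> \<longrightarrow> (F has_vector_derivative \<psi> x) (at x)"
    by (intro einterval_antiderivative) auto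
  then show ?thesis
    by (simp add: has_real_derivative_iff_has_vector_derivative)
qed

text \<open>Lemma of du Bois-Reymond: test functions whose derivative approximates
  \<open>l 1\<^bsub>[0, s]\<^esub> - s 1\<^bsub>[0, l]\<^esub>\<close> show that \<open>f - volterra l g\<close> is constant.\<close>

lemma weak_derivative_imp_antideriv:
  assumes l: "0 < l" and fg: "weak_derivative l f g"
  shows "\<exists>a. f = antideriv l a g"
proof -
  have f: "f \<in> L2_interval l" and g: "g \<in> L2_interval l"
    using fg by (auto simp: weak_derivative_def)
  define r where "r = f - volterra l g"
  have r: "r \<in> L2_interval l"
    unfolding r_def by (rule csubspace_diff[OF L2_interval_csubspace f volterra_mem])
  have r_test: "cinner r (l2_cut l (\<lambda>t. complex_of_real (\<phi>' t))) = 0" if \<phi>: "test_function l \<phi> \<phi>'" for \<phi> \<phi>'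
  proof -
    have c: "continuous_on UNIV \<phi>'" "continuous_on UNIV \<phi>"
      by (rule test_function_continuous[OF \<phi>])+
    have "(LINT t:{0..l}|lebesgue. rep_l2 f t * complex_of_real (\<phi>' t)) =
        - (LINT t:{0..l}|lebesgue. rep_l2 g t * complex_of_real (\<phi> t))"
      using fg \<phi> unfolding weak_derivative_def by (elim conjE allE) (erule mp)
    then have "cinner f (l2_cut l (\<lambda>t. complex_of_real (\<phi>' t))) = - cinner g (l2_cut l (\<lambda>t. complex_of_real (\<phi> t)))"
      unfolding set_integral_cinner_cut[OF c(1)] set_integral_cinner_cut[OF c(2)] .
    then show ?thesis
      by (simp add: r_def cinner_diff_left test_function_pairing[OF l \<phi>])
  qed
  define P where "P n s = l2_cut l (\<lambda>t. complex_of_real (trapezoid n s t))" for n s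
  have PL: "(\<lambda>n. cinner x (P n s)) \<longlonglongrightarrow> cinner x (l2_ind s)" if "0 < s" "s \<le> l" for x s
    unfolding P_def by (rule cinner_trapezoid_LIMSEQ[OF that])
  have "\<exists>F. \<forall>t. (F has_real_derivative trapezoid n s t) (at t)" for n s
    by (rule continuous_antiderivative_exists[OF continuous_on_trapezoid])
  then obtain F where F: "\<And>n s t. (F n s has_real_derivative trapezoid n s t) (at t)"
    by metis
  \<comment> \<open>The integral of the trapezoid over the edge; it tends to
    \<open>s\<close>.\<close>
  define m where "m n s = F n s l - F n s 0" for n s
  have mP: "cinner (l2_ind l) (P n s) = complex_of_real (m n s)" for n s
  proof -
    have "l2_prim (P n s) l = complex_of_real (m n s)"
      unfolding P_def m_def by (rule l2_prim_cut_derivative[OF F continuous_on_trapezoid]) (use l in auto)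
    then show ?thesis
      using cinner_commute[of "l2_ind l" "P n s"] by (simp add: l2_prim_def)
  qed
  have key: "complex_of_real (m n l) * cinner r (P n s) = complex_of_real (m n s) * cinner r (P n l)"
    if s: "0 < s" "s \<le> l" and n: "0 < n" for n s
  proof -
    \<comment> \<open>The weights make the integral of \<phi>' vanish, and near both ends \<phi>' is
      0. Its primitive is therefore constant there, with value 0, and so has support in the open
      interval.\<close>
    define \<phi>' where "\<phi>' t = m n l * trapezoid n s t - m n s * trapezoid n l t" for t
    define \<phi> where "\<phi> t = m n l * (F n s t - F n s 0) - m n s * (F n l t - F n l 0)" for t
    have der: "(\<phi> has_real_derivative \<phi>' t) (at t)" for t
      unfolding \<phi>_def \<phi>'_def by (auto intro!: derivative_eq_intros F)
    have cont: "continuous_on UNIV \<phi>'"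
      unfolding \<phi>'_def by (intro continuous_intros continuous_on_trapezoid)
    have \<phi>0: "\<phi> 0 = 0" and \<phi>l: "\<phi> l = 0"
      by (simp_all add: \<phi>_def m_def)
    have \<phi>'0: "\<phi>' t = 0" if "t \<le> 1 / real n \<or> l - 1 / real n \<le> t" for t
    proof -
      have "t \<le> 1 / real n \<or> s - 1 / real n \<le> t"
        using that s(2) by auto
      then show ?thesis
        using that n by (simp add: \<phi>'_def trapezoid_eq_0)
    qed
    have const: "\<phi> x = \<phi> y"
      if S: "convex S" "\<And>t. t \<in> S \<Longrightarrow> t \<le> 1 / real n \<or> l - 1 / real n \<le> t" "x \<in> S" "y \<in> S" for S x y
    proof -
      have "(\<phi> has_field_derivative 0) (at t within S)" if "t \<in> S" for t
        using has_field_derivative_at_within[OF der[of t], of S] \<phi>'0[OF S(2)[OF that]] by simp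
      then obtain c where "\<And>t. t \<in> S \<Longrightarrow> \<phi> t = c"
        using has_field_derivative_zero_constant[OF S(1)] by blast
      then show ?thesis
        using S(3,4) by simp
    qed
    have left: "\<phi> t = 0" if "t \<le> 1 / real n" for t
      using const[of "{..1 / real n}" t 0] that \<phi>0 by simp
    have right: "\<phi> t = 0" if "l - 1 / real n \<le> t" for t
      using const[of "{l - 1 / real n..}" t l] that \<phi>l by simp
    have "test_function l \<phi> \<phi>'"
      unfolding test_function_def
      by (intro conjI allI der cont exI[of _ "1 / real n"] exI[of _ "l - 1 / real n"])
        (use n left right in \<open>auto simp: not_le\<close>)
    then have "cinner r (l2_cut l (\<lambda>t. complex_of_real (\<phi>' t))) = 0"
      by (rule r_test)
    moreover have "l2_cut l (\<lambda>t. complex_of_real (\<phi>' t)) = complex_of_real (m n l) *\<^sub>C P n s - complex_of_real (m n s) *\<^sub>C P n l"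
    proof (rule l2_eqI)
      have c: "continuous_on {0..l} (\<lambda>t. complex_of_real (trapezoid n s t))" for s
        by (intro continuous_intros continuous_on_trapezoid)
      have c': "continuous_on {0..l} (\<lambda>t. complex_of_real (\<phi>' t))"
        by (intro continuous_intros continuous_on_subset[OF cont]) auto
      show "AE t in lebesgue. rep_l2 (l2_cut l (\<lambda>t. complex_of_real (\<phi>' t))) t =
          rep_l2 (complex_of_real (m n l) *\<^sub>C P n s - complex_of_real (m n s) *\<^sub>C P n l) t"
        using rep_l2_cut[OF c'] rep_l2_cut[OF c[of s]] rep_l2_cut[OF c[of l]]
          rep_l2_diff[of "complex_of_real (m n l) *\<^sub>C P n s" "complex_of_real (m n s) *\<^sub>C P n l"]
          rep_l2_scaleC[of "complex_of_real (m n l)" "P n s"] rep_l2_scaleC[of "complex_of_real (m n s)" "P n l"]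
        unfolding P_def[symmetric] by eventually_elim (simp add: restr_def \<phi>'_def)
    qed
    ultimately show ?thesis
      by (simp add: cinner_simps)
  qed
  have lim: "complex_of_real l * cinner r (l2_ind s) = complex_of_real s * cinner r (l2_ind l)" if s: "0 < s" "s \<le> l" for s
  proof (rule LIMSEQ_unique)
    have ml: "(\<lambda>n. complex_of_real (m n s)) \<longlonglongrightarrow> complex_of_real s" if "0 < s" "s \<le> l" for s
      using PL[OF that, of "l2_ind l"] l2_prim_ind[of s l] that by (simp add: mP l2_prim_def)
    show "(\<lambda>n. complex_of_real (m n l) * cinner r (P n s)) \<longlonglongrightarrow> complex_of_real l * cinner r (l2_ind s)"
      by (intro tendsto_mult ml PL s l order_refl)
    have "(\<lambda>n. complex_of_real (m n s) * cinner r (P n l)) \<longlonglongrightarrow> complex_of_real s * cinner r (l2_ind l)"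
      by (intro tendsto_mult ml PL s l order_refl)
    moreover have "eventually (\<lambda>n. complex_of_real (m n s) * cinner r (P n l) = complex_of_real (m n l) * cinner r (P n s)) sequentially"
      using eventually_gt_at_top[of 0] by eventually_elim (simp add: key[OF s])
    ultimately show "(\<lambda>n. complex_of_real (m n l) * cinner r (P n s)) \<longlonglongrightarrow> complex_of_real s * cinner r (l2_ind l)"
      by (rule Lim_transform_eventually)
  qed
  \<comment> \<open>The mean value of \<open>r\<close>. By \<open>lim\<close>, the primitive of
    \<open>r\<close> is linear with this slope.\<close>
  define a where "a = cinner r (l2_ind l) / complex_of_real l"
  have "r - a *\<^sub>C l2_ind l = 0"
  proof (rule L2_interval_ind_total[OF _ l])
    show "r - a *\<^sub>C l2_ind l \<in> L2_interval l"
      by (intro csubspace_diff csubspace_scaleC L2_interval_csubspace r l2_ind_mem)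
    fix t assume t: "t \<in> {0..l}"
    show "l2_prim (r - a *\<^sub>C l2_ind l) t = 0"
    proof (cases "t = 0")
      case False
      then have "l2_prim r t = a * complex_of_real t"
        using lim[of t] t l by (simp add: l2_prim_def a_def field_simps)
      then show ?thesis
        using l2_prim_ind[of t l] t by (simp add: l2_prim_def cinner_simps)
    qed simp
  qed
  then have "f = antideriv l a g"
    by (simp add: r_def antideriv_def algebra_simps)
  then show ?thesis ..
qed

lemma weak_derivative_iff:
  assumes "0 < l"
  shows "weak_derivative l f g \<longleftrightarrow> g \<in> L2_interval l \<and> (\<exists>a. f = antideriv l a g)"
proof
  assume w: "weak_derivative l f g"
  then have "g \<in> L2_interval l"
    unfolding weak_derivative_def by (elim conjE)
  then show "g \<in> L2_interval l \<and> (\<exists>a. f = antideriv l a g)"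
    using weak_derivative_imp_antideriv[OF assms w] by blast
next
  assume "g \<in> L2_interval l \<and> (\<exists>a. f = antideriv l a g)"
  then show "weak_derivative l f g"
    using weak_derivative_antideriv[OF assms] by blast
qed

lemma wderiv_antideriv:
  assumes l: "0 < l" and g: "g \<in> L2_interval l"
  shows "wderiv l (antideriv l a g) = g"
  unfolding wderiv_def
proof (rule the_equality)
  show "weak_derivative l (antideriv l a g) g"
    by (rule weak_derivative_antideriv[OF l g])
  show "h = g" if "weak_derivative l (antideriv l a g) h" for h
    using that antideriv_inject(2)[OF l g] unfolding weak_derivative_iff[OF l] by blast
qed

text \<open>Normal form of an H^2 function f: \<open>a\<close> = f(0), \<open>b\<close> = f'(0) and
  \<open>h\<close> = f''.\<close>

definition antideriv2 :: "real \<Rightarrow> complex \<Rightarrow> complex \<Rightarrow> l2 \<Rightarrow> l2" where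
  "antideriv2 l a b h = antideriv l a (antideriv l b h)"

lemma sobolev2_iff:
  assumes l: "0 < l"
  shows "f \<in> sobolev2 l \<longleftrightarrow> (\<exists>a b h. h \<in> L2_interval l \<and> f = antideriv2 l a b h)"
proof
  assume "f \<in> sobolev2 l"
  then obtain g where g: "weak_derivative l f g" and w: "wderiv l f \<in> sobolev1 l"
    by (auto simp: sobolev2_def sobolev1_def)
  then obtain a where a: "f = antideriv l a g" and gm: "g \<in> L2_interval l"
    unfolding weak_derivative_iff[OF l] by blast
  then obtain h where "weak_derivative l g h"
    using w wderiv_antideriv[OF l gm] by (auto simp: sobolev1_def)
  then show "\<exists>a b h. h \<in> L2_interval l \<and> f = antideriv2 l a b h"
    unfolding weak_derivative_iff[OF l] antideriv2_def a by blast
next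
  assume "\<exists>a b h. h \<in> L2_interval l \<and> f = antideriv2 l a b h"
  then obtain a b h where h: "h \<in> L2_interval l" "f = antideriv2 l a b h"
    by blast
  have "antideriv l b h \<in> sobolev1 l" "f \<in> sobolev1 l"
    unfolding sobolev1_def mem_Collect_eq h(2) antideriv2_def
    using weak_derivative_antideriv[OF l h(1)] weak_derivative_antideriv[OF l antideriv_mem] by blast+
  then show "f \<in> sobolev2 l"
    unfolding sobolev2_def by (simp add: h(2) antideriv2_def wderiv_antideriv[OF l antideriv_mem])
qed

section \<open>The initial value problem with a square integrable potential\<close>

lemma clinear_funpow: "clinear (B :: 'a::complex_inner \<Rightarrow> 'a) \<Longrightarrow> clinear (B ^^ n)"
  by (induction n) (auto simp: clinear_def)

text \<open>The assumption bounds all powers with a common constant \<open>C\<close> instead of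
  asking for a contraction, since the operator in question contracts only in an equivalent weighted
  norm.\<close>

lemma neumann_series:
  fixes B :: "'a::chilbert_space \<Rightarrow> 'a"
  assumes B: "bounded_linear B" "clinear B" and bound: "\<And>n x. norm ((B ^^ n) x) \<le> C * (1/2) ^ n * norm x"
  shows "\<exists>S. clinear S \<and> (\<forall>x. S x = x + B (S x)) \<and> (\<forall>x. norm (S x) \<le> 2 * C * norm x)"
proof -
  define S where "S x = (\<Sum>n. (B ^^ n) x)" for x
  have g: "summable (\<lambda>n. C * (1/2) ^ n * norm x)" for x
    by (intro summable_mult summable_mult2 summable_geometric) simp
  have sn: "summable (\<lambda>n. norm ((B ^^ n) x))" for x
    by (rule summable_comparison_test'[OF g[of x], of 0]) (simp add: bound)
  note s = summable_norm_cancel[OF sn]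
  have cB: "clinear (B ^^ n)" for n
    by (rule clinear_funpow[OF B(2)])
  have "clinear S"
  proof (rule clinearI)
    show "S (x + y) = S x + S y" for x y
      unfolding S_def suminf_add[OF s s] by (simp add: clinear_add[OF cB])
    show "S (c *\<^sub>C x) = c *\<^sub>C S x" for c x
      unfolding S_def bounded_linear.suminf[OF bounded_linear_scaleC_right s] by (simp add: clinear_scaleC[OF cB])
  qed
  moreover have "S x = x + B (S x)" for x
  proof -
    have "B (S x) = (\<Sum>n. B ((B ^^ n) x))"
      unfolding S_def by (rule bounded_linear.suminf[OF B(1) s])
    then show ?thesis
      using suminf_split_head[OF s[of x]] by (simp add: S_def)
  qed
  moreover have "norm (S x) \<le> 2 * C * norm x" for x
  proof -
    have "norm (S x) \<le> (\<Sum>n. norm ((B ^^ n) x))"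
      unfolding S_def by (rule summable_norm[OF sn])
    also have "\<dots> \<le> (\<Sum>n. C * (1/2) ^ n * norm x)"
      by (rule suminf_le[OF bound sn g])
    also have "\<dots> = (\<Sum>n. (C * norm x) * (1/2) ^ n)"
      by (simp add: mult_ac)
    also have "\<dots> = (C * norm x) * (\<Sum>n. (1/2) ^ n)"
      by (rule suminf_mult) (rule summable_geometric, simp)
    also have "\<dots> = 2 * C * norm x"
      by (simp add: suminf_geometric)
    finally show ?thesis .
  qed
  ultimately show ?thesis
    by blast
qed

section \<open>Multiplication by the potential and exponential weights\<close>

definition mult_potential :: "real \<Rightarrow> (real \<Rightarrow> real) \<Rightarrow> l2 \<Rightarrow> l2" where
  "mult_potential l q f = abs_l2 (\<lambda>t. if t \<in> {0..l} then complex_of_real (q t) * rep_l2 f t else 0)"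

text \<open>With q only in L^2, the product with f is known to be in L^2 for bounded f, and outside
  L^2 the class \<open>abs_l2\<close> says nothing about the product. H^1 functions are bounded,
  which is why the Schroedinger expression makes sense on H^2.\<close>

definition ess_bounded :: "real \<Rightarrow> l2 \<Rightarrow> bool" where
  "ess_bounded l f \<longleftrightarrow> (\<exists>C. AE t in lebesgue. t \<in> {0..l} \<longrightarrow> cmod (rep_l2 f t) \<le> C)"

lemma ess_bounded_antideriv: "ess_bounded l (antideriv l a g)"
  unfolding ess_bounded_def
proof
  show "AE t in lebesgue. t \<in> {0..l} \<longrightarrow> cmod (rep_l2 (antideriv l a g) t) \<le> cmod a + sqrt l * norm g"
    using rep_antideriv[of l a g]
  proof eventually_elim
    case (elim t)
    show ?case
    proof
      assume t: "t \<in> {0..l}"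
      then have "cmod (l2_prim g t) \<le> sqrt t * norm g"
        by (intro l2_prim_le) simp
      also have "\<dots> \<le> sqrt l * norm g"
        using t by (intro mult_right_mono) auto
      finally show "cmod (rep_l2 (antideriv l a g) t) \<le> cmod a + sqrt l * norm g"
        using t elim norm_triangle_ineq[of a "l2_prim g t"] by (simp add: restr_def)
    qed
  qed
qed

lemma volterra_antideriv: "volterra l g = antideriv l 0 g"
  by (simp add: antideriv_def)

text \<open>The usual exponential weight that makes Volterra operators contractive. The exponent is
  frozen outside the edge so that the weight is bounded and continuous on the whole line.\<close>

definition weight :: "real \<Rightarrow> real \<Rightarrow> real \<Rightarrow> real" where
  "weight l \<kappa> t = exp (- \<kappa> * max 0 (min t l))"

lemma weight_measurable: "weight l \<kappa> \<in> borel_measurable borel"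
  unfolding weight_def by (intro borel_measurable_continuous_onI continuous_intros)

lemma weight_bound: "0 \<le> \<kappa> \<Longrightarrow> \<bar>weight l \<kappa> t\<bar> \<le> 1"
  by (simp add: weight_def)

lemma weight_eq: "t \<in> {0..l} \<Longrightarrow> weight l \<kappa> t = exp (- \<kappa> * t)"
  by (simp add: weight_def)

lemma norm_weight_ge:
  assumes "0 \<le> \<kappa>" "0 \<le> l"
  shows "norm h \<le> exp (\<kappa> * l) * norm (l2_mult (weight l \<kappa>) h)"
proof (rule norm_l2_le)
  show "AE t in lebesgue. cmod (rep_l2 h t) \<le> exp (\<kappa> * l) * cmod (rep_l2 (l2_mult (weight l \<kappa>) h) t)"
    using rep_l2_mult[OF weight_measurable weight_bound[OF assms(1)], of l h]
  proof eventually_elim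
    case (elim t)
    have "\<kappa> * max 0 (min t l) \<le> \<kappa> * l"
      using assms by (intro mult_left_mono) auto
    then have "1 \<le> exp (\<kappa> * l) * weight l \<kappa> t"
      by (simp add: weight_def flip: exp_add)
    then have "1 * cmod (rep_l2 h t) \<le> (exp (\<kappa> * l) * weight l \<kappa> t) * cmod (rep_l2 h t)"
      by (rule mult_right_mono) simp
    then show ?case
      by (simp add: elim norm_mult weight_def)
  qed
qed simp

lemma norm_l2_cut_exp:
  assumes "0 < \<kappa>" "0 \<le> t"
  shows "norm (l2_cut t (\<lambda>s. complex_of_real (exp (\<kappa> * s)))) \<le> exp (\<kappa> * t) / sqrt (2 * \<kappa>)"
proof -
  define c where "c = l2_cut t (\<lambda>s. complex_of_real (exp (\<kappa> * s)))"
  define d where "d = l2_cut t (\<lambda>s. complex_of_real (exp (2 * \<kappa> * s)))"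
  have cont: "continuous_on {0..t} (\<lambda>s. complex_of_real (exp (\<mu> * s)))" for \<mu>
    by (intro continuous_intros)
  have "cinner c c = (LINT s|lebesgue. restr t (\<lambda>s. rep_l2 c s * cnj (complex_of_real (exp (\<kappa> * s)))) s)"
    unfolding c_def by (rule cinner_l2_cut[OF cont])
  also have "\<dots> = (LINT s|lebesgue. restr t (rep_l2 d) s)"
  proof (rule integral_cong_AE)
    show "AE s in lebesgue. restr t (\<lambda>s. rep_l2 c s * cnj (complex_of_real (exp (\<kappa> * s)))) s = restr t (rep_l2 d) s"
      using rep_l2_cut[OF cont[of \<kappa>]] rep_l2_cut[OF cont[of "2 * \<kappa>"]] unfolding c_def[symmetric] d_def[symmetric]
    proof eventually_elim
      case (elim s)
      have "exp (\<kappa> * s) * exp (\<kappa> * s) = exp (2 * \<kappa> * s)"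
        by (simp flip: exp_add)
      then have "complex_of_real (exp (\<kappa> * s)) * complex_of_real (exp (\<kappa> * s)) = complex_of_real (exp (2 * \<kappa> * s))"
        by (metis of_real_mult)
      then show ?case
        unfolding restr_def elim by (simp add: restr_def)
    qed
    show "restr t (\<lambda>s. rep_l2 c s * cnj (complex_of_real (exp (\<kappa> * s)))) \<in> borel_measurable lebesgue"
      by (rule borel_measurable_integrable[OF integrable_l2_cut[OF cont]])
    show "restr t (rep_l2 d) \<in> borel_measurable lebesgue"
      by (rule borel_measurable_integrable[OF integrable_restr_rep])
  qed
  also have "\<dots> = l2_prim d t"
    by (rule l2_prim_integral[symmetric])
  also have "\<dots> = complex_of_real (exp (2 * \<kappa> * t) / (2 * \<kappa>) - exp (2 * \<kappa> * 0) / (2 * \<kappa>))"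
    unfolding d_def
  proof (rule l2_prim_cut_derivative)
    show "((\<lambda>s. exp (2 * \<kappa> * s) / (2 * \<kappa>)) has_real_derivative exp (2 * \<kappa> * s)) (at s)" for s
      using assms(1) by (auto intro!: derivative_eq_intros)
  qed (use assms(2) in \<open>auto intro!: continuous_intros\<close>)
  finally have "(norm c)\<^sup>2 = exp (2 * \<kappa> * t) / (2 * \<kappa>) - 1 / (2 * \<kappa>)"
    by (metis cinner_self of_real_eq_iff mult_zero_right exp_zero)
  also have "\<dots> \<le> exp (2 * \<kappa> * t) / (2 * \<kappa>)"
    using assms(1) by simp
  also have "\<dots> = (exp (\<kappa> * t) / sqrt (2 * \<kappa>))\<^sup>2"
    using assms(1) by (simp add: power_divide mult.assoc flip: exp_double)
  finally show ?thesis
    unfolding c_def[symmetric] by (rule power2_le_imp_le) (use assms(1) in simp)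
qed

text \<open>On the interval from 0 to t, h is the weighted function times the inverse weight.
  Cauchy-Schwarz then contributes the L^2 norm of exp (\<kappa> s), which is at most exp (\<kappa>
  t) / sqrt (2 \<kappa>).\<close>

lemma l2_prim_weighted:
  assumes \<kappa>: "0 < \<kappa>" and t: "t \<in> {0..l}"
  shows "cmod (l2_prim h t) \<le> exp (\<kappa> * t) / sqrt (2 * \<kappa>) * norm (l2_mult (weight l \<kappa>) h)"
proof -
  define E where "E = l2_mult (weight l \<kappa>) h"
  have cont: "continuous_on {0..t} (\<lambda>s. complex_of_real (exp (\<kappa> * s)))"
    by (intro continuous_intros)
  have "l2_prim h t = cinner E (l2_cut t (\<lambda>s. complex_of_real (exp (\<kappa> * s))))"
    unfolding l2_prim_integral cinner_l2_cut[OF cont]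
  proof (rule integral_cong_AE)
    show "AE s in lebesgue. restr t (rep_l2 h) s = restr t (\<lambda>s. rep_l2 E s * cnj (complex_of_real (exp (\<kappa> * s)))) s"
      using rep_l2_mult[OF weight_measurable weight_bound[OF less_imp_le[OF \<kappa>]], of l h] unfolding E_def[symmetric]
    proof (elim eventually_mono)
      fix s assume s: "rep_l2 E s = complex_of_real (weight l \<kappa> s) * rep_l2 h s"
      show "restr t (rep_l2 h) s = restr t (\<lambda>s. rep_l2 E s * cnj (complex_of_real (exp (\<kappa> * s)))) s"
      proof (cases "s \<in> {0..t}")
        case True
        then have "weight l \<kappa> s * exp (\<kappa> * s) = 1"
          using t weight_eq[of s l \<kappa>] by (simp flip: exp_add)
        then have "complex_of_real (weight l \<kappa> s) * complex_of_real (exp (\<kappa> * s)) = 1"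
          by (metis of_real_1 of_real_mult)
        then have "rep_l2 h s = rep_l2 E s * complex_of_real (exp (\<kappa> * s))"
          unfolding s by (simp add: mult_ac)
        then show ?thesis
          using True by (simp add: restr_def)
      qed (auto simp: restr_def)
    qed
    show "restr t (rep_l2 h) \<in> borel_measurable lebesgue"
      by (rule borel_measurable_integrable[OF integrable_restr_rep])
    show "restr t (\<lambda>s. rep_l2 E s * cnj (complex_of_real (exp (\<kappa> * s)))) \<in> borel_measurable lebesgue"
      by (rule borel_measurable_integrable[OF integrable_l2_cut[OF cont]])
  qed
  then have "cmod (l2_prim h t) \<le> norm E * norm (l2_cut t (\<lambda>s. complex_of_real (exp (\<kappa> * s))))"
    using cinner_bound by simp
  also have "\<dots> \<le> norm E * (exp (\<kappa> * t) / sqrt (2 * \<kappa>))"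
    using t by (intro mult_left_mono norm_l2_cut_exp \<kappa>) auto
  finally show ?thesis
    by (simp add: E_def mult.commute)
qed

text \<open>Each integration gains a factor 1 / sqrt (2 \<kappa>) in the weighted norm, because the
  exponential growth of the primitive is cancelled by the weight.\<close>

lemma norm_weight_volterra:
  assumes \<kappa>: "0 < \<kappa>" and l: "0 \<le> l"
  shows "norm (l2_mult (weight l \<kappa>) (volterra l h)) \<le> sqrt l / sqrt (2 * \<kappa>) * norm (l2_mult (weight l \<kappa>) h)"
proof -
  define n where "n = norm (l2_mult (weight l \<kappa>) h)"
  have "norm (l2_mult (weight l \<kappa>) (volterra l h)) \<le> (n / sqrt (2 * \<kappa>)) * norm (l2_ind l)"
  proof (rule norm_l2_le)
    show "AE t in lebesgue. cmod (rep_l2 (l2_mult (weight l \<kappa>) (volterra l h)) t) \<le> n / sqrt (2 * \<kappa>) * cmod (rep_l2 (l2_ind l) t)"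
      using rep_l2_mult[OF weight_measurable weight_bound[OF less_imp_le[OF \<kappa>]], of l "volterra l h"] rep_volterra[of l h] rep_l2_ind[of l]
    proof eventually_elim
      case (elim t)
      show ?case
      proof (cases "t \<in> {0..l}")
        case True
        have "weight l \<kappa> t * cmod (l2_prim h t) \<le> weight l \<kappa> t * (exp (\<kappa> * t) / sqrt (2 * \<kappa>) * n)"
          unfolding n_def by (intro mult_left_mono l2_prim_weighted \<kappa> True) (simp add: weight_def)
        also have "\<dots> = (weight l \<kappa> t * exp (\<kappa> * t)) * (n / sqrt (2 * \<kappa>))"
          by simp
        also have "\<dots> = n / sqrt (2 * \<kappa>)"
          by (simp add: weight_eq[OF True] flip: exp_add)
        finally show ?thesis
          using True by (simp add: elim restr_def norm_mult weight_def)
      qed (use elim in \<open>auto simp: restr_def\<close>)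
    qed
  qed (use \<kappa> in \<open>simp add: n_def\<close>)
  then show ?thesis
    by (simp add: norm_l2_ind[OF l] n_def mult_ac)
qed

context
  fixes l :: real and q :: "real \<Rightarrow> real"
  assumes l: "0 < l" and q_meas: "q \<in> borel_measurable (lebesgue_on {0..l})"
    and q_int: "integrable (lebesgue_on {0..l}) (\<lambda>t. (q t)\<^sup>2)"
begin

lemma potential_measurable: "(\<lambda>t. indicator {0..l} t * q t) \<in> borel_measurable lebesgue"
  using q_meas by (subst (asm) borel_measurable_restrict_space_iff) auto

lemma sq_integrable_potential: "sq_integrable (restr l (\<lambda>t. complex_of_real (q t)))"
proof (rule sq_integrable_restr)
  have eq: "restr l (\<lambda>t. complex_of_real (q t)) = (\<lambda>t. complex_of_real (indicator {0..l} t * q t))"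
    by (auto simp: restr_def fun_eq_iff)
  show "restr l (\<lambda>t. complex_of_real (q t)) \<in> borel_measurable lebesgue"
    unfolding eq using potential_measurable by measurable
  have "set_integrable lebesgue {0..l} (\<lambda>t. (q t)\<^sup>2)"
    using q_int by (subst (asm) integrable_restrict_space) (auto simp: set_integrable_def)
  then show "integrable lebesgue (\<lambda>t. (cmod (restr l (\<lambda>t. complex_of_real (q t)) t))\<^sup>2)"
    unfolding set_integrable_def by (rule back_subst[of "integrable lebesgue"]) (auto simp: restr_def fun_eq_iff)
qed

lemma sq_integrable_mult_potential:
  assumes "ess_bounded l f"
  shows "sq_integrable (\<lambda>t. if t \<in> {0..l} then complex_of_real (q t) * rep_l2 f t else 0)"
proof -
  obtain C where C: "AE t in lebesgue. t \<in> {0..l} \<longrightarrow> cmod (rep_l2 f t) \<le> C"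
    using assms by (auto simp: ess_bounded_def)
  have eq: "(\<lambda>t. if t \<in> {0..l} then complex_of_real (q t) * rep_l2 f t else 0) =
      (\<lambda>t. complex_of_real (indicator {0..l} t * q t) * rep_l2 f t)"
    by (auto simp: fun_eq_iff)
  note [measurable] = potential_measurable
  have "integrable lebesgue (\<lambda>t. C\<^sup>2 * (cmod (restr l (\<lambda>t. complex_of_real (q t)) t))\<^sup>2)"
    using sq_integrable_potential by (simp add: sq_integrable_def)
  then have "integrable lebesgue (\<lambda>t. (cmod (complex_of_real (indicator {0..l} t * q t) * rep_l2 f t))\<^sup>2)"
  proof (rule Bochner_Integration.integrable_bound)
    show "AE t in lebesgue. norm ((cmod (complex_of_real (indicator {0..l} t * q t) * rep_l2 f t))\<^sup>2)
        \<le> norm (C\<^sup>2 * (cmod (restr l (\<lambda>t. complex_of_real (q t)) t))\<^sup>2)"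
      using C
    proof eventually_elim
      case (elim t)
      show ?case
      proof (cases "t \<in> {0..l}")
        case True
        then have "(cmod (rep_l2 f t))\<^sup>2 \<le> C\<^sup>2"
          using elim by (intro power_mono) auto
        then have "(q t)\<^sup>2 * (cmod (rep_l2 f t))\<^sup>2 \<le> (q t)\<^sup>2 * C\<^sup>2"
          by (rule mult_left_mono) simp
        then show ?thesis
          using True by (simp add: restr_def norm_mult power_mult_distrib mult.commute)
      qed simp
    qed
  qed measurable
  moreover have "(\<lambda>t. complex_of_real (indicator {0..l} t * q t) * rep_l2 f t) \<in> borel_measurable lebesgue"
    by measurable
  ultimately show ?thesis
    unfolding sq_integrable_def eq by (intro conjI)
qed

lemma rep_mult_potential:
  assumes "ess_bounded l f"
  shows "AE t in lebesgue. rep_l2 (mult_potential l q f) t = restr l (\<lambda>t. complex_of_real (q t) * rep_l2 f t) t"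
  using rep_abs_l2[OF sq_integrable_mult_potential[OF assms]] unfolding mult_potential_def restr_def .

lemma mult_potential_mem:
  assumes "ess_bounded l f" shows "mult_potential l q f \<in> L2_interval l"
  unfolding L2_interval_def mem_Collect_eq
  using rep_mult_potential[OF assms] by eventually_elim (auto simp: restr_def)

lemma mult_potential_add:
  assumes "ess_bounded l f" "ess_bounded l g" "ess_bounded l (f + g)"
  shows "mult_potential l q (f + g) = mult_potential l q f + mult_potential l q g"
  by (rule l2_eqI, use rep_mult_potential[OF assms(1)] rep_mult_potential[OF assms(2)] rep_mult_potential[OF assms(3)]
      rep_l2_add[of f g] rep_l2_add[of "mult_potential l q f" "mult_potential l q g"] in eventually_elim)
    (simp add: restr_def algebra_simps)

lemma mult_potential_scaleC:
  assumes "ess_bounded l f" "ess_bounded l (c *\<^sub>C f)"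
  shows "mult_potential l q (c *\<^sub>C f) = c *\<^sub>C mult_potential l q f"
  by (rule l2_eqI, use rep_mult_potential[OF assms(1)] rep_mult_potential[OF assms(2)]
      rep_l2_scaleC[of c f] rep_l2_scaleC[of c "mult_potential l q f"] in eventually_elim)
    (simp add: restr_def)

lemma cinner_mult_potential:
  assumes "ess_bounded l f" "ess_bounded l g"
  shows "cinner (mult_potential l q f) g = cinner f (mult_potential l q g)"
  unfolding cinner_l2.rep_eq
proof (rule integral_cong_AE)
  show "AE t in lebesgue. rep_l2 (mult_potential l q f) t * cnj (rep_l2 g t) = rep_l2 f t * cnj (rep_l2 (mult_potential l q g) t)"
    using rep_mult_potential[OF assms(1)] rep_mult_potential[OF assms(2)] by eventually_elim (simp add: restr_def)
qed simp_all

text \<open>Insert f = \<open>antideriv2 l a b h\<close> into - f'' + q f = g. The unknown h = f''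
  satisfies h = r + \<open>volterra_potential h\<close>, where r collects g and the contribution of
  the initial values.\<close>

definition volterra_potential :: "l2 \<Rightarrow> l2" where
  "volterra_potential h = mult_potential l q (volterra l (volterra l h))"

lemma ess_bounded_volterra: "ess_bounded l (volterra l h)"
  unfolding volterra_antideriv by (rule ess_bounded_antideriv)

lemma clinear_volterra_potential: "clinear volterra_potential"
proof (rule clinearI)
  show "volterra_potential (f + g) = volterra_potential f + volterra_potential g" for f g
    unfolding volterra_potential_def clinear_add[OF clinear_volterra]
    by (rule mult_potential_add) (simp_all add: ess_bounded_volterra flip: clinear_add[OF clinear_volterra])
  show "volterra_potential (c *\<^sub>C f) = c *\<^sub>C volterra_potential f" for c f
    unfolding volterra_potential_def clinear_scaleC[OF clinear_volterra]
    by (rule mult_potential_scaleC) (simp_all add: ess_bounded_volterra flip: clinear_scaleC[OF clinear_volterra])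
qed

lemma volterra_potential_contraction:
  obtains \<kappa> where "0 < \<kappa>"
    "\<And>h. norm (l2_mult (weight l \<kappa>) (volterra_potential h)) \<le> (1/2) * norm (l2_mult (weight l \<kappa>) h)"
proof
  define qv where "qv = abs_l2 (restr l (\<lambda>t. complex_of_real (q t)))"
  \<comment> \<open>The two integrations, the outer one estimated pointwise and the inner one in
    L^2, together give the factor sqrt l |q| / (2 \<kappa>), which this choice makes at most
    1/2.\<close>
  define \<kappa> where "\<kappa> = sqrt l * norm qv + 1"
  show \<kappa>: "0 < \<kappa>"
    using l by (simp add: \<kappa>_def add_nonneg_pos)
  fix h
  define E where "E = l2_mult (weight l \<kappa>)"
  define n where "n = norm (E (volterra l h)) / sqrt (2 * \<kappa>)"
  have rep_q: "AE t in lebesgue. rep_l2 qv t = restr l (\<lambda>t. complex_of_real (q t)) t"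
    unfolding qv_def by (rule rep_abs_l2[OF sq_integrable_potential])
  have "norm (E (volterra_potential h)) \<le> n * norm qv"
  proof (rule norm_l2_le)
    show "AE t in lebesgue. cmod (rep_l2 (E (volterra_potential h)) t) \<le> n * cmod (rep_l2 qv t)"
      using rep_l2_mult[OF weight_measurable weight_bound[OF less_imp_le[OF \<kappa>]], of l "volterra_potential h", folded E_def]
        rep_mult_potential[OF ess_bounded_volterra, of "volterra l h", folded volterra_potential_def]
        rep_volterra[of l "volterra l h"] rep_q
    proof eventually_elim
      case (elim t)
      show ?case
      proof (cases "t \<in> {0..l}")
        case True
        have "weight l \<kappa> t * cmod (l2_prim (volterra l h) t) \<le> weight l \<kappa> t * (exp (\<kappa> * t) / sqrt (2 * \<kappa>) * norm (E (volterra l h)))"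
          unfolding E_def by (intro mult_left_mono l2_prim_weighted \<kappa> True) (simp add: weight_def)
        also have "\<dots> = (weight l \<kappa> t * exp (\<kappa> * t)) * n"
          by (simp add: n_def)
        also have "\<dots> = n"
          by (simp add: weight_eq[OF True] flip: exp_add)
        finally have "weight l \<kappa> t * cmod (l2_prim (volterra l h) t) * \<bar>q t\<bar> \<le> n * \<bar>q t\<bar>"
          by (rule mult_right_mono) simp
        then show ?thesis
          using True unfolding elim restr_def by (simp add: elim restr_def norm_mult weight_def mult_ac)
      qed (use elim in \<open>auto simp: restr_def\<close>)
    qed
  qed (use \<kappa> in \<open>simp add: n_def\<close>)
  also have "n \<le> (sqrt l / sqrt (2 * \<kappa>) * norm (E h)) / sqrt (2 * \<kappa>)"
    unfolding n_def E_def using \<kappa> l by (intro divide_right_mono norm_weight_volterra) auto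
  then have "n * norm qv \<le> (sqrt l / sqrt (2 * \<kappa>) * norm (E h)) / sqrt (2 * \<kappa>) * norm qv"
    by (rule mult_right_mono) simp
  also have "\<dots> = (sqrt l * norm qv) * norm (E h) / (sqrt (2 * \<kappa>) * sqrt (2 * \<kappa>))"
    by simp
  also have "\<dots> = (sqrt l * norm qv) / (2 * \<kappa>) * norm (E h)"
    using \<kappa> by (simp del: real_sqrt_mult)
  also have "\<dots> \<le> (1/2) * norm (E h)"
    using \<kappa> by (intro mult_right_mono) (auto simp: \<kappa>_def pos_divide_le_eq)
  finally show "norm (l2_mult (weight l \<kappa>) (volterra_potential h)) \<le> (1/2) * norm (l2_mult (weight l \<kappa>) h)"
    by (simp add: E_def)
qed

text \<open>Powers decay geometrically in the weighted norm. That norm is at most the original one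
  and at least exp (- \<kappa> l) times it, which yields the constant in the Neumann series.\<close>

lemma initial_value_solution_operator:
  "\<exists>S K. clinear S \<and> (\<forall>r. S r = r + mult_potential l q (volterra l (volterra l (S r)))) \<and> (\<forall>r. norm (S r) \<le> K * norm r)"
proof -
  obtain \<kappa> where \<kappa>: "0 < \<kappa>"
    and contr: "\<And>h. norm (l2_mult (weight l \<kappa>) (volterra_potential h)) \<le> (1/2) * norm (l2_mult (weight l \<kappa>) h)"
    by (rule volterra_potential_contraction) (rule that; assumption)
  define E where "E = l2_mult (weight l \<kappa>)"
  define C where "C = exp (\<kappa> * l)"
  have E_le: "norm (E h) \<le> norm h" for h
    using norm_l2_mult[OF weight_measurable weight_bound[OF less_imp_le[OF \<kappa>]], of l h] by (simp add: E_def)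
  have E_ge: "norm h \<le> C * norm (E h)" for h
    unfolding E_def C_def using \<kappa> l by (intro norm_weight_ge) auto
  have pow: "norm (E ((volterra_potential ^^ n) h)) \<le> (1/2) ^ n * norm (E h)" for n h
  proof (induction n)
    case (Suc n)
    have "norm (E ((volterra_potential ^^ Suc n) h)) \<le> (1/2) * norm (E ((volterra_potential ^^ n) h))"
      using contr[of "(volterra_potential ^^ n) h"] by (simp add: E_def)
    also have "\<dots> \<le> (1/2) * ((1/2) ^ n * norm (E h))"
      using Suc.IH by (intro mult_left_mono) auto
    finally show ?case
      by simp
  qed simp
  have bound: "norm ((volterra_potential ^^ n) h) \<le> C * (1/2) ^ n * norm h" for n h
  proof -
    have "norm ((volterra_potential ^^ n) h) \<le> C * norm (E ((volterra_potential ^^ n) h))"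
      by (rule E_ge)
    also have "\<dots> \<le> C * ((1/2) ^ n * norm (E h))"
      by (intro mult_left_mono pow) (simp add: C_def)
    also have "\<dots> \<le> C * ((1/2) ^ n * norm h)"
      by (intro mult_left_mono E_le) (simp_all add: C_def)
    finally show ?thesis
      by simp
  qed
  have "bounded_linear volterra_potential"
    using bound[of 1] by (intro clinear_bounded_linear[OF clinear_volterra_potential, of "C * (1/2)"]) (simp add: mult.commute)
  from neumann_series[OF this clinear_volterra_potential bound]
  show ?thesis
    unfolding volterra_potential_def by blast
qed

section \<open>Integration by parts and Green's formula on an edge\<close>

lemma cinner_antideriv_by_parts:
  "cinner h (antideriv l a k) = (b + l2_prim h l) * cnj (a + l2_prim k l) - b * cnj a - cinner (antideriv l b h) k"
proof -
  have 1: "cinner h (volterra l k) = l2_prim h l * cnj (l2_prim k l) - cinner (volterra l h) k"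
    using volterra_adjoint[of l h k] by (simp add: algebra_simps)
  have 2: "cinner (l2_ind l) k = cnj (l2_prim k l)"
    using cinner_commute[of "l2_ind l" k] by (simp add: l2_prim_def)
  show ?thesis
    unfolding antideriv_def cinner_add_left cinner_add_right cinner_scaleC_left cinner_scaleC_right 1 2
    by (simp add: l2_prim_def[symmetric] algebra_simps)
qed

text \<open>Both second order terms are integrated by parts once; the remaining scalar products of
  first derivatives cancel, and so do the potential terms, as q is real. At the far end the
  derivative into the edge is minus the derivative, hence - dfl and - dgl.\<close>

lemma edge_green:
  fixes a b a' b' :: complex and h h' :: l2
  defines "f \<equiv> antideriv2 l a b h" and "g \<equiv> antideriv2 l a' b' h'"
  defines "fl \<equiv> a + l2_prim (antideriv l b h) l" and "gl \<equiv> a' + l2_prim (antideriv l b' h') l"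
    and "dfl \<equiv> b + l2_prim h l" and "dgl \<equiv> b' + l2_prim h' l"
  shows "cinner (- h + mult_potential l q f) g - cinner f (- h' + mult_potential l q g) =
    (b * cnj a' - a * cnj b') + (- dfl * cnj gl - fl * cnj (- dgl))"
proof -
  have bd: "ess_bounded l f" "ess_bounded l g"
    unfolding f_def g_def antideriv2_def by (rule ess_bounded_antideriv)+
  have 1: "cinner h g = dfl * cnj gl - b * cnj a' - cinner (antideriv l b h) (antideriv l b' h')"
    unfolding g_def antideriv2_def gl_def dfl_def by (rule cinner_antideriv_by_parts)
  have "cinner h' f = dgl * cnj fl - b' * cnj a - cinner (antideriv l b' h') (antideriv l b h)"
    unfolding f_def antideriv2_def fl_def dgl_def by (rule cinner_antideriv_by_parts)
  then have 2: "cinner f h' = cnj (dgl * cnj fl - b' * cnj a - cinner (antideriv l b' h') (antideriv l b h))"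
    using cinner_commute[of f h'] by simp
  have 3: "cnj (cinner (antideriv l b' h') (antideriv l b h)) = cinner (antideriv l b h) (antideriv l b' h')"
    by (rule cinner_commute[symmetric])
  show ?thesis
    unfolding cinner_add_left cinner_add_right cinner_mult_potential[OF bd] cinner_minus_left cinner_minus_right 1 2
      complex_cnj_diff complex_cnj_mult complex_cnj_cnj 3
    by (simp add: algebra_simps)
qed

end

section \<open>Schroedinger operators on metric graphs\<close>

lemma antideriv2_add: "antideriv2 l a b f + antideriv2 l a' b' g = antideriv2 l (a + a') (b + b') (f + g)"
  by (simp add: antideriv2_def antideriv_add)

lemma antideriv2_scaleC: "c *\<^sub>C antideriv2 l a b f = antideriv2 l (c * a) (c * b) (c *\<^sub>C f)"
  by (simp add: antideriv2_def antideriv_scaleC)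

lemma ess_bounded_antideriv2: "ess_bounded l (antideriv2 l a b h)"
  unfolding antideriv2_def by (rule ess_bounded_antideriv)

text \<open>\<open>\<Phi> a b g\<close> is the second derivative of the solution of - f'' + q f = g
  with f(0) = a and f'(0) = b. Linearity is stated jointly in a, b and g so that solutions of the
  homogeneous equation (g = 0) and a right inverse (a = b = 0) are both special cases.\<close>

lemma edge_initial_value_problem:
  fixes l :: real and q :: "real \<Rightarrow> real"
  assumes l: "0 < l" and q: "q \<in> borel_measurable (lebesgue_on {0..l})"
    "integrable (lebesgue_on {0..l}) (\<lambda>t. (q t)\<^sup>2)"
  shows "\<exists>\<Phi> K. (\<forall>a b. \<forall>g\<in>L2_interval l. \<Phi> a b g \<in> L2_interval l \<and>
      - \<Phi> a b g + mult_potential l q (antideriv2 l a b (\<Phi> a b g)) = g) \<and>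
    (\<forall>a b g a' b' g'. \<Phi> (a + a') (b + b') (g + g') = \<Phi> a b g + \<Phi> a' b' g') \<and>
    (\<forall>c a b g. \<Phi> (c * a) (c * b) (c *\<^sub>C g) = c *\<^sub>C \<Phi> a b g) \<and>
    (\<forall>g. norm (\<Phi> 0 0 g) \<le> K * norm g) \<and> 0 \<le> K"
proof -
  obtain S K where S: "clinear S" "\<And>r. S r = r + mult_potential l q (volterra l (volterra l (S r)))"
    and K: "\<And>r. norm (S r) \<le> K * norm r"
    using initial_value_solution_operator[OF l q] by blast
  define N where "N a b = mult_potential l q (antideriv2 l a b 0)" for a b
  note mp_add = mult_potential_add[OF l q, OF ess_bounded_antideriv2 ess_bounded_antideriv2]
  have N_add: "N (a + a') (b + b') = N a b + N a' b'" for a b a' b'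
    using mp_add[of a b 0 a' b' 0] by (simp add: N_def antideriv2_add ess_bounded_antideriv2)
  have N_scale: "N (c * a) (c * b) = c *\<^sub>C N a b" for a b c
    using mult_potential_scaleC[OF l q, OF ess_bounded_antideriv2[of l a b 0], of c]
    by (simp add: N_def antideriv2_scaleC ess_bounded_antideriv2)
  define \<Phi> where "\<Phi> a b g = S (N a b - g)" for a b g
  have eq: "\<Phi> a b g = mult_potential l q (antideriv2 l a b (\<Phi> a b g)) - g" for a b g
  proof -
    have "\<Phi> a b g = N a b - g + mult_potential l q (antideriv2 l 0 0 (\<Phi> a b g))"
      using S(2)[of "N a b - g"] by (simp add: \<Phi>_def antideriv2_def volterra_antideriv)
    also have "\<dots> = mult_potential l q (antideriv2 l a b 0 + antideriv2 l 0 0 (\<Phi> a b g)) - g"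
      by (subst mp_add) (simp_all add: N_def antideriv2_add ess_bounded_antideriv2)
    finally show ?thesis
      by (simp add: antideriv2_add)
  qed
  have "N 0 0 = 0"
    using N_scale[of 0 0 0] by simp
  then have bound: "norm (\<Phi> 0 0 g) \<le> \<bar>K\<bar> * norm g" for g
    using K[of "- g"] abs_ge_self[of K] mult_right_mono[of K "\<bar>K\<bar>" "norm g"] by (simp add: \<Phi>_def)
  show ?thesis
  proof (intro exI conjI allI ballI)
    show "\<Phi> a b g \<in> L2_interval l" if "g \<in> L2_interval l" for a b g
      by (subst eq) (intro csubspace_diff[OF L2_interval_csubspace] mult_potential_mem[OF l q] ess_bounded_antideriv2 that)
    show "- \<Phi> a b g + mult_potential l q (antideriv2 l a b (\<Phi> a b g)) = g" for a b g
      using eq[of a b g] by (simp add: algebra_simps)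
    show "\<Phi> (a + a') (b + b') (g + g') = \<Phi> a b g + \<Phi> a' b' g'" for a b g a' b' g'
      unfolding \<Phi>_def N_add clinear_add[OF S(1), symmetric] by (simp add: algebra_simps)
    show "\<Phi> (c * a) (c * b) (c *\<^sub>C g) = c *\<^sub>C \<Phi> a b g" for c a b g
      unfolding \<Phi>_def N_scale clinear_scaleC[OF S(1), symmetric] by (simp add: scaleC_diff_right)
    show "norm (\<Phi> 0 0 g) \<le> \<bar>K\<bar> * norm g" for g
      by (rule bound)
  qed simp
qed

lemma norm_vec_le_sum:
  fixes x :: "'a::real_normed_vector ^ 'n::finite"
  assumes "\<And>i. norm (x $ i) \<le> c i * r"
  shows "norm x \<le> (\<Sum>i\<in>UNIV. c i) * r"
proof -
  have "norm x \<le> (\<Sum>i\<in>UNIV. norm (x $ i))"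
    unfolding norm_vec_def by (rule L2_set_le_sum) simp
  also have "\<dots> \<le> (\<Sum>i\<in>UNIV. c i * r)"
    by (intro sum_mono assms)
  finally show ?thesis
    by (simp add: sum_distrib_right)
qed

lemma scaleC_component [simp]: "(c *\<^sub>C x) $ i = c *\<^sub>C (x $ i)"
  by (simp add: scaleC_vec_def)

section \<open>The Hilbert space of a graph\<close>

lemma L2_graph_csubspace: "csubspace (L2_graph G)"
  unfolding csubspace_def L2_graph_def
  by (auto intro: csubspace_0 csubspace_add csubspace_scaleC L2_interval_csubspace)

lemma closed_L2_graph: "closed (L2_graph (G :: ('v, 'e::finite) metric_graph))"
proof -
  have "closed {f :: l2 ^ 'e. f $ e \<in> L2_interval (edge_length G e)}" for e
    using closed_vimage[OF closed_L2_interval, of "\<lambda>f :: l2 ^ 'e. f $ e"]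
    by (simp add: vimage_def continuous_intros)
  then have "closed (\<Inter>e. {f :: l2 ^ 'e. f $ e \<in> L2_interval (edge_length G e)})"
    by blast
  moreover have "L2_graph G = (\<Inter>e. {f. f $ e \<in> L2_interval (edge_length G e)})"
    by (auto simp: L2_graph_def)
  ultimately show ?thesis
    by simp
qed

lemma cinner_axis: "cinner x (axis i z) = cinner (x $ i) (z::'a::complex_inner)"
proof -
  have "cinner x (axis i z) = (\<Sum>j\<in>UNIV. if j = i then cinner (x $ i) z else 0)"
    unfolding cinner_vec_def by (rule sum.cong) (auto simp: axis_def)
  then show ?thesis
    by simp
qed

text \<open>Orthogonality to these countably many functions makes the primitive on each edge vanish
  at rational points, hence everywhere by continuity. This is the form in which separability of
  L^2(G) is used.\<close>

lemma L2_graph_total: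
  fixes G :: "('v::finite, 'e::finite) metric_graph"
  assumes G: "finite_metric_graph G" and x: "x \<in> L2_graph G"
    and orth: "\<And>s. s \<in> (\<lambda>(e, r). axis e (l2_ind (real_of_rat r))) ` UNIV \<Longrightarrow> cinner x s = 0"
  shows "x = 0"
proof (rule vec_eq_iff[THEN iffD2], rule allI)
  fix e
  have l: "0 < edge_length G e"
    using G by (simp add: finite_metric_graph_def)
  have rat: "l2_prim (x $ e) t = 0" if "t \<in> \<rat>" for t
  proof -
    obtain r where "t = real_of_rat r"
      using \<open>t \<in> \<rat>\<close> by (auto elim: Rats_cases)
    then show ?thesis
      using orth[of "axis e (l2_ind t)"] by (force simp: cinner_axis l2_prim_def)
  qed
  have "l2_prim (x $ e) t = 0" if t: "t \<in> {0..edge_length G e}" for t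
  proof -
    let ?S = "{0<..<edge_length G e} \<inter> \<rat>"
    have S: "closure ?S = {0..edge_length G e}"
      using closure_open_Int_superset[OF open_greaterThanLessThan, of 0 "edge_length G e" \<rat>] l
      by (simp add: Rats_closure_real)
    show ?thesis
      by (rule continuous_constant_on_closure[of ?S]) (use continuous_on_l2_prim rat t in \<open>auto simp: S\<close>)
  qed
  then show "x $ e = 0 $ e"
    using x l L2_interval_ind_total[of "x $ e" "edge_length G e"] by (simp add: L2_graph_def)
qed

text \<open>The boundary space doubles as the space of initial data: on each edge the entry at
  \<open>(e, False)\<close> is f(0) and the entry at \<open>(e, True)\<close> is f'(0), not a value
  at the far end.\<close>

definition graph_antideriv :: "('v, 'e::finite) metric_graph \<Rightarrow> 'e boundary_space \<Rightarrow> l2 ^ 'e \<Rightarrow> l2 ^ 'e" where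
  "graph_antideriv G k h = (\<chi> e. antideriv2 (edge_length G e) (k $ (e, False)) (k $ (e, True)) (h $ e))"

lemma graph_antideriv_add:
  "graph_antideriv G k h + graph_antideriv G k' h' = graph_antideriv G (k + k') (h + h')"
  by (simp add: graph_antideriv_def vec_eq_iff antideriv2_add)

lemma graph_antideriv_scaleC:
  "c *\<^sub>C graph_antideriv G k h = graph_antideriv G (c *\<^sub>C k) (c *\<^sub>C h)"
  by (simp add: graph_antideriv_def vec_eq_iff antideriv2_scaleC scaleC_complex_def)

lemma boundary_vec_eqI:
  fixes x y :: "'a ^ ('e::finite \<times> bool)"
  assumes "\<And>e. x $ (e, False) = y $ (e, False)" "\<And>e. x $ (e, True) = y $ (e, True)"
  shows "x = y"
  unfolding vec_eq_iff
proof
  show "x $ p = y $ p" for p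
    using assms by (cases p; cases "snd p") auto
qed

lemma cinner_boundary: "cinner x (y :: 'e::finite boundary_space) =
    (\<Sum>e\<in>UNIV. x $ (e, False) * cnj (y $ (e, False)) + x $ (e, True) * cnj (y $ (e, True)))"
proof -
  have "cinner x y = (\<Sum>p\<in>UNIV \<times> UNIV. x $ p * cnj (y $ p))"
    by (simp add: cinner_vec_def cinner_complex_def UNIV_Times_UNIV)
  also have "\<dots> = (\<Sum>e\<in>UNIV. \<Sum>s\<in>UNIV. x $ (e, s) * cnj (y $ (e, s)))"
    by (simp only: sum.cartesian_product case_prod_eta) simp
  finally show ?thesis
    by (simp add: UNIV_bool)
qed

section \<open>The Schroedinger operator on a graph as a boundary triple\<close>

context
  fixes G :: "('v::finite, 'e::finite) metric_graph" and q :: "'e \<Rightarrow> real \<Rightarrow> real"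
  assumes G: "finite_metric_graph G" and q: "L2_potential G q"
begin

lemma length_pos: "0 < edge_length G e"
  using G by (simp add: finite_metric_graph_def)

lemma potential_measurable_integrable:
  "q e \<in> borel_measurable (lebesgue_on {0..edge_length G e})"
  "integrable (lebesgue_on {0..edge_length G e}) (\<lambda>t. (q e t)\<^sup>2)"
  using q by (simp_all add: L2_potential_def)

lemma sobolev2_graph_iff: "f \<in> sobolev2_graph G \<longleftrightarrow> (\<exists>k. \<exists>h\<in>L2_graph G. f = graph_antideriv G k h)"
proof
  assume "f \<in> sobolev2_graph G"
  then have "\<forall>e. \<exists>a b h. h \<in> L2_interval (edge_length G e) \<and> f $ e = antideriv2 (edge_length G e) a b h"
    by (simp add: sobolev2_graph_def sobolev2_iff length_pos)
  then obtain a b h where *: "\<And>e. h e \<in> L2_interval (edge_length G e) \<and> f $ e = antideriv2 (edge_length G e) (a e) (b e) (h e)"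
    by metis
  then have "f = graph_antideriv G (\<chi> p. if snd p then b (fst p) else a (fst p)) (\<chi> e. h e)"
    by (simp add: graph_antideriv_def vec_eq_iff)
  moreover have "(\<chi> e. h e) \<in> L2_graph G"
    using * by (simp add: L2_graph_def)
  ultimately show "\<exists>k. \<exists>h\<in>L2_graph G. f = graph_antideriv G k h"
    by blast
next
  assume "\<exists>k. \<exists>h\<in>L2_graph G. f = graph_antideriv G k h"
  then show "f \<in> sobolev2_graph G"
    unfolding sobolev2_graph_def mem_Collect_eq sobolev2_iff[OF length_pos]
    by (force simp: graph_antideriv_def L2_graph_def)
qed

lemma schroedinger_graph_antideriv:
  assumes h: "h \<in> L2_graph G"
  shows "schroedinger G q (graph_antideriv G k h) $ e =
    - (h $ e) + mult_potential (edge_length G e) (q e) (graph_antideriv G k h $ e)"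
proof -
  have "wderiv (edge_length G e) (wderiv (edge_length G e) (graph_antideriv G k h $ e)) = h $ e"
    using h by (simp add: graph_antideriv_def antideriv2_def wderiv_antideriv[OF length_pos] antideriv_mem L2_graph_def)
  then show ?thesis
    by (simp add: schroedinger_def mult_potential_def)
qed

lemma boundary_value_graph_antideriv:
  "boundary_value G (graph_antideriv G k h) $ (e, False) = k $ (e, False)"
  "boundary_value G (graph_antideriv G k h) $ (e, True) =
    k $ (e, False) + l2_prim (antideriv (edge_length G e) (k $ (e, True)) (h $ e)) (edge_length G e)"
  using length_pos[of e]
  by (simp_all add: boundary_value_def graph_antideriv_def antideriv2_def Let_def value_at_antideriv)

lemma boundary_gradient_graph_antideriv:
  assumes h: "h \<in> L2_graph G"
  shows "boundary_gradient G (graph_antideriv G k h) $ (e, False) = k $ (e, True)"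
    "boundary_gradient G (graph_antideriv G k h) $ (e, True) = - (k $ (e, True) + l2_prim (h $ e) (edge_length G e))"
  using length_pos[of e] h
  by (simp_all add: boundary_gradient_def graph_antideriv_def antideriv2_def Let_def value_at_antideriv
      wderiv_antideriv antideriv_mem L2_graph_def)

lemma graph_green:
  assumes f: "f \<in> sobolev2_graph G" and g: "g \<in> sobolev2_graph G"
  shows "cinner (schroedinger G q f) g - cinner f (schroedinger G q g) =
    symplectic_form (boundary_value G f, boundary_gradient G f) (boundary_value G g, boundary_gradient G g)"
proof -
  obtain k h where h: "h \<in> L2_graph G" and f: "f = graph_antideriv G k h"
    using f unfolding sobolev2_graph_iff by blast
  obtain k' h' where h': "h' \<in> L2_graph G" and g: "g = graph_antideriv G k' h'"
    using g unfolding sobolev2_graph_iff by blast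
  have edge: "cinner (schroedinger G q f $ e) (g $ e) - cinner (f $ e) (schroedinger G q g $ e) =
      (boundary_gradient G f $ (e, False) * cnj (boundary_value G g $ (e, False)) +
       boundary_gradient G f $ (e, True) * cnj (boundary_value G g $ (e, True))) -
      (boundary_value G f $ (e, False) * cnj (boundary_gradient G g $ (e, False)) +
       boundary_value G f $ (e, True) * cnj (boundary_gradient G g $ (e, True)))" for e
    using edge_green[OF length_pos potential_measurable_integrable, where a = "k $ (e, False)" and b = "k $ (e, True)" and h = "h $ e"
        and a' = "k' $ (e, False)" and b' = "k' $ (e, True)" and h' = "h' $ e"]
    unfolding f g schroedinger_graph_antideriv[OF h] schroedinger_graph_antideriv[OF h']
      boundary_value_graph_antideriv boundary_gradient_graph_antideriv[OF h] boundary_gradient_graph_antideriv[OF h']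
    by (simp add: graph_antideriv_def)
  have "cinner (schroedinger G q f) g - cinner f (schroedinger G q g) =
      (\<Sum>e\<in>UNIV. cinner (schroedinger G q f $ e) (g $ e) - cinner (f $ e) (schroedinger G q g $ e))"
    by (simp add: cinner_vec_def sum_subtractf)
  then show ?thesis
    unfolding edge symplectic_form_def fst_conv snd_conv cinner_boundary sum_subtractf .
qed

text \<open>Solving the initial value problem edge by edge gives U k g, the solution of D f = g with
  initial data k. Then \<open>F\<close> and \<open>R\<close> are obtained from it by setting g = 0
  and k = 0 respectively.\<close>

lemma schroedinger_boundary_triple:
  "\<exists>F R c. boundary_triple (L2_graph G) (sobolev2_graph G) (schroedinger G q)
    (\<lambda>f. (boundary_value G f, boundary_gradient G f)) F R c"
proof -
  let ?l = "edge_length G"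
  let ?\<Gamma> = "\<lambda>f. (boundary_value G f, boundary_gradient G f)"
  have "\<forall>e. \<exists>\<Phi> K. (\<forall>a b. \<forall>g\<in>L2_interval (?l e). \<Phi> a b g \<in> L2_interval (?l e) \<and>
      - \<Phi> a b g + mult_potential (?l e) (q e) (antideriv2 (?l e) a b (\<Phi> a b g)) = g) \<and>
    (\<forall>a b g a' b' g'. \<Phi> (a + a') (b + b') (g + g') = \<Phi> a b g + \<Phi> a' b' g') \<and>
    (\<forall>c a b g. \<Phi> (c * a) (c * b) (c *\<^sub>C g) = c *\<^sub>C \<Phi> a b g) \<and>
    (\<forall>g. norm (\<Phi> 0 0 g) \<le> K * norm g) \<and> 0 \<le> K"
    by (intro allI edge_initial_value_problem length_pos potential_measurable_integrable)
  then obtain \<Phi> K where *: "\<forall>e. (\<forall>a b. \<forall>g\<in>L2_interval (?l e). \<Phi> e a b g \<in> L2_interval (?l e) \<and>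
      - \<Phi> e a b g + mult_potential (?l e) (q e) (antideriv2 (?l e) a b (\<Phi> e a b g)) = g) \<and>
    (\<forall>a b g a' b' g'. \<Phi> e (a + a') (b + b') (g + g') = \<Phi> e a b g + \<Phi> e a' b' g') \<and>
    (\<forall>c a b g. \<Phi> e (c * a) (c * b) (c *\<^sub>C g) = c *\<^sub>C \<Phi> e a b g) \<and>
    (\<forall>g. norm (\<Phi> e 0 0 g) \<le> K e * norm g) \<and> 0 \<le> K e"
    by (elim choice[THEN exE]) (rule that)
  have \<Phi>_mem: "\<And>e a b g. g \<in> L2_interval (?l e) \<Longrightarrow> \<Phi> e a b g \<in> L2_interval (?l e)"
    and \<Phi>_eq: "\<And>e a b g. g \<in> L2_interval (?l e) \<Longrightarrow>
      - \<Phi> e a b g + mult_potential (?l e) (q e) (antideriv2 (?l e) a b (\<Phi> e a b g)) = g"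
    and \<Phi>_add: "\<And>e a b g a' b' g'. \<Phi> e (a + a') (b + b') (g + g') = \<Phi> e a b g + \<Phi> e a' b' g'"
    and \<Phi>_scale: "\<And>e c a b g. \<Phi> e (c * a) (c * b) (c *\<^sub>C g) = c *\<^sub>C \<Phi> e a b g"
    and \<Phi>_bound: "\<And>e g. norm (\<Phi> e 0 0 g) \<le> K e * norm g" and K: "\<And>e. 0 \<le> K e"
    using * by blast+
  define P where "P k g = (\<chi> e. \<Phi> e (k $ (e, False)) (k $ (e, True)) (g $ e))" for k :: "'e boundary_space" and g
  define U where "U k g = graph_antideriv G k (P k g)" for k g
  have P_mem: "P k g \<in> L2_graph G" if "g \<in> L2_graph G" for k g
    using that by (simp add: P_def L2_graph_def \<Phi>_mem)
  have U_mem: "U k g \<in> sobolev2_graph G" if "g \<in> L2_graph G" for k g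
    using P_mem[OF that, of k] unfolding sobolev2_graph_iff U_def by blast
  have D_U: "schroedinger G q (U k g) = g" if "g \<in> L2_graph G" for k g
    using that \<Phi>_eq unfolding vec_eq_iff U_def schroedinger_graph_antideriv[OF P_mem[OF that]]
    by (simp add: graph_antideriv_def P_def L2_graph_def)
  have U_add: "U (k + k') (g + g') = U k g + U k' g'" for k k' g g'
  proof -
    have "P (k + k') (g + g') = P k g + P k' g'"
      by (simp add: P_def vec_eq_iff \<Phi>_add)
    then show ?thesis
      by (simp add: U_def graph_antideriv_add)
  qed
  have U_scale: "U (a *\<^sub>C k) (a *\<^sub>C g) = a *\<^sub>C U k g" for a k g
  proof -
    have "P (a *\<^sub>C k) (a *\<^sub>C g) = a *\<^sub>C P k g"
      by (simp add: P_def vec_eq_iff scaleC_complex_def \<Phi>_scale)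
    then show ?thesis
      by (simp add: U_def graph_antideriv_scaleC)
  qed
  have P_bound: "norm (P 0 g $ e) \<le> K e * norm g" for g e
  proof -
    have "norm (P 0 g $ e) \<le> K e * norm (g $ e)"
      by (simp add: P_def \<Phi>_bound)
    also have "\<dots> \<le> K e * norm g"
      by (intro mult_left_mono Finite_Cartesian_Product.norm_nth_le K)
    finally show ?thesis .
  qed
  have V_bound: "norm (volterra (?l e) (P 0 g $ e)) \<le> ?l e * K e * norm g" for g e
    using order_trans[OF norm_volterra mult_left_mono[OF P_bound]] length_pos[of e] by (simp add: mult.assoc)
  \<comment> \<open>The three sums bound the solution operator, its boundary values and its boundary
    gradients; each sum is nonnegative, so one constant serves for all.\<close>
  define c where "c = (\<Sum>e\<in>UNIV. ?l e * (?l e * K e)) + ((\<Sum>p\<in>(UNIV :: ('e \<times> bool) set). sqrt (?l (fst p)) * (?l (fst p) * K (fst p)))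
    + (\<Sum>p\<in>(UNIV :: ('e \<times> bool) set). sqrt (?l (fst p)) * K (fst p)))"
  have nonneg: "0 \<le> ?l e * (?l e * K e)" "0 \<le> sqrt (?l e) * (?l e * K e)" "0 \<le> sqrt (?l e) * K e" for e
    using less_imp_le[OF length_pos[of e]] K[of e] by simp_all
  have R_bound: "norm (U 0 g) \<le> c * norm g" for g
  proof -
    have "norm (U 0 g) \<le> (\<Sum>e\<in>UNIV. ?l e * (?l e * K e)) * norm g"
    proof (rule norm_vec_le_sum)
      fix e
      have "norm (U 0 g $ e) = norm (volterra (?l e) (volterra (?l e) (P 0 g $ e)))"
        by (simp add: U_def graph_antideriv_def antideriv2_def volterra_antideriv)
      also have "\<dots> \<le> ?l e * norm (volterra (?l e) (P 0 g $ e))"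
        using length_pos[of e] by (intro norm_volterra) simp
      also have "\<dots> \<le> ?l e * (?l e * K e * norm g)"
        using length_pos[of e] by (intro mult_left_mono V_bound) simp
      finally show "norm (U 0 g $ e) \<le> ?l e * (?l e * K e) * norm g"
        by (simp add: mult.assoc)
    qed
    also have "\<dots> \<le> c * norm g"
      unfolding c_def by (intro mult_right_mono) (simp_all add: sum_nonneg nonneg)
    finally show ?thesis .
  qed
  have \<Gamma>_bound: "norm (?\<Gamma> (U 0 g)) \<le> c * norm g" if g: "g \<in> L2_graph G" for g
  proof -
    have "norm (boundary_value G (U 0 g)) \<le> (\<Sum>p\<in>(UNIV :: ('e \<times> bool) set). sqrt (?l (fst p)) * (?l (fst p) * K (fst p))) * norm g"
    proof (rule norm_vec_le_sum)
      fix p :: "'e \<times> bool"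
      obtain e s where p: "p = (e, s)"
        by (cases p)
      have "cmod (l2_prim (volterra (?l e) (P 0 g $ e)) (?l e)) \<le> sqrt (?l e) * norm (volterra (?l e) (P 0 g $ e))"
        using length_pos[of e] by (intro l2_prim_le) simp
      also have "\<dots> \<le> sqrt (?l e) * (?l e * K e * norm g)"
        using length_pos[of e] by (intro mult_left_mono V_bound) simp
      finally have b: "cmod (l2_prim (volterra (?l e) (P 0 g $ e)) (?l e)) \<le> sqrt (?l e) * (?l e * K e) * norm g"
        by (simp add: mult.assoc)
      show "norm (boundary_value G (U 0 g) $ p) \<le> sqrt (?l (fst p)) * (?l (fst p) * K (fst p)) * norm g"
        using b mult_nonneg_nonneg[OF nonneg(2)[of e] norm_ge_zero[of g]] unfolding p U_def
        by (cases s) (simp_all only: boundary_value_graph_antideriv zero_index fst_conv volterra_antideriv add_0 norm_zero)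
    qed
    moreover have "norm (boundary_gradient G (U 0 g)) \<le> (\<Sum>p\<in>(UNIV :: ('e \<times> bool) set). sqrt (?l (fst p)) * K (fst p)) * norm g"
    proof (rule norm_vec_le_sum)
      fix p :: "'e \<times> bool"
      obtain e s where p: "p = (e, s)"
        by (cases p)
      have "cmod (l2_prim (P 0 g $ e) (?l e)) \<le> sqrt (?l e) * norm (P 0 g $ e)"
        using length_pos[of e] by (intro l2_prim_le) simp
      also have "\<dots> \<le> sqrt (?l e) * (K e * norm g)"
        using length_pos[of e] by (intro mult_left_mono P_bound) simp
      finally have b: "cmod (l2_prim (P 0 g $ e) (?l e)) \<le> sqrt (?l e) * K e * norm g"
        by (simp add: mult.assoc)
      show "norm (boundary_gradient G (U 0 g) $ p) \<le> sqrt (?l (fst p)) * K (fst p) * norm g"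
        using b mult_nonneg_nonneg[OF nonneg(3)[of e] norm_ge_zero[of g]] unfolding p U_def
        by (cases s) (simp_all only: boundary_gradient_graph_antideriv[OF P_mem[OF g]] zero_index fst_conv add_0 norm_zero norm_minus_cancel)
    qed
    ultimately have "norm (?\<Gamma> (U 0 g)) \<le> (\<Sum>p\<in>(UNIV :: ('e \<times> bool) set). sqrt (?l (fst p)) * (?l (fst p) * K (fst p))) * norm g
        + (\<Sum>p\<in>(UNIV :: ('e \<times> bool) set). sqrt (?l (fst p)) * K (fst p)) * norm g"
      using norm_Pair_le[of "boundary_value G (U 0 g)" "boundary_gradient G (U 0 g)"] by linarith
    also have "\<dots> \<le> c * norm g"
      unfolding c_def distrib_right by (simp add: sum_nonneg nonneg mult_nonneg_nonneg)
    finally show ?thesis .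
  qed
  have sob: "\<exists>k. \<exists>h\<in>L2_graph G. f = graph_antideriv G k h" if "f \<in> sobolev2_graph G" for f
    using that unfolding sobolev2_graph_iff .
  note W = L2_graph_csubspace[of G]
  have dom: "csubspace (sobolev2_graph G)"
    unfolding csubspace_def
  proof (intro conjI ballI allI)
    show "0 \<in> sobolev2_graph G"
      using U_mem[OF csubspace_0[OF W], of 0] U_scale[of 0 0 0] by simp
    fix f g assume f: "f \<in> sobolev2_graph G" and g: "g \<in> sobolev2_graph G"
    show "f + g \<in> sobolev2_graph G"
      using sob[OF f] sob[OF g] unfolding sobolev2_graph_iff
      by (elim exE bexE) (simp only: graph_antideriv_add, intro exI bexI, rule refl, intro csubspace_add[OF W])
  next
    fix f c assume f: "f \<in> sobolev2_graph G"
    show "c *\<^sub>C f \<in> sobolev2_graph G"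
      using sob[OF f] unfolding sobolev2_graph_iff
      by (elim exE bexE) (simp only: graph_antideriv_scaleC, intro exI bexI, rule refl, intro csubspace_scaleC[OF W])
  qed
  have mp_add: "mult_potential (?l e) (q e) (antideriv2 (?l e) a b h + antideriv2 (?l e) a' b' h') =
      mult_potential (?l e) (q e) (antideriv2 (?l e) a b h) + mult_potential (?l e) (q e) (antideriv2 (?l e) a' b' h')"
    for e a b h a' b' h'
    by (intro mult_potential_add length_pos potential_measurable_integrable) (simp_all only: antideriv2_add ess_bounded_antideriv2)
  have mp_scale: "mult_potential (?l e) (q e) (c *\<^sub>C antideriv2 (?l e) a b h) =
      c *\<^sub>C mult_potential (?l e) (q e) (antideriv2 (?l e) a b h)" for e a b h c
    by (intro mult_potential_scaleC length_pos potential_measurable_integrable) (simp_all only: antideriv2_scaleC ess_bounded_antideriv2)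
  have "boundary_triple (L2_graph G) (sobolev2_graph G) (schroedinger G q) ?\<Gamma> (\<lambda>k. U k 0) (\<lambda>g. U 0 g) c"
  proof
    show "csubspace (L2_graph G)" "csubspace (sobolev2_graph G)"
      by (fact W dom)+
    show "sobolev2_graph G \<subseteq> L2_graph G"
      by (auto dest!: sob simp: graph_antideriv_def L2_graph_def antideriv2_def antideriv_mem)
    show "cinner (schroedinger G q f) g - cinner f (schroedinger G q g) = symplectic_form (?\<Gamma> f) (?\<Gamma> g)"
      if "f \<in> sobolev2_graph G" "g \<in> sobolev2_graph G" for f g
      using that by (rule graph_green)
    show "clinear (\<lambda>k. U k 0)"
      using U_add[of _ _ 0 0] U_scale[of _ _ 0] by (intro clinearI) simp_all
    show "U k 0 \<in> sobolev2_graph G" "schroedinger G q (U k 0) = 0" for k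
      by (simp_all add: U_mem D_U csubspace_0[OF W])
    \<comment> \<open>Values and gradients at the ends \<open>(e, False)\<close> alone already
      reproduce the initial data.\<close>
    show "k = 0" if "?\<Gamma> (U k 0) = 0" for k
    proof (rule boundary_vec_eqI)
      have z: "boundary_value G (U k 0) = 0" "boundary_gradient G (U k 0) = 0"
        using that by (simp_all add: zero_prod_def)
      show "k $ (e, False) = 0 $ (e, False)" "k $ (e, True) = 0 $ (e, True)" for e
        using boundary_value_graph_antideriv(1)[of k "P k 0" e]
          boundary_gradient_graph_antideriv(1)[OF P_mem[OF csubspace_0[OF W]], of k k e]
        by (simp_all add: z flip: U_def)
    qed
    show "U 0 g \<in> sobolev2_graph G" "schroedinger G q (U 0 g) = g" "norm (?\<Gamma> (U 0 g)) \<le> c * norm g"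
      if "g \<in> L2_graph G" for g
      using that by (rule U_mem D_U \<Gamma>_bound)+
    show "norm (U 0 g) \<le> c * norm g" for g
      by (rule R_bound)
    show "U 0 (f + g) = U 0 f + U 0 g" for f g
      using U_add[of 0 0 f g] by simp
    show "U 0 (a *\<^sub>C f) = a *\<^sub>C U 0 f" for f a
      using U_scale[of a 0 f] by simp
    fix f assume "f \<in> sobolev2_graph G"
    then obtain k h where h: "h \<in> L2_graph G" and f: "f = graph_antideriv G k h"
      using sob by blast
    fix a
    have ah: "a *\<^sub>C h \<in> L2_graph G"
      by (intro csubspace_scaleC W h)
    show "schroedinger G q (a *\<^sub>C f) = a *\<^sub>C schroedinger G q f"
      unfolding vec_eq_iff
    proof
      fix e
      have "schroedinger G q (a *\<^sub>C f) $ e = - (a *\<^sub>C h $ e) + mult_potential (?l e) (q e) (a *\<^sub>C f $ e)"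
        unfolding f graph_antideriv_scaleC schroedinger_graph_antideriv[OF ah]
        by (simp flip: graph_antideriv_scaleC)
      also have "\<dots> = a *\<^sub>C schroedinger G q f $ e"
        unfolding f schroedinger_graph_antideriv[OF h] by (simp add: graph_antideriv_def mp_scale scaleC_diff_right)
      finally show "schroedinger G q (a *\<^sub>C f) $ e = (a *\<^sub>C schroedinger G q f) $ e"
        by simp
    qed
    show "?\<Gamma> (a *\<^sub>C f) = a *\<^sub>C ?\<Gamma> f"
      unfolding scaleC_Pair prod.inject f graph_antideriv_scaleC
      by (intro conjI boundary_vec_eqI)
        (simp_all add: boundary_value_graph_antideriv boundary_gradient_graph_antideriv h ah scaleC_complex_def
          clinear_l2_prim algebra_simps flip: antideriv_scaleC)
    fix g assume "g \<in> sobolev2_graph G"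
    then obtain k' h' where h': "h' \<in> L2_graph G" and g: "g = graph_antideriv G k' h'"
      using sob by blast
    have hh: "h + h' \<in> L2_graph G"
      by (intro csubspace_add W h h')
    show "schroedinger G q (f + g) = schroedinger G q f + schroedinger G q g"
      unfolding vec_eq_iff
    proof
      fix e
      have "schroedinger G q (f + g) $ e = - (h $ e + h' $ e) + mult_potential (?l e) (q e) (f $ e + g $ e)"
        unfolding f g graph_antideriv_add schroedinger_graph_antideriv[OF hh]
        by (simp flip: graph_antideriv_add)
      also have "\<dots> = schroedinger G q f $ e + schroedinger G q g $ e"
        unfolding f g schroedinger_graph_antideriv[OF h] schroedinger_graph_antideriv[OF h']
        by (simp add: graph_antideriv_def mp_add)
      finally show "schroedinger G q (f + g) $ e = (schroedinger G q f + schroedinger G q g) $ e"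
        by simp
    qed
    show "?\<Gamma> (f + g) = ?\<Gamma> f + ?\<Gamma> g"
      unfolding add_Pair prod.inject f g graph_antideriv_add
      by (intro conjI boundary_vec_eqI)
        (simp_all add: boundary_value_graph_antideriv boundary_gradient_graph_antideriv h h' hh
          clinear_l2_prim flip: antideriv_add)
  qed
  then show ?thesis
    by blast
qed

end

theorem theorem16p2:
  fixes G :: "('v::finite, 'e::finite) metric_graph"
    and q :: "'e \<Rightarrow> real \<Rightarrow> real"
    and X :: "'x topology"
    and L :: "'x \<Rightarrow> ('e boundary_space \<times> 'e boundary_space) set"
    and M :: "('e boundary_space \<times> 'e boundary_space) set"
  assumes "finite_metric_graph G"
    and "L2_potential G q"
    and "continuous_lagrangian_family X L"
    and "lagrangian M"
    and "separable_infinite_dim TYPE('h::chilbert_space)"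
  shows "operator_index X (L2_graph G) (\<lambda>x. realization_domain G (L x)) (\<lambda>x. schroedinger G q) =
           (lagrangian_index X L M :: ('x \<Rightarrow> 'h \<Rightarrow>\<^sub>L 'h) set) \<and>
         (lagrangian_index X L M :: ('x \<Rightarrow> 'h \<Rightarrow>\<^sub>L 'h) set) \<in> K1 X"
proof -
  have inf: "\<not> (\<exists>B::'h set. finite B \<and> span B = UNIV)"
    using assms(5) by (simp add: separable_infinite_dim_def)
  obtain J :: "'e boundary_space \<Rightarrow>\<^sub>L 'h" and Js where J: "cayley_data 0 J J Js"
    using exists_isometry_orthogonal[OF inf finite.emptyI] by blast
  have countable: "countable ((\<lambda>(e, r). axis e (l2_ind (real_of_rat r))) ` (UNIV :: ('e \<times> rat) set))"
    by simp
  obtain F R c where triple: "boundary_triple (L2_graph G) (sobolev2_graph G) (schroedinger G q)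
      (\<lambda>f. (boundary_value G f, boundary_gradient G f)) F R c"
    using schroedinger_boundary_triple[OF assms(1,2)] by blast
  \<comment> \<open>Both index computations allow any constant unitary in front of
    \<open>lagrangian_map (L x)\<close>. Taking the identity in both yields literally the same
    homotopy class.\<close>
  let ?g = "\<lambda>x. cayley_rel 0 J J Js (id_blinfun o\<^sub>L lagrangian_map (L x))"
  have op: "operator_index X (L2_graph G) (\<lambda>x. realization_domain G (L x)) (\<lambda>x. schroedinger G q) = {g. homotopic_UF X ?g g}"
    unfolding realization_domain_def
    by (rule boundary_triple.operator_index_eq_homotopy_class[OF triple assms(5) closed_L2_graph countable
          L2_graph_total[OF assms(1)] assms(3) J unitary_maps_id])
  have lag: "lagrangian_index X L M = {g. homotopic_UF X ?g g}"
    by (rule lagrangian_index_eq[OF assms(5,3,4) J unitary_maps_id])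
  have "continuous_map X (top_of_set \<U>\<^sub>F) ?g"
    using assms(3) unfolding continuous_lagrangian_family_def
    by (intro continuous_map_cayley_rel continuous_map_const[THEN iffD2] disjI2 continuous_map_blinfun_compose
        continuous_lagrangian_map[OF assms(3)] unitary_maps_compose unitary_maps_id lagrangian_map_unitary J) simp_all
  then have "homotopic_UF X ?g ?g"
    by simp
  then show ?thesis
    unfolding op lag using homotopy_class_in_K1 by blast
qed

end
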